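(* Let $\Lambda$ be an artin algebra and $\mathcal{E}$ a contravariantly finite resolving subcategory of $\mathsf{mod}\,\Lambda$. Then the following are equivalent. (1) $\mathcal{E}$ is of finite type. (2) $\mathcal{E}$ is admissible. (3) $\mathsf{AR}(\mathcal{E}) = \mathsf{Ex}(\mathcal{E})$ holds. (4) $\mathsf{AR}(\mathcal{E}) \otimes_{\mathbb{Z}} \mathbb{Q} = \mathsf{Ex}(\mathcal{E}) \otimes_{\mathbb{Z}} \mathbb{Q}$ holds.
   Context: All categories are additive, and all subcategories are additive, full and closed under isomorphisms. An artin algebra is an algebra over a commutative artinian local ring $R$ which is finitely generated as an $R$-module; $\mathsf{mod}\,\Lambda$ is the category of finitely generated $\Lambda$-modules. A subcategory $\mathcal{E}$ of $\mathsf{mod}\,\Lambda$ is resolving if it contains $\Lambda$, is closed under extensions, under kernels of surjections between objects of $\mathcal{E}$, and under direct summands. It is contravariantly finite if every $X \in \mathsf{mod}\,\Lambda$ has a right $\mathcal{E}$-approximation, i.e. a morphism $E_X \to X$ with $E_X\in\mathcal{E}$ through which every morphism $E\to X$ with $E \in \mathcal{E}$ factors. A resolving subcategory is regarded as an exact category whose conflations are the short exact sequences of $\mathsf{mod}\,\Lambda$ with all terms in $\mathcal{E}$; it is Krull-Schmidt here. The second map of a conflation is called a deflation. $\mathcal{E}$ is of finite type if $\mathcal{E}=\mathsf{add}\,G$ for some $G\in\mathcal{E}$, where $\mathsf{add}\,G$ consists of all direct summands of finite direct sums of $G$. $\mathsf{Mod}\,\mathcal{E}$ is the abelian category of additive contravariant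 functors from $\mathcal{E}$ to abelian groups. $\mathsf{eff}\,\mathcal{E}$ is its subcategory of effaceable functors: those $M$ admitting an exact sequence $\mathcal{E}(-,Y)\xrightarrow{\mathcal{E}(-,f)}\mathcal{E}(-,Z)\to M\to 0$ with $f:Y\to Z$ a deflation. $\mathcal{E}$ is admissible if every object in $\mathsf{eff}\,\mathcal{E}$ has finite length in $\mathsf{Mod}\,\mathcal{E}$. Let $\mathcal{J}$ be the Jacobson radical of $\mathcal{E}$. A morphism $g:Y\to Z$ is right almost split if $Z$ is indecomposable, $g\in\mathcal{J}$, and any $h: W\to Z$ in $\mathcal{J}$ factors through $g$; left almost split is the dual notion. A conflation $0\to X\xrightarrow{f}Y\xrightarrow{g}Z\to 0$ is an AR conflation if $f$ is left almost split and $g$ is right almost split. $\mathsf{K}_0(\mathcal{E},0)$ is the free abelian group on the set of isomorphism classes of indecomposable objects, where for $X\cong\bigoplus X_i$ with $X_i$ indecomposable one puts $[X]=\sum [X_i]$. $\mathsf{Ex}(\mathcal{E})$ (resp. $\mathsf{AR}(\mathcal{E})$) is the subgroup of $\mathsf{K}_0(\mathcal{E},0)$ generated by $[X]-[Y]+[Z]$ for all conflations (resp. all AR conflations) $0\to X\to Y\to Z\to 0$ in $\mathcal{E}$. The equality in (4) is one of subspaces of $\mathsf{K}_0(\mathcal{E},0)\otimes_{\mathbb{Z}}\mathbb{Q}$. *)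

theory Defs
  imports Complex_Main "HOL-Algebra.Module" "HOL-Algebra.Ideal" "HOL-Algebra.Generated_Groups"
    "HOL-Algebra.Free_Abelian_Groups"
begin

section \<open>Modules over a not necessarily commutative ring\<close>

text \<open>The library locale \<open>module\<close> requires a commutative base ring. We reuse its record
  type; as for abelian groups in the library, the multiplicative fields of the record play no
  role.\<close>

locale left_module = ring \<Lambda> + M?: abelian_group M
    for \<Lambda> :: "('a, 'x) ring_scheme" (structure)
      and M :: "('a, 'm, 'y) module_scheme" (structure) +
  assumes lsmult_closed:
      "\<lbrakk>a \<in> carrier \<Lambda>; x \<in> carrier M\<rbrakk> \<Longrightarrow> a \<odot>\<^bsub>M\<^esub> x \<in> carrier M"
    and lsmult_l_distr:
      "\<lbrakk>a \<in> carrier \<Lambda>; b \<in> carrier \<Lambda>; x \<in> carrier M\<rbrakk> \<Longrightarrow>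
        (a \<oplus>\<^bsub>\<Lambda>\<^esub> b) \<odot>\<^bsub>M\<^esub> x = a \<odot>\<^bsub>M\<^esub> x \<oplus>\<^bsub>M\<^esub> b \<odot>\<^bsub>M\<^esub> x"
    and lsmult_r_distr:
      "\<lbrakk>a \<in> carrier \<Lambda>; x \<in> carrier M; y \<in> carrier M\<rbrakk> \<Longrightarrow>
        a \<odot>\<^bsub>M\<^esub> (x \<oplus>\<^bsub>M\<^esub> y) = a \<odot>\<^bsub>M\<^esub> x \<oplus>\<^bsub>M\<^esub> a \<odot>\<^bsub>M\<^esub> y"
    and lsmult_assoc:
      "\<lbrakk>a \<in> carrier \<Lambda>; b \<in> carrier \<Lambda>; x \<in> carrier M\<rbrakk> \<Longrightarrow>
        (a \<otimes>\<^bsub>\<Lambda>\<^esub> b) \<odot>\<^bsub>M\<^esub> x = a \<odot>\<^bsub>M\<^esub> (b \<odot>\<^bsub>M\<^esub> x)"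
    and lsmult_one:
      "x \<in> carrier M \<Longrightarrow> \<one>\<^bsub>\<Lambda>\<^esub> \<odot>\<^bsub>M\<^esub> x = x"

definition finitely_generated ::
    "('a, 'x) ring_scheme \<Rightarrow> ('a, 'm, 'y) module_scheme \<Rightarrow> bool" where
  "finitely_generated \<Lambda> M \<longleftrightarrow>
    (\<exists>S. finite S \<and> S \<subseteq> carrier M \<and>
      (\<forall>x \<in> carrier M. \<exists>c \<in> S \<rightarrow> carrier \<Lambda>. x = (\<Oplus>\<^bsub>M\<^esub>s\<in>S. c s \<odot>\<^bsub>M\<^esub> s)))"

text \<open>The finitely generated modules whose underlying set lives in the type \<open>'m\<close>.\<close>

definition fg_modules :: "('a, 'x) ring_scheme \<Rightarrow> ('a, 'm) module set" where
  "fg_modules \<Lambda> = {M. left_module \<Lambda> M \<and> finitely_generated \<Lambda> M}"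

text \<open>Morphisms are extensional functions, so that equality of morphisms is equality in HOL;
  composition is \<open>compose\<close>.\<close>

definition lin_hom ::
    "('a, 'x) ring_scheme \<Rightarrow> ('a, 'm, 'y) module_scheme \<Rightarrow> ('a, 'n, 'z) module_scheme
      \<Rightarrow> ('m \<Rightarrow> 'n) set" where
  "lin_hom \<Lambda> M N =
    {f. f \<in> carrier M \<rightarrow>\<^sub>E carrier N \<and>
      (\<forall>x \<in> carrier M. \<forall>y \<in> carrier M. f (x \<oplus>\<^bsub>M\<^esub> y) = f x \<oplus>\<^bsub>N\<^esub> f y) \<and>
      (\<forall>a \<in> carrier \<Lambda>. \<forall>x \<in> carrier M. f (a \<odot>\<^bsub>M\<^esub> x) = a \<odot>\<^bsub>N\<^esub> f x)}"

definition hom_id :: "('a, 'm, 'y) module_scheme \<Rightarrow> 'm \<Rightarrow> 'm" where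
  "hom_id M = (\<lambda>x\<in>carrier M. x)"

definition hom_zero ::
    "('a, 'm, 'y) module_scheme \<Rightarrow> ('a, 'n, 'z) module_scheme \<Rightarrow> 'm \<Rightarrow> 'n" where
  "hom_zero M N = (\<lambda>x\<in>carrier M. \<zero>\<^bsub>N\<^esub>)"

definition hom_add ::
    "('a, 'm, 'y) module_scheme \<Rightarrow> ('a, 'n, 'z) module_scheme
      \<Rightarrow> ('m \<Rightarrow> 'n) \<Rightarrow> ('m \<Rightarrow> 'n) \<Rightarrow> 'm \<Rightarrow> 'n" where
  "hom_add M N f g = (\<lambda>x\<in>carrier M. f x \<oplus>\<^bsub>N\<^esub> g x)"

definition hom_diff ::
    "('a, 'm, 'y) module_scheme \<Rightarrow> ('a, 'n, 'z) module_scheme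
      \<Rightarrow> ('m \<Rightarrow> 'n) \<Rightarrow> ('m \<Rightarrow> 'n) \<Rightarrow> 'm \<Rightarrow> 'n" where
  "hom_diff M N f g = (\<lambda>x\<in>carrier M. f x \<ominus>\<^bsub>N\<^esub> g x)"

definition lin_iso ::
    "('a, 'x) ring_scheme \<Rightarrow> ('a, 'm, 'y) module_scheme \<Rightarrow> ('a, 'n, 'z) module_scheme
      \<Rightarrow> ('m \<Rightarrow> 'n) set" where
  "lin_iso \<Lambda> M N = {f \<in> lin_hom \<Lambda> M N. bij_betw f (carrier M) (carrier N)}"

definition isomorphic ::
    "('a, 'x) ring_scheme \<Rightarrow> ('a, 'm, 'y) module_scheme \<Rightarrow> ('a, 'n, 'z) module_scheme
      \<Rightarrow> bool" where
  "isomorphic \<Lambda> M N \<longleftrightarrow> lin_iso \<Lambda> M N \<noteq> {}"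

definition regular_module :: "('a, 'x) ring_scheme \<Rightarrow> ('a, 'a) module" where
  "regular_module \<Lambda> =
    \<lparr>carrier = carrier \<Lambda>, monoid.mult = monoid.mult \<Lambda>, one = one \<Lambda>,
     ring.zero = ring.zero \<Lambda>, ring.add = ring.add \<Lambda>, smult = monoid.mult \<Lambda>\<rparr>"

definition short_exact ::
    "('a, 'x) ring_scheme \<Rightarrow> ('a, 'm) module \<Rightarrow> ('m \<Rightarrow> 'm) \<Rightarrow> ('a, 'm) module
      \<Rightarrow> ('m \<Rightarrow> 'm) \<Rightarrow> ('a, 'm) module \<Rightarrow> bool" where
  "short_exact \<Lambda> X f Y g Z \<longleftrightarrow>
    f \<in> lin_hom \<Lambda> X Y \<and> g \<in> lin_hom \<Lambda> Y Z \<and>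
    inj_on f (carrier X) \<and>
    f ` carrier X = {y \<in> carrier Y. g y = \<zero>\<^bsub>Z\<^esub>} \<and>
    g ` carrier Y = carrier Z"

text \<open>\<open>X\<close> is a direct sum of the modules in the list \<open>Xs\<close> (with inclusions \<open>\<iota> i\<close> and
  projections \<open>\<pi> i\<close>). For the empty list this says that \<open>X\<close> is zero.\<close>

definition direct_sum ::
    "('a, 'x) ring_scheme \<Rightarrow> ('a, 'm) module \<Rightarrow> ('a, 'm) module list \<Rightarrow> bool" where
  "direct_sum \<Lambda> X Xs \<longleftrightarrow>
    (\<exists>\<iota> \<pi>.
      (\<forall>i < length Xs. \<iota> i \<in> lin_hom \<Lambda> (Xs ! i) X \<and> \<pi> i \<in> lin_hom \<Lambda> X (Xs ! i)) \<and>
      (\<forall>i < length Xs. \<forall>j < length Xs.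
        compose (carrier (Xs ! j)) (\<pi> i) (\<iota> j) =
          (if i = j then hom_id (Xs ! i) else hom_zero (Xs ! j) (Xs ! i))) \<and>
      (\<forall>x \<in> carrier X. x = (\<Oplus>\<^bsub>X\<^esub>i\<in>{..<length Xs}. \<iota> i (\<pi> i x))))"


lemma fg_module_transport:
  fixes M :: "('a, 'm, 'y) module_scheme" and \<phi> :: "'m \<Rightarrow> 'n"
  assumes M: "left_module \<Lambda> M" and fg: "finitely_generated \<Lambda> M"
    and inj: "inj_on \<phi> (carrier M)"
  shows "\<exists>N :: ('a, 'n) module. N \<in> fg_modules \<Lambda> \<and> isomorphic \<Lambda> M N"
proof -
  interpret M: left_module \<Lambda> M by (rule M)
  define \<psi> where "\<psi> = inv_into (carrier M) \<phi>"
  have \<psi> [simp]: "\<psi> (\<phi> x) = x" if "x \<in> carrier M" for x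
    using inj that by (simp add: \<psi>_def)
  define N :: "('a, 'n) module" where
    "N = \<lparr>carrier = \<phi> ` carrier M, monoid.mult = undefined, one = undefined,
      ring.zero = \<phi> \<zero>\<^bsub>M\<^esub>, ring.add = (\<lambda>u v. \<phi> (\<psi> u \<oplus>\<^bsub>M\<^esub> \<psi> v)),
      smult = (\<lambda>a u. \<phi> (a \<odot>\<^bsub>M\<^esub> \<psi> u))\<rparr>"
  have N: "left_module \<Lambda> N"
  proof (intro left_module.intro left_module_axioms.intro abelian_groupI)
    show "ring \<Lambda>" by (rule M.ring_axioms)
    show "\<exists>v\<in>carrier N. v \<oplus>\<^bsub>N\<^esub> u = \<zero>\<^bsub>N\<^esub>" if "u \<in> carrier N" for u
    proof -
      obtain x where x: "x \<in> carrier M" "u = \<phi> x" using \<open>u \<in> carrier N\<close> by (auto simp: N_def)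
      have "\<phi> (\<ominus>\<^bsub>M\<^esub> x) \<oplus>\<^bsub>N\<^esub> u = \<zero>\<^bsub>N\<^esub>"
        using x by (simp add: N_def M.M.l_neg)
      then show ?thesis using x by (force simp: N_def)
    qed
  qed (auto simp: N_def M.lsmult_closed M.lsmult_l_distr M.lsmult_r_distr M.lsmult_assoc
      M.lsmult_one M.M.a_ac)
  interpret N: left_module \<Lambda> N by (rule N)
  have add: "\<phi> (x \<oplus>\<^bsub>M\<^esub> y) = \<phi> x \<oplus>\<^bsub>N\<^esub> \<phi> y" if "x \<in> carrier M" "y \<in> carrier M" for x y
    using that by (simp add: N_def)
  have smult: "\<phi> (a \<odot>\<^bsub>M\<^esub> x) = a \<odot>\<^bsub>N\<^esub> \<phi> x" if "x \<in> carrier M" for a x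
    using that by (simp add: N_def)
  have zero: "\<phi> \<zero>\<^bsub>M\<^esub> = \<zero>\<^bsub>N\<^esub>"
    by (simp add: N_def)
  have sum: "\<phi> (\<Oplus>\<^bsub>M\<^esub>s\<in>A. f s) = (\<Oplus>\<^bsub>N\<^esub>s\<in>A. \<phi> (f s))"
    if "finite A" "f \<in> A \<rightarrow> carrier M" for f :: "'m \<Rightarrow> 'm" and A
    using that
  proof (induction A)
    case empty
    then show ?case by (simp add: zero)
  next
    case (insert s A)
    then have "(\<lambda>s. \<phi> (f s)) \<in> A \<rightarrow> carrier N" "\<phi> (f s) \<in> carrier N" 
      by (auto simp: N_def)
    with insert show ?case
      by (simp add: add Pi_def)
  qed
  have fgN: "finitely_generated \<Lambda> N"
  proof -
    obtain S where S: "finite S" "S \<subseteq> carrier M"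
      and gen: "\<And>x. x \<in> carrier M \<Longrightarrow>
        \<exists>c \<in> S \<rightarrow> carrier \<Lambda>. x = (\<Oplus>\<^bsub>M\<^esub>s\<in>S. c s \<odot>\<^bsub>M\<^esub> s)"
      using fg unfolding finitely_generated_def by metis
    have "\<exists>c \<in> \<phi> ` S \<rightarrow> carrier \<Lambda>. u = (\<Oplus>\<^bsub>N\<^esub>s\<in>\<phi> ` S. c s \<odot>\<^bsub>N\<^esub> s)"
      if "u \<in> carrier N" for u
    proof -
      obtain x where x: "x \<in> carrier M" "u = \<phi> x" using \<open>u \<in> carrier N\<close> by (auto simp: N_def)
      obtain c where c: "c \<in> S \<rightarrow> carrier \<Lambda>" "x = (\<Oplus>\<^bsub>M\<^esub>s\<in>S. c s \<odot>\<^bsub>M\<^esub> s)"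
        using gen[OF x(1)] by blast
      have 1: "(\<lambda>s. c s \<odot>\<^bsub>M\<^esub> s) \<in> S \<rightarrow> carrier M"
        using c(1) S(2) by (auto intro!: M.lsmult_closed)
      have cS: "c s \<in> carrier \<Lambda>" "s \<in> carrier M" if "s \<in> S" for s
        using c(1) S(2) that by auto
      have \<phi>N: "\<phi> s \<in> carrier N" if "s \<in> carrier M" for s
        using that by (simp add: N_def)
      have 2: "(\<lambda>s. c s \<odot>\<^bsub>N\<^esub> \<phi> s) \<in> S \<rightarrow> carrier N"
        using cS \<phi>N by (blast intro: N.lsmult_closed)
      have 3: "(\<lambda>u. c (\<psi> u) \<odot>\<^bsub>N\<^esub> u) \<in> \<phi> ` S \<rightarrow> carrier N"
      proof
        fix u assume "u \<in> \<phi> ` S"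
        then obtain s where "s \<in> S" "u = \<phi> s" by blast
        then show "c (\<psi> u) \<odot>\<^bsub>N\<^esub> u \<in> carrier N"
          using cS \<phi>N \<psi> N.lsmult_closed by metis
      qed
      have "u = (\<Oplus>\<^bsub>N\<^esub>s\<in>S. \<phi> (c s \<odot>\<^bsub>M\<^esub> s))"
        unfolding x(2) c(2) by (rule sum[OF S(1) 1])
      also have "\<dots> = (\<Oplus>\<^bsub>N\<^esub>s\<in>S. c (\<psi> (\<phi> s)) \<odot>\<^bsub>N\<^esub> \<phi> s)"
      proof (rule N.finsum_cong'[OF refl])
        show "(\<lambda>s. c (\<psi> (\<phi> s)) \<odot>\<^bsub>N\<^esub> \<phi> s) \<in> S \<rightarrow> carrier N"
          using 3 by blast
        show "\<phi> (c s \<odot>\<^bsub>M\<^esub> s) = c (\<psi> (\<phi> s)) \<odot>\<^bsub>N\<^esub> \<phi> s" if "s \<in> S" for s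
          using cS[OF that] by (simp add: smult)
      qed
      also have "\<dots> = (\<Oplus>\<^bsub>N\<^esub>u\<in>\<phi> ` S. c (\<psi> u) \<odot>\<^bsub>N\<^esub> u)"
        using N.finsum_reindex[OF 3 inj_on_subset[OF inj S(2)]] by simp
      finally show ?thesis
        using S(2) c(1) by (intro bexI[of _ "\<lambda>u. c (\<psi> u)"]) (auto simp: subset_iff Pi_def)
    qed
    then show ?thesis
      unfolding finitely_generated_def using S by (intro exI[of _ "\<phi> ` S"]) (auto simp: N_def)
  qed
  have "(\<lambda>x\<in>carrier M. \<phi> x) \<in> lin_iso \<Lambda> M N"
    using inj by (auto simp: lin_iso_def lin_hom_def bij_betw_def add smult M.lsmult_closed
      inj_on_def) (auto simp: N_def)
  with N fgN show ?thesis
    by (auto simp: fg_modules_def isomorphic_def)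
qed

text \<open>Every finitely generated module, over whatever type, has an isomorphic copy with
  elements of type \<open>(nat \<Rightarrow> 'a) set\<close>. So for this choice of \<open>'m\<close> the full category on
  \<open>fg_modules \<Lambda>\<close> is equivalent to the category of all finitely generated modules.\<close>

lemma fg_module_representative:
  fixes M :: "('a, 'm, 'y) module_scheme"
  assumes M: "left_module \<Lambda> M" and fg: "finitely_generated \<Lambda> M"
  shows "\<exists>N :: ('a, (nat \<Rightarrow> 'a) set) module. N \<in> fg_modules \<Lambda> \<and> isomorphic \<Lambda> M N"
proof -
  interpret M: left_module \<Lambda> M by (rule M)
  obtain S where S: "finite S" "S \<subseteq> carrier M"
    and gen: "\<And>x. x \<in> carrier M \<Longrightarrow>
      \<exists>c \<in> S \<rightarrow> carrier \<Lambda>. x = (\<Oplus>\<^bsub>M\<^esub>s\<in>S. c s \<odot>\<^bsub>M\<^esub> s)"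
    using fg unfolding finitely_generated_def by metis
  obtain t :: "'m \<Rightarrow> nat" where t: "inj_on t S"
    using finite_imp_inj_to_nat_seg[OF S(1)] by blast
  define \<phi> where
    "\<phi> x = {c. (\<forall>s\<in>S. c (t s) \<in> carrier \<Lambda>) \<and> x = (\<Oplus>\<^bsub>M\<^esub>s\<in>S. c (t s) \<odot>\<^bsub>M\<^esub> s)}" for x
  have "\<phi> x \<noteq> {}" if x: "x \<in> carrier M" for x
  proof -
    obtain c where c: "c \<in> S \<rightarrow> carrier \<Lambda>" "x = (\<Oplus>\<^bsub>M\<^esub>s\<in>S. c s \<odot>\<^bsub>M\<^esub> s)"
      using gen[OF x] by blast
    have "x = (\<Oplus>\<^bsub>M\<^esub>s\<in>S. c (inv_into S t (t s)) \<odot>\<^bsub>M\<^esub> s)"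
      unfolding c(2) using S(2) c(1) t
      by (intro M.finsum_cong') (auto simp: subset_iff intro!: M.lsmult_closed)
    then have "(\<lambda>i. c (inv_into S t i)) \<in> \<phi> x"
      using c(1) t by (auto simp: \<phi>_def)
    then show ?thesis by blast
  qed
  then have "inj_on \<phi> (carrier M)"
    unfolding inj_on_def \<phi>_def by blast
  then show ?thesis
    by (rule fg_module_transport[OF M fg])
qed

section \<open>Artin algebras\<close>

definition artinian :: "('r, 'x) ring_scheme \<Rightarrow> bool" where
  "artinian R \<longleftrightarrow>
    (\<forall>I :: nat \<Rightarrow> 'r set. (\<forall>n. ideal (I n) R \<and> I (Suc n) \<subseteq> I n) \<longrightarrow>
      (\<exists>N. \<forall>n \<ge> N. I n = I N))"

definition local_ring :: "('r, 'x) ring_scheme \<Rightarrow> bool" where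
  "local_ring R \<longleftrightarrow> (\<exists>!I. maximalideal I R)"

text \<open>The library locale \<open>algebra\<close> only covers commutative algebras. The record \<open>\<Lambda>\<close> carries
  both the ring structure of the algebra and its \<open>R\<close>-module structure.\<close>

locale artin_algebra = module R \<Lambda> + \<Lambda>: ring \<Lambda>
    for R :: "('r, 'x) ring_scheme" (structure)
      and \<Lambda> :: "('r, 'a, 'y) module_scheme" (structure) +
  assumes base_artinian: "artinian R"
    and base_local: "local_ring R"
    and smult_mult_left:
      "\<lbrakk>r \<in> carrier R; a \<in> carrier \<Lambda>; b \<in> carrier \<Lambda>\<rbrakk> \<Longrightarrow>
        (r \<odot>\<^bsub>\<Lambda>\<^esub> a) \<otimes>\<^bsub>\<Lambda>\<^esub> b = r \<odot>\<^bsub>\<Lambda>\<^esub> (a \<otimes>\<^bsub>\<Lambda>\<^esub> b)"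
    and smult_mult_right:
      "\<lbrakk>r \<in> carrier R; a \<in> carrier \<Lambda>; b \<in> carrier \<Lambda>\<rbrakk> \<Longrightarrow>
        a \<otimes>\<^bsub>\<Lambda>\<^esub> (r \<odot>\<^bsub>\<Lambda>\<^esub> b) = r \<odot>\<^bsub>\<Lambda>\<^esub> (a \<otimes>\<^bsub>\<Lambda>\<^esub> b)"
    and finitely_generated: "finitely_generated R \<Lambda>"


section \<open>Resolving subcategories\<close>

text \<open>Subcategories are full, hence given by their sets of objects.\<close>

definition additive_subcategory ::
    "('a, 'x) ring_scheme \<Rightarrow> ('a, 'm) module set \<Rightarrow> bool" where
  "additive_subcategory \<Lambda> \<E> \<longleftrightarrow>
    \<E> \<subseteq> fg_modules \<Lambda> \<and>
    (\<forall>X \<in> \<E>. \<forall>Y \<in> fg_modules \<Lambda>. isomorphic \<Lambda> X Y \<longrightarrow> Y \<in> \<E>) \<and>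
    (\<forall>Xs. set Xs \<subseteq> \<E> \<longrightarrow> (\<forall>X \<in> fg_modules \<Lambda>. direct_sum \<Lambda> X Xs \<longrightarrow> X \<in> \<E>))"

text \<open>The elements of \<open>\<Lambda>\<close> need not be of type \<open>'m\<close>; containing \<open>\<Lambda>\<close> means containing an
  isomorphic copy of the regular module.\<close>

definition resolving :: "('a, 'x) ring_scheme \<Rightarrow> ('a, 'm) module set \<Rightarrow> bool" where
  "resolving \<Lambda> \<E> \<longleftrightarrow>
    additive_subcategory \<Lambda> \<E> \<and>
    (\<exists>P \<in> \<E>. isomorphic \<Lambda> (regular_module \<Lambda>) P) \<and>
    (\<forall>X \<in> \<E>. \<forall>Y \<in> fg_modules \<Lambda>. \<forall>Z \<in> \<E>. \<forall>f g. short_exact \<Lambda> X f Y g Z \<longrightarrow> Y \<in> \<E>) \<and>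
    (\<forall>X \<in> fg_modules \<Lambda>. \<forall>Y \<in> \<E>. \<forall>Z \<in> \<E>. \<forall>f g. short_exact \<Lambda> X f Y g Z \<longrightarrow> X \<in> \<E>) \<and>
    (\<forall>X \<in> fg_modules \<Lambda>. \<forall>X' \<in> fg_modules \<Lambda>. \<forall>Y \<in> \<E>.
      direct_sum \<Lambda> Y [X, X'] \<longrightarrow> X \<in> \<E>)"

definition right_approximation ::
    "('a, 'x) ring_scheme \<Rightarrow> ('a, 'm) module set \<Rightarrow> ('a, 'm) module \<Rightarrow> ('m \<Rightarrow> 'm)
      \<Rightarrow> ('a, 'm) module \<Rightarrow> bool" where
  "right_approximation \<Lambda> \<E> E\<^sub>X p X \<longleftrightarrow>
    E\<^sub>X \<in> \<E> \<and> p \<in> lin_hom \<Lambda> E\<^sub>X X \<and>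
    (\<forall>E \<in> \<E>. \<forall>h \<in> lin_hom \<Lambda> E X. \<exists>k \<in> lin_hom \<Lambda> E E\<^sub>X. h = compose (carrier E) p k)"

definition contravariantly_finite ::
    "('a, 'x) ring_scheme \<Rightarrow> ('a, 'm) module set \<Rightarrow> bool" where
  "contravariantly_finite \<Lambda> \<E> \<longleftrightarrow>
    (\<forall>X \<in> fg_modules \<Lambda>. \<exists>E\<^sub>X p. right_approximation \<Lambda> \<E> E\<^sub>X p X)"

definition add_closure ::
    "('a, 'x) ring_scheme \<Rightarrow> ('a, 'm) module \<Rightarrow> ('a, 'm) module set" where
  "add_closure \<Lambda> G =
    {X \<in> fg_modules \<Lambda>. \<exists>n. \<exists>Y \<in> fg_modules \<Lambda>. \<exists>X' \<in> fg_modules \<Lambda>.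
      direct_sum \<Lambda> Y (replicate n G) \<and> direct_sum \<Lambda> Y [X, X']}"

definition finite_type :: "('a, 'x) ring_scheme \<Rightarrow> ('a, 'm) module set \<Rightarrow> bool" where
  "finite_type \<Lambda> \<E> \<longleftrightarrow> (\<exists>G \<in> \<E>. \<E> = add_closure \<Lambda> G)"

definition conflation ::
    "('a, 'x) ring_scheme \<Rightarrow> ('a, 'm) module set \<Rightarrow> ('a, 'm) module \<Rightarrow> ('m \<Rightarrow> 'm)
      \<Rightarrow> ('a, 'm) module \<Rightarrow> ('m \<Rightarrow> 'm) \<Rightarrow> ('a, 'm) module \<Rightarrow> bool" where
  "conflation \<Lambda> \<E> X f Y g Z \<longleftrightarrow>
    X \<in> \<E> \<and> Y \<in> \<E> \<and> Z \<in> \<E> \<and> short_exact \<Lambda> X f Y g Z"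

definition deflation ::
    "('a, 'x) ring_scheme \<Rightarrow> ('a, 'm) module set \<Rightarrow> ('a, 'm) module \<Rightarrow> ('m \<Rightarrow> 'm)
      \<Rightarrow> ('a, 'm) module \<Rightarrow> bool" where
  "deflation \<Lambda> \<E> Y g Z \<longleftrightarrow> (\<exists>X f. conflation \<Lambda> \<E> X f Y g Z)"


section \<open>Functors on a subcategory\<close>

text \<open>Contravariant functors to abelian groups with elements in \<open>'v\<close>; the groups are written
  multiplicatively, as usual in the library. Morphisms do not determine their domain and
  codomain, so these are arguments of \<open>arr\<close>. Only the values on objects of the subcategory and
  on homomorphisms between them are relevant.\<close>

record ('a, 'm, 'v) ab_functor =
  obj :: "('a, 'm) module \<Rightarrow> 'v monoid"
  arr :: "('a, 'm) module \<Rightarrow> ('a, 'm) module \<Rightarrow> ('m \<Rightarrow> 'm) \<Rightarrow> 'v \<Rightarrow> 'v"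

definition additive_functor ::
    "('a, 'x) ring_scheme \<Rightarrow> ('a, 'm) module set \<Rightarrow> ('a, 'm, 'v) ab_functor \<Rightarrow> bool" where
  "additive_functor \<Lambda> \<E> F \<longleftrightarrow>
    (\<forall>X \<in> \<E>. comm_group (obj F X)) \<and>
    (\<forall>X \<in> \<E>. \<forall>Y \<in> \<E>. \<forall>f \<in> lin_hom \<Lambda> X Y. arr F X Y f \<in> hom (obj F Y) (obj F X)) \<and>
    (\<forall>X \<in> \<E>. \<forall>v \<in> carrier (obj F X). arr F X X (hom_id X) v = v) \<and>
    (\<forall>X \<in> \<E>. \<forall>Y \<in> \<E>. \<forall>Z \<in> \<E>. \<forall>f \<in> lin_hom \<Lambda> X Y. \<forall>g \<in> lin_hom \<Lambda> Y Z.
      \<forall>v \<in> carrier (obj F Z).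
        arr F X Z (compose (carrier X) g f) v = arr F X Y f (arr F Y Z g v)) \<and>
    (\<forall>X \<in> \<E>. \<forall>Y \<in> \<E>. \<forall>f \<in> lin_hom \<Lambda> X Y. \<forall>g \<in> lin_hom \<Lambda> X Y.
      \<forall>v \<in> carrier (obj F Y).
        arr F X Y (hom_add X Y f g) v = arr F X Y f v \<otimes>\<^bsub>obj F X\<^esub> arr F X Y g v)"

definition nat_trans ::
    "('a, 'x) ring_scheme \<Rightarrow> ('a, 'm) module set \<Rightarrow> ('a, 'm, 'v) ab_functor
      \<Rightarrow> ('a, 'm, 'w) ab_functor \<Rightarrow> (('a, 'm) module \<Rightarrow> 'v \<Rightarrow> 'w) \<Rightarrow> bool" where
  "nat_trans \<Lambda> \<E> F G \<eta> \<longleftrightarrow>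
    (\<forall>X \<in> \<E>. \<eta> X \<in> hom (obj F X) (obj G X)) \<and>
    (\<forall>X \<in> \<E>. \<forall>Y \<in> \<E>. \<forall>f \<in> lin_hom \<Lambda> X Y. \<forall>v \<in> carrier (obj F Y).
      \<eta> X (arr F X Y f v) = arr G X Y f (\<eta> Y v))"

definition hom_functor ::
    "('a, 'x) ring_scheme \<Rightarrow> ('a, 'm) module \<Rightarrow> ('a, 'm, 'm \<Rightarrow> 'm) ab_functor" where
  "hom_functor \<Lambda> Z =
    \<lparr>obj = (\<lambda>X. \<lparr>carrier = lin_hom \<Lambda> X Z, monoid.mult = hom_add X Z, one = hom_zero X Z\<rparr>),
     arr = (\<lambda>X Y f h. compose (carrier X) h f)\<rparr>"

text \<open>Exactness of sequences of functors is exactness at every object.\<close>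

definition effaceable ::
    "('a, 'x) ring_scheme \<Rightarrow> ('a, 'm) module set \<Rightarrow> ('a, 'm, 'v) ab_functor \<Rightarrow> bool" where
  "effaceable \<Lambda> \<E> M \<longleftrightarrow>
    additive_functor \<Lambda> \<E> M \<and>
    (\<exists>Y f Z \<pi>.
      deflation \<Lambda> \<E> Y f Z \<and> nat_trans \<Lambda> \<E> (hom_functor \<Lambda> Z) M \<pi> \<and>
      (\<forall>X \<in> \<E>.
        \<pi> X ` lin_hom \<Lambda> X Z = carrier (obj M X) \<and>
        kernel (obj (hom_functor \<Lambda> Z) X) (obj M X) (\<pi> X) =
          (\<lambda>h. compose (carrier X) f h) ` lin_hom \<Lambda> X Y))"

definition subfunctor ::
    "('a, 'x) ring_scheme \<Rightarrow> ('a, 'm) module set \<Rightarrow> ('a, 'm, 'v) ab_functor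
      \<Rightarrow> (('a, 'm) module \<Rightarrow> 'v set) \<Rightarrow> bool" where
  "subfunctor \<Lambda> \<E> F S \<longleftrightarrow>
    (\<forall>X \<in> \<E>. subgroup (S X) (obj F X)) \<and>
    (\<forall>X \<in> \<E>. \<forall>Y \<in> \<E>. \<forall>f \<in> lin_hom \<Lambda> X Y. arr F X Y f ` S Y \<subseteq> S X)"

text \<open>The quotient of a subfunctor \<open>T\<close> by a subfunctor \<open>S\<close> contained in it, with cosets as
  elements.\<close>

definition subquotient ::
    "('a, 'm, 'v) ab_functor \<Rightarrow> (('a, 'm) module \<Rightarrow> 'v set) \<Rightarrow> (('a, 'm) module \<Rightarrow> 'v set)
      \<Rightarrow> ('a, 'm, 'v set) ab_functor" where
  "subquotient F T S =
    \<lparr>obj = (\<lambda>X. (obj F X)\<lparr>carrier := T X\<rparr> Mod S X),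
     arr = (\<lambda>X Y f C. S X <#>\<^bsub>obj F X\<^esub> (arr F X Y f ` C))\<rparr>"

definition simple_functor ::
    "('a, 'x) ring_scheme \<Rightarrow> ('a, 'm) module set \<Rightarrow> ('a, 'm, 'v) ab_functor \<Rightarrow> bool" where
  "simple_functor \<Lambda> \<E> F \<longleftrightarrow>
    (\<exists>X \<in> \<E>. carrier (obj F X) \<noteq> {\<one>\<^bsub>obj F X\<^esub>}) \<and>
    (\<forall>S. subfunctor \<Lambda> \<E> F S \<longrightarrow>
      (\<forall>X \<in> \<E>. S X = {\<one>\<^bsub>obj F X\<^esub>}) \<or> (\<forall>X \<in> \<E>. S X = carrier (obj F X)))"

definition finite_length ::
    "('a, 'x) ring_scheme \<Rightarrow> ('a, 'm) module set \<Rightarrow> ('a, 'm, 'v) ab_functor \<Rightarrow> bool" where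
  "finite_length \<Lambda> \<E> F \<longleftrightarrow>
    (\<exists>(n :: nat) S.
      (\<forall>i \<le> n. subfunctor \<Lambda> \<E> F (S i)) \<and>
      (\<forall>X \<in> \<E>. S 0 X = {\<one>\<^bsub>obj F X\<^esub>}) \<and>
      (\<forall>X \<in> \<E>. S n X = carrier (obj F X)) \<and>
      (\<forall>i < n. (\<forall>X \<in> \<E>. S i X \<subseteq> S (Suc i) X) \<and>
        simple_functor \<Lambda> \<E> (subquotient F (S (Suc i)) (S i))))"

text \<open>Up to isomorphism, the values of an effaceable functor are groups whose elements are sets
  of homomorphisms, so it suffices to consider functors with such values.\<close>

lemma effaceable_representative:
  fixes M :: "('a, 'm, 'v) ab_functor"
  assumes eff: "effaceable \<Lambda> \<E> M"
  shows "\<exists>(M' :: ('a, 'm, ('m \<Rightarrow> 'm) set) ab_functor) \<eta>.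
    effaceable \<Lambda> \<E> M' \<and> nat_trans \<Lambda> \<E> M M' \<eta> \<and>
    (\<forall>X \<in> \<E>. bij_betw (\<eta> X) (carrier (obj M X)) (carrier (obj M' X)))"
proof -
  obtain Y f Z \<pi> where add: "additive_functor \<Lambda> \<E> M" and defl: "deflation \<Lambda> \<E> Y f Z"
    and nat: "nat_trans \<Lambda> \<E> (hom_functor \<Lambda> Z) M \<pi>"
    and surj: "\<And>X. X \<in> \<E> \<Longrightarrow> \<pi> X ` lin_hom \<Lambda> X Z = carrier (obj M X)"
    and ker: "\<And>X. X \<in> \<E> \<Longrightarrow> kernel (obj (hom_functor \<Lambda> Z) X) (obj M X) (\<pi> X) =
          (\<lambda>h. compose (carrier X) f h) ` lin_hom \<Lambda> X Y"
    using eff unfolding effaceable_def by (elim conjE exE) metis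
  define \<phi> where "\<phi> X v = {h \<in> lin_hom \<Lambda> X Z. \<pi> X h = v}" for X v
  define \<psi> where "\<psi> X = inv_into (carrier (obj M X)) (\<phi> X)" for X
  have inj: "inj_on (\<phi> X) (carrier (obj M X))" if "X \<in> \<E>" for X
    unfolding inj_on_def surj[OF that, symmetric] \<phi>_def by blast
  have \<psi> [simp]: "\<psi> X (\<phi> X v) = v" if "X \<in> \<E>" "v \<in> carrier (obj M X)" for X v
    using inj that by (simp add: \<psi>_def)
  define M' where "M' =
    \<lparr>obj = (\<lambda>X. \<lparr>carrier = \<phi> X ` carrier (obj M X),
       monoid.mult = (\<lambda>u w. \<phi> X (\<psi> X u \<otimes>\<^bsub>obj M X\<^esub> \<psi> X w)), one = \<phi> X \<one>\<^bsub>obj M X\<^esub>\<rparr>),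
     arr = (\<lambda>X Y f u. \<phi> X (arr M X Y f (\<psi> Y u)))\<rparr>"
  have grp: "comm_group (obj M X)" if "X \<in> \<E>" for X
    using add that unfolding additive_functor_def by blast
  have grp': "comm_group (obj M' X)" if X: "X \<in> \<E>" for X
  proof -
    interpret G: comm_group "obj M X" by (rule grp[OF X])
    show ?thesis
    proof (rule comm_groupI)
      show "\<exists>w\<in>carrier (obj M' X). w \<otimes>\<^bsub>obj M' X\<^esub> u = \<one>\<^bsub>obj M' X\<^esub>"
        if "u \<in> carrier (obj M' X)" for u
      proof -
        obtain v where v: "v \<in> carrier (obj M X)" "u = \<phi> X v"
          using \<open>u \<in> carrier (obj M' X)\<close> by (auto simp: M'_def)
        have "\<phi> X (inv\<^bsub>obj M X\<^esub> v) \<otimes>\<^bsub>obj M' X\<^esub> u = \<one>\<^bsub>obj M' X\<^esub>"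
          using v X by (simp add: M'_def)
        then show ?thesis using v by (force simp: M'_def)
      qed
    qed (use X in \<open>auto simp: M'_def G.m_ac\<close>)
  qed
  have arr: "arr M X Y f \<in> hom (obj M Y) (obj M X)"
    if "X \<in> \<E>" "Y \<in> \<E>" "f \<in> lin_hom \<Lambda> X Y" for X Y f
    using add that unfolding additive_functor_def by blast
  have arr_closed: "arr M X Y f v \<in> carrier (obj M X)"
    if "X \<in> \<E>" "Y \<in> \<E>" "f \<in> lin_hom \<Lambda> X Y" "v \<in> carrier (obj M Y)" for X Y f v
    using hom_in_carrier[OF arr[OF that(1-3)] that(4)] .
  have mult_closed: "u \<otimes>\<^bsub>obj M X\<^esub> v \<in> carrier (obj M X)"
    if "X \<in> \<E>" "u \<in> carrier (obj M X)" "v \<in> carrier (obj M X)" for X u v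
    using grp[OF that(1)] that by (simp add: comm_group_def group.is_monoid monoid.m_closed)
  have \<phi>_hom: "\<phi> X \<in> hom (obj M X) (obj M' X)" if "X \<in> \<E>" for X
    using that by (auto simp: hom_def M'_def)
  have \<phi>_nat: "\<phi> X (arr M X Y f v) = arr M' X Y f (\<phi> Y v)"
    if "X \<in> \<E>" "Y \<in> \<E>" "f \<in> lin_hom \<Lambda> X Y" "v \<in> carrier (obj M Y)" for X Y f v
    using that by (simp add: M'_def)
  have nat\<phi>: "nat_trans \<Lambda> \<E> M M' \<phi>"
    using \<phi>_hom \<phi>_nat by (simp add: nat_trans_def)
  have carr: "carrier (obj M' X) = \<phi> X ` carrier (obj M X)" for X
    by (simp add: M'_def)
  have bij: "bij_betw (\<phi> X) (carrier (obj M X)) (carrier (obj M' X))" if "X \<in> \<E>" for X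
    using inj[OF that] by (simp add: bij_betw_def carr)
  have add_id: "arr M X X (hom_id X) v = v" if "X \<in> \<E>" "v \<in> carrier (obj M X)" for X v
    using add that unfolding additive_functor_def by blast
  have add_comp: "arr M X Z (compose (carrier X) g f) v = arr M X Y f (arr M Y Z g v)"
    if "X \<in> \<E>" "Y \<in> \<E>" "Z \<in> \<E>" "f \<in> lin_hom \<Lambda> X Y" "g \<in> lin_hom \<Lambda> Y Z"
      "v \<in> carrier (obj M Z)" for X Y Z f g v
    using add that unfolding additive_functor_def by blast
  have add_add: "arr M X Y (hom_add X Y f g) v = arr M X Y f v \<otimes>\<^bsub>obj M X\<^esub> arr M X Y g v"
    if "X \<in> \<E>" "Y \<in> \<E>" "f \<in> lin_hom \<Lambda> X Y" "g \<in> lin_hom \<Lambda> X Y"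
      "v \<in> carrier (obj M Y)" for X Y f g v
    using add that unfolding additive_functor_def by blast
  have add': "additive_functor \<Lambda> \<E> M'"
    unfolding additive_functor_def
  proof (intro conjI ballI)
    show "arr M' X Y f \<in> hom (obj M' Y) (obj M' X)"
      if "X \<in> \<E>" "Y \<in> \<E>" "f \<in> lin_hom \<Lambda> X Y" for X Y f
      using that arr_closed[OF that] hom_mult[OF arr[OF that]] mult_closed
      by (auto simp: hom_def M'_def)
    show "arr M' X X (hom_id X) u = u" if "X \<in> \<E>" "u \<in> carrier (obj M' X)" for X u
      using that add_id by (auto simp: M'_def)
    show "arr M' X Z (compose (carrier X) g f) u = arr M' X Y f (arr M' Y Z g u)"
      if "X \<in> \<E>" "Y \<in> \<E>" "Z \<in> \<E>" "f \<in> lin_hom \<Lambda> X Y" "g \<in> lin_hom \<Lambda> Y Z"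
        and u: "u \<in> carrier (obj M' Z)" for X Y Z f g u
    proof -
      obtain v where v: "v \<in> carrier (obj M Z)" "u = \<phi> Z v" using u by (auto simp: carr)
      show ?thesis
        using add_comp[OF that(1-5) v(1)] arr_closed[OF that(2,3,5) v(1)] that(1-3) v
        by (simp add: M'_def)
    qed
    show "arr M' X Y (hom_add X Y f g) u = arr M' X Y f u \<otimes>\<^bsub>obj M' X\<^esub> arr M' X Y g u"
      if "X \<in> \<E>" "Y \<in> \<E>" "f \<in> lin_hom \<Lambda> X Y" "g \<in> lin_hom \<Lambda> X Y"
        and u: "u \<in> carrier (obj M' Y)" for X Y f g u
    proof -
      obtain v where v: "v \<in> carrier (obj M Y)" "u = \<phi> Y v" using u by (auto simp: carr)
      show ?thesis
        using add_add[OF that(1-4) v(1)] arr_closed[OF that(1-3) v(1)]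
          arr_closed[OF that(1,2,4) v(1)] that(1,2) v
        by (simp add: M'_def)
    qed
  qed (use grp' in simp)
  have \<pi>_closed: "\<pi> X h \<in> carrier (obj M X)" if "X \<in> \<E>" "h \<in> lin_hom \<Lambda> X Z" for X h
    using surj[OF that(1)] that(2) by blast
  have nat': "nat_trans \<Lambda> \<E> (hom_functor \<Lambda> Z) M' (\<lambda>X. \<phi> X \<circ> \<pi> X)"
    unfolding nat_trans_def
  proof (intro conjI ballI)
    show "\<phi> X \<circ> \<pi> X \<in> hom (obj (hom_functor \<Lambda> Z) X) (obj M' X)" if "X \<in> \<E>" for X
      using nat \<phi>_hom that unfolding nat_trans_def by (blast intro: hom_compose)
    show "(\<phi> X \<circ> \<pi> X) (arr (hom_functor \<Lambda> Z) X Y f v) = arr M' X Y f ((\<phi> Y \<circ> \<pi> Y) v)"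
      if "X \<in> \<E>" "Y \<in> \<E>" "f \<in> lin_hom \<Lambda> X Y" "v \<in> carrier (obj (hom_functor \<Lambda> Z) Y)"
      for X Y f v
    proof -
      have "v \<in> lin_hom \<Lambda> Y Z" using that(4) by (simp add: hom_functor_def)
      then have "\<pi> Y v \<in> carrier (obj M Y)" using \<pi>_closed that by blast
      then show ?thesis
        using nat that unfolding nat_trans_def by (simp add: \<phi>_nat)
    qed
  qed
  have "effaceable \<Lambda> \<E> M'"
    unfolding effaceable_def
  proof (intro conjI exI ballI)
    show "(\<phi> X \<circ> \<pi> X) ` lin_hom \<Lambda> X Z = carrier (obj M' X)" if "X \<in> \<E>" for X
      unfolding image_comp[symmetric] surj[OF that] carr ..
    show "kernel (obj (hom_functor \<Lambda> Z) X) (obj M' X) (\<phi> X \<circ> \<pi> X) =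
        (\<lambda>h. compose (carrier X) f h) ` lin_hom \<Lambda> X Y" if X: "X \<in> \<E>" for X
    proof -
      interpret G: comm_group "obj M X" by (rule grp[OF X])
      have "\<phi> X (\<pi> X h) = \<one>\<^bsub>obj M' X\<^esub> \<longleftrightarrow> \<pi> X h = \<one>\<^bsub>obj M X\<^esub>" if "h \<in> lin_hom \<Lambda> X Z" for h
        using inj_onD[OF inj[OF X], of "\<pi> X h" "\<one>\<^bsub>obj M X\<^esub>"] \<pi>_closed[OF X that]
        by (auto simp: M'_def)
      then show ?thesis
        unfolding ker[OF X, symmetric] kernel_def by (auto simp: hom_functor_def)
    qed
  qed (rule add' defl nat')+
  with nat\<phi> bij show ?thesis by blast
qed

definition admissible :: "('a, 'x) ring_scheme \<Rightarrow> ('a, 'm) module set \<Rightarrow> bool" where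
  "admissible \<Lambda> \<E> \<longleftrightarrow>
    (\<forall>M :: ('a, 'm, ('m \<Rightarrow> 'm) set) ab_functor.
      effaceable \<Lambda> \<E> M \<longrightarrow> finite_length \<Lambda> \<E> M)"


section \<open>Almost split sequences\<close>

definition radical ::
    "('a, 'x) ring_scheme \<Rightarrow> ('a, 'm) module \<Rightarrow> ('a, 'm) module \<Rightarrow> ('m \<Rightarrow> 'm) set" where
  "radical \<Lambda> X Y =
    {f \<in> lin_hom \<Lambda> X Y. \<forall>g \<in> lin_hom \<Lambda> Y X.
      hom_diff X X (hom_id X) (compose (carrier X) g f) \<in> lin_iso \<Lambda> X X}"

definition indecomposable ::
    "('a, 'x) ring_scheme \<Rightarrow> ('a, 'm) module set \<Rightarrow> ('a, 'm) module \<Rightarrow> bool" where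
  "indecomposable \<Lambda> \<E> X \<longleftrightarrow>
    X \<in> \<E> \<and> carrier X \<noteq> {\<zero>\<^bsub>X\<^esub>} \<and>
    (\<forall>A \<in> \<E>. \<forall>B \<in> \<E>. direct_sum \<Lambda> X [A, B] \<longrightarrow>
      carrier A = {\<zero>\<^bsub>A\<^esub>} \<or> carrier B = {\<zero>\<^bsub>B\<^esub>})"

definition right_almost_split ::
    "('a, 'x) ring_scheme \<Rightarrow> ('a, 'm) module set \<Rightarrow> ('a, 'm) module \<Rightarrow> ('m \<Rightarrow> 'm)
      \<Rightarrow> ('a, 'm) module \<Rightarrow> bool" where
  "right_almost_split \<Lambda> \<E> Y g Z \<longleftrightarrow>
    Y \<in> \<E> \<and> indecomposable \<Lambda> \<E> Z \<and> g \<in> radical \<Lambda> Y Z \<and>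
    (\<forall>W \<in> \<E>. \<forall>h \<in> radical \<Lambda> W Z. \<exists>k \<in> lin_hom \<Lambda> W Y. h = compose (carrier W) g k)"

definition left_almost_split ::
    "('a, 'x) ring_scheme \<Rightarrow> ('a, 'm) module set \<Rightarrow> ('a, 'm) module \<Rightarrow> ('m \<Rightarrow> 'm)
      \<Rightarrow> ('a, 'm) module \<Rightarrow> bool" where
  "left_almost_split \<Lambda> \<E> X f Y \<longleftrightarrow>
    Y \<in> \<E> \<and> indecomposable \<Lambda> \<E> X \<and> f \<in> radical \<Lambda> X Y \<and>
    (\<forall>W \<in> \<E>. \<forall>h \<in> radical \<Lambda> X W. \<exists>k \<in> lin_hom \<Lambda> Y W. h = compose (carrier X) k f)"

definition AR_conflation ::
    "('a, 'x) ring_scheme \<Rightarrow> ('a, 'm) module set \<Rightarrow> ('a, 'm) module \<Rightarrow> ('m \<Rightarrow> 'm)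
      \<Rightarrow> ('a, 'm) module \<Rightarrow> ('m \<Rightarrow> 'm) \<Rightarrow> ('a, 'm) module \<Rightarrow> bool" where
  "AR_conflation \<Lambda> \<E> X f Y g Z \<longleftrightarrow>
    conflation \<Lambda> \<E> X f Y g Z \<and>
    left_almost_split \<Lambda> \<E> X f Y \<and> right_almost_split \<Lambda> \<E> Y g Z"


section \<open>Grothendieck groups\<close>

definition iso_class ::
    "('a, 'x) ring_scheme \<Rightarrow> ('a, 'm) module set \<Rightarrow> ('a, 'm) module
      \<Rightarrow> ('a, 'm) module set" where
  "iso_class \<Lambda> \<E> X = {Y \<in> \<E>. isomorphic \<Lambda> X Y}"

definition K0_split ::
    "('a, 'x) ring_scheme \<Rightarrow> ('a, 'm) module set
      \<Rightarrow> (('a, 'm) module set \<Rightarrow>\<^sub>0 int) monoid" where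
  "K0_split \<Lambda> \<E> = free_Abelian_group (iso_class \<Lambda> \<E> ` {X. indecomposable \<Lambda> \<E> X})"

text \<open>The class \<open>[X]\<close>; existence and uniqueness of the described element are the Krull-Schmidt
  theorem.\<close>

definition K0_class ::
    "('a, 'x) ring_scheme \<Rightarrow> ('a, 'm) module set \<Rightarrow> ('a, 'm) module
      \<Rightarrow> (('a, 'm) module set \<Rightarrow>\<^sub>0 int)" where
  "K0_class \<Lambda> \<E> X =
    (THE c. \<exists>Xs. (\<forall>Y \<in> set Xs. indecomposable \<Lambda> \<E> Y) \<and> direct_sum \<Lambda> X Xs \<and>
      c = (\<Sum>Y\<leftarrow>Xs. frag_of (iso_class \<Lambda> \<E> Y)))"

definition Ex_group ::
    "('a, 'x) ring_scheme \<Rightarrow> ('a, 'm) module set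
      \<Rightarrow> (('a, 'm) module set \<Rightarrow>\<^sub>0 int) set" where
  "Ex_group \<Lambda> \<E> = generate (K0_split \<Lambda> \<E>)
    {K0_class \<Lambda> \<E> X - K0_class \<Lambda> \<E> Y + K0_class \<Lambda> \<E> Z | X f Y g Z.
      conflation \<Lambda> \<E> X f Y g Z}"

definition AR_group ::
    "('a, 'x) ring_scheme \<Rightarrow> ('a, 'm) module set
      \<Rightarrow> (('a, 'm) module set \<Rightarrow>\<^sub>0 int) set" where
  "AR_group \<Lambda> \<E> = generate (K0_split \<Lambda> \<E>)
    {K0_class \<Lambda> \<E> X - K0_class \<Lambda> \<E> Y + K0_class \<Lambda> \<E> Z | X f Y g Z.
      AR_conflation \<Lambda> \<E> X f Y g Z}"

definition rat_scale :: "rat \<Rightarrow> ('s \<Rightarrow>\<^sub>0 rat) \<Rightarrow> ('s \<Rightarrow>\<^sub>0 rat)" where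
  "rat_scale q c = Poly_Mapping.map ((*) q) c"

lemma lookup_rat_scale [simp]:
  "Poly_Mapping.lookup (rat_scale q c) s = q * Poly_Mapping.lookup c s"
  by (simp add: rat_scale_def Poly_Mapping.map.rep_eq when_def)

interpretation rat_free: vector_space rat_scale
  by unfold_locales
    (auto intro!: poly_mapping_eqI simp: lookup_add algebra_simps)

text \<open>The tensor product with the rationals of the free abelian group on \<open>B\<close> is the space of
  finitely supported functions \<open>B \<rightarrow> \<rat>\<close>. As the rationals are flat, for a subgroup \<open>H\<close> the
  space \<open>H \<otimes> \<rat>\<close> is the subspace spanned by the image of \<open>H\<close>.\<close>

definition tensor_rat :: "('s \<Rightarrow>\<^sub>0 int) set \<Rightarrow> ('s \<Rightarrow>\<^sub>0 rat) set" where
  "tensor_rat H = rat_free.span (Poly_Mapping.map rat_of_int ` H)"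

end

theory Submission
  imports Defs "HOL-Library.Extended_Nat"
begin

text \<open>
  Consider a conflation \<open>X \<rightarrow> Y \<rightarrow> Z\<close> and the cokernel \<open>M\<close> of \<open>\<E>(-,Y) \<rightarrow> \<E>(-,Z)\<close>.

  If \<open>\<E> = add G\<close>, a subfunctor of \<open>M\<close> is determined by an \<open>R\<close>-submodule of the finite length module
  \<open>Hom(G,Z)\<close>, so \<open>M\<close> has finite length.

  If \<open>M\<close> has finite length, a composition series of \<open>M\<close> is a chain of subfunctors of \<open>\<E>(-,Z)\<close> starting
  with the image of \<open>\<E>(-,Y)\<close>. Let \<open>h : W \<rightarrow> Z\<close> with \<open>W\<close> indecomposable belong to the second member of the chain
  and not to the first, and let \<open>P\<close> be the pullback of \<open>Y\<close> and \<open>W\<close> over \<open>Z\<close>. The conflation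
  \<open>X \<rightarrow> P \<rightarrow> W\<close> has a simple cokernel functor, \<open>P \<rightarrow> Y \<oplus> W \<rightarrow> Z\<close> one of smaller length, and
  the class \<open>[X] - [Y] + [Z]\<close> is the sum of the corresponding classes. If \<open>M\<close> is simple, replace \<open>Y\<close> by a
  middle term of minimal length; by Schanuel's lemma the class does not change, and minimality makes the
  conflation an AR conflation. So finite length of all \<open>M\<close> implies \<open>AR(\<E>) = Ex(\<E>)\<close>.

  For an indecomposable \<open>U\<close> the length of \<open>Hom(U,-)\<close> is a functional on \<open>K\<^sub>0(\<E>,0) \<otimes> \<rat>\<close> whose value on
  \<open>[X] - [Y] + [Z]\<close> is the length of \<open>M(U)\<close>. On an AR conflation ending in \<open>Z\<close> it vanishes unless
  \<open>U \<cong> Z\<close>. Hence on an element of \<open>AR(\<E>) \<otimes> \<rat>\<close> it vanishes for almost all \<open>U\<close>. Under (4) this applies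
  to a conflation \<open>K \<rightarrow> \<Lambda>\<^sup>n \<rightarrow> E\<^sub>S\<close>, where \<open>E\<^sub>S\<close> is a right approximation of a simple module \<open>S\<close>. If the
  functional of \<open>U\<close> vanishes there, every epimorphism \<open>U \<rightarrow> S\<close> factors through \<open>\<Lambda>\<^sup>n\<close>, which forces \<open>U\<close> to
  be a summand of \<open>\<Lambda>\<close>. As there are only finitely many \<open>S\<close>, there are only finitely many \<open>U\<close>.
\<close>

section \<open>Modules and homomorphisms\<close>

text \<open>No almost split sequence is assumed to exist. One is obtained only where a simple
  cokernel functor already supplies a conflation along which all radical morphisms into its end
  lift. The conditions on the left end then come from comparing the conflation with its pushouts. A
  middle term of least length helps here because, by Fitting's lemma, every endomorphism of it over
  the end term is invertible. Contravariant finiteness enters through the passage from S to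
  \<open>E_S\<close>: a simple module need not lie in \<open>\<E>\<close>, but all morphisms from
  \<open>\<E>\<close> to it pass through the approximation, so lifting morphisms into
  \<open>E_S\<close> controls epimorphisms onto S. Hom-sets are measured by their length over R.
  Length is a supremum of chain lengths, and its additivity does the work of the Jordan-Hoelder
  theorem; the length of Hom modulo the radical also gives uniqueness of decompositions. Only the
  vanishing of linear functionals is used at the end, which is why rational coefficients suffice.
  Kernels, quotients and biproducts must all be realised over one element type, since the objects of
  \<open>\<E>\<close> are modules over a fixed type.\<close>

locale mod_base =
  fixes A :: "('a, 'x) ring_scheme"
  assumes ring_A: "ring A"
begin

abbreviation lm :: "('a, 'm, 'y) module_scheme \<Rightarrow> bool" where
  "lm X \<equiv> left_module A X"

lemma lm_group: "lm X \<Longrightarrow> abelian_group X"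
  by (rule left_module.axioms)

text \<open>Most arguments involve several modules at once. The group and module laws are therefore
  stated with the module as an explicit premise, instead of through one interpretation per
  module.\<close>

lemma lm_closed [simp]:
  assumes "lm X"
  shows "\<zero>\<^bsub>X\<^esub> \<in> carrier X"
    "\<lbrakk>x \<in> carrier X; y \<in> carrier X\<rbrakk> \<Longrightarrow> x \<oplus>\<^bsub>X\<^esub> y \<in> carrier X"
    "x \<in> carrier X \<Longrightarrow> \<ominus>\<^bsub>X\<^esub> x \<in> carrier X"
    "\<lbrakk>x \<in> carrier X; y \<in> carrier X\<rbrakk> \<Longrightarrow> x \<ominus>\<^bsub>X\<^esub> y \<in> carrier X"
    "\<lbrakk>a \<in> carrier A; x \<in> carrier X\<rbrakk> \<Longrightarrow> a \<odot>\<^bsub>X\<^esub> x \<in> carrier X"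
proof -
  interpret abelian_group X by (rule lm_group[OF assms])
  show "\<zero>\<^bsub>X\<^esub> \<in> carrier X"
    "\<lbrakk>x \<in> carrier X; y \<in> carrier X\<rbrakk> \<Longrightarrow> x \<oplus>\<^bsub>X\<^esub> y \<in> carrier X"
    "x \<in> carrier X \<Longrightarrow> \<ominus>\<^bsub>X\<^esub> x \<in> carrier X"
    "\<lbrakk>x \<in> carrier X; y \<in> carrier X\<rbrakk> \<Longrightarrow> x \<ominus>\<^bsub>X\<^esub> y \<in> carrier X"
      by auto
  show "\<lbrakk>a \<in> carrier A; x \<in> carrier X\<rbrakk> \<Longrightarrow> a \<odot>\<^bsub>X\<^esub> x \<in> carrier X"
    using left_module.lsmult_closed[OF assms] .
qed

lemma lm_add:
  assumes "lm X" "x \<in> carrier X"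
  shows "\<zero>\<^bsub>X\<^esub> \<oplus>\<^bsub>X\<^esub> x = x" "x \<oplus>\<^bsub>X\<^esub> \<zero>\<^bsub>X\<^esub> = x" "x \<ominus>\<^bsub>X\<^esub> x = \<zero>\<^bsub>X\<^esub>" "x \<ominus>\<^bsub>X\<^esub> \<zero>\<^bsub>X\<^esub> = x"
    "\<ominus>\<^bsub>X\<^esub> x \<oplus>\<^bsub>X\<^esub> x = \<zero>\<^bsub>X\<^esub>" "x \<oplus>\<^bsub>X\<^esub> \<ominus>\<^bsub>X\<^esub> x = \<zero>\<^bsub>X\<^esub>" "\<ominus>\<^bsub>X\<^esub> (\<ominus>\<^bsub>X\<^esub> x) = x" "\<ominus>\<^bsub>X\<^esub> \<zero>\<^bsub>X\<^esub> = \<zero>\<^bsub>X\<^esub>"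
    "\<zero>\<^bsub>X\<^esub> \<ominus>\<^bsub>X\<^esub> x = \<ominus>\<^bsub>X\<^esub> x"
proof -
  interpret abelian_group X by (rule lm_group[OF assms(1)])
  show "\<zero>\<^bsub>X\<^esub> \<oplus>\<^bsub>X\<^esub> x = x" "x \<oplus>\<^bsub>X\<^esub> \<zero>\<^bsub>X\<^esub> = x" "x \<ominus>\<^bsub>X\<^esub> x = \<zero>\<^bsub>X\<^esub>" "x \<ominus>\<^bsub>X\<^esub> \<zero>\<^bsub>X\<^esub> = x"
    "\<ominus>\<^bsub>X\<^esub> x \<oplus>\<^bsub>X\<^esub> x = \<zero>\<^bsub>X\<^esub>" "x \<oplus>\<^bsub>X\<^esub> \<ominus>\<^bsub>X\<^esub> x = \<zero>\<^bsub>X\<^esub>" "\<ominus>\<^bsub>X\<^esub> (\<ominus>\<^bsub>X\<^esub> x) = x" "\<ominus>\<^bsub>X\<^esub> \<zero>\<^bsub>X\<^esub> = \<zero>\<^bsub>X\<^esub>"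
    "\<zero>\<^bsub>X\<^esub> \<ominus>\<^bsub>X\<^esub> x = \<ominus>\<^bsub>X\<^esub> x"
    using assms(2) by (auto simp: a_minus_def l_neg r_neg)
qed

lemma lm_zero_zero [simp]:
  assumes "lm X" shows "\<zero>\<^bsub>X\<^esub> \<oplus>\<^bsub>X\<^esub> \<zero>\<^bsub>X\<^esub> = \<zero>\<^bsub>X\<^esub>"
  using lm_add(1)[OF assms] assms by simp

lemma lm_ac:
  assumes "lm X" "x \<in> carrier X" "y \<in> carrier X"
  shows "x \<oplus>\<^bsub>X\<^esub> y = y \<oplus>\<^bsub>X\<^esub> x"
    "z \<in> carrier X \<Longrightarrow> (x \<oplus>\<^bsub>X\<^esub> y) \<oplus>\<^bsub>X\<^esub> z = x \<oplus>\<^bsub>X\<^esub> (y \<oplus>\<^bsub>X\<^esub> z)"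
    "z \<in> carrier X \<Longrightarrow> x \<oplus>\<^bsub>X\<^esub> (y \<oplus>\<^bsub>X\<^esub> z) = y \<oplus>\<^bsub>X\<^esub> (x \<oplus>\<^bsub>X\<^esub> z)"
proof -
  interpret abelian_group X by (rule lm_group[OF assms(1)])
  show "x \<oplus>\<^bsub>X\<^esub> y = y \<oplus>\<^bsub>X\<^esub> x"
    "z \<in> carrier X \<Longrightarrow> (x \<oplus>\<^bsub>X\<^esub> y) \<oplus>\<^bsub>X\<^esub> z = x \<oplus>\<^bsub>X\<^esub> (y \<oplus>\<^bsub>X\<^esub> z)"
    "z \<in> carrier X \<Longrightarrow> x \<oplus>\<^bsub>X\<^esub> (y \<oplus>\<^bsub>X\<^esub> z) = y \<oplus>\<^bsub>X\<^esub> (x \<oplus>\<^bsub>X\<^esub> z)"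
    using assms(2,3) by (auto simp: a_ac)
qed

lemma lm_minus:
  assumes "lm X" "x \<in> carrier X" "y \<in> carrier X"
  shows "x \<ominus>\<^bsub>X\<^esub> y = \<zero>\<^bsub>X\<^esub> \<longleftrightarrow> x = y" "(x \<ominus>\<^bsub>X\<^esub> y) \<oplus>\<^bsub>X\<^esub> y = x" "y \<oplus>\<^bsub>X\<^esub> (x \<ominus>\<^bsub>X\<^esub> y) = x"
    "(x \<oplus>\<^bsub>X\<^esub> y) \<ominus>\<^bsub>X\<^esub> y = x" "(x \<oplus>\<^bsub>X\<^esub> y) \<ominus>\<^bsub>X\<^esub> x = y" "x \<ominus>\<^bsub>X\<^esub> (x \<ominus>\<^bsub>X\<^esub> y) = y"
    "x \<oplus>\<^bsub>X\<^esub> y = \<zero>\<^bsub>X\<^esub> \<longleftrightarrow> x = \<ominus>\<^bsub>X\<^esub> y"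
proof -
  interpret abelian_group X by (rule lm_group[OF assms(1)])
  note [simp] = assms(2,3)
  show 1: "(x \<ominus>\<^bsub>X\<^esub> y) \<oplus>\<^bsub>X\<^esub> y = x" "y \<oplus>\<^bsub>X\<^esub> (x \<ominus>\<^bsub>X\<^esub> y) = x"
    "(x \<oplus>\<^bsub>X\<^esub> y) \<ominus>\<^bsub>X\<^esub> y = x" "(x \<oplus>\<^bsub>X\<^esub> y) \<ominus>\<^bsub>X\<^esub> x = y" "x \<ominus>\<^bsub>X\<^esub> (x \<ominus>\<^bsub>X\<^esub> y) = y"
  proof -
    show a: "(x \<ominus>\<^bsub>X\<^esub> y) \<oplus>\<^bsub>X\<^esub> y = x"
      by (simp add: a_minus_def a_assoc l_neg)
    then show "y \<oplus>\<^bsub>X\<^esub> (x \<ominus>\<^bsub>X\<^esub> y) = x"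
      using a_comm[of y "x \<ominus>\<^bsub>X\<^esub> y"] by simp
    show b: "(x \<oplus>\<^bsub>X\<^esub> y) \<ominus>\<^bsub>X\<^esub> y = x"
      by (simp add: a_minus_def a_assoc r_neg)
    show "(x \<oplus>\<^bsub>X\<^esub> y) \<ominus>\<^bsub>X\<^esub> x = y"
      by (simp add: a_minus_def a_comm[of x y] a_assoc r_neg)
    show "x \<ominus>\<^bsub>X\<^esub> (x \<ominus>\<^bsub>X\<^esub> y) = y"
      by (simp add: a_minus_def minus_add a_assoc[symmetric] r_neg)
  qed
  show "x \<ominus>\<^bsub>X\<^esub> y = \<zero>\<^bsub>X\<^esub> \<longleftrightarrow> x = y"
    using 1(1) by (auto simp: a_minus_def r_neg)
  show "x \<oplus>\<^bsub>X\<^esub> y = \<zero>\<^bsub>X\<^esub> \<longleftrightarrow> x = \<ominus>\<^bsub>X\<^esub> y"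
    using minus_equality[of x y] by (auto simp: l_neg)
qed

lemma lm_smult:
  assumes "lm X" "x \<in> carrier X"
  shows "\<one>\<^bsub>A\<^esub> \<odot>\<^bsub>X\<^esub> x = x"
    "\<lbrakk>a \<in> carrier A; b \<in> carrier A\<rbrakk> \<Longrightarrow> (a \<otimes>\<^bsub>A\<^esub> b) \<odot>\<^bsub>X\<^esub> x = a \<odot>\<^bsub>X\<^esub> (b \<odot>\<^bsub>X\<^esub> x)"
    "\<lbrakk>a \<in> carrier A; b \<in> carrier A\<rbrakk> \<Longrightarrow> (a \<oplus>\<^bsub>A\<^esub> b) \<odot>\<^bsub>X\<^esub> x = a \<odot>\<^bsub>X\<^esub> x \<oplus>\<^bsub>X\<^esub> b \<odot>\<^bsub>X\<^esub> x"
    "\<lbrakk>a \<in> carrier A; y \<in> carrier X\<rbrakk> \<Longrightarrow> a \<odot>\<^bsub>X\<^esub> (x \<oplus>\<^bsub>X\<^esub> y) = a \<odot>\<^bsub>X\<^esub> x \<oplus>\<^bsub>X\<^esub> a \<odot>\<^bsub>X\<^esub> y"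
    "\<zero>\<^bsub>A\<^esub> \<odot>\<^bsub>X\<^esub> x = \<zero>\<^bsub>X\<^esub>"
    "a \<in> carrier A \<Longrightarrow> a \<odot>\<^bsub>X\<^esub> \<zero>\<^bsub>X\<^esub> = \<zero>\<^bsub>X\<^esub>"
    "a \<in> carrier A \<Longrightarrow> (\<ominus>\<^bsub>A\<^esub> a) \<odot>\<^bsub>X\<^esub> x = \<ominus>\<^bsub>X\<^esub> (a \<odot>\<^bsub>X\<^esub> x)"
    "a \<in> carrier A \<Longrightarrow> a \<odot>\<^bsub>X\<^esub> (\<ominus>\<^bsub>X\<^esub> x) = \<ominus>\<^bsub>X\<^esub> (a \<odot>\<^bsub>X\<^esub> x)"
    "\<lbrakk>a \<in> carrier A; y \<in> carrier X\<rbrakk> \<Longrightarrow> a \<odot>\<^bsub>X\<^esub> (x \<ominus>\<^bsub>X\<^esub> y) = a \<odot>\<^bsub>X\<^esub> x \<ominus>\<^bsub>X\<^esub> a \<odot>\<^bsub>X\<^esub> y"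
proof -
  interpret X: abelian_group X by (rule lm_group[OF assms(1)])
  interpret A: ring A by (rule ring_A)
  note [simp] = assms(2) lm_closed[OF assms(1)]
  note D = left_module.lsmult_one[OF assms(1)] left_module.lsmult_assoc[OF assms(1)]
    left_module.lsmult_l_distr[OF assms(1)] left_module.lsmult_r_distr[OF assms(1)]
  show "\<one>\<^bsub>A\<^esub> \<odot>\<^bsub>X\<^esub> x = x"
    "\<lbrakk>a \<in> carrier A; b \<in> carrier A\<rbrakk> \<Longrightarrow> (a \<otimes>\<^bsub>A\<^esub> b) \<odot>\<^bsub>X\<^esub> x = a \<odot>\<^bsub>X\<^esub> (b \<odot>\<^bsub>X\<^esub> x)"
    "\<lbrakk>a \<in> carrier A; b \<in> carrier A\<rbrakk> \<Longrightarrow> (a \<oplus>\<^bsub>A\<^esub> b) \<odot>\<^bsub>X\<^esub> x = a \<odot>\<^bsub>X\<^esub> x \<oplus>\<^bsub>X\<^esub> b \<odot>\<^bsub>X\<^esub> x"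
    "\<lbrakk>a \<in> carrier A; y \<in> carrier X\<rbrakk> \<Longrightarrow> a \<odot>\<^bsub>X\<^esub> (x \<oplus>\<^bsub>X\<^esub> y) = a \<odot>\<^bsub>X\<^esub> x \<oplus>\<^bsub>X\<^esub> a \<odot>\<^bsub>X\<^esub> y"
    using D by auto
  have idem: "u = \<zero>\<^bsub>X\<^esub>" if "u \<in> carrier X" "u \<oplus>\<^bsub>X\<^esub> u = u" for u
    using that X.add.r_cancel_one by blast
  show z: "\<zero>\<^bsub>A\<^esub> \<odot>\<^bsub>X\<^esub> x = \<zero>\<^bsub>X\<^esub>"
    using D(3)[of "\<zero>\<^bsub>A\<^esub>" "\<zero>\<^bsub>A\<^esub>" x] by (intro idem) auto
  have z2: "a \<odot>\<^bsub>X\<^esub> \<zero>\<^bsub>X\<^esub> = \<zero>\<^bsub>X\<^esub>" if "a \<in> carrier A" for a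
    using D(4)[of a "\<zero>\<^bsub>X\<^esub>" "\<zero>\<^bsub>X\<^esub>"] that by (intro idem) auto
  then show "a \<in> carrier A \<Longrightarrow> a \<odot>\<^bsub>X\<^esub> \<zero>\<^bsub>X\<^esub> = \<zero>\<^bsub>X\<^esub>" .
  show "a \<in> carrier A \<Longrightarrow> (\<ominus>\<^bsub>A\<^esub> a) \<odot>\<^bsub>X\<^esub> x = \<ominus>\<^bsub>X\<^esub> (a \<odot>\<^bsub>X\<^esub> x)"
    using D(3)[of "\<ominus>\<^bsub>A\<^esub> a" a x] z by (intro X.minus_equality[symmetric]) (auto simp: A.l_neg)
  have n: "a \<odot>\<^bsub>X\<^esub> (\<ominus>\<^bsub>X\<^esub> x) = \<ominus>\<^bsub>X\<^esub> (a \<odot>\<^bsub>X\<^esub> x)" if a: "a \<in> carrier A" and "x \<in> carrier X" for a x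
    using D(4)[of a "\<ominus>\<^bsub>X\<^esub> x" x] that z2 by (intro X.minus_equality[symmetric]) (auto simp: X.l_neg)
  then show "a \<in> carrier A \<Longrightarrow> a \<odot>\<^bsub>X\<^esub> (\<ominus>\<^bsub>X\<^esub> x) = \<ominus>\<^bsub>X\<^esub> (a \<odot>\<^bsub>X\<^esub> x)"
    by simp
  show "\<lbrakk>a \<in> carrier A; y \<in> carrier X\<rbrakk> \<Longrightarrow> a \<odot>\<^bsub>X\<^esub> (x \<ominus>\<^bsub>X\<^esub> y) = a \<odot>\<^bsub>X\<^esub> x \<ominus>\<^bsub>X\<^esub> a \<odot>\<^bsub>X\<^esub> y"
    using D(4)[of a x "\<ominus>\<^bsub>X\<^esub> y"] n by (auto simp: a_minus_def)
qed

lemma lmI: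
  fixes X :: "('a, 'm, 'y) module_scheme"
  assumes "abelian_group X"
    and "\<And>a x. \<lbrakk>a \<in> carrier A; x \<in> carrier X\<rbrakk> \<Longrightarrow> a \<odot>\<^bsub>X\<^esub> x \<in> carrier X"
    and "\<And>a b x. \<lbrakk>a \<in> carrier A; b \<in> carrier A; x \<in> carrier X\<rbrakk> \<Longrightarrow>
        (a \<oplus>\<^bsub>A\<^esub> b) \<odot>\<^bsub>X\<^esub> x = a \<odot>\<^bsub>X\<^esub> x \<oplus>\<^bsub>X\<^esub> b \<odot>\<^bsub>X\<^esub> x"
    and "\<And>a x y. \<lbrakk>a \<in> carrier A; x \<in> carrier X; y \<in> carrier X\<rbrakk> \<Longrightarrow>
        a \<odot>\<^bsub>X\<^esub> (x \<oplus>\<^bsub>X\<^esub> y) = a \<odot>\<^bsub>X\<^esub> x \<oplus>\<^bsub>X\<^esub> a \<odot>\<^bsub>X\<^esub> y"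
    and "\<And>a b x. \<lbrakk>a \<in> carrier A; b \<in> carrier A; x \<in> carrier X\<rbrakk> \<Longrightarrow>
        (a \<otimes>\<^bsub>A\<^esub> b) \<odot>\<^bsub>X\<^esub> x = a \<odot>\<^bsub>X\<^esub> (b \<odot>\<^bsub>X\<^esub> x)"
    and "\<And>x. x \<in> carrier X \<Longrightarrow> \<one>\<^bsub>A\<^esub> \<odot>\<^bsub>X\<^esub> x = x"
  shows "lm X"
  by (intro left_module.intro left_module_axioms.intro ring_A assms)

lemma lin_homI:
  assumes "\<And>x. x \<in> carrier X \<Longrightarrow> f x \<in> carrier Y"
    and "\<And>x y. \<lbrakk>x \<in> carrier X; y \<in> carrier X\<rbrakk> \<Longrightarrow> f (x \<oplus>\<^bsub>X\<^esub> y) = f x \<oplus>\<^bsub>Y\<^esub> f y"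
    and "\<And>a x. \<lbrakk>a \<in> carrier A; x \<in> carrier X\<rbrakk> \<Longrightarrow> f (a \<odot>\<^bsub>X\<^esub> x) = a \<odot>\<^bsub>Y\<^esub> f x"
    and "lm X"
  shows "(\<lambda>x\<in>carrier X. f x) \<in> lin_hom A X Y"
  using assms by (auto simp: lin_hom_def)

text \<open>Morphisms are extensional functions, so equality depends on the domain only. The two
  codomains may differ, which helps when a map into a submodule is compared with a map into the
  whole module.\<close>

lemma lin_hom_eqI:
  assumes "f \<in> lin_hom A X Y" "g \<in> lin_hom A X Y'" "\<And>x. x \<in> carrier X \<Longrightarrow> f x = g x"
  shows "f = g"
proof -
  have "f \<in> extensional (carrier X)" "g \<in> extensional (carrier X)"
    using assms(1,2) by (simp_all add: lin_hom_def PiE_iff)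
  then show ?thesis using assms(3) by (rule extensionalityI)
qed

lemma hom_closed: "\<lbrakk>f \<in> lin_hom A X Y; x \<in> carrier X\<rbrakk> \<Longrightarrow> f x \<in> carrier Y"
  by (simp add: lin_hom_def PiE_iff)

lemma hom_add':
  "\<lbrakk>f \<in> lin_hom A X Y; x \<in> carrier X; y \<in> carrier X\<rbrakk> \<Longrightarrow> f (x \<oplus>\<^bsub>X\<^esub> y) = f x \<oplus>\<^bsub>Y\<^esub> f y"
  by (simp add: lin_hom_def PiE_iff)

lemma hom_smult:
  "\<lbrakk>f \<in> lin_hom A X Y; a \<in> carrier A; x \<in> carrier X\<rbrakk> \<Longrightarrow> f (a \<odot>\<^bsub>X\<^esub> x) = a \<odot>\<^bsub>Y\<^esub> f x"
  by (simp add: lin_hom_def PiE_iff)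

lemma hom_simps:
  assumes "f \<in> lin_hom A X Y" "lm X" "lm Y"
  shows "x \<in> carrier X \<Longrightarrow> f x \<in> carrier Y"
    "\<lbrakk>x \<in> carrier X; y \<in> carrier X\<rbrakk> \<Longrightarrow> f (x \<oplus>\<^bsub>X\<^esub> y) = f x \<oplus>\<^bsub>Y\<^esub> f y"
    "\<lbrakk>a \<in> carrier A; x \<in> carrier X\<rbrakk> \<Longrightarrow> f (a \<odot>\<^bsub>X\<^esub> x) = a \<odot>\<^bsub>Y\<^esub> f x"
    "f \<zero>\<^bsub>X\<^esub> = \<zero>\<^bsub>Y\<^esub>"
    "x \<in> carrier X \<Longrightarrow> f (\<ominus>\<^bsub>X\<^esub> x) = \<ominus>\<^bsub>Y\<^esub> f x"
    "\<lbrakk>x \<in> carrier X; y \<in> carrier X\<rbrakk> \<Longrightarrow> f (x \<ominus>\<^bsub>X\<^esub> y) = f x \<ominus>\<^bsub>Y\<^esub> f y"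
proof -
  interpret Y: abelian_group Y by (rule lm_group[OF assms(3)])
  note [simp] = hom_closed[OF assms(1)] lm_closed[OF assms(2)] lm_add[OF assms(2)]
  note a = hom_add'[OF assms(1)]
  show "x \<in> carrier X \<Longrightarrow> f x \<in> carrier Y"
    "\<lbrakk>x \<in> carrier X; y \<in> carrier X\<rbrakk> \<Longrightarrow> f (x \<oplus>\<^bsub>X\<^esub> y) = f x \<oplus>\<^bsub>Y\<^esub> f y"
    "\<lbrakk>a \<in> carrier A; x \<in> carrier X\<rbrakk> \<Longrightarrow> f (a \<odot>\<^bsub>X\<^esub> x) = a \<odot>\<^bsub>Y\<^esub> f x"
    using a hom_smult[OF assms(1)] by auto
  show z: "f \<zero>\<^bsub>X\<^esub> = \<zero>\<^bsub>Y\<^esub>"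
    using a[of "\<zero>\<^bsub>X\<^esub>" "\<zero>\<^bsub>X\<^esub>"] Y.add.r_cancel_one[of "f \<zero>\<^bsub>X\<^esub>" "f \<zero>\<^bsub>X\<^esub>"] by simp
  have n: "f (\<ominus>\<^bsub>X\<^esub> x) = \<ominus>\<^bsub>Y\<^esub> f x" if "x \<in> carrier X" for x
    using a[of "\<ominus>\<^bsub>X\<^esub> x" x] z that by (intro Y.minus_equality[symmetric]) auto
  then show "x \<in> carrier X \<Longrightarrow> f (\<ominus>\<^bsub>X\<^esub> x) = \<ominus>\<^bsub>Y\<^esub> f x" .
  show "\<lbrakk>x \<in> carrier X; y \<in> carrier X\<rbrakk> \<Longrightarrow> f (x \<ominus>\<^bsub>X\<^esub> y) = f x \<ominus>\<^bsub>Y\<^esub> f y"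
    using a[of x "\<ominus>\<^bsub>X\<^esub> y"] n by (simp add: a_minus_def)
qed

lemma compose_hom:
  "\<lbrakk>f \<in> lin_hom A X Y; g \<in> lin_hom A Y Z\<rbrakk> \<Longrightarrow> lm X \<Longrightarrow> compose (carrier X) g f \<in> lin_hom A X Z"
  unfolding lin_hom_def compose_def by (auto simp: Pi_iff PiE_iff)

lemma id_hom: "lm X \<Longrightarrow> hom_id X \<in> lin_hom A X X"
  unfolding hom_id_def by (rule lin_homI) auto

lemma zero_hom: "\<lbrakk>lm X; lm Y\<rbrakk> \<Longrightarrow> hom_zero X Y \<in> lin_hom A X Y"
  unfolding hom_zero_def using lm_smult(6)[of Y "\<zero>\<^bsub>Y\<^esub>"] by (intro lin_homI) auto

lemma add_hom:
  assumes "lm X" "lm Y" "f \<in> lin_hom A X Y" "g \<in> lin_hom A X Y"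
  shows "hom_add X Y f g \<in> lin_hom A X Y"
  unfolding hom_add_def
  by (rule lin_homI) (auto simp: hom_simps[OF assms(3,1,2)] hom_simps[OF assms(4,1,2)] assms(1,2)
      lm_ac lm_smult)

lemma diff_hom:
  assumes "lm X" "lm Y" "f \<in> lin_hom A X Y" "g \<in> lin_hom A X Y"
  shows "hom_diff X Y f g \<in> lin_hom A X Y"
proof -
  interpret Y: abelian_group Y by (rule lm_group[OF assms(2)])
  show ?thesis
    unfolding hom_diff_def
    by (rule lin_homI) (auto simp: hom_simps[OF assms(3,1,2)] hom_simps[OF assms(4,1,2)] assms(1,2)
      lm_smult a_minus_def Y.minus_add Y.a_ac)
qed

lemma hom_apply [simp]:
  "x \<in> carrier X \<Longrightarrow> hom_id X x = x"
  "x \<in> carrier X \<Longrightarrow> hom_zero X Y x = \<zero>\<^bsub>Y\<^esub>"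
  "x \<in> carrier X \<Longrightarrow> hom_add X Y f g x = f x \<oplus>\<^bsub>Y\<^esub> g x"
  "x \<in> carrier X \<Longrightarrow> hom_diff X Y f g x = f x \<ominus>\<^bsub>Y\<^esub> g x"
  by (auto simp: hom_id_def hom_zero_def hom_add_def hom_diff_def)

lemma compose_apply [simp]: "x \<in> S \<Longrightarrow> compose S g f x = g (f x)"
  by (auto simp: compose_def)

lemma hom_inj_iff:
  assumes "lm X" "lm Y" "f \<in> lin_hom A X Y"
  shows "inj_on f (carrier X) \<longleftrightarrow> (\<forall>x\<in>carrier X. f x = \<zero>\<^bsub>Y\<^esub> \<longrightarrow> x = \<zero>\<^bsub>X\<^esub>)"
proof -
  note [simp] = hom_simps[OF assms(3,1,2)] assms(1,2)
  have "x = y" if "\<forall>x\<in>carrier X. f x = \<zero>\<^bsub>Y\<^esub> \<longrightarrow> x = \<zero>\<^bsub>X\<^esub>" "x \<in> carrier X" "y \<in> carrier X" "f x = f y" for x y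
    using that(1)[rule_format, of "x \<ominus>\<^bsub>X\<^esub> y"] that(2-) by (auto simp: lm_minus lm_add)
  then show ?thesis
    by (metis assms(1) hom_simps(4)[OF assms(3,1,2)] inj_on_def lm_closed(1))
qed

lemma lin_iso_inv:
  assumes "lm X" "lm Y" "f \<in> lin_iso A X Y"
  obtains g where "g \<in> lin_iso A Y X" "\<And>x. x \<in> carrier X \<Longrightarrow> g (f x) = x"
    "\<And>y. y \<in> carrier Y \<Longrightarrow> f (g y) = y"
proof -
  have f: "f \<in> lin_hom A X Y" and b: "bij_betw f (carrier X) (carrier Y)"
    using assms(3) by (auto simp: lin_iso_def)
  note [simp] = hom_simps[OF f assms(1,2)] assms(1,2)
  define h where "h = inv_into (carrier X) f"
  have hc: "h y \<in> carrier X" "f (h y) = y" if "y \<in> carrier Y" for y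
    using b that unfolding h_def bij_betw_def by (simp_all add: inv_into_into f_inv_into_f)
  have hf: "h (f x) = x" if "x \<in> carrier X" for x
    using b that unfolding h_def bij_betw_def by auto
  have "(\<lambda>y\<in>carrier Y. h y) \<in> lin_hom A Y X"
  proof (rule lin_homI)
    show "h (y \<oplus>\<^bsub>Y\<^esub> z) = h y \<oplus>\<^bsub>X\<^esub> h z" if "y \<in> carrier Y" "z \<in> carrier Y" for y z
      using hf[of "h y \<oplus>\<^bsub>X\<^esub> h z"] hc that by simp
    show "h (a \<odot>\<^bsub>Y\<^esub> y) = a \<odot>\<^bsub>X\<^esub> h y" if "a \<in> carrier A" "y \<in> carrier Y" for a y
      using hf[of "a \<odot>\<^bsub>X\<^esub> h y"] hc that by simp
  qed (auto simp: hc)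
  moreover have "bij_betw (\<lambda>y\<in>carrier Y. h y) (carrier Y) (carrier X)"
    by (rule bij_betwI[of _ _ _ f]) (auto simp: hc hf)
  ultimately show thesis
    by (intro that[of "\<lambda>y\<in>carrier Y. h y"]) (auto simp: lin_iso_def hc hf)
qed

lemma isomorphic_refl: "lm X \<Longrightarrow> isomorphic A X X"
  unfolding isomorphic_def lin_iso_def using id_hom[of X]
  by (auto simp: bij_betw_def inj_on_def intro!: exI[of _ "hom_id X"])

lemma isomorphic_sym: "\<lbrakk>lm X; lm Y; isomorphic A X Y\<rbrakk> \<Longrightarrow> isomorphic A Y X"
  unfolding isomorphic_def by (metis ex_in_conv lin_iso_inv)

lemma isomorphic_trans:
  assumes "lm X" "lm Y" "lm Z" "isomorphic A X Y" "isomorphic A Y Z"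
  shows "isomorphic A X Z"
proof -
  obtain f g where "f \<in> lin_iso A X Y" "g \<in> lin_iso A Y Z"
    using assms by (auto simp: isomorphic_def)
  then have "compose (carrier X) g f \<in> lin_iso A X Z"
    using assms by (auto simp: lin_iso_def bij_betw_compose intro!: compose_hom)
  then show ?thesis by (auto simp: isomorphic_def)
qed

section \<open>Submodules\<close>

text \<open>Negation is covered by the action of the scalar -1, see
  \<open>submod_neg\<close>.\<close>

definition submod :: "('a, 'm, 'y) module_scheme \<Rightarrow> 'm set \<Rightarrow> bool" where
  "submod X U \<longleftrightarrow> U \<subseteq> carrier X \<and> \<zero>\<^bsub>X\<^esub> \<in> U \<and> (\<forall>x\<in>U. \<forall>y\<in>U. x \<oplus>\<^bsub>X\<^esub> y \<in> U) \<and>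
    (\<forall>a\<in>carrier A. \<forall>x\<in>U. a \<odot>\<^bsub>X\<^esub> x \<in> U)"

lemma submodI:
  assumes "U \<subseteq> carrier X" "\<zero>\<^bsub>X\<^esub> \<in> U" "\<And>x y. \<lbrakk>x \<in> U; y \<in> U\<rbrakk> \<Longrightarrow> x \<oplus>\<^bsub>X\<^esub> y \<in> U"
    "\<And>a x. \<lbrakk>a \<in> carrier A; x \<in> U\<rbrakk> \<Longrightarrow> a \<odot>\<^bsub>X\<^esub> x \<in> U"
  shows "submod X U"
  using assms by (auto simp: submod_def)

lemma submodD:
  assumes "submod X U"
  shows "x \<in> U \<Longrightarrow> x \<in> carrier X" "\<zero>\<^bsub>X\<^esub> \<in> U" "\<lbrakk>x \<in> U; y \<in> U\<rbrakk> \<Longrightarrow> x \<oplus>\<^bsub>X\<^esub> y \<in> U"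
    "\<lbrakk>a \<in> carrier A; x \<in> U\<rbrakk> \<Longrightarrow> a \<odot>\<^bsub>X\<^esub> x \<in> U"
  using assms by (auto simp: submod_def)

lemma submod_neg:
  assumes "lm X" "submod X U"
  shows "x \<in> U \<Longrightarrow> \<ominus>\<^bsub>X\<^esub> x \<in> U" "\<lbrakk>x \<in> U; y \<in> U\<rbrakk> \<Longrightarrow> x \<ominus>\<^bsub>X\<^esub> y \<in> U"
proof -
  interpret A: ring A by (rule ring_A)
  show 1: "\<ominus>\<^bsub>X\<^esub> x \<in> U" if "x \<in> U" for x
    using submodD(4)[OF assms(2) _ that, of "\<ominus>\<^bsub>A\<^esub> \<one>\<^bsub>A\<^esub>"] submodD(1)[OF assms(2) that]
    by (simp add: lm_smult assms)
  show "\<lbrakk>x \<in> U; y \<in> U\<rbrakk> \<Longrightarrow> x \<ominus>\<^bsub>X\<^esub> y \<in> U"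
    unfolding a_minus_def using 1 submodD(3)[OF assms(2)] by blast
qed

lemma submod_carrier [simp]: "lm X \<Longrightarrow> submod X (carrier X)"
  by (rule submodI) auto

lemma submod_zero [simp]: "lm X \<Longrightarrow> submod X {\<zero>\<^bsub>X\<^esub>}"
  using lm_smult(6)[of X "\<zero>\<^bsub>X\<^esub>"] by (intro submodI) auto

lemma submod_Int: "\<lbrakk>submod X U; submod X V\<rbrakk> \<Longrightarrow> submod X (U \<inter> V)"
  by (auto simp: submod_def)

definition ssum :: "('a, 'm, 'y) module_scheme \<Rightarrow> 'm set \<Rightarrow> 'm set \<Rightarrow> 'm set" where
  "ssum X U V = {x \<oplus>\<^bsub>X\<^esub> y | x y. x \<in> U \<and> y \<in> V}"

lemma submod_ssum:
  assumes "lm X" "submod X U" "submod X V"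
  shows "submod X (ssum X U V)"
proof (rule submodI)
  interpret X: abelian_group X by (rule lm_group[OF assms(1)])
  note U = submodD[OF assms(2)] and V = submodD[OF assms(3)]
  show "ssum X U V \<subseteq> carrier X" using U V by (auto simp: ssum_def)
  have "\<zero>\<^bsub>X\<^esub> = \<zero>\<^bsub>X\<^esub> \<oplus>\<^bsub>X\<^esub> \<zero>\<^bsub>X\<^esub>"
    using assms(1) by simp
  then show "\<zero>\<^bsub>X\<^esub> \<in> ssum X U V" using U(2) V(2) unfolding ssum_def by blast
  show "x \<oplus>\<^bsub>X\<^esub> y \<in> ssum X U V" if xy: "x \<in> ssum X U V" "y \<in> ssum X U V" for x y
  proof -
    obtain u v u' v' where *: "u \<in> U" "v \<in> V" "u' \<in> U" "v' \<in> V" "x = u \<oplus>\<^bsub>X\<^esub> v" "y = u' \<oplus>\<^bsub>X\<^esub> v'"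
      using xy by (auto simp: ssum_def)
    then have "x \<oplus>\<^bsub>X\<^esub> y = (u \<oplus>\<^bsub>X\<^esub> u') \<oplus>\<^bsub>X\<^esub> (v \<oplus>\<^bsub>X\<^esub> v')"
      using U(1) V(1) by (simp add: X.a_ac)
    then show ?thesis using U(3) V(3) * unfolding ssum_def by blast
  qed
  show "a \<odot>\<^bsub>X\<^esub> x \<in> ssum X U V" if ax: "a \<in> carrier A" "x \<in> ssum X U V" for a x
  proof -
    obtain u v where *: "u \<in> U" "v \<in> V" "x = u \<oplus>\<^bsub>X\<^esub> v"
      using ax by (auto simp: ssum_def)
    then have "a \<odot>\<^bsub>X\<^esub> x = a \<odot>\<^bsub>X\<^esub> u \<oplus>\<^bsub>X\<^esub> a \<odot>\<^bsub>X\<^esub> v"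
      using U(1) V(1) ax(1) lm_smult(4)[OF assms(1)] by simp
    then show ?thesis using U(4) V(4) ax(1) * unfolding ssum_def by blast
  qed
qed

lemma ssum_upper:
  assumes "lm X" "submod X U" "submod X V"
  shows "U \<subseteq> ssum X U V" "V \<subseteq> ssum X U V"
proof -
  note U = submodD[OF assms(2)] and V = submodD[OF assms(3)]
  have "u = u \<oplus>\<^bsub>X\<^esub> \<zero>\<^bsub>X\<^esub>" if "u \<in> U" for u using U(1)[OF that] lm_add(2)[OF assms(1)] by simp
  then show "U \<subseteq> ssum X U V" using V(2) by (auto simp: ssum_def)
  have "u = \<zero>\<^bsub>X\<^esub> \<oplus>\<^bsub>X\<^esub> u" if "u \<in> V" for u using V(1)[OF that] lm_add(1)[OF assms(1)] by simp
  then show "V \<subseteq> ssum X U V" using U(2) by (auto simp: ssum_def)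
qed

lemma ssum_least: "\<lbrakk>U \<subseteq> W; V \<subseteq> W; submod X W\<rbrakk> \<Longrightarrow> ssum X U V \<subseteq> W"
  by (auto simp: ssum_def submod_def subset_iff)

text \<open>Write an element x of U' as u + v with u in U and v in V. Then v = x - u lies in U' and
  in V, hence in U. Read contrapositively: when a submodule grows strictly, its intersection with V
  or its sum with V grows strictly.\<close>

lemma ssum_modular:
  assumes "lm X" "submod X U" "submod X U'" "submod X V" "U \<subseteq> U'" "U \<inter> V = U' \<inter> V"
    "ssum X U V = ssum X U' V"
  shows "U = U'"
proof -
  have "x \<in> U" if x: "x \<in> U'" for x
  proof -
    have "x \<in> ssum X U V" using ssum_upper(1)[OF assms(1,3,4)] x assms(7) by auto
    then obtain u v where uv: "u \<in> U" "v \<in> V" "x = u \<oplus>\<^bsub>X\<^esub> v"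
      by (auto simp: ssum_def)
    have c: "u \<in> carrier X" "v \<in> carrier X"
      using submodD(1)[OF assms(2)] submodD(1)[OF assms(4)] uv by auto
    have "v = x \<ominus>\<^bsub>X\<^esub> u" using c lm_minus(5)[OF assms(1)] uv by simp
    then have "v \<in> U'" using submod_neg(2)[OF assms(1,3), of x u] x uv(1) assms(5) by auto
    then have "v \<in> U" using uv assms(6) by auto
    then show ?thesis using uv submodD(3)[OF assms(2)] by simp
  qed
  then show ?thesis using assms(5) by auto
qed

lemma submod_image:
  assumes "lm X" "lm Y" "f \<in> lin_hom A X Y" "submod X U"
  shows "submod Y (f ` U)"
proof -
  note [simp] = hom_simps[OF assms(3,1,2)] and U = submodD[OF assms(4)]
  show ?thesis
  proof (rule submodI)
    show "\<zero>\<^bsub>Y\<^esub> \<in> f ` U" using U(2) hom_simps(4)[OF assms(3,1,2)] by (metis imageI)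
    show "x \<oplus>\<^bsub>Y\<^esub> y \<in> f ` U" if xy: "x \<in> f ` U" "y \<in> f ` U" for x y
    proof -
      obtain u v where "u \<in> U" "v \<in> U" "x = f u" "y = f v" using xy by auto
      then have "x \<oplus>\<^bsub>Y\<^esub> y = f (u \<oplus>\<^bsub>X\<^esub> v)" using U(1) by auto
      then show ?thesis using U(3) \<open>u \<in> U\<close> \<open>v \<in> U\<close> by auto
    qed
    show "a \<odot>\<^bsub>Y\<^esub> x \<in> f ` U" if ax: "a \<in> carrier A" "x \<in> f ` U" for a x
    proof -
      obtain u where "u \<in> U" "x = f u" using ax by auto
      then have "a \<odot>\<^bsub>Y\<^esub> x = f (a \<odot>\<^bsub>X\<^esub> u)" using U(1) ax by auto
      then show ?thesis using U(4) \<open>u \<in> U\<close> ax by auto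
    qed
  qed (use U in auto)
qed

lemma submod_vimage:
  assumes "lm X" "lm Y" "f \<in> lin_hom A X Y" "submod X U" "submod Y V"
  shows "submod X {x \<in> U. f x \<in> V}"
  using submodD[OF assms(4)] submodD[OF assms(5)] hom_simps[OF assms(3,1,2)]
  by (intro submodI) auto

text \<open>Submodules are turned into modules by shrinking the carrier and keeping all operations.
  Inclusions are then the identity on elements, and no new element type arises.\<close>

lemma lm_sub:
  fixes X :: "('a, 'm, 'y) module_scheme"
  assumes "lm X" "submod X U"
  shows "lm (X\<lparr>carrier := U\<rparr>)"
proof -
  interpret X: abelian_group X by (rule lm_group[OF assms(1)])
  note U = submodD[OF assms(2)]
  show ?thesis
  proof (rule lmI)
    show "abelian_group (X\<lparr>carrier := U\<rparr>)"
    proof (rule abelian_groupI)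
      show "\<exists>y\<in>carrier (X\<lparr>carrier := U\<rparr>). y \<oplus>\<^bsub>X\<lparr>carrier := U\<rparr>\<^esub> x = \<zero>\<^bsub>X\<lparr>carrier := U\<rparr>\<^esub>"
        if "x \<in> carrier (X\<lparr>carrier := U\<rparr>)" for x
        using that submod_neg(1)[OF assms] X.l_neg U(1) by auto
    qed (use U in \<open>auto simp: X.a_ac\<close>)
  qed (use U assms(1) in \<open>auto simp: lm_smult\<close>)
qed

lemma submod_sub:
  assumes "submod X U" "V \<subseteq> U"
  shows "submod (X\<lparr>carrier := U\<rparr>) V \<longleftrightarrow> submod X V"
  using assms by (auto simp: submod_def)

lemma incl_hom: "\<lbrakk>lm X; submod X U\<rbrakk> \<Longrightarrow> (\<lambda>x\<in>U. x) \<in> lin_hom A (X\<lparr>carrier := U\<rparr>) X"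
  using lin_homI[of "X\<lparr>carrier := U\<rparr>" "\<lambda>x. x" X] lm_sub[of X U] submodD(1)[of X U] by auto

lemma restrict_hom:
  assumes "lm X" "lm Y" "f \<in> lin_hom A X Y" "submod X U"
  shows "restrict f U \<in> lin_hom A (X\<lparr>carrier := U\<rparr>) Y"
  using lin_homI[of "X\<lparr>carrier := U\<rparr>" f Y] lm_sub[of X U] submodD(1)[of X U] assms
  by (auto simp: hom_simps[OF assms(3,1,2)])

lemma corestrict_hom:
  assumes "f \<in> lin_hom A X Y" "\<And>x. x \<in> carrier X \<Longrightarrow> f x \<in> U"
  shows "f \<in> lin_hom A X (Y\<lparr>carrier := U\<rparr>)"
  using assms by (auto simp: lin_hom_def PiE_iff)

text \<open>The maximality is relative to an upper bound \<open>V\<close>, so that the lemma also gives maximal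
  submodules of submodules.\<close>

lemma maximal_avoiding:
  assumes "submod X K" "K \<subseteq> V" "x \<notin> K"
  obtains J where "submod X J" "K \<subseteq> J" "J \<subseteq> V" "x \<notin> J"
    "\<And>J'. \<lbrakk>submod X J'; J \<subset> J'; J' \<subseteq> V\<rbrakk> \<Longrightarrow> x \<in> J'"
proof -
  define F where "F = {J. submod X J \<and> K \<subseteq> J \<and> J \<subseteq> V \<and> x \<notin> J}"
  have "\<exists>M\<in>F. \<forall>X\<in>F. M \<subseteq> X \<longrightarrow> X = M"
  proof (rule subset_Zorn_nonempty)
    show "F \<noteq> {}" using assms by (auto simp: F_def)
    show "\<Union>C \<in> F" if C: "C \<noteq> {}" "subset.chain F C" for C
    proof -
      have cf: "C \<subseteq> F" and tot: "\<And>S T. S \<in> C \<Longrightarrow> T \<in> C \<Longrightarrow> S \<subseteq> T \<or> T \<subseteq> S"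
        using C by (auto simp: subset_chain_def)
      have s: "submod X S" if "S \<in> C" for S using cf that by (auto simp: F_def)
      have "submod X (\<Union>C)"
      proof (rule submodI)
        show "x \<oplus>\<^bsub>X\<^esub> y \<in> \<Union>C" if xy: "x \<in> \<Union>C" "y \<in> \<Union>C" for x y
        proof -
          obtain S T where "S \<in> C" "T \<in> C" "x \<in> S" "y \<in> T" using xy by auto
          then show ?thesis using tot[of S T] submodD(3)[OF s] by blast
        qed
      next
        show "\<Union>C \<subseteq> carrier X" using submodD(1)[OF s] by blast
        show "\<zero>\<^bsub>X\<^esub> \<in> \<Union>C" using C(1) submodD(2)[OF s] by blast
        show "a \<odot>\<^bsub>X\<^esub> y \<in> \<Union>C" if "a \<in> carrier A" "y \<in> \<Union>C" for a y
          using submodD(4)[OF s] \<open>a \<in> carrier A\<close> \<open>y \<in> \<Union>C\<close> by blast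
      qed
      then show ?thesis using cf C(1) by (auto simp: F_def)
    qed
  qed
  then obtain M where M: "M \<in> F" and max: "\<And>S. \<lbrakk>S \<in> F; M \<subseteq> S\<rbrakk> \<Longrightarrow> S = M"
    by blast
  show thesis
    by (rule that[of M]) (use M max in \<open>auto simp: F_def\<close>)
qed

end

section \<open>Length\<close>

text \<open>The predicate P is arbitrary so that chains can be carried from one module to another,
  and from one ring of scalars to another.\<close>

inductive chn :: "('s set \<Rightarrow> bool) \<Rightarrow> 's set \<Rightarrow> 's set \<Rightarrow> nat \<Rightarrow> bool" for P where
  base: "P U \<Longrightarrow> chn P U U 0"
| step: "\<lbrakk>P U; U \<subset> V; chn P V W n\<rbrakk> \<Longrightarrow> chn P U W (Suc n)"

text \<open>A supremum in \<open>enat\<close> makes sense before composition series are known to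
  exist, and finite length becomes the condition that the value differs from \<infinity>.\<close>

definition len :: "('s set \<Rightarrow> bool) \<Rightarrow> 's set \<Rightarrow> 's set \<Rightarrow> enat" where
  "len P U W = (SUP n\<in>{n. chn P U W n}. enat n)"

lemma chn_dest: "chn P U W n \<Longrightarrow> P U \<and> P W \<and> U \<subseteq> W"
  by (induction rule: chn.induct) auto

lemma chn_append: "\<lbrakk>chn P U V m; chn P V W n\<rbrakk> \<Longrightarrow> chn P U W (m + n)"
  by (induction rule: chn.induct) (auto intro: chn.intros)

lemma chn_single: "\<lbrakk>P U; P V; U \<subset> V\<rbrakk> \<Longrightarrow> chn P U V 1"
  using chn.step[of P U V V 0] chn.base[of P V] by simp

lemma chn_ex: "\<lbrakk>P U; P V; U \<subseteq> V\<rbrakk> \<Longrightarrow> \<exists>n. chn P U V n"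
  using chn_single[of P U V] chn.base[of P U] by blast

lemma chn_map:
  assumes "chn P U W n"
    and "\<And>S. \<lbrakk>P S; U \<subseteq> S; S \<subseteq> W\<rbrakk> \<Longrightarrow> P' (\<Phi> S)"
    and "\<And>S T. \<lbrakk>P S; P T; U \<subseteq> S; S \<subset> T; T \<subseteq> W\<rbrakk> \<Longrightarrow> \<Phi> S \<subset> \<Phi> T"
  shows "chn P' (\<Phi> U) (\<Phi> W) n"
  using assms
proof (induction rule: chn.induct)
  case (base U)
  then show ?case by (auto intro: chn.base)
next
  case (step U V W n)
  have d: "P V" "V \<subseteq> W" "U \<subseteq> V" using chn_dest[OF step.hyps(3)] step.hyps(2) by auto
  have "chn P' (\<Phi> V) (\<Phi> W) n"
    using d by (intro step.IH step.prems) auto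
  moreover have "P' (\<Phi> U)" using step.hyps d by (intro step.prems(1)) auto
  moreover have "\<Phi> U \<subset> \<Phi> V" using step.hyps d by (intro step.prems(2)) auto
  ultimately show ?case by (blast intro: chn.step)
qed

lemma chn_le_len: "chn P U W n \<Longrightarrow> enat n \<le> len P U W"
  unfolding len_def by (rule SUP_upper) simp

lemma len_leI: "(\<And>n. chn P U W n \<Longrightarrow> enat n \<le> L) \<Longrightarrow> len P U W \<le> L"
  unfolding len_def by (rule SUP_least) simp

lemma len_attained:
  assumes "P U" "P W" "U \<subseteq> W" "len P U W = enat m"
  shows "chn P U W m"
proof -
  let ?S = "enat ` {n. chn P U W n}"
  have ne: "?S \<noteq> {}" using chn_ex[OF assms(1-3)] by auto
  \<comment> \<open>An infinite set of naturals has supremum \<infinity> in \<open>enat\<close>; a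
    finite value thus forces a finite set, whose supremum is a maximum.\<close>
  have "finite ?S" using assms(4) ne unfolding len_def Sup_enat_def by (auto split: if_splits)
  then have "len P U W = Max ?S" "Max ?S \<in> ?S"
    using ne Max_in[of ?S] unfolding len_def Sup_enat_def by auto
  then show ?thesis using assms(4) by auto
qed

lemma len_map_le:
  assumes "\<And>S. \<lbrakk>P S; U \<subseteq> S; S \<subseteq> W\<rbrakk> \<Longrightarrow> P' (\<Phi> S)"
    and "\<And>S T. \<lbrakk>P S; P T; U \<subseteq> S; S \<subset> T; T \<subseteq> W\<rbrakk> \<Longrightarrow> \<Phi> S \<subset> \<Phi> T"
  shows "len P U W \<le> len P' (\<Phi> U) (\<Phi> W)"
  by (rule len_leI, rule chn_le_len, erule chn_map) (use assms in auto)

lemma enat_add_le_imp: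
  "a + b = a \<Longrightarrow> a \<noteq> \<infinity> \<Longrightarrow> b = (0::enat)"
  by (cases a; cases b) (auto simp: zero_enat_def)

context mod_base begin

text \<open>By \<open>ssum_modular\<close> every strict inclusion of the given chain stays strict
  after intersecting with V or after adding V. The two derived chains, with repetitions removed,
  therefore have at least n steps together.\<close>

lemma chn_split:
  assumes "lm X" "submod X V" "chn (submod X) U W n"
  shows "\<exists>p q. chn (submod X) (U \<inter> V) (W \<inter> V) p \<and> chn (submod X) (ssum X U V) (ssum X W V) q \<and> n \<le> p + q"
  using assms(3)
proof (induction rule: chn.induct)
  case (base U)
  have "chn (submod X) (U \<inter> V) (U \<inter> V) 0" "chn (submod X) (ssum X U V) (ssum X U V) 0"
    using base assms by (auto intro!: chn.base submod_Int submod_ssum)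
  then show ?case by blast
next
  case (step U U' W n)
  obtain p q where pq: "chn (submod X) (U' \<inter> V) (W \<inter> V) p" "chn (submod X) (ssum X U' V) (ssum X W V) q" "n \<le> p + q"
    using step.IH by blast
  have s: "submod X U'" using chn_dest[OF step.hyps(3)] by blast
  have 1: "submod X (U \<inter> V)" "submod X (ssum X U V)"
    using step.hyps(1) assms by (auto intro!: submod_Int submod_ssum)
  have 2: "U \<inter> V \<subseteq> U' \<inter> V" "ssum X U V \<subseteq> ssum X U' V"
    using step.hyps(2) by (auto simp: ssum_def)
  have 3: "U \<inter> V \<noteq> U' \<inter> V \<or> ssum X U V \<noteq> ssum X U' V"
    using ssum_modular[OF assms(1) step.hyps(1) s assms(2)] step.hyps(2) by auto
  have 4: "\<exists>p'. chn (submod X) (U \<inter> V) (W \<inter> V) p' \<and> p + (if U \<inter> V \<noteq> U' \<inter> V then 1 else 0) \<le> p'"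
    using chn.step[OF 1(1) _ pq(1)] pq(1) 2(1) by (cases "U \<inter> V = U' \<inter> V") auto
  have 5: "\<exists>q'. chn (submod X) (ssum X U V) (ssum X W V) q' \<and> q + (if ssum X U V \<noteq> ssum X U' V then 1 else 0) \<le> q'"
    using chn.step[OF 1(2) _ pq(2)] pq(2) 2(2) by (cases "ssum X U V = ssum X U' V") auto
  obtain p' q' where "chn (submod X) (U \<inter> V) (W \<inter> V) p'" "p + (if U \<inter> V \<noteq> U' \<inter> V then 1 else 0) \<le> p'"
    "chn (submod X) (ssum X U V) (ssum X W V) q'" "q + (if ssum X U V \<noteq> ssum X U' V then 1 else 0) \<le> q'"
    using 4 5 by blast
  moreover have "Suc n \<le> p' + q'" using calculation 3 pq(3) by (auto split: if_splits)
  ultimately show ?case by blast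
qed

abbreviation mlen :: "('a, 'm, 'y) module_scheme \<Rightarrow> 'm set \<Rightarrow> 'm set \<Rightarrow> enat" where
  "mlen X \<equiv> len (submod X)"

text \<open>Splitting a chain at V by \<open>chn_split\<close> gives one inequality. For the other,
  chains below and above V are concatenated; when the total length is finite, both partial suprema
  are attained and can be used as chains.\<close>

lemma len_add:
  assumes X: "lm X" and s: "submod X U" "submod X V" "submod X W" and i: "U \<subseteq> V" "V \<subseteq> W"
  shows "mlen X U W = mlen X U V + mlen X V W"
proof (rule antisym)
  show "mlen X U W \<le> mlen X U V + mlen X V W"
  proof (rule len_leI)
    fix n assume "chn (submod X) U W n"
    then obtain p q where pq: "chn (submod X) (U \<inter> V) (W \<inter> V) p" "chn (submod X) (ssum X U V) (ssum X W V) q" "n \<le> p + q"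
      using chn_split[OF X s(2)] by blast
    have "U \<inter> V = U" "W \<inter> V = V" using i by auto
    moreover have "ssum X U V = V" using ssum_least[OF i(1) subset_refl s(2)] ssum_upper[OF X s(1,2)] by blast
    moreover have "ssum X W V = W" using ssum_least[OF subset_refl i(2) s(3)] ssum_upper[OF X s(3,2)] by blast
    ultimately have "enat p \<le> mlen X U V" "enat q \<le> mlen X V W" using pq by (auto intro: chn_le_len)
    then have "enat p + enat q \<le> mlen X U V + mlen X V W" by (rule add_mono)
    then show "enat n \<le> mlen X U V + mlen X V W" using pq(3)
      by (metis enat_ord_simps(1) order_trans plus_enat_simps(1))
  qed
next
  have le: "enat p + enat q \<le> mlen X U W" if "chn (submod X) U V p" "chn (submod X) V W q" for p q
    using chn_le_len[OF chn_append[OF that]] by simp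
  show "mlen X U V + mlen X V W \<le> mlen X U W"
  proof (cases "mlen X U W")
    case (enat m)
    obtain p0 q0 where pq0: "chn (submod X) U V p0" "chn (submod X) V W q0"
      using chn_ex[of "submod X"] s i by meson
    have "mlen X U V \<le> enat m"
      by (rule len_leI) (use le pq0 enat in \<open>fastforce simp: add_leD1\<close>)
    moreover have "mlen X V W \<le> enat m"
      by (rule len_leI) (use le pq0 enat in \<open>fastforce simp: add_leD2\<close>)
    ultimately obtain p q where pq: "mlen X U V = enat p" "mlen X V W = enat q"
      using enat_ile by metis
    show ?thesis unfolding pq
      by (rule le) (use len_attained pq s i in \<open>blast+\<close>)
  qed auto
qed

lemma len_mono:
  assumes "lm X" "submod X U'" "submod X U" "submod X V" "submod X V'" "U' \<subseteq> U" "U \<subseteq> V" "V \<subseteq> V'"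
  shows "mlen X U V \<le> mlen X U' V'"
proof -
  have "mlen X U' V' = mlen X U' U + (mlen X U V + mlen X V V')"
    using len_add[OF assms(1), of U' U V'] len_add[OF assms(1), of U V V'] assms by (simp add: subset_trans)
  then show ?thesis by (simp add: add.commute add.left_commute)
qed

lemma len_eq_0_iff:
  assumes "lm X" "submod X U" "submod X V" "U \<subseteq> V"
  shows "mlen X U V = 0 \<longleftrightarrow> U = V"
proof
  show "U = V" if "mlen X U V = 0"
    using chn_le_len[OF chn_single[of "submod X" U V]] assms that by (auto simp: zero_enat_def)
  have "n = 0" if "chn (submod X) V V n" for n
    using that by (cases rule: chn.cases) (auto dest!: chn_dest)
  then show "U = V \<Longrightarrow> mlen X U V = 0"
    using len_leI[of "submod X" V V 0] by (fastforce simp flip: zero_enat_def)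
qed

text \<open>This is the correspondence theorem: images and preimages are mutually inverse between
  submodules of U above U' and submodules of C above D. The map f is linear on U only, so the lemma
  also applies to maps defined on one layer of a filtration.\<close>

lemma len_map:
  assumes X: "lm X" and Y: "lm Y" and f: "f \<in> lin_hom A (X\<lparr>carrier := U\<rparr>) Y" and U: "submod X U"
    and D: "submod Y D" and C: "submod Y C" and DC: "D \<subseteq> C" and fU: "f ` U = C"
    and U': "U' = {x \<in> U. f x \<in> D}"
  shows "mlen X U' U = mlen Y D C"
proof -
  have lU: "lm (X\<lparr>carrier := U\<rparr>)" by (rule lm_sub[OF X U])
  note f_simps = hom_simps[OF f lU Y, simplified]
  have inU: "x \<in> carrier X" if "x \<in> U" for x using submodD(1)[OF U that] .
  have sub: "submod (X\<lparr>carrier := U\<rparr>) S \<longleftrightarrow> submod X S" if "S \<subseteq> U" for S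
    using submod_sub[OF U that] .
  have sv: "submod X {x \<in> U. f x \<in> S}" if "submod Y S" for S
    using submod_vimage[OF lU Y f _ that, of U] sub[of U] sub[of "{x \<in> U. f x \<in> S}"] U by auto
  have im: "submod Y (f ` S)" if "submod X S" "S \<subseteq> U" for S
    using submod_image[OF lU Y f] that sub by blast
  \<comment> \<open>Inverses are defined relative to the carrier, so subtraction in the restricted
    record has to be compared with subtraction in X.\<close>
  have minus: "x \<ominus>\<^bsub>X\<lparr>carrier := U\<rparr>\<^esub> y = x \<ominus>\<^bsub>X\<^esub> y" if "x \<in> U" "y \<in> U" for x y
  proof -
    have "\<ominus>\<^bsub>X\<lparr>carrier := U\<rparr>\<^esub> y = \<ominus>\<^bsub>X\<^esub> y"
      using lm_minus(7)[OF X, of "\<ominus>\<^bsub>X\<lparr>carrier := U\<rparr>\<^esub> y" y] lm_closed(3)[OF lU, of y] lm_add(5)[OF lU, of y] inU that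
      by auto
    then show ?thesis by (simp add: a_minus_def)
  qed
  have "mlen X U' U \<le> mlen Y (f ` U') (f ` U)"
  proof (rule len_map_le)
    show "submod Y (f ` S)" if "submod X S" "S \<subseteq> U" for S using im that .
    fix S T assume ST: "submod X S" "submod X T" "U' \<subseteq> S" "S \<subset> T" "T \<subseteq> U"
    then obtain t where t: "t \<in> T" "t \<notin> S" by auto
    have "f t \<notin> f ` S"
    proof
      assume "f t \<in> f ` S"
      then obtain s where s: "s \<in> S" "f t = f s" by auto
      have tU: "t \<in> U" "s \<in> U" using t s ST by auto
      have "f (t \<ominus>\<^bsub>X\<^esub> s) = \<zero>\<^bsub>Y\<^esub>"
        using f_simps(6)[OF tU] s tU f_simps(1) Y by (simp add: minus lm_add)
      moreover have "t \<ominus>\<^bsub>X\<^esub> s \<in> U" using submod_neg(2)[OF X U] tU by blast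
      ultimately have "t \<ominus>\<^bsub>X\<^esub> s \<in> S" using ST(3) U' submodD(2)[OF D] by auto
      then have "(t \<ominus>\<^bsub>X\<^esub> s) \<oplus>\<^bsub>X\<^esub> s \<in> S"
        using submodD(3)[OF ST(1)] s by blast
      then show False using t lm_minus(2)[OF X] inU tU by simp
    qed
    then show "f ` S \<subset> f ` T" using t ST(4) by blast
  qed
  also have "f ` U' = D" using fU DC U' by auto
  finally have 1: "mlen X U' U \<le> mlen Y D C" using fU by simp
  have "mlen Y D C \<le> mlen X {x \<in> U. f x \<in> D} {x \<in> U. f x \<in> C}"
  proof (rule len_map_le)
    fix S T assume ST: "submod Y S" "submod Y T" "S \<subset> T" "T \<subseteq> C"
    then show "{x \<in> U. f x \<in> S} \<subset> {x \<in> U. f x \<in> T}" using fU by blast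
  qed (rule sv)
  also have "{x \<in> U. f x \<in> C} = U" using fU by auto
  finally show ?thesis using 1 U' by auto
qed

abbreviation tlen :: "('a, 'm, 'y) module_scheme \<Rightarrow> enat" where
  "tlen X \<equiv> mlen X {\<zero>\<^bsub>X\<^esub>} (carrier X)"

lemma len_restrict:
  assumes "lm X" "submod X U" "submod X V" "V \<subseteq> U"
  shows "mlen (X\<lparr>carrier := U\<rparr>) V U = mlen X V U"
proof -
  have lU: "lm (X\<lparr>carrier := U\<rparr>)" by (rule lm_sub[OF assms(1,2)])
  have f: "(\<lambda>x\<in>U. x) \<in> lin_hom A ((X\<lparr>carrier := U\<rparr>)\<lparr>carrier := U\<rparr>) X"
    using incl_hom[OF assms(1,2)] by simp
  show ?thesis
    by (rule len_map[OF lU assms(1) f _ assms(3,2,4)])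
      (use assms submod_carrier[OF lU] in auto)
qed

lemma len_ker_im:
  assumes X: "lm X" and Y: "lm Y" and f: "f \<in> lin_hom A X Y"
  shows "mlen X {x \<in> carrier X. f x = \<zero>\<^bsub>Y\<^esub>} (carrier X) = mlen Y {\<zero>\<^bsub>Y\<^esub>} (f ` carrier X)"
proof (rule len_map[OF X Y, where f = f and U = "carrier X"])
  show s: "submod Y (f ` carrier X)" using submod_image[OF X Y f submod_carrier[OF X]] .
  show "{\<zero>\<^bsub>Y\<^esub>} \<subseteq> f ` carrier X" using submodD(2)[OF s] by simp
  show "{x \<in> carrier X. f x = \<zero>\<^bsub>Y\<^esub>} = {x \<in> carrier X. f x \<in> {\<zero>\<^bsub>Y\<^esub>}}"
    by simp
qed (use assms in simp_all)

lemma ker_submod: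
  assumes X: "lm X" and Y: "lm Y" and f: "f \<in> lin_hom A X Y"
  shows "submod X {x \<in> carrier X. f x = \<zero>\<^bsub>Y\<^esub>}"
  using submod_vimage[OF X Y f submod_carrier[OF X] submod_zero[OF Y]] by simp

lemma len_hom:
  assumes X: "lm X" and Y: "lm Y" and f: "f \<in> lin_hom A X Y"
  shows "tlen X = mlen X {\<zero>\<^bsub>X\<^esub>} {x \<in> carrier X. f x = \<zero>\<^bsub>Y\<^esub>} + mlen Y {\<zero>\<^bsub>Y\<^esub>} (f ` carrier X)"
  unfolding len_ker_im[OF assms, symmetric]
  by (rule len_add[OF X submod_zero[OF X] ker_submod[OF assms] submod_carrier[OF X]])
    (use hom_simps(4)[OF f X Y] X in auto)

text \<open>The image of an injective endomorphism has the same length as X, so by additivity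
  nothing lies above it. This converts injectivity into invertibility throughout.\<close>

lemma inj_endo_surj:
  assumes X: "lm X" and f: "f \<in> lin_hom A X X" and fin: "tlen X \<noteq> \<infinity>"
    and inj: "\<And>x. \<lbrakk>x \<in> carrier X; f x = \<zero>\<^bsub>X\<^esub>\<rbrakk> \<Longrightarrow> x = \<zero>\<^bsub>X\<^esub>"
  shows "f \<in> lin_iso A X X"
proof -
  have k: "{x \<in> carrier X. f x = \<zero>\<^bsub>X\<^esub>} = {\<zero>\<^bsub>X\<^esub>}"
    using inj hom_simps(4)[OF f X X] X by auto
  have z: "mlen X {\<zero>\<^bsub>X\<^esub>} {\<zero>\<^bsub>X\<^esub>} = 0" using len_eq_0_iff[OF X] X by simp
  have sub: "f ` carrier X \<subseteq> carrier X" using hom_simps(1)[OF f X X] by auto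
  have im: "submod X (f ` carrier X)" using submod_image[OF X X f] X by auto
  have "tlen X = mlen X {\<zero>\<^bsub>X\<^esub>} (f ` carrier X)" using len_hom[OF X X f] k z by simp
  moreover have "tlen X = mlen X {\<zero>\<^bsub>X\<^esub>} (f ` carrier X) + mlen X (f ` carrier X) (carrier X)"
    by (rule len_add[OF X]) (use im X sub submodD(2)[OF im] in auto)
  ultimately have "mlen X (f ` carrier X) (carrier X) = 0"
    using enat_add_le_imp fin by metis
  then have "f ` carrier X = carrier X" using len_eq_0_iff[OF X im] X sub by simp
  moreover have "inj_on f (carrier X)" using hom_inj_iff[OF X X f] inj by auto
  ultimately show ?thesis using f by (auto simp: lin_iso_def bij_betw_def)
qed

text \<open>A proper submodule of least colength in C is maximal, because a submodule strictly
  between it and C would have smaller colength.\<close>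

lemma maximal_submod_ex:
  assumes X: "lm X" and C: "submod X C" and nz: "C \<noteq> {\<zero>\<^bsub>X\<^esub>}" and fin: "mlen X {\<zero>\<^bsub>X\<^esub>} C \<noteq> \<infinity>"
  shows "\<exists>D. submod X D \<and> D \<subset> C \<and> (\<forall>E. submod X E \<longrightarrow> D \<subseteq> E \<longrightarrow> E \<subseteq> C \<longrightarrow> E = D \<or> E = C)"
proof -
  define Q where "Q D \<longleftrightarrow> submod X D \<and> D \<subset> C" for D
  have zs: "{\<zero>\<^bsub>X\<^esub>} \<subseteq> S" if "submod X S" for S using submodD(2)[OF that] by auto
  have "Q {\<zero>\<^bsub>X\<^esub>}" using X C nz zs[OF C] by (auto simp: Q_def)
  then obtain D where D: "Q D" and min: "\<And>E. Q E \<Longrightarrow> the_enat (mlen X D C) \<le> the_enat (mlen X E C)"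
    using ex_has_least_nat[of Q "{\<zero>\<^bsub>X\<^esub>}" "\<lambda>D. the_enat (mlen X D C)"] by metis
  have finD: "mlen X E C \<noteq> \<infinity>" if "Q E" for E
    using len_add[OF X submod_zero[OF X], of E C] that C fin zs[of E] by (auto simp: Q_def)
  show ?thesis
  proof (intro exI[of _ D] conjI allI impI)
    show "submod X D" "D \<subset> C" using D by (auto simp: Q_def)
    fix E assume E: "submod X E" "D \<subseteq> E" "E \<subseteq> C"
    show "E = D \<or> E = C"
    proof (rule ccontr)
      assume n: "\<not> (E = D \<or> E = C)"
      then have QE: "Q E" using E by (auto simp: Q_def)
      have "mlen X D C = mlen X D E + mlen X E C"
        by (rule len_add[OF X]) (use D E C in \<open>auto simp: Q_def\<close>)
      moreover have "mlen X D E \<noteq> 0" using len_eq_0_iff[OF X _ E(1,2)] D n by (auto simp: Q_def)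
      ultimately show False using min[OF QE] finD[OF D] finD[OF QE]
        by (cases "mlen X D C"; cases "mlen X D E"; cases "mlen X E C") (auto simp: zero_enat_def)
    qed
  qed
qed

text \<open>Each new image raises the length by at most that of N, since a chain between U and the
  sum of U with the image of \<open>\<phi> s\<close> has a strictly increasing preimage in N. This
  is how finite generation is turned into finite length.\<close>

lemma bounded_generated:
  fixes N :: "('a, 'n, 'z) module_scheme" and X :: "('a, 'm, 'y) module_scheme"
  assumes X: "lm X" and N: "lm N" and fin: "tlen N \<noteq> \<infinity>" and "finite S"
    and "\<And>s. s \<in> S \<Longrightarrow> \<phi> s \<in> lin_hom A N X"
  shows "\<exists>U. submod X U \<and> (\<forall>s\<in>S. \<phi> s ` carrier N \<subseteq> U) \<and> mlen X {\<zero>\<^bsub>X\<^esub>} U \<noteq> \<infinity>"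
  using assms(4,5)
proof (induction S)
  case empty
  have "mlen X {\<zero>\<^bsub>X\<^esub>} {\<zero>\<^bsub>X\<^esub>} = 0" using len_eq_0_iff[OF X] X by simp
  then show ?case using X by (intro exI[of _ "{\<zero>\<^bsub>X\<^esub>}"]) auto
next
  case (insert s S)
  obtain U where U: "submod X U" "\<forall>s\<in>S. \<phi> s ` carrier N \<subseteq> U" "mlen X {\<zero>\<^bsub>X\<^esub>} U \<noteq> \<infinity>"
    using insert.IH insert.prems by auto
  have f: "\<phi> s \<in> lin_hom A N X" using insert.prems by auto
  note fs = hom_simps[OF f N X]
  let ?I = "\<phi> s ` carrier N"
  have I: "submod X ?I" using submod_image[OF N X f] N by auto
  let ?V = "ssum X U ?I"
  have V: "submod X ?V" using submod_ssum[OF X U(1) I] .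
  note up = ssum_upper[OF X U(1) I]
  have "mlen X U ?V \<le> mlen N {n \<in> carrier N. \<phi> s n \<in> U} {n \<in> carrier N. \<phi> s n \<in> ?V}"
  proof (rule len_map_le)
    show "submod N {n \<in> carrier N. \<phi> s n \<in> T}" if "submod X T" for T
      using submod_vimage[OF N X f submod_carrier[OF N] that] by simp
    fix T T' assume T: "submod X T" "submod X T'" "U \<subseteq> T" "T \<subset> T'" "T' \<subseteq> ?V"
    then obtain t where t: "t \<in> T'" "t \<notin> T" by auto
    then obtain u n where un: "u \<in> U" "n \<in> carrier N" "t = u \<oplus>\<^bsub>X\<^esub> \<phi> s n"
      using T(5) by (auto simp: ssum_def)
    have uc: "u \<in> carrier X" using submodD(1)[OF U(1)] un by auto
    have "\<phi> s n = t \<ominus>\<^bsub>X\<^esub> u" using lm_minus(5)[OF X uc, of "\<phi> s n"] un fs by simp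
    then have "\<phi> s n \<in> T'" using submod_neg(2)[OF X T(2), of t u] t un T by auto
    moreover have "\<phi> s n \<notin> T" using submodD(3)[OF T(1), of u "\<phi> s n"] t un T by auto
    ultimately show "{n \<in> carrier N. \<phi> s n \<in> T} \<subset> {n \<in> carrier N. \<phi> s n \<in> T'}"
      using T(4) un(2) by blast
  qed
  also have "\<dots> \<le> tlen N"
    by (rule len_mono[OF N])
      (use submod_vimage[OF N X f submod_carrier[OF N] U(1)] submod_vimage[OF N X f submod_carrier[OF N] V]
        N up submodD(2)[OF U(1)] fs(4) in auto)
  finally have "mlen X U ?V \<noteq> \<infinity>" using fin enat_ile not_infinity_eq by metis
  moreover have "mlen X {\<zero>\<^bsub>X\<^esub>} ?V = mlen X {\<zero>\<^bsub>X\<^esub>} U + mlen X U ?V"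
    by (rule len_add[OF X]) (use U V up X submodD(2)[OF U(1)] in auto)
  ultimately have "mlen X {\<zero>\<^bsub>X\<^esub>} ?V \<noteq> \<infinity>"
    using U(3) by (simp add: plus_eq_infty_iff_enat)
  then show ?case using V U(2) up by (intro exI[of _ ?V]) auto
qed

section \<open>Finite generation\<close>

text \<open>Building combinations one term at a time gives rule induction, for instance for
  transport along homomorphisms. The link to the finite sums in \<open>finitely_generated\<close> is
  \<open>fg_iff\<close>.\<close>

inductive_set lspan :: "('a, 'm, 'y) module_scheme \<Rightarrow> 'm set \<Rightarrow> 'm set"
  for X :: "('a, 'm, 'y) module_scheme" and S where
  zero: "\<zero>\<^bsub>X\<^esub> \<in> lspan X S"
| add: "\<lbrakk>a \<in> carrier A; s \<in> S; x \<in> lspan X S\<rbrakk> \<Longrightarrow> a \<odot>\<^bsub>X\<^esub> s \<oplus>\<^bsub>X\<^esub> x \<in> lspan X S"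

lemma lspan_least:
  assumes "submod X U" "S \<subseteq> U" shows "lspan X S \<subseteq> U"
proof
  show "x \<in> U" if "x \<in> lspan X S" for x
    using that by (induction) (use assms in \<open>auto intro!: submodD[OF assms(1)]\<close>)
qed

lemma lspan_submod:
  assumes X: "lm X" and S: "S \<subseteq> carrier X" shows "submod X (lspan X S)"
proof (rule submodI)
  show c: "lspan X S \<subseteq> carrier X" using lspan_least[OF submod_carrier[OF X] S] .
  show "\<zero>\<^bsub>X\<^esub> \<in> lspan X S" by (rule lspan.zero)
  show "x \<oplus>\<^bsub>X\<^esub> y \<in> lspan X S" if xy: "x \<in> lspan X S" "y \<in> lspan X S" for x y
    using that(1)
  proof induction
    case zero then show ?case using that c X by (auto simp: lm_add)
  next
    case (add a s x)
    then have "(a \<odot>\<^bsub>X\<^esub> s \<oplus>\<^bsub>X\<^esub> x) \<oplus>\<^bsub>X\<^esub> y = a \<odot>\<^bsub>X\<^esub> s \<oplus>\<^bsub>X\<^esub> (x \<oplus>\<^bsub>X\<^esub> y)"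
      using lm_ac(2)[OF X, of "a \<odot>\<^bsub>X\<^esub> s" x y] that c X S by (auto simp: subset_iff)
    then show ?case using add by (auto intro: lspan.add)
  qed
  show "b \<odot>\<^bsub>X\<^esub> x \<in> lspan X S" if "b \<in> carrier A" "x \<in> lspan X S" for b x
    using that(2)
  proof induction
    case zero then show ?case
      using that X lm_smult(6)[OF X, of "\<zero>\<^bsub>X\<^esub>"] by (auto intro: lspan.zero)
  next
    case (add a s x)
    interpret A: ring A by (rule ring_A)
    have "b \<odot>\<^bsub>X\<^esub> (a \<odot>\<^bsub>X\<^esub> s \<oplus>\<^bsub>X\<^esub> x) = (b \<otimes>\<^bsub>A\<^esub> a) \<odot>\<^bsub>X\<^esub> s \<oplus>\<^bsub>X\<^esub> b \<odot>\<^bsub>X\<^esub> x"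
      using lm_smult[OF X] that add c S X by (auto simp: subset_iff)
    then show ?case using add that by (auto intro: lspan.add)
  qed
qed

lemma lspan_superset:
  assumes X: "lm X" and S: "S \<subseteq> carrier X" shows "S \<subseteq> lspan X S"
proof
  fix s assume s: "s \<in> S"
  interpret A: ring A by (rule ring_A)
  have "\<one>\<^bsub>A\<^esub> \<odot>\<^bsub>X\<^esub> s \<oplus>\<^bsub>X\<^esub> \<zero>\<^bsub>X\<^esub> \<in> lspan X S"
    using s by (intro lspan.intros) auto
  then show "s \<in> lspan X S" using s S X lm_smult(1)[OF X] lm_add(2)[OF X] by auto
qed

lemma lspan_mono: "S \<subseteq> T \<Longrightarrow> lspan X S \<subseteq> lspan X T"
proof
  fix x assume "S \<subseteq> T" "x \<in> lspan X S"
  from this(2) show "x \<in> lspan X T"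
    by induction (use \<open>S \<subseteq> T\<close> in \<open>auto intro: lspan.intros\<close>)
qed

lemma lspan_sub: "lspan (X\<lparr>carrier := U\<rparr>) S = lspan X S"
proof (intro equalityI subsetI)
  show "x \<in> lspan X S" if "x \<in> lspan (X\<lparr>carrier := U\<rparr>) S" for x
    using that by induction (auto intro: lspan.intros)
  show "x \<in> lspan (X\<lparr>carrier := U\<rparr>) S" if "x \<in> lspan X S" for x
    using that
  proof induction
    case zero
    then show ?case using lspan.zero[of "X\<lparr>carrier := U\<rparr>" S] by simp
  next
    case (add a s x)
    then show ?case using lspan.add[of a s S x "X\<lparr>carrier := U\<rparr>"] by simp
  qed
qed

lemma lspan_image:
  assumes X: "lm X" and Y: "lm Y" and f: "f \<in> lin_hom A X Y" and S: "S \<subseteq> carrier X"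
  shows "f ` lspan X S = lspan Y (f ` S)"
proof (intro equalityI)
  note fs = hom_simps[OF f X Y]
  have c: "lspan X S \<subseteq> carrier X" using lspan_least[OF submod_carrier[OF X] S] .
  have "f x \<in> lspan Y (f ` S)" if "x \<in> lspan X S" for x
    using that
  proof induction
    case (add a s x)
    then have "f (a \<odot>\<^bsub>X\<^esub> s \<oplus>\<^bsub>X\<^esub> x) = a \<odot>\<^bsub>Y\<^esub> f s \<oplus>\<^bsub>Y\<^esub> f x"
      using fs c S X by (auto simp: subset_iff)
    then show ?case using add by (auto intro: lspan.add)
  qed (use fs in \<open>auto intro: lspan.zero\<close>)
  then show "f ` lspan X S \<subseteq> lspan Y (f ` S)" by auto
  show "lspan Y (f ` S) \<subseteq> f ` lspan X S"
    using lspan_superset[OF X S] by (intro lspan_least submod_image[OF X Y f] lspan_submod X S) auto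
qed

lemma finsum_in_lspan:
  assumes X: "lm X" and S: "finite S" "S \<subseteq> carrier X" "c \<in> S \<rightarrow> carrier A"
  shows "(\<Oplus>\<^bsub>X\<^esub>s\<in>S. c s \<odot>\<^bsub>X\<^esub> s) \<in> lspan X S"
proof -
  interpret X: abelian_group X by (rule lm_group[OF X])
  have cl: "c s \<odot>\<^bsub>X\<^esub> s \<in> carrier X" if "s \<in> S" for s
    using lm_closed(5)[OF X, of "c s" s] S that by blast
  have "(\<Oplus>\<^bsub>X\<^esub>s\<in>T. c s \<odot>\<^bsub>X\<^esub> s) \<in> lspan X S" if "T \<subseteq> S" for T
    using finite_subset[OF that S(1)] that
  proof (induction T)
    case (insert t T)
    then have "(\<Oplus>\<^bsub>X\<^esub>s\<in>insert t T. c s \<odot>\<^bsub>X\<^esub> s) = c t \<odot>\<^bsub>X\<^esub> t \<oplus>\<^bsub>X\<^esub> (\<Oplus>\<^bsub>X\<^esub>s\<in>T. c s \<odot>\<^bsub>X\<^esub> s)"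
      using cl by (intro X.finsum_insert) auto
    moreover have "c t \<in> carrier A" "t \<in> S" using insert.prems S(3) by auto
    ultimately show ?case using insert by (simp add: lspan.add)
  qed (simp add: lspan.zero)
  then show ?thesis by blast
qed

lemma lspan_finsum:
  assumes X: "lm X" and S: "finite S" "S \<subseteq> carrier X" and x: "x \<in> lspan X S"
  shows "\<exists>c \<in> S \<rightarrow> carrier A. x = (\<Oplus>\<^bsub>X\<^esub>s\<in>S. c s \<odot>\<^bsub>X\<^esub> s)"
  using x
proof induction
  interpret X: abelian_group X by (rule lm_group[OF X])
  interpret A: ring A by (rule ring_A)
  case zero
  have "(\<Oplus>\<^bsub>X\<^esub>s\<in>S. \<zero>\<^bsub>A\<^esub> \<odot>\<^bsub>X\<^esub> s) = (\<Oplus>\<^bsub>X\<^esub>s\<in>S. \<zero>\<^bsub>X\<^esub>)"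
    using X S by (intro X.finsum_cong') (auto simp: lm_smult)
  then show ?case by (intro bexI[of _ "\<lambda>_. \<zero>\<^bsub>A\<^esub>"]) auto
next
  interpret X: abelian_group X by (rule lm_group[OF X])
  interpret A: ring A by (rule ring_A)
  case (add a t x)
  then obtain c where c: "c \<in> S \<rightarrow> carrier A" "x = (\<Oplus>\<^bsub>X\<^esub>s\<in>S. c s \<odot>\<^bsub>X\<^esub> s)"
    by blast
  \<comment> \<open>The generator t may already occur in the sum for x, so a is added to its
    existing coefficient.\<close>
  let ?d = "\<lambda>s. if s = t then a \<oplus>\<^bsub>A\<^esub> c t else c s"
  have cl: "c s \<odot>\<^bsub>X\<^esub> s \<in> carrier X" if "s \<in> S" for s
    using lm_closed(5)[OF X, of "c s" s] S c(1) that by blast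
  have ct: "t \<in> carrier X" "c t \<in> carrier A" "a \<in> carrier A" using add(1,2) S c(1) by auto
  have dt: "(a \<oplus>\<^bsub>A\<^esub> c t) \<odot>\<^bsub>X\<^esub> t = a \<odot>\<^bsub>X\<^esub> t \<oplus>\<^bsub>X\<^esub> c t \<odot>\<^bsub>X\<^esub> t" "a \<odot>\<^bsub>X\<^esub> t \<in> carrier X"
    using ct lm_smult(3)[OF X] X by auto
  have S': "S = insert t (S - {t})" using add by auto
  have "x = (\<Oplus>\<^bsub>X\<^esub>s\<in>insert t (S - {t}). c s \<odot>\<^bsub>X\<^esub> s)"
    using c S' by simp
  also have "\<dots> = c t \<odot>\<^bsub>X\<^esub> t \<oplus>\<^bsub>X\<^esub> (\<Oplus>\<^bsub>X\<^esub>s\<in>S - {t}. c s \<odot>\<^bsub>X\<^esub> s)"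
    using cl S add by (intro X.finsum_insert) auto
  finally have 1: "x = c t \<odot>\<^bsub>X\<^esub> t \<oplus>\<^bsub>X\<^esub> (\<Oplus>\<^bsub>X\<^esub>s\<in>S - {t}. c s \<odot>\<^bsub>X\<^esub> s)" .
  have 2: "(\<Oplus>\<^bsub>X\<^esub>s\<in>S - {t}. c s \<odot>\<^bsub>X\<^esub> s) \<in> carrier X"
    using cl by (intro X.finsum_closed) auto
  have "(\<Oplus>\<^bsub>X\<^esub>s\<in>S. ?d s \<odot>\<^bsub>X\<^esub> s) = (\<Oplus>\<^bsub>X\<^esub>s\<in>insert t (S - {t}). ?d s \<odot>\<^bsub>X\<^esub> s)"
    using S' by simp
  also have "\<dots> = ?d t \<odot>\<^bsub>X\<^esub> t \<oplus>\<^bsub>X\<^esub> (\<Oplus>\<^bsub>X\<^esub>s\<in>S - {t}. ?d s \<odot>\<^bsub>X\<^esub> s)"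
    using cl S(1) cl[OF add(2)] dt by (intro X.finsum_insert) auto
  also have "(\<Oplus>\<^bsub>X\<^esub>s\<in>S - {t}. ?d s \<odot>\<^bsub>X\<^esub> s) = (\<Oplus>\<^bsub>X\<^esub>s\<in>S - {t}. c s \<odot>\<^bsub>X\<^esub> s)"
    using cl by (intro X.finsum_cong') auto
  also have "?d t \<odot>\<^bsub>X\<^esub> t = a \<odot>\<^bsub>X\<^esub> t \<oplus>\<^bsub>X\<^esub> c t \<odot>\<^bsub>X\<^esub> t"
    using dt by simp
  finally have "(\<Oplus>\<^bsub>X\<^esub>s\<in>S. ?d s \<odot>\<^bsub>X\<^esub> s) = a \<odot>\<^bsub>X\<^esub> t \<oplus>\<^bsub>X\<^esub> x"
    unfolding 1 using 2 cl[OF add(2)] dt(2) by (simp add: X.a_assoc)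
  moreover have "?d \<in> S \<rightarrow> carrier A" using c(1) ct by auto
  ultimately show ?case by (intro bexI[of _ ?d]) auto
qed

lemma fg_iff:
  assumes X: "lm X"
  shows "finitely_generated A X \<longleftrightarrow> (\<exists>S. finite S \<and> S \<subseteq> carrier X \<and> lspan X S = carrier X)"
proof
  assume "finitely_generated A X"
  then obtain S where *: "finite S \<and> S \<subseteq> carrier X \<and> (\<forall>x \<in> carrier X.
      \<exists>c \<in> S \<rightarrow> carrier A. x = (\<Oplus>\<^bsub>X\<^esub>s\<in>S. c s \<odot>\<^bsub>X\<^esub> s))"
    unfolding finitely_generated_def by (elim exE) (rule that)
  then have S: "finite S" "S \<subseteq> carrier X" by simp_all
  have "x \<in> lspan X S" if "x \<in> carrier X" for x
  proof -
    obtain c where "c \<in> S \<rightarrow> carrier A" "x = (\<Oplus>\<^bsub>X\<^esub>s\<in>S. c s \<odot>\<^bsub>X\<^esub> s)"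
      using *[THEN conjunct2, THEN conjunct2, rule_format, OF \<open>x \<in> carrier X\<close>] by (elim bexE) (rule that)
    then show ?thesis using finsum_in_lspan[OF X S] by simp
  qed
  then have "lspan X S = carrier X" using lspan_least[OF submod_carrier[OF X] S(2)] by auto
  then show "\<exists>S. finite S \<and> S \<subseteq> carrier X \<and> lspan X S = carrier X" using S by auto
next
  assume "\<exists>S. finite S \<and> S \<subseteq> carrier X \<and> lspan X S = carrier X"
  then obtain S where S: "finite S" "S \<subseteq> carrier X" "lspan X S = carrier X" by auto
  then show "finitely_generated A X"
    unfolding finitely_generated_def using lspan_finsum[OF X S(1,2)] by (intro exI[of _ S]) simp
qed

text \<open>Among the finite subsets of U choose one whose span has least colength in U. Adjoining
  an element outside the span would lower the colength, so the span is U. This is the noetherian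
  property of modules of finite length.\<close>

lemma submod_fg:
  assumes X: "lm X" and fin: "tlen X \<noteq> \<infinity>" and U: "submod X U"
  shows "\<exists>S. finite S \<and> S \<subseteq> U \<and> lspan X S = U"
proof -
  have Uc: "U \<subseteq> carrier X" using submodD(1)[OF U] by auto
  define Q where "Q S \<longleftrightarrow> finite S \<and> S \<subseteq> U" for S
  have z: "{\<zero>\<^bsub>X\<^esub>} \<subseteq> S" if "submod X S" for S using submodD(2)[OF that] by auto
  have sub: "submod X (lspan X S)" "lspan X S \<subseteq> U" if "Q S" for S
    using that Uc lspan_submod[OF X] lspan_least[OF U] by (auto simp: Q_def)
  have fin': "mlen X (lspan X S) U \<noteq> \<infinity>" if "Q S" for S
    using len_mono[OF X submod_zero[OF X] sub(1)[OF that] U submod_carrier[OF X] z[OF sub(1)[OF that]]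
        sub(2)[OF that] Uc] fin enat_ile not_infinity_eq by metis
  obtain S where S: "Q S" and min: "\<And>T. Q T \<Longrightarrow> the_enat (mlen X (lspan X S) U) \<le> the_enat (mlen X (lspan X T) U)"
    using ex_has_least_nat[of Q "{}" "\<lambda>S. the_enat (mlen X (lspan X S) U)"] by (auto simp: Q_def)
  have "lspan X S = U"
  proof (rule ccontr)
    assume "lspan X S \<noteq> U"
    then obtain u where u: "u \<in> U" "u \<notin> lspan X S" using sub[OF S] by auto
    have T: "Q (insert u S)" using S u by (auto simp: Q_def)
    have "u \<in> lspan X (insert u S)" using lspan_superset[OF X, of "insert u S"] T Uc by (auto simp: Q_def)
    then have ne: "lspan X S \<noteq> lspan X (insert u S)" using u by auto
    have "mlen X (lspan X S) U = mlen X (lspan X S) (lspan X (insert u S)) + mlen X (lspan X (insert u S)) U"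
      by (rule len_add[OF X sub(1)[OF S] sub(1)[OF T] U lspan_mono sub(2)[OF T]]) auto
    moreover have "mlen X (lspan X S) (lspan X (insert u S)) \<noteq> 0"
      using len_eq_0_iff[OF X sub(1)[OF S] sub(1)[OF T]] ne lspan_mono[of S "insert u S" X] by auto
    ultimately show False using min[OF T] fin'[OF S] fin'[OF T]
      by (cases "mlen X (lspan X S) U"; cases "mlen X (lspan X S) (lspan X (insert u S))"; cases "mlen X (lspan X (insert u S)) U") (auto simp: zero_enat_def)
  qed
  then show ?thesis using S by (auto simp: Q_def)
qed

end

lemma chn_self: "chn P U U n \<Longrightarrow> n = 0"
  by (erule chn.cases) (auto dest: chn_dest)

section \<open>Local artinian rings\<close>

lemma (in mod_base) regular_lm: "lm (regular_module A)"
proof -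
  interpret A: ring A by (rule ring_A)
  show ?thesis
  proof (rule lmI)
    show "abelian_group (regular_module A)"
    proof (rule abelian_groupI)
      show "\<exists>y\<in>carrier (regular_module A). y \<oplus>\<^bsub>regular_module A\<^esub> x = \<zero>\<^bsub>regular_module A\<^esub>"
        if "x \<in> carrier (regular_module A)" for x
        using that A.l_neg[of x] by (auto simp: regular_module_def intro!: bexI[of _ "\<ominus>\<^bsub>A\<^esub> x"])
    qed (auto simp: regular_module_def A.a_ac)
  qed (auto simp: regular_module_def A.l_distr A.r_distr A.m_assoc)
qed

lemma (in mod_base) regular_simps [simp]:
  "carrier (regular_module A) = carrier A" "\<zero>\<^bsub>regular_module A\<^esub> = \<zero>\<^bsub>A\<^esub>"
  "x \<oplus>\<^bsub>regular_module A\<^esub> y = x \<oplus>\<^bsub>A\<^esub> y" "a \<odot>\<^bsub>regular_module A\<^esub> x = a \<otimes>\<^bsub>A\<^esub> x"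
  by (auto simp: regular_module_def)

lemma (in mod_base) right_mult_hom:
  assumes X: "lm X" and x: "x \<in> carrier X"
  shows "(\<lambda>a\<in>carrier A. a \<odot>\<^bsub>X\<^esub> x) \<in> lin_hom A (regular_module A) X"
proof -
  interpret A: ring A by (rule ring_A)
  have "(\<lambda>a\<in>carrier (regular_module A). a \<odot>\<^bsub>X\<^esub> x) \<in> lin_hom A (regular_module A) X"
    by (rule lin_homI) (use X x lm_smult[OF X x] regular_lm in auto)
  then show ?thesis by simp
qed

locale local_artinian =
  fixes R :: "('r, 'x) ring_scheme" (structure)
  assumes cring_R: "cring R" and artinian_R: "artinian R" and local_R: "local_ring R"

sublocale local_artinian \<subseteq> mod_base R
  by (rule mod_base.intro) (rule cring.axioms(1)[OF cring_R])

context local_artinian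
begin

abbreviation reg :: "('r, 'r) module" where "reg \<equiv> regular_module R"

lemma submod_reg_iff: "submod reg I \<longleftrightarrow> ideal I R"
proof
  interpret cring R by (rule cring_R)
  assume I: "submod reg I"
  note sd = submodD[OF I, simplified]
  have neg: "\<ominus> x \<in> I" if "x \<in> I" for x
    using sd(4)[of "\<ominus> \<one>" x] sd(1)[OF that] that by (simp add: l_minus)
  show "ideal I R"
  proof (rule idealI[OF ring_axioms])
    show "subgroup I (add_monoid R)"
    proof (rule subgroup.intro)
      show "inv\<^bsub>add_monoid R\<^esub> x \<in> I" if "x \<in> I" for x
        using neg[OF that] by (simp add: a_inv_def)
    qed (use sd in auto)
    show l: "x \<otimes> a \<in> I" if "a \<in> I" "x \<in> carrier R" for a x using sd(4) that by blast
    show "a \<otimes> x \<in> I" if "a \<in> I" "x \<in> carrier R" for a x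
      using l[OF that] m_comm[OF sd(1)[OF that(1)] that(2)] by simp
  qed
next
  assume "ideal I R"
  then interpret ideal I R .
  show "submod reg I"
    by (rule submodI) (use a_subset in \<open>auto simp: I_l_closed\<close>)
qed

text \<open>The chain condition in \<open>artinian\<close> is about sequences of ideals; dependent
  choice turns it into the minimum condition used below.\<close>

lemma ideal_minimal:
  assumes "Q I0" and "\<And>I. Q I \<Longrightarrow> submod reg I"
  obtains I where "Q I" "\<And>J. \<lbrakk>Q J; J \<subseteq> I\<rbrakk> \<Longrightarrow> J = I"
proof (rule ccontr)
  assume neg: "\<not> thesis"
  note found = that
  have step: "\<exists>J. Q J \<and> J \<subset> I" if "Q I" for I
    using neg found[of I] \<open>Q I\<close> by blast
  have "\<exists>f. \<forall>n. Q (f n) \<and> f (Suc n) \<subset> f n"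
  proof (rule dependent_nat_choice)
    show "\<exists>I. Q I" using assms(1) by blast
    show "\<exists>J. Q J \<and> J \<subset> I" if "Q I" for I n using step[OF that] .
  qed
  then obtain f where f: "\<And>n. Q (f n)" "\<And>n. f (Suc n) \<subset> f n" by blast
  have "\<exists>N. \<forall>n\<ge>N. f n = f N"
    using artinian_R f assms(2) unfolding artinian_def submod_reg_iff by blast
  then obtain N where "\<forall>n\<ge>N. f n = f N" by blast
  then have "f (Suc N) = f N" by (meson le_SucI order_refl)
  then show False using f(2)[of N] by simp
qed

definition maxid :: "'r set" where
  "maxid = (THE I. maximalideal I R)"

lemma maxid: "maximalideal maxid R" "maximalideal I R \<Longrightarrow> I = maxid"
proof -
  have "\<exists>!I. maximalideal I R" using local_R by (simp add: local_ring_def)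
  then show "maximalideal maxid R" "maximalideal I R \<Longrightarrow> I = maxid"
    unfolding maxid_def using theI'[of "\<lambda>I. maximalideal I R"] the1_equality by metis+
qed

lemma maxid_facts:
  "maxid \<subseteq> carrier R" "\<one> \<notin> maxid"
  "\<lbrakk>a \<in> maxid; x \<in> carrier R\<rbrakk> \<Longrightarrow> a \<otimes> x \<in> maxid"
  "\<lbrakk>a \<in> maxid; b \<in> maxid\<rbrakk> \<Longrightarrow> a \<oplus> b \<in> maxid"
proof -
  interpret maximalideal maxid R by (rule maxid(1))
  show "maxid \<subseteq> carrier R" using a_subset .
  show "\<one> \<notin> maxid" using I_notcarr one_imp_carrier by blast
  show "\<lbrakk>a \<in> maxid; x \<in> carrier R\<rbrakk> \<Longrightarrow> a \<otimes> x \<in> maxid"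
    using I_r_closed .
  show "\<lbrakk>a \<in> maxid; b \<in> maxid\<rbrakk> \<Longrightarrow> a \<oplus> b \<in> maxid"
    using submodD(3)[of reg maxid] submod_reg_iff is_ideal by simp
qed

text \<open>If the principal ideal of a avoided 1, it could be enlarged to an ideal maximal among
  those avoiding 1. That is a maximal ideal, hence equal to \<open>maxid\<close>, and it contains
  a.\<close>

lemma unit_if_notin_maxid:
  assumes a: "a \<in> carrier R" "a \<notin> maxid"
  obtains b where "b \<in> carrier R" "b \<otimes> a = \<one>"
proof (rule ccontr)
  assume neg: "\<not> thesis"
  interpret cring R by (rule cring_R)
  let ?K = "(\<lambda>b\<in>carrier R. b \<otimes> a) ` carrier R"
  have h: "(\<lambda>b\<in>carrier R. b \<odot>\<^bsub>reg\<^esub> a) \<in> lin_hom R reg reg"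
    using right_mult_hom[OF regular_lm, of a] a by simp
  have K: "submod reg ?K"
    using submod_image[OF regular_lm regular_lm h submod_carrier[OF regular_lm]] by simp
  have one: "\<one> \<notin> ?K" using neg that by force
  obtain J where J: "submod reg J" "?K \<subseteq> J" "J \<subseteq> carrier R" "\<one> \<notin> J"
    "\<And>J'. \<lbrakk>submod reg J'; J \<subset> J'; J' \<subseteq> carrier R\<rbrakk> \<Longrightarrow> \<one> \<in> J'"
    using maximal_avoiding[OF K _ one, of "carrier R"] a by auto
  have "maximalideal J R"
  proof (rule maximalidealI)
    show "ideal J R" using J(1) submod_reg_iff by simp
    show "carrier R \<noteq> J" using J(4) by auto
    show "J' = J \<or> J' = carrier R" if J': "ideal J' R" "J \<subseteq> J'" "J' \<subseteq> carrier R" for J'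
    proof (cases "J' = J")
      case False
      then have "\<one> \<in> J'" using J(5)[of J'] J' submod_reg_iff by auto
      then show ?thesis using ideal.one_imp_carrier[OF J'(1)] by simp
    qed simp
  qed
  then have "J = maxid" by (rule maxid(2))
  moreover have "a \<in> ?K" using a by (auto intro!: image_eqI[of _ _ \<one>])
  ultimately show False using J(2) a(2) by auto
qed

lemma one_minus_unit:
  assumes b: "b \<in> maxid"
  obtains c where "c \<in> carrier R" "c \<otimes> (\<one> \<ominus> b) = \<one>"
proof -
  interpret cring R by (rule cring_R)
  have bc: "b \<in> carrier R" using b maxid_facts(1) by auto
  have "\<one> \<ominus> b \<notin> maxid"
  proof
    assume "\<one> \<ominus> b \<in> maxid"
    then have "(\<one> \<ominus> b) \<oplus> b \<in> maxid" using b maxid_facts(4) by simp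
    moreover have "(\<one> \<ominus> b) \<oplus> b = \<one>" using bc by (simp add: a_minus_def a_assoc l_neg)
    ultimately show False using maxid_facts(2) by simp
  qed
  then show thesis using unit_if_notin_maxid[of "\<one> \<ominus> b"] bc that by auto
qed

text \<open>An ideal \<open>I\<close> with \<open>maxid I = I\<close> is zero. Otherwise pick \<open>J\<close> minimal with \<open>J I \<noteq> 0\<close>; it is
  principal, say generated by \<open>a\<close>, and \<open>a b\<close> with suitable \<open>b \<in> maxid\<close> generates it as well.\<close>

lemma ideal_eq_maxid_mult:
  assumes I: "submod reg I"
    and eq: "\<And>K. \<lbrakk>submod reg K; K \<subseteq> I; \<And>b x. \<lbrakk>b \<in> maxid; x \<in> I\<rbrakk> \<Longrightarrow> b \<otimes> x \<in> K\<rbrakk> \<Longrightarrow> K = I"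
  shows "I = {\<zero>}"
proof (rule ccontr)
  interpret cring R by (rule cring_R)
  assume "I \<noteq> {\<zero>}"
  note Id = submodD[OF I, simplified]
  then obtain x0 where x0: "x0 \<in> I" "x0 \<noteq> \<zero>" using \<open>I \<noteq> {\<zero>}\<close> by auto
  define Q where "Q J \<longleftrightarrow> submod reg J \<and> (\<exists>a\<in>J. \<exists>x\<in>I. a \<otimes> x \<noteq> \<zero>)" for J
  have "\<exists>a\<in>carrier R. \<exists>x\<in>I. a \<otimes> x \<noteq> \<zero>"
    using x0 Id(1)[OF x0(1)] by (intro bexI[of _ \<one>] bexI[of _ x0]) auto
  then have "Q (carrier R)"
    using submod_carrier[OF regular_lm] unfolding Q_def by simp
  then obtain J where J: "Q J" and min: "\<And>J'. \<lbrakk>Q J'; J' \<subseteq> J\<rbrakk> \<Longrightarrow> J' = J"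
    by (rule ideal_minimal) (auto simp: Q_def)
  obtain a x where ax: "a \<in> J" "x \<in> I" "a \<otimes> x \<noteq> \<zero>" using J by (auto simp: Q_def)
  have sJ: "submod reg J" using J by (simp add: Q_def)
  note Jd = submodD[OF sJ, simplified]
  have ac: "a \<in> carrier R" using Jd(1) ax by auto
  \<comment> \<open>The annihilator of a in I is proper, so by \<open>eq\<close> some product b y
    with b in \<open>maxid\<close> and y in I escapes it. This makes the ideal generated by a b act
    nontrivially on I.\<close>
  let ?K = "{x \<in> I. a \<otimes> x = \<zero>}"
  have K: "submod reg ?K"
    by (rule submodI) (use Id ac in \<open>auto simp: r_distr m_lcomm\<close>)
  have "?K \<noteq> I" using ax by auto
  then obtain b y where b: "b \<in> maxid" "y \<in> I" "b \<otimes> y \<notin> ?K" using eq[OF K] by blast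
  have bc: "b \<in> carrier R" "y \<in> carrier R" using b maxid_facts(1) Id(1) by auto
  have aby: "a \<otimes> (b \<otimes> y) \<noteq> \<zero>" using b Id(4)[of b y] bc by auto
  let ?L = "(\<lambda>c\<in>carrier R. c \<otimes> (a \<otimes> b)) ` carrier R"
  have h: "(\<lambda>c\<in>carrier R. c \<odot>\<^bsub>reg\<^esub> (a \<otimes> b)) \<in> lin_hom R reg reg"
    using right_mult_hom[OF regular_lm, of "a \<otimes> b"] ac bc by simp
  have sL: "submod reg ?L"
    using submod_image[OF regular_lm regular_lm h submod_carrier[OF regular_lm]] by simp
  have abL: "a \<otimes> b \<in> ?L" using ac bc by (auto intro!: image_eqI[of _ _ \<one>])
  have "(a \<otimes> b) \<otimes> y \<noteq> \<zero>" using aby ac bc by (simp add: m_assoc)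
  then have QL: "Q ?L" using sL abL b(2) unfolding Q_def by blast
  have "?L \<subseteq> J"
  proof
    fix z assume "z \<in> ?L"
    then obtain c where c: "c \<in> carrier R" "z = c \<otimes> (a \<otimes> b)" by auto
    have "z = (c \<otimes> b) \<otimes> a" using c ac bc by (simp add: m_ac)
    then show "z \<in> J" using Jd(4)[of "c \<otimes> b" a] c bc ax by simp
  qed
  then have "a \<in> ?L" using min[OF QL] ax by auto
  then obtain c where c: "c \<in> carrier R" "a = c \<otimes> (a \<otimes> b)" by auto
  \<comment> \<open>From a = c a b follows a (1 - b c) = 0, and 1 - b c is invertible because b c
    lies in \<open>maxid\<close>. So a = 0, against the choice of a.\<close>
  have bcm: "b \<otimes> c \<in> maxid" using maxid_facts(3) b c by auto
  obtain u where u: "u \<in> carrier R" "u \<otimes> (\<one> \<ominus> b \<otimes> c) = \<one>"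
    using one_minus_unit[OF bcm] by auto
  have "a \<otimes> (\<one> \<ominus> b \<otimes> c) = a \<ominus> c \<otimes> (a \<otimes> b)"
    using ac bc c(1) by (simp add: a_minus_def r_distr r_minus m_ac)
  also have "\<dots> = \<zero>" using c ac by (simp add: a_minus_def r_neg)
  finally have z: "a \<otimes> (\<one> \<ominus> b \<otimes> c) = \<zero>" .
  have "a = a \<otimes> (u \<otimes> (\<one> \<ominus> b \<otimes> c))" using u ac by simp
  also have "\<dots> = u \<otimes> (a \<otimes> (\<one> \<ominus> b \<otimes> c))"
    using u(1) ac bc c(1) by (intro m_lcomm) auto
  also have "\<dots> = \<zero>" using z u by simp
  finally show False using ax(3) Id(1)[OF ax(2)] by simp
qed

text \<open>Let I be minimal among the ideals of finite colength. If I were nonzero,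
  \<open>ideal_eq_maxid_mult\<close> would leave room for a proper K below I that contains all
  products of \<open>maxid\<close> with I. An ideal J between K and I that is maximal with respect
  to avoiding some x has no ideal strictly between it and I, so J has finite colength as well,
  contradicting minimality.\<close>

theorem local_artinian_finite_length: "tlen reg \<noteq> \<infinity>"
proof -
  interpret cring R by (rule cring_R)
  note X = regular_lm
  define Q where "Q I \<longleftrightarrow> submod reg I \<and> mlen reg I (carrier R) \<noteq> \<infinity>" for I
  have "mlen reg (carrier R) (carrier R) = 0"
    using len_eq_0_iff[OF X, of "carrier R" "carrier R"] submod_carrier[OF X] by simp
  then have "Q (carrier R)" using submod_carrier[OF X] by (simp add: Q_def)
  then obtain I where I: "Q I" and min: "\<And>J. \<lbrakk>Q J; J \<subseteq> I\<rbrakk> \<Longrightarrow> J = I"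
    by (rule ideal_minimal) (auto simp: Q_def)
  have sI: "submod reg I" using I by (simp add: Q_def)
  have Ic: "I \<subseteq> carrier R" using submodD(1)[OF sI] by auto
  have "I = {\<zero>}"
  proof (rule ideal_eq_maxid_mult[OF sI])
    fix K assume K: "submod reg K" "K \<subseteq> I" "\<And>b x. \<lbrakk>b \<in> maxid; x \<in> I\<rbrakk> \<Longrightarrow> b \<otimes> x \<in> K"
    show "K = I"
    proof (rule ccontr)
      assume "K \<noteq> I"
      then obtain x where x: "x \<in> I" "x \<notin> K" using K(2) by auto
      obtain J where J: "submod reg J" "K \<subseteq> J" "J \<subseteq> I" "x \<notin> J"
        "\<And>J'. \<lbrakk>submod reg J'; J \<subset> J'; J' \<subseteq> I\<rbrakk> \<Longrightarrow> x \<in> J'"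
        using maximal_avoiding[OF K(1,2) x(2)] by auto
      have simple: "J' = I" if J': "submod reg J'" "J \<subset> J'" "J' \<subseteq> I" for J'
      proof -
        have xJ': "x \<in> J'" using J(5)[OF J'] .
        have "y \<in> J'" if y: "y \<in> I" for y
        proof (cases "y \<in> J")
          case False
          let ?S = "ssum reg J ((\<lambda>r\<in>carrier R. r \<otimes> y) ` carrier R)"
          have yc: "y \<in> carrier R" using y Ic by auto
          have h: "(\<lambda>c\<in>carrier R. c \<odot>\<^bsub>reg\<^esub> y) \<in> lin_hom R reg reg"
            using right_mult_hom[OF X, of y] yc by simp
          have sY: "submod reg ((\<lambda>r\<in>carrier R. r \<otimes> y) ` carrier R)"
            using submod_image[OF X X h submod_carrier[OF X]] by simp
          have sS: "submod reg ?S" by (rule submod_ssum[OF X J(1) sY])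
          have "y \<in> (\<lambda>r\<in>carrier R. r \<otimes> y) ` carrier R"
            using yc by (auto intro!: image_eqI[of _ _ \<one>])
          then have "J \<subset> ?S" using ssum_upper[OF X J(1) sY] False by auto
          moreover have "?S \<subseteq> I"
            using submodD(4)[OF sI] y by (intro ssum_least[OF J(3) _ sI]) auto
          ultimately have "x \<in> ?S" using J(5)[OF sS] by blast
          then obtain j r where jr: "j \<in> J" "r \<in> carrier R" "x = j \<oplus> r \<otimes> y"
            by (auto simp: ssum_def)
          have jc: "j \<in> carrier R" using jr(1) J(3) Ic by auto
          \<comment> \<open>Otherwise r y would lie in K, hence in J, and so would x. As r is
            invertible, y is a multiple of x modulo J; thus every ideal strictly above J contains
            all of I.\<close>
          have "r \<notin> maxid"
          proof
            assume "r \<in> maxid"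
            then have "r \<otimes> y \<in> J" using K(3) y J(2) by auto
            then show False using submodD(3)[OF J(1) jr(1)] jr(3) J(4) by auto
          qed
          then obtain s where s: "s \<in> carrier R" "s \<otimes> r = \<one>"
            using unit_if_notin_maxid jr(2) by blast
          have "r \<otimes> y = x \<ominus> j"
            using jr jc yc by (simp add: a_minus_def a_assoc a_comm[of j] r_neg)
          moreover have "x \<ominus> j \<in> J'"
            using submod_neg(2)[OF X J'(1) xJ', of j] jr(1) J'(2)
            by (auto simp: a_minus_def a_inv_def m_inv_def regular_module_def)
          ultimately have "s \<otimes> (r \<otimes> y) \<in> J'" using submodD(4)[OF J'(1) s(1)] by simp
          then show ?thesis using s jr yc by (simp flip: m_assoc)
        qed (use J'(2) in auto)
        then show ?thesis using J'(3) by auto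
      qed
      have JI: "J \<subset> I" using J x by auto
      have "n \<le> 1" if "chn (submod reg) J I n" for n
        using that
      proof cases
        case (step V m)
        have "V = I" using simple[OF _ step(3)] chn_dest[OF step(4)] by auto
        then have "m = 0" using step(4) chn_self by blast
        then show ?thesis using step by simp
      qed simp
      then have "mlen reg J I \<le> enat 1" by (intro len_leI) auto
      then have f1: "mlen reg J I \<noteq> \<infinity>" using enat_ile by force
      have "mlen reg J (carrier R) = mlen reg J I + mlen reg I (carrier R)"
        by (rule len_add[OF X J(1) sI]) (use submod_carrier[OF X] J(3) Ic in auto)
      then have "Q J" using f1 I J(1) by (simp add: Q_def plus_eq_infty_iff_enat)
      then show False using min J(3) JI by blast
    qed
  qed
  then show ?thesis using I by (simp add: Q_def)
qed

end

section \<open>Quotients, products and direct sums\<close>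

context mod_base
begin

text \<open>Equational laws pass to the target of a surjection that respects the operations. This
  saves checking the module axioms for quotients by hand.\<close>

lemma lm_surj:
  fixes X :: "('a, 'm, 'y) module_scheme" and Q :: "('a, 'n, 'z) module_scheme"
  assumes X: "lm X" and r: "r ` carrier X = carrier Q"
    and add: "\<And>x y. \<lbrakk>x \<in> carrier X; y \<in> carrier X\<rbrakk> \<Longrightarrow> r (x \<oplus>\<^bsub>X\<^esub> y) = r x \<oplus>\<^bsub>Q\<^esub> r y"
    and sm: "\<And>a x. \<lbrakk>a \<in> carrier A; x \<in> carrier X\<rbrakk> \<Longrightarrow> r (a \<odot>\<^bsub>X\<^esub> x) = a \<odot>\<^bsub>Q\<^esub> r x"
    and z: "r \<zero>\<^bsub>X\<^esub> = \<zero>\<^bsub>Q\<^esub>"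
  shows "lm Q" "restrict r (carrier X) \<in> lin_hom A X Q"
proof -
  interpret A: ring A by (rule ring_A)
  have c: "r x \<in> carrier Q" if "x \<in> carrier X" for x using r that by auto
  have ex: "\<exists>x\<in>carrier X. q = r x" if "q \<in> carrier Q" for q using r that by auto
  show "lm Q"
  proof (rule lmI)
    show "abelian_group Q"
    proof (rule abelian_groupI)
      show "u \<oplus>\<^bsub>Q\<^esub> v \<in> carrier Q" if uv: "u \<in> carrier Q" "v \<in> carrier Q" for u v
      proof -
        obtain x y where "x \<in> carrier X" "y \<in> carrier X" "u = r x" "v = r y" using ex uv by metis
        then show ?thesis using c X by (simp flip: add)
      qed
      show "\<zero>\<^bsub>Q\<^esub> \<in> carrier Q" using c[of "\<zero>\<^bsub>X\<^esub>"] X z by simp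
      show "u \<oplus>\<^bsub>Q\<^esub> v \<oplus>\<^bsub>Q\<^esub> w = u \<oplus>\<^bsub>Q\<^esub> (v \<oplus>\<^bsub>Q\<^esub> w)" if uvw: "u \<in> carrier Q" "v \<in> carrier Q" "w \<in> carrier Q" for u v w
      proof -
        obtain x y t where "x \<in> carrier X" "y \<in> carrier X" "t \<in> carrier X" "u = r x" "v = r y" "w = r t"
          using ex uvw by metis
        then show ?thesis using X lm_ac(2)[OF X] by (simp flip: add)
      qed
      show "u \<oplus>\<^bsub>Q\<^esub> v = v \<oplus>\<^bsub>Q\<^esub> u" if uv: "u \<in> carrier Q" "v \<in> carrier Q" for u v
      proof -
        obtain x y where "x \<in> carrier X" "y \<in> carrier X" "u = r x" "v = r y" using ex uv by metis
        then show ?thesis using lm_ac(1)[OF X, of x y] by (simp flip: add)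
      qed
      show "\<zero>\<^bsub>Q\<^esub> \<oplus>\<^bsub>Q\<^esub> u = u" if u: "u \<in> carrier Q" for u
      proof -
        obtain x where "x \<in> carrier X" "u = r x" using ex u by metis
        then show ?thesis using X add[of "\<zero>\<^bsub>X\<^esub>" x] lm_add(1)[OF X, of x] z by simp
      qed
      show "\<exists>v\<in>carrier Q. v \<oplus>\<^bsub>Q\<^esub> u = \<zero>\<^bsub>Q\<^esub>" if u: "u \<in> carrier Q" for u
      proof -
        obtain x where x: "x \<in> carrier X" "u = r x" using ex u by metis
        then have "r (\<ominus>\<^bsub>X\<^esub> x) \<oplus>\<^bsub>Q\<^esub> u = \<zero>\<^bsub>Q\<^esub>"
          using X add[of "\<ominus>\<^bsub>X\<^esub> x" x] lm_add(5)[OF X, of x] z by simp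
        then show ?thesis using c[of "\<ominus>\<^bsub>X\<^esub> x"] x X by auto
      qed
    qed
    fix a u assume a: "a \<in> carrier A" and u: "u \<in> carrier Q"
    obtain x where x: "x \<in> carrier X" "u = r x" using ex u by metis
    show "a \<odot>\<^bsub>Q\<^esub> u \<in> carrier Q" using x a c X by (simp flip: sm)
    show "(a \<oplus>\<^bsub>A\<^esub> b) \<odot>\<^bsub>Q\<^esub> u = a \<odot>\<^bsub>Q\<^esub> u \<oplus>\<^bsub>Q\<^esub> b \<odot>\<^bsub>Q\<^esub> u" if "b \<in> carrier A" for b
      using x a that X lm_smult(3)[OF X, of x a b] by (simp flip: sm add)
    show "a \<odot>\<^bsub>Q\<^esub> (u \<oplus>\<^bsub>Q\<^esub> v) = a \<odot>\<^bsub>Q\<^esub> u \<oplus>\<^bsub>Q\<^esub> a \<odot>\<^bsub>Q\<^esub> v" if v: "v \<in> carrier Q" for v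
    proof -
      obtain y where "y \<in> carrier X" "v = r y" using ex v by metis
      then show ?thesis using x a X lm_smult(4)[OF X, of x a y] by (simp flip: sm add)
    qed
    show "(a \<otimes>\<^bsub>A\<^esub> b) \<odot>\<^bsub>Q\<^esub> u = a \<odot>\<^bsub>Q\<^esub> (b \<odot>\<^bsub>Q\<^esub> u)" if "b \<in> carrier A" for b
      using x a that X lm_smult(2)[OF X, of x a b] by (simp flip: sm)
  next
    fix u assume u: "u \<in> carrier Q"
    obtain x where x: "x \<in> carrier X" "u = r x" using ex u by metis
    show "\<one>\<^bsub>A\<^esub> \<odot>\<^bsub>Q\<^esub> u = u"
      using x X lm_smult(1)[OF X, of x] by (simp flip: sm)
  qed
  show "restrict r (carrier X) \<in> lin_hom A X Q"
    by (rule lin_homI) (use c add sm X in auto)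
qed

text \<open>The quotient is carried by chosen representatives inside X instead of by cosets. It
  keeps the element type of X, so quotients of objects stay among the modules over the same
  type.\<close>

lemma quotient_lm:
  fixes X :: "('a, 'm) module"
  assumes X: "lm X" and U: "submod X U"
  obtains Q :: "('a, 'm) module" and q where "lm Q" "q \<in> lin_hom A X Q" "q ` carrier X = carrier Q"
    "\<And>x. x \<in> carrier X \<Longrightarrow> q x = \<zero>\<^bsub>Q\<^esub> \<longleftrightarrow> x \<in> U"
proof -
  interpret X: abelian_group X by (rule lm_group[OF X])
  note Ud = submodD[OF U] submod_neg[OF X U]
  define r where "r x = (SOME y. y \<in> carrier X \<and> x \<ominus>\<^bsub>X\<^esub> y \<in> U)" for x
  have r: "r x \<in> carrier X" "x \<ominus>\<^bsub>X\<^esub> r x \<in> U" if "x \<in> carrier X" for x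
    using someI[of "\<lambda>y. y \<in> carrier X \<and> x \<ominus>\<^bsub>X\<^esub> y \<in> U" x] that Ud(2) X
    by (auto simp: r_def lm_add)
  \<comment> \<open>Congruent elements satisfy the same predicate in the definition of r, so the
    choice operator returns the same representative for both.\<close>
  have eq: "r x = r y" if xy: "x \<in> carrier X" "y \<in> carrier X" "x \<ominus>\<^bsub>X\<^esub> y \<in> U" for x y
  proof -
    have "x \<ominus>\<^bsub>X\<^esub> z \<in> U \<longleftrightarrow> y \<ominus>\<^bsub>X\<^esub> z \<in> U" if z: "z \<in> carrier X" for z
    proof -
      have 1: "x \<ominus>\<^bsub>X\<^esub> z = (x \<ominus>\<^bsub>X\<^esub> y) \<oplus>\<^bsub>X\<^esub> (y \<ominus>\<^bsub>X\<^esub> z)"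
        using xy z by (simp add: a_minus_def X.a_assoc X.r_neg1)
      have 2: "y \<ominus>\<^bsub>X\<^esub> z = (x \<ominus>\<^bsub>X\<^esub> z) \<ominus>\<^bsub>X\<^esub> (x \<ominus>\<^bsub>X\<^esub> y)"
        using lm_minus(5)[OF X, of "x \<ominus>\<^bsub>X\<^esub> y" "y \<ominus>\<^bsub>X\<^esub> z"] xy z X unfolding 1 by simp
      show ?thesis using 1 2 Ud(3)[OF xy(3)] Ud(6)[OF _ xy(3)] by metis
    qed
    then have "(\<lambda>z. z \<in> carrier X \<and> x \<ominus>\<^bsub>X\<^esub> z \<in> U) = (\<lambda>z. z \<in> carrier X \<and> y \<ominus>\<^bsub>X\<^esub> z \<in> U)"
      by auto
    then show ?thesis by (simp add: r_def)
  qed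
  define Q :: "('a, 'm) module" where
    "Q = \<lparr>carrier = r ` carrier X, monoid.mult = undefined, one = undefined,
      ring.zero = r \<zero>\<^bsub>X\<^esub>, ring.add = (\<lambda>u v. r (u \<oplus>\<^bsub>X\<^esub> v)), smult = (\<lambda>a u. r (a \<odot>\<^bsub>X\<^esub> u))\<rparr>"
  have add: "r (x \<oplus>\<^bsub>X\<^esub> y) = r (r x \<oplus>\<^bsub>X\<^esub> r y)" if xy: "x \<in> carrier X" "y \<in> carrier X" for x y
  proof (rule eq)
    have "(x \<oplus>\<^bsub>X\<^esub> y) \<ominus>\<^bsub>X\<^esub> (r x \<oplus>\<^bsub>X\<^esub> r y) = (x \<ominus>\<^bsub>X\<^esub> r x) \<oplus>\<^bsub>X\<^esub> (y \<ominus>\<^bsub>X\<^esub> r y)"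
      using xy r(1) by (simp add: a_minus_def X.minus_add X.a_ac)
    then show "(x \<oplus>\<^bsub>X\<^esub> y) \<ominus>\<^bsub>X\<^esub> (r x \<oplus>\<^bsub>X\<^esub> r y) \<in> U"
      using r(2) xy Ud(3) by simp
  qed (use xy r X in auto)
  have sm: "r (a \<odot>\<^bsub>X\<^esub> x) = r (a \<odot>\<^bsub>X\<^esub> r x)" if a: "a \<in> carrier A" "x \<in> carrier X" for a x
  proof (rule eq)
    have "a \<odot>\<^bsub>X\<^esub> x \<ominus>\<^bsub>X\<^esub> a \<odot>\<^bsub>X\<^esub> r x = a \<odot>\<^bsub>X\<^esub> (x \<ominus>\<^bsub>X\<^esub> r x)"
      using lm_smult(9)[OF X] a r(1) by simp
    then show "a \<odot>\<^bsub>X\<^esub> x \<ominus>\<^bsub>X\<^esub> a \<odot>\<^bsub>X\<^esub> r x \<in> U"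
      using r(2) a Ud(4) by simp
  qed (use a r X in auto)
  have rU: "r x = r \<zero>\<^bsub>X\<^esub> \<longleftrightarrow> x \<in> U" if x: "x \<in> carrier X" for x
  proof
    show "r x = r \<zero>\<^bsub>X\<^esub>" if "x \<in> U"
      using eq[of x "\<zero>\<^bsub>X\<^esub>"] x that X by (simp add: lm_add)
    assume e: "r x = r \<zero>\<^bsub>X\<^esub>"
    have 0: "\<zero>\<^bsub>X\<^esub> \<ominus>\<^bsub>X\<^esub> r \<zero>\<^bsub>X\<^esub> \<in> U"
      using r(2)[of "\<zero>\<^bsub>X\<^esub>"] X by simp
    have "x = (x \<ominus>\<^bsub>X\<^esub> r x) \<oplus>\<^bsub>X\<^esub> r \<zero>\<^bsub>X\<^esub>"
      using lm_minus(2)[OF X x, of "r x"] r(1)[OF x] e by simp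
    moreover have "r \<zero>\<^bsub>X\<^esub> = \<ominus>\<^bsub>X\<^esub> (\<zero>\<^bsub>X\<^esub> \<ominus>\<^bsub>X\<^esub> r \<zero>\<^bsub>X\<^esub>)"
      using r(1)[of "\<zero>\<^bsub>X\<^esub>"] X by (simp add: lm_add)
    ultimately show "x \<in> U" using Ud(3)[OF r(2)[OF x] Ud(5)[OF 0]] by simp
  qed
  have *: "lm Q" "restrict r (carrier X) \<in> lin_hom A X Q"
    by (rule lm_surj[OF X, of r Q]; simp add: Q_def; fact add sm)+
  show thesis
    by (rule that[OF *]) (use rU in \<open>auto simp: Q_def\<close>)
qed

definition prod_mod :: "('a, 'm, 'y) module_scheme \<Rightarrow> ('a, 'n, 'z) module_scheme \<Rightarrow> ('a, 'm \<times> 'n) module" where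
  "prod_mod X Y = \<lparr>carrier = carrier X \<times> carrier Y, monoid.mult = undefined, one = undefined,
    ring.zero = (\<zero>\<^bsub>X\<^esub>, \<zero>\<^bsub>Y\<^esub>), ring.add = (\<lambda>u v. (fst u \<oplus>\<^bsub>X\<^esub> fst v, snd u \<oplus>\<^bsub>Y\<^esub> snd v)),
    smult = (\<lambda>a u. (a \<odot>\<^bsub>X\<^esub> fst u, a \<odot>\<^bsub>Y\<^esub> snd u))\<rparr>"

lemma prod_lm:
  assumes X: "lm X" and Y: "lm Y"
  shows "lm (prod_mod X Y)"
proof -
  interpret X: abelian_group X by (rule lm_group[OF X])
  interpret Y: abelian_group Y by (rule lm_group[OF Y])
  show ?thesis
  proof (rule lmI)
    show "abelian_group (prod_mod X Y)"
    proof (rule abelian_groupI)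
      show "\<exists>v\<in>carrier (prod_mod X Y). v \<oplus>\<^bsub>prod_mod X Y\<^esub> u = \<zero>\<^bsub>prod_mod X Y\<^esub>"
        if "u \<in> carrier (prod_mod X Y)" for u
        using that by (auto simp: prod_mod_def X.l_neg Y.l_neg intro!: bexI[of _ "(\<ominus>\<^bsub>X\<^esub> fst u, \<ominus>\<^bsub>Y\<^esub> snd u)"])
    qed (auto simp: prod_mod_def X.a_ac Y.a_ac)
  qed (use X Y in \<open>auto simp: prod_mod_def lm_smult\<close>)
qed

lemma prod_homs:
  assumes X: "lm X" and Y: "lm Y"
  shows "(\<lambda>x\<in>carrier X. (x, \<zero>\<^bsub>Y\<^esub>)) \<in> lin_hom A X (prod_mod X Y)"
    "(\<lambda>y\<in>carrier Y. (\<zero>\<^bsub>X\<^esub>, y)) \<in> lin_hom A Y (prod_mod X Y)"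
    "(\<lambda>u\<in>carrier X \<times> carrier Y. fst u) \<in> lin_hom A (prod_mod X Y) X"
    "(\<lambda>u\<in>carrier X \<times> carrier Y. snd u) \<in> lin_hom A (prod_mod X Y) Y"
proof -
  have s: "a \<in> carrier A \<Longrightarrow> a \<odot>\<^bsub>X\<^esub> \<zero>\<^bsub>X\<^esub> = \<zero>\<^bsub>X\<^esub>" "a \<in> carrier A \<Longrightarrow> a \<odot>\<^bsub>Y\<^esub> \<zero>\<^bsub>Y\<^esub> = \<zero>\<^bsub>Y\<^esub>" for a
    using lm_smult(6)[OF X, of "\<zero>\<^bsub>X\<^esub>" a] lm_smult(6)[OF Y, of "\<zero>\<^bsub>Y\<^esub>" a] X Y by auto
  have c: "carrier (prod_mod X Y) = carrier X \<times> carrier Y" by (simp add: prod_mod_def)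
  show "(\<lambda>x\<in>carrier X. (x, \<zero>\<^bsub>Y\<^esub>)) \<in> lin_hom A X (prod_mod X Y)"
    "(\<lambda>y\<in>carrier Y. (\<zero>\<^bsub>X\<^esub>, y)) \<in> lin_hom A Y (prod_mod X Y)"
    by (rule lin_homI; use X Y s in \<open>auto simp: prod_mod_def\<close>)+
  show "(\<lambda>u\<in>carrier X \<times> carrier Y. fst u) \<in> lin_hom A (prod_mod X Y) X"
    "(\<lambda>u\<in>carrier X \<times> carrier Y. snd u) \<in> lin_hom A (prod_mod X Y) Y"
    unfolding c[symmetric] by (rule lin_homI; use X Y s prod_lm[OF X Y] in \<open>auto simp: prod_mod_def\<close>)+
qed

text \<open>A biproduct with its four maps as explicit data and with equations between elements.
  \<open>direct_sum_pair\<close> identifies it with \<open>direct_sum\<close> for two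
  summands.\<close>

definition bip where
  "bip X A1 A2 i1 i2 p1 p2 \<longleftrightarrow>
    i1 \<in> lin_hom A A1 X \<and> i2 \<in> lin_hom A A2 X \<and> p1 \<in> lin_hom A X A1 \<and> p2 \<in> lin_hom A X A2 \<and>
    (\<forall>a\<in>carrier A1. p1 (i1 a) = a \<and> p2 (i1 a) = \<zero>\<^bsub>A2\<^esub>) \<and>
    (\<forall>b\<in>carrier A2. p2 (i2 b) = b \<and> p1 (i2 b) = \<zero>\<^bsub>A1\<^esub>) \<and>
    (\<forall>x\<in>carrier X. x = i1 (p1 x) \<oplus>\<^bsub>X\<^esub> i2 (p2 x))"

lemma bipD:
  assumes "bip X A1 A2 i1 i2 p1 p2"
  shows "i1 \<in> lin_hom A A1 X" "i2 \<in> lin_hom A A2 X" "p1 \<in> lin_hom A X A1" "p2 \<in> lin_hom A X A2"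
    "a \<in> carrier A1 \<Longrightarrow> p1 (i1 a) = a" "a \<in> carrier A1 \<Longrightarrow> p2 (i1 a) = \<zero>\<^bsub>A2\<^esub>"
    "b \<in> carrier A2 \<Longrightarrow> p2 (i2 b) = b" "b \<in> carrier A2 \<Longrightarrow> p1 (i2 b) = \<zero>\<^bsub>A1\<^esub>"
    "x \<in> carrier X \<Longrightarrow> i1 (p1 x) \<oplus>\<^bsub>X\<^esub> i2 (p2 x) = x"
  using assms unfolding bip_def by simp_all

lemma bip_sym:
  assumes "lm X" "bip X A1 A2 i1 i2 p1 p2"
  shows "bip X A2 A1 i2 i1 p2 p1"
proof -
  note b = bipD[OF assms(2)]
  have "x = i2 (p2 x) \<oplus>\<^bsub>X\<^esub> i1 (p1 x)" if x: "x \<in> carrier X" for x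
    using b(9)[OF x] lm_ac(1)[OF assms(1)] hom_closed[OF b(1)] hom_closed[OF b(2)]
      hom_closed[OF b(3) x] hom_closed[OF b(4) x] by metis
  then show ?thesis using b unfolding bip_def by simp
qed

lemma hom_finsum:
  assumes X: "lm X" and Y: "lm Y" and f: "f \<in> lin_hom A X Y" and I: "finite I" "g \<in> I \<rightarrow> carrier X"
  shows "f (\<Oplus>\<^bsub>X\<^esub>i\<in>I. g i) = (\<Oplus>\<^bsub>Y\<^esub>i\<in>I. f (g i))"
  using I
proof (induction I)
  interpret X: abelian_group X by (rule lm_group[OF X])
  interpret Y: abelian_group Y by (rule lm_group[OF Y])
  case empty
  then show ?case using hom_simps(4)[OF f X Y] by simp
next
  interpret X: abelian_group X by (rule lm_group[OF X])
  interpret Y: abelian_group Y by (rule lm_group[OF Y])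
  case (insert i I)
  then have g: "g \<in> I \<rightarrow> carrier X" "g i \<in> carrier X" by auto
  have fg: "(\<lambda>i. f (g i)) \<in> I \<rightarrow> carrier Y" "f (g i) \<in> carrier Y"
    using g hom_simps(1)[OF f X Y] by auto
  show ?case
    using insert.hyps insert.IH g fg hom_simps(2)[OF f X Y, of "g i" "\<Oplus>\<^bsub>X\<^esub>i\<in>I. g i"]
    by simp
qed

lemma finsum_lessThan_Suc:
  assumes X: "lm X" and g: "\<And>i. i < Suc n \<Longrightarrow> g i \<in> carrier X"
  shows "(\<Oplus>\<^bsub>X\<^esub>i\<in>{..<Suc n}. g i) = g 0 \<oplus>\<^bsub>X\<^esub> (\<Oplus>\<^bsub>X\<^esub>i\<in>{..<n}. g (Suc i))"
proof -
  interpret X: abelian_group X by (rule lm_group[OF X])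
  have "(\<Oplus>\<^bsub>X\<^esub>i\<in>Suc ` {..<n}. g i) = (\<Oplus>\<^bsub>X\<^esub>i\<in>{..<n}. g (Suc i))"
    by (rule X.finsum_reindex) (use g in auto)
  moreover have "(\<Oplus>\<^bsub>X\<^esub>i\<in>insert 0 (Suc ` {..<n}). g i) = g 0 \<oplus>\<^bsub>X\<^esub> (\<Oplus>\<^bsub>X\<^esub>i\<in>Suc ` {..<n}. g i)"
    by (rule X.finsum_insert) (use g in auto)
  ultimately show ?thesis by (simp add: lessThan_Suc_eq_insert_0)
qed

text \<open>\<open>direct_sum\<close> with explicit maps, and with equations between elements in
  place of equations between composites.\<close>

definition dsum where
  "dsum X Xs \<iota> \<pi> \<longleftrightarrow>
      (\<forall>i < length Xs. \<iota> i \<in> lin_hom A (Xs ! i) X \<and> \<pi> i \<in> lin_hom A X (Xs ! i)) \<and>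
      (\<forall>i < length Xs. \<forall>j < length Xs. \<forall>x\<in>carrier (Xs ! j).
        \<pi> i (\<iota> j x) = (if i = j then x else \<zero>\<^bsub>Xs ! i\<^esub>)) \<and>
      (\<forall>x \<in> carrier X. x = (\<Oplus>\<^bsub>X\<^esub>i\<in>{..<length Xs}. \<iota> i (\<pi> i x)))"

lemma direct_sum_iff:
  fixes X :: "('a, 'm) module"
  assumes X: "lm X" and Xs: "\<And>Y. Y \<in> set Xs \<Longrightarrow> lm Y"
  shows "direct_sum A X Xs \<longleftrightarrow> (\<exists>\<iota> \<pi>. dsum X Xs \<iota> \<pi>)"
proof -
  have "compose (carrier (Xs ! j)) (\<pi> i) (\<iota> j) =
          (if i = j then hom_id (Xs ! i) else hom_zero (Xs ! j) (Xs ! i)) \<longleftrightarrow>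
        (\<forall>x\<in>carrier (Xs ! j). \<pi> i (\<iota> j x) = (if i = j then x else \<zero>\<^bsub>Xs ! i\<^esub>))"
    if ij: "i < length Xs" "j < length Xs"
      and h: "\<forall>i < length Xs. \<iota> i \<in> lin_hom A (Xs ! i) X \<and> \<pi> i \<in> lin_hom A X (Xs ! i)" for i j \<iota> \<pi>
  proof -
    have l: "lm (Xs ! i)" "lm (Xs ! j)" using Xs ij by auto
    have 1: "compose (carrier (Xs ! j)) (\<pi> i) (\<iota> j) \<in> lin_hom A (Xs ! j) (Xs ! i)"
      using h ij l by (intro compose_hom) auto
    have 2: "(if i = j then hom_id (Xs ! i) else hom_zero (Xs ! j) (Xs ! i)) \<in> lin_hom A (Xs ! j) (Xs ! i)"
      using id_hom zero_hom l by auto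
    have "compose (carrier (Xs ! j)) (\<pi> i) (\<iota> j) =
          (if i = j then hom_id (Xs ! i) else hom_zero (Xs ! j) (Xs ! i)) \<longleftrightarrow>
        (\<forall>x\<in>carrier (Xs ! j). compose (carrier (Xs ! j)) (\<pi> i) (\<iota> j) x = (if i = j then hom_id (Xs ! i) else hom_zero (Xs ! j) (Xs ! i)) x)"
      by (rule iffI; use lin_hom_eqI[OF 1 2] in \<open>simp del: hom_apply compose_apply\<close>)
    also have "\<dots> \<longleftrightarrow> (\<forall>x\<in>carrier (Xs ! j). \<pi> i (\<iota> j x) = (if i = j then x else \<zero>\<^bsub>Xs ! i\<^esub>))"
      by (intro ball_cong refl) auto
    finally show ?thesis .
  qed
  then show ?thesis
    unfolding direct_sum_def dsum_def by (intro ex_cong1 conj_cong refl) blast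
qed

lemma direct_sum_Nil:
  fixes X :: "('a, 'm) module"
  assumes X: "lm X"
  shows "direct_sum A X [] \<longleftrightarrow> carrier X = {\<zero>\<^bsub>X\<^esub>}"
proof -
  interpret X: abelian_group X by (rule lm_group[OF X])
  show ?thesis unfolding direct_sum_def using X by auto
qed

lemma finsum_sub:
  assumes X: "lm X" and U: "submod X U" and g: "finite I" "g \<in> I \<rightarrow> U"
  shows "(\<Oplus>\<^bsub>X\<lparr>carrier := U\<rparr>\<^esub>i\<in>I. g i) = (\<Oplus>\<^bsub>X\<^esub>i\<in>I. g i)"
proof -
  have l: "lm (X\<lparr>carrier := U\<rparr>)" by (rule lm_sub[OF X U])
  interpret X: abelian_group X by (rule lm_group[OF X])
  interpret U: abelian_group "X\<lparr>carrier := U\<rparr>" by (rule lm_group[OF l])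
  have g1: "g \<in> I \<rightarrow> carrier X" "g \<in> I \<rightarrow> carrier (X\<lparr>carrier := U\<rparr>)"
    using g(2) submodD(1)[OF U] by auto
  have f: "(\<lambda>x\<in>U. x) \<in> lin_hom A (X\<lparr>carrier := U\<rparr>) X" by (rule incl_hom[OF X U])
  have "(\<Oplus>\<^bsub>X\<lparr>carrier := U\<rparr>\<^esub>i\<in>I. g i) \<in> U"
    using U.finsum_closed[OF g1(2)] by simp
  then have "(\<Oplus>\<^bsub>X\<lparr>carrier := U\<rparr>\<^esub>i\<in>I. g i) = (\<Oplus>\<^bsub>X\<^esub>i\<in>I. (\<lambda>x\<in>U. x) (g i))"
    using hom_finsum[OF l X f g(1) g1(2)] by simp
  also have "\<dots> = (\<Oplus>\<^bsub>X\<^esub>i\<in>I. g i)"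
    by (rule X.finsum_cong') (use g g1 in auto)
  finally show ?thesis .
qed

text \<open>The complement of the first summand is taken to be the kernel of its projection. The
  remaining summands decompose this submodule, which has the element type of X, and this makes
  induction on the list possible.\<close>

lemma direct_sum_ConsD:
  fixes X :: "('a, 'm) module"
  assumes X: "lm X" and Y: "lm Y" and Ys: "\<And>Z. Z \<in> set Ys \<Longrightarrow> lm Z" and ds: "direct_sum A X (Y # Ys)"
  obtains U i1 i2 p1 p2 where "submod X U" "bip X Y (X\<lparr>carrier := U\<rparr>) i1 i2 p1 p2"
    "direct_sum A (X\<lparr>carrier := U\<rparr>) Ys"
proof -
  let ?n = "length Ys"
  obtain \<iota> \<pi> where d: "dsum X (Y # Ys) \<iota> \<pi>"
    using direct_sum_iff[OF X, of "Y # Ys"] Y Ys ds by auto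
  have h0: "\<iota> 0 \<in> lin_hom A Y X" "\<pi> 0 \<in> lin_hom A X Y"
    using d unfolding dsum_def by (metis length_Cons nth_Cons_0 zero_less_Suc)+
  have hS: "\<iota> (Suc i) \<in> lin_hom A (Ys ! i) X" "\<pi> (Suc i) \<in> lin_hom A X (Ys ! i)" if "i < ?n" for i
    using d that unfolding dsum_def by (metis Suc_mono length_Cons nth_Cons_Suc)+
  have e: "\<forall>i < length (Y # Ys). \<forall>j < length (Y # Ys). \<forall>x\<in>carrier ((Y # Ys) ! j).
        \<pi> i (\<iota> j x) = (if i = j then x else \<zero>\<^bsub>(Y # Ys) ! i\<^esub>)"
    using d unfolding dsum_def by blast
  have e00: "\<pi> 0 (\<iota> 0 x) = x" if "x \<in> carrier Y" for x
    using e[rule_format, of 0 0 x] that by simp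
  have e0S: "\<pi> 0 (\<iota> (Suc j) x) = \<zero>\<^bsub>Y\<^esub>" if "j < ?n" "x \<in> carrier (Ys ! j)" for j x
    using e[rule_format, of 0 "Suc j" x] that by simp
  have eSS: "\<pi> (Suc i) (\<iota> (Suc j) x) = (if i = j then x else \<zero>\<^bsub>Ys ! i\<^esub>)"
    if "i < ?n" "j < ?n" "x \<in> carrier (Ys ! j)" for i j x
    using e[rule_format, of "Suc i" "Suc j" x] that by simp
  have lYs: "lm (Ys ! i)" if "i < ?n" for i using Ys that by auto
  note s0 = hom_simps[OF h0(1) Y X] hom_simps[OF h0(2) X Y]
  note cS = hom_closed[OF hS(1)] hom_closed[OF hS(2)]
  have xs: "x = \<iota> 0 (\<pi> 0 x) \<oplus>\<^bsub>X\<^esub> (\<Oplus>\<^bsub>X\<^esub>i\<in>{..<?n}. \<iota> (Suc i) (\<pi> (Suc i) x))" if x: "x \<in> carrier X" for x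
  proof -
    have "x = (\<Oplus>\<^bsub>X\<^esub>i\<in>{..<Suc ?n}. \<iota> i (\<pi> i x))"
      using d x unfolding dsum_def by simp
    also have "\<dots> = \<iota> 0 (\<pi> 0 x) \<oplus>\<^bsub>X\<^esub> (\<Oplus>\<^bsub>X\<^esub>i\<in>{..<?n}. \<iota> (Suc i) (\<pi> (Suc i) x))"
    proof (rule finsum_lessThan_Suc[OF X])
      show "\<iota> i (\<pi> i x) \<in> carrier X" if "i < Suc ?n" for i
        using that s0 cS x by (cases i) auto
    qed
    finally show ?thesis .
  qed
  define U where "U = {x \<in> carrier X. \<pi> 0 x = \<zero>\<^bsub>Y\<^esub>}"
  have U: "submod X U" unfolding U_def by (rule ker_submod[OF X Y h0(2)])
  let ?B = "X\<lparr>carrier := U\<rparr>"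
  have lB: "lm ?B" by (rule lm_sub[OF X U])
  let ?p = "\<lambda>x\<in>carrier X. x \<ominus>\<^bsub>X\<^esub> \<iota> 0 (\<pi> 0 x)"
  interpret Xg: abelian_group X by (rule lm_group[OF X])
  have "?p \<in> lin_hom A X X"
    by (rule lin_homI) (use X s0 in \<open>auto simp: a_minus_def lm_smult Xg.minus_add Xg.a_ac\<close>)
  then have p: "?p \<in> lin_hom A X ?B"
    by (rule corestrict_hom) (use X Y s0 e00 in \<open>auto simp: U_def lm_add\<close>)
  have i: "(\<lambda>x\<in>U. x) \<in> lin_hom A ?B X" by (rule incl_hom[OF X U])
  have b: "bip X Y ?B (\<iota> 0) (\<lambda>x\<in>U. x) (\<pi> 0) ?p"
    unfolding bip_def
  proof (intro conjI ballI)
    show "?p (\<iota> 0 a) = \<zero>\<^bsub>?B\<^esub>" if "a \<in> carrier Y" for a using that s0 e00 X by (simp add: lm_add)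
    show "?p ((\<lambda>x\<in>U. x) b) = b" "\<pi> 0 ((\<lambda>x\<in>U. x) b) = \<zero>\<^bsub>Y\<^esub>" if "b \<in> carrier ?B" for b
      using that s0(4) X by (auto simp: U_def lm_add)
    show "x = \<iota> 0 (\<pi> 0 x) \<oplus>\<^bsub>X\<^esub> (\<lambda>x\<in>U. x) (?p x)" if "x \<in> carrier X" for x
      using that s0 hom_closed[OF p that] lm_minus(3)[OF X that, of "\<iota> 0 (\<pi> 0 x)"] by simp
  qed (use h0 i p e00 in auto)
  have inU: "\<iota> (Suc i) x \<in> U" if "i < ?n" "x \<in> carrier (Ys ! i)" for i x
    using that cS(1) e0S by (auto simp: U_def)
  have "dsum ?B Ys (\<lambda>i. \<iota> (Suc i)) (\<lambda>i. restrict (\<pi> (Suc i)) U)"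
    unfolding dsum_def
  proof (intro conjI allI impI ballI)
    show "\<iota> (Suc i) \<in> lin_hom A (Ys ! i) ?B" if "i < ?n" for i
      using corestrict_hom[OF hS(1)[OF that]] inU that by simp
    show "restrict (\<pi> (Suc i)) U \<in> lin_hom A ?B (Ys ! i)" if "i < ?n" for i
      by (rule restrict_hom[OF X lYs[OF that] hS(2)[OF that] U])
    show "restrict (\<pi> (Suc i)) U (\<iota> (Suc j) x) = (if i = j then x else \<zero>\<^bsub>Ys ! i\<^esub>)"
      if "i < ?n" "j < ?n" "x \<in> carrier (Ys ! j)" for i j x
      using eSS[OF that] inU[OF that(2,3)] by simp
    show "x = (\<Oplus>\<^bsub>?B\<^esub>i\<in>{..<?n}. \<iota> (Suc i) (restrict (\<pi> (Suc i)) U x))" if x: "x \<in> carrier ?B" for x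
    proof -
      have xU: "x \<in> U" "x \<in> carrier X" "\<pi> 0 x = \<zero>\<^bsub>Y\<^esub>"
        using x by (auto simp: U_def)
      have g: "(\<lambda>i. \<iota> (Suc i) (\<pi> (Suc i) x)) \<in> {..<?n} \<rightarrow> U"
        using inU cS(2) xU by auto
      have "(\<Oplus>\<^bsub>?B\<^esub>i\<in>{..<?n}. \<iota> (Suc i) (restrict (\<pi> (Suc i)) U x)) = (\<Oplus>\<^bsub>?B\<^esub>i\<in>{..<?n}. \<iota> (Suc i) (\<pi> (Suc i) x))"
        using xU by simp
      also have "\<dots> = (\<Oplus>\<^bsub>X\<^esub>i\<in>{..<?n}. \<iota> (Suc i) (\<pi> (Suc i) x))"
        by (rule finsum_sub[OF X U _ g]) simp
      also have "\<dots> = x"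
        using xs[OF xU(2)] xU(3) s0(4) lm_add(1)[OF X]
          Xg.finsum_closed[of "\<lambda>i. \<iota> (Suc i) (\<pi> (Suc i) x)" "{..<?n}"] g submodD(1)[OF U]
        by (auto simp: Pi_iff)
      finally show ?thesis by simp
    qed
  qed
  then have "direct_sum A ?B Ys" using direct_sum_iff[OF lB Ys] by blast
  then show thesis using that[OF U b] by blast
qed

lemma direct_sum_ConsI:
  fixes X :: "('a, 'm) module"
  assumes X: "lm X" and Y: "lm Y" and B: "lm B" and Ys: "\<And>Z. Z \<in> set Ys \<Longrightarrow> lm Z"
    and b: "bip X Y B i1 i2 p1 p2" and ds: "direct_sum A B Ys"
  shows "direct_sum A X (Y # Ys)"
proof -
  let ?n = "length Ys"
  note bD = bipD[OF b]
  obtain \<iota> \<pi> where d: "dsum B Ys \<iota> \<pi>"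
    using direct_sum_iff[OF B, of Ys] Ys ds by auto
  have h: "\<iota> i \<in> lin_hom A (Ys ! i) B" "\<pi> i \<in> lin_hom A B (Ys ! i)" if "i < ?n" for i
    using d that unfolding dsum_def by blast+
  have e: "\<pi> i (\<iota> j x) = (if i = j then x else \<zero>\<^bsub>Ys ! i\<^esub>)"
    if "i < ?n" "j < ?n" "x \<in> carrier (Ys ! j)" for i j x
    using d that unfolding dsum_def by simp
  have s: "x = (\<Oplus>\<^bsub>B\<^esub>i\<in>{..<?n}. \<iota> i (\<pi> i x))" if "x \<in> carrier B" for x
    using d that unfolding dsum_def by simp
  have lYs: "lm (Ys ! i)" if "i < ?n" for i using Ys that by auto
  note s1 = hom_simps[OF bD(1) Y X] and s2 = hom_simps[OF bD(2) B X] and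
    t1 = hom_simps[OF bD(3) X Y] and t2 = hom_simps[OF bD(4) X B]
  define \<iota>' where "\<iota>' i = (case i of 0 \<Rightarrow> i1 | Suc j \<Rightarrow> compose (carrier (Ys ! j)) i2 (\<iota> j))" for i
  define \<pi>' where "\<pi>' i = (case i of 0 \<Rightarrow> p1 | Suc j \<Rightarrow> compose (carrier X) (\<pi> j) p2)" for i
  have "dsum X (Y # Ys) \<iota>' \<pi>'"
    unfolding dsum_def
  proof (intro conjI allI impI ballI)
    fix i assume i: "i < length (Y # Ys)"
    show "\<iota>' i \<in> lin_hom A ((Y # Ys) ! i) X" "\<pi>' i \<in> lin_hom A X ((Y # Ys) ! i)"
      using i bD(1,3) compose_hom[OF h(1) bD(2) lYs] compose_hom[OF bD(4) h(2) X]
      by (cases i; simp add: \<iota>'_def \<pi>'_def)+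
    show "\<pi>' i (\<iota>' j x) = (if i = j then x else \<zero>\<^bsub>(Y # Ys) ! i\<^esub>)"
      if j: "j < length (Y # Ys)" "x \<in> carrier ((Y # Ys) ! j)" for j x
    proof (cases i)
      case 0
      then show ?thesis using j bD(5,8) hom_closed[OF h(1)]
        by (cases j) (auto simp: \<iota>'_def \<pi>'_def)
    next
      case (Suc i')
      then show ?thesis using i j bD(6,7) s1(1) s2(1) e hom_closed[OF h(1)] hom_simps(4)[OF h(2) B lYs]
        by (cases j) (auto simp: \<iota>'_def \<pi>'_def)
    qed
  next
    fix x assume x: "x \<in> carrier X"
    have c: "\<iota> i (\<pi> i (p2 x)) \<in> carrier B" if "i < ?n" for i
      using hom_closed[OF h(1)[OF that]] hom_closed[OF h(2)[OF that]] t2(1)[OF x] by blast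
    have e': "\<iota>' (Suc i) (\<pi>' (Suc i) x) = i2 (\<iota> i (\<pi> i (p2 x)))" if "i < ?n" for i
      using x hom_closed[OF h(2)[OF that] t2(1)[OF x]] by (simp add: \<iota>'_def \<pi>'_def)
    interpret Xg: abelian_group X by (rule lm_group[OF X])
    have "(\<Oplus>\<^bsub>X\<^esub>i\<in>{..<Suc ?n}. \<iota>' i (\<pi>' i x)) = \<iota>' 0 (\<pi>' 0 x) \<oplus>\<^bsub>X\<^esub> (\<Oplus>\<^bsub>X\<^esub>i\<in>{..<?n}. \<iota>' (Suc i) (\<pi>' (Suc i) x))"
    proof (rule finsum_lessThan_Suc[OF X])
      show "\<iota>' i (\<pi>' i x) \<in> carrier X" if "i < Suc ?n" for i
        using that e' c s2(1) s1(1) t1(1) x by (cases i) (simp_all add: \<iota>'_def \<pi>'_def)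
    qed
    also have "(\<Oplus>\<^bsub>X\<^esub>i\<in>{..<?n}. \<iota>' (Suc i) (\<pi>' (Suc i) x)) = (\<Oplus>\<^bsub>X\<^esub>i\<in>{..<?n}. i2 (\<iota> i (\<pi> i (p2 x))))"
      by (rule Xg.finsum_cong') (use e' c s2(1) in auto)
    also have "\<dots> = i2 (\<Oplus>\<^bsub>B\<^esub>i\<in>{..<?n}. \<iota> i (\<pi> i (p2 x)))"
      by (rule hom_finsum[OF B X bD(2), symmetric]) (use c in auto)
    also have "(\<Oplus>\<^bsub>B\<^esub>i\<in>{..<?n}. \<iota> i (\<pi> i (p2 x))) = p2 x"
      using s[OF t2(1)[OF x]] by simp
    also have "\<iota>' 0 (\<pi>' 0 x) = i1 (p1 x)" by (simp add: \<iota>'_def \<pi>'_def)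
    finally show "x = (\<Oplus>\<^bsub>X\<^esub>i\<in>{..<length (Y # Ys)}. \<iota>' i (\<pi>' i x))"
      using bD(9)[OF x] by simp
  qed
  then show ?thesis using direct_sum_iff[OF X, of "Y # Ys"] Y Ys by auto
qed

text \<open>An isomorphism is read as a biproduct with zero complement. Invariance under isomorphism
  then becomes a special case of additivity on biproducts, as in \<open>colen_iso\<close> and
  \<open>K0_iso\<close>.\<close>

lemma bip_zero:
  fixes X :: "('a, 'm) module"
  assumes X: "lm X" and Y: "lm Y" and Z: "lm Z" and z: "carrier Z = {\<zero>\<^bsub>Z\<^esub>}" and f: "f \<in> lin_iso A X Y"
  obtains i1 i2 p1 p2 where "bip X Y Z i1 i2 p1 p2"
proof -
  obtain g where g: "g \<in> lin_iso A Y X" "\<And>x. x \<in> carrier X \<Longrightarrow> g (f x) = x"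
    "\<And>y. y \<in> carrier Y \<Longrightarrow> f (g y) = y" using lin_iso_inv[OF X Y f] by blast
  have h: "f \<in> lin_hom A X Y" "g \<in> lin_hom A Y X" using f g(1) by (auto simp: lin_iso_def)
  have "bip X Y Z g (hom_zero Z X) f (hom_zero X Z)"
    unfolding bip_def
  proof (intro conjI ballI)
    show "hom_zero X Z (g a) = \<zero>\<^bsub>Z\<^esub>" if "a \<in> carrier Y" for a
      using hom_closed[OF h(2) that] by simp
    show "hom_zero X Z (hom_zero Z X b) = b" "f (hom_zero Z X b) = \<zero>\<^bsub>Y\<^esub>" if b: "b \<in> carrier Z" for b
      using b z X hom_simps(4)[OF h(1) X Y] by simp_all
    show "x = g (f x) \<oplus>\<^bsub>X\<^esub> hom_zero Z X (hom_zero X Z x)" if "x \<in> carrier X" for x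
      using that g(2) Z lm_add(2)[OF X that] by simp
  qed (use h g zero_hom[OF X Z] zero_hom[OF Z X] in auto)
  then show thesis by (rule that)
qed

lemma direct_sum_pair:
  fixes X :: "('a, 'm) module"
  assumes X: "lm X" and Y: "lm Y" and Z: "lm Z"
  shows "direct_sum A X [Y, Z] \<longleftrightarrow> (\<exists>i1 i2 p1 p2. bip X Y Z i1 i2 p1 p2)"
proof
  assume "direct_sum A X [Y, Z]"
  then obtain \<iota> \<pi> where d: "dsum X [Y, Z] \<iota> \<pi>"
    using direct_sum_iff[OF X, of "[Y, Z]"] Y Z by auto
  have h: "\<forall>i < length [Y, Z]. \<iota> i \<in> lin_hom A ([Y, Z] ! i) X \<and> \<pi> i \<in> lin_hom A X ([Y, Z] ! i)"
    and e: "\<forall>i < length [Y, Z]. \<forall>j < length [Y, Z]. \<forall>x\<in>carrier ([Y, Z] ! j).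
        \<pi> i (\<iota> j x) = (if i = j then x else \<zero>\<^bsub>[Y, Z] ! i\<^esub>)"
    and s: "\<forall>x \<in> carrier X. x = (\<Oplus>\<^bsub>X\<^esub>i\<in>{..<length [Y, Z]}. \<iota> i (\<pi> i x))"
    using d unfolding dsum_def by blast+
  have hh: "\<iota> 0 \<in> lin_hom A Y X" "\<pi> 0 \<in> lin_hom A X Y" "\<iota> 1 \<in> lin_hom A Z X" "\<pi> 1 \<in> lin_hom A X Z"
    using h[rule_format, of 0] h[rule_format, of 1] by simp_all
  interpret Xg: abelian_group X by (rule lm_group[OF X])
  have "x = \<iota> 0 (\<pi> 0 x) \<oplus>\<^bsub>X\<^esub> \<iota> 1 (\<pi> 1 x)" if x: "x \<in> carrier X" for x
  proof -
    have c: "\<iota> 0 (\<pi> 0 x) \<in> carrier X" "\<iota> 1 (\<pi> 1 x) \<in> carrier X"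
      using hom_closed[OF hh(1)] hom_closed[OF hh(2)] hom_closed[OF hh(3)] hom_closed[OF hh(4)] x by blast+
    have "{..<length [Y, Z]} = {0, 1}" by auto
    then have "x = (\<Oplus>\<^bsub>X\<^esub>i\<in>{0, 1}. \<iota> i (\<pi> i x))" using s x by simp
    also have "\<dots> = \<iota> 0 (\<pi> 0 x) \<oplus>\<^bsub>X\<^esub> \<iota> 1 (\<pi> 1 x)"
      using c by simp
    finally show ?thesis .
  qed
  then have "bip X Y Z (\<iota> 0) (\<iota> 1) (\<pi> 0) (\<pi> 1)"
    unfolding bip_def
    using hh e[rule_format, of 0 0] e[rule_format, of 0 1] e[rule_format, of 1 0] e[rule_format, of 1 1] by simp
  then show "\<exists>i1 i2 p1 p2. bip X Y Z i1 i2 p1 p2" by blast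
next
  assume "\<exists>i1 i2 p1 p2. bip X Y Z i1 i2 p1 p2"
  then obtain i1 i2 p1 p2 where b: "bip X Y Z i1 i2 p1 p2" by blast
  let ?O = "Z\<lparr>carrier := {\<zero>\<^bsub>Z\<^esub>}\<rparr>"
  have O: "lm ?O" using lm_sub[OF Z submod_zero[OF Z]] .
  have "id_iso": "hom_id Z \<in> lin_iso A Z Z"
    using id_hom[OF Z] by (auto simp: lin_iso_def bij_betw_def inj_on_def)
  obtain i1' i2' p1' p2' where "bip Z Z ?O i1' i2' p1' p2'"
    by (rule bip_zero[OF Z Z O _ id_iso]) simp
  then have "direct_sum A Z [Z]"
    using direct_sum_ConsI[OF Z Z O, of "[]"] direct_sum_Nil[OF O] by simp
  then show "direct_sum A X [Y, Z]"
    using direct_sum_ConsI[OF X Y Z _ b, of "[Z]"] Z by simp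
qed

end

section \<open>Modules over an artin algebra\<close>

locale artin_setup =
  fixes R :: "'r ring" and \<Lambda> :: "('r, 'a) module"
  assumes art: "artin_algebra R \<Lambda>"

text \<open>The module theory is instantiated twice: without prefix over \<open>\<Lambda>\<close>,
  and with prefix \<open>R\<close> over the base ring, where the Hom-sets live.\<close>

sublocale artin_setup \<subseteq> mod_base \<Lambda>
  by (rule mod_base.intro) (rule artin_algebra.axioms(2)[OF art])

sublocale artin_setup \<subseteq> R: local_artinian R
proof (rule local_artinian.intro)
  interpret artin_algebra R \<Lambda> by (rule art)
  show "cring R" by (rule R.is_cring)
  show "artinian R" "local_ring R" by (rule base_artinian, rule base_local)
qed

context artin_setup
begin

abbreviation Mo :: "('a, 'm) module set" where "Mo \<equiv> fg_modules \<Lambda>"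

abbreviation Hom :: "('a, 'm, 'y) module_scheme \<Rightarrow> ('a, 'n, 'z) module_scheme \<Rightarrow> ('m \<Rightarrow> 'n) set" where
  "Hom \<equiv> lin_hom \<Lambda>"

text \<open>The structure map from R to the algebra. Its image is central by
  \<open>scal_comm\<close>, which is what makes Hom-sets into modules over R.\<close>

definition scal :: "'r \<Rightarrow> 'a" where
  "scal r = r \<odot>\<^bsub>\<Lambda>\<^esub> \<one>\<^bsub>\<Lambda>\<^esub>"

lemma Lambda_R: "R.lm \<Lambda>"
proof -
  interpret module R \<Lambda> by (rule artin_algebra.axioms(1)[OF art])
  show ?thesis
    by (rule R.lmI) (auto simp: smult_l_distr smult_r_distr smult_assoc1 abelian_group_axioms)
qed

lemma scal:
  "r \<in> carrier R \<Longrightarrow> scal r \<in> carrier \<Lambda>"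
  "\<lbrakk>r \<in> carrier R; s \<in> carrier R\<rbrakk> \<Longrightarrow> scal (r \<oplus>\<^bsub>R\<^esub> s) = scal r \<oplus>\<^bsub>\<Lambda>\<^esub> scal s"
  "\<lbrakk>r \<in> carrier R; s \<in> carrier R\<rbrakk> \<Longrightarrow> scal (r \<otimes>\<^bsub>R\<^esub> s) = scal r \<otimes>\<^bsub>\<Lambda>\<^esub> scal s"
  "scal \<one>\<^bsub>R\<^esub> = \<one>\<^bsub>\<Lambda>\<^esub>"
  "\<lbrakk>r \<in> carrier R; a \<in> carrier \<Lambda>\<rbrakk> \<Longrightarrow> scal r \<otimes>\<^bsub>\<Lambda>\<^esub> a = r \<odot>\<^bsub>\<Lambda>\<^esub> a"
  "\<lbrakk>r \<in> carrier R; a \<in> carrier \<Lambda>\<rbrakk> \<Longrightarrow> a \<otimes>\<^bsub>\<Lambda>\<^esub> scal r = r \<odot>\<^bsub>\<Lambda>\<^esub> a"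
proof -
  interpret artin_algebra R \<Lambda> by (rule art)
  show 1: "scal r \<in> carrier \<Lambda>" if "r \<in> carrier R" for r using that by (simp add: scal_def)
  show 5: "scal r \<otimes>\<^bsub>\<Lambda>\<^esub> a = r \<odot>\<^bsub>\<Lambda>\<^esub> a" if "r \<in> carrier R" "a \<in> carrier \<Lambda>" for r a
    using that by (simp add: scal_def smult_mult_left)
  show "a \<otimes>\<^bsub>\<Lambda>\<^esub> scal r = r \<odot>\<^bsub>\<Lambda>\<^esub> a" if "r \<in> carrier R" "a \<in> carrier \<Lambda>" for r a
    using that by (simp add: scal_def smult_mult_right)
  show "scal (r \<oplus>\<^bsub>R\<^esub> s) = scal r \<oplus>\<^bsub>\<Lambda>\<^esub> scal s" if "r \<in> carrier R" "s \<in> carrier R" for r s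
    using that by (simp add: scal_def smult_l_distr)
  show "scal (r \<otimes>\<^bsub>R\<^esub> s) = scal r \<otimes>\<^bsub>\<Lambda>\<^esub> scal s" if "r \<in> carrier R" "s \<in> carrier R" for r s
    using that 5[OF that(1) 1[OF that(2)]] by (simp add: scal_def smult_assoc1)
  show "scal \<one>\<^bsub>R\<^esub> = \<one>\<^bsub>\<Lambda>\<^esub>" by (simp add: scal_def)
qed

lemma scal_comm: "\<lbrakk>r \<in> carrier R; a \<in> carrier \<Lambda>\<rbrakk> \<Longrightarrow> scal r \<otimes>\<^bsub>\<Lambda>\<^esub> a = a \<otimes>\<^bsub>\<Lambda>\<^esub> scal r"
  using scal(5,6) by simp

lemma smult_scal:
  assumes "lm X" "r \<in> carrier R" "a \<in> carrier \<Lambda>" "x \<in> carrier X"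
  shows "scal r \<odot>\<^bsub>X\<^esub> (a \<odot>\<^bsub>X\<^esub> x) = a \<odot>\<^bsub>X\<^esub> (scal r \<odot>\<^bsub>X\<^esub> x)"
    "(r \<odot>\<^bsub>\<Lambda>\<^esub> a) \<odot>\<^bsub>X\<^esub> x = scal r \<odot>\<^bsub>X\<^esub> (a \<odot>\<^bsub>X\<^esub> x)"
  using assms scal scal_comm lm_smult(2)[OF assms(1,4)] by (simp_all flip: lm_smult(2)[OF assms(1,4)])

text \<open>Restriction of scalars along \<open>scal\<close>. A new record is formed because the
  type of a module mentions the type of its scalars.\<close>

definition rmod :: "('a, 'm, 'y) module_scheme \<Rightarrow> ('r, 'm) module" where
  "rmod X = \<lparr>carrier = carrier X, monoid.mult = undefined, one = undefined,
      ring.zero = ring.zero X, ring.add = ring.add X, smult = (\<lambda>r x. scal r \<odot>\<^bsub>X\<^esub> x)\<rparr>"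

lemma rmod_simps [simp]:
  "carrier (rmod X) = carrier X" "\<zero>\<^bsub>rmod X\<^esub> = \<zero>\<^bsub>X\<^esub>" "x \<oplus>\<^bsub>rmod X\<^esub> y = x \<oplus>\<^bsub>X\<^esub> y"
  "r \<odot>\<^bsub>rmod X\<^esub> x = scal r \<odot>\<^bsub>X\<^esub> x"
  by (simp_all add: rmod_def)

lemma rmod_lm: assumes X: "lm X" shows "R.lm (rmod X)"
proof -
  interpret X: abelian_group X by (rule lm_group[OF X])
  show ?thesis
  proof (rule R.lmI)
    show "abelian_group (rmod X)"
    proof (rule abelian_groupI)
      show "\<exists>y\<in>carrier (rmod X). y \<oplus>\<^bsub>rmod X\<^esub> x = \<zero>\<^bsub>rmod X\<^esub>" if "x \<in> carrier (rmod X)" for x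
        using that X.l_neg[of x] by (auto intro!: bexI[of _ "\<ominus>\<^bsub>X\<^esub> x"])
    qed (auto simp: X.a_ac)
  qed (use X scal(1-4) lm_smult[OF X] in auto)
qed

lemma submod_rmod: "submod X U \<Longrightarrow> R.submod (rmod X) U"
  by (rule R.submodI) (auto simp: submodD scal)

text \<open>\<open>bounded_generated\<close> is applied twice: R has finite length over itself,
  hence so does \<Lambda> over R, hence so does X over R. Submodules over \<Lambda> are also
  submodules over R, which bounds the length over \<Lambda>.\<close>

lemma fg_finite_length:
  assumes X: "lm X" and fg: "finitely_generated \<Lambda> X"
  shows "R.tlen (rmod X) \<noteq> \<infinity>" "tlen X \<noteq> \<infinity>"
proof -
  have \<Lambda>g: "finitely_generated R \<Lambda>" using artin_algebra.finitely_generated[OF art] .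
  obtain S where S: "finite S" "S \<subseteq> carrier \<Lambda>" "R.lspan \<Lambda> S = carrier \<Lambda>"
    using R.fg_iff[OF Lambda_R] \<Lambda>g by auto
  obtain U where U: "R.submod \<Lambda> U" "\<And>s. s \<in> S \<Longrightarrow> (\<lambda>a\<in>carrier R. a \<odot>\<^bsub>\<Lambda>\<^esub> s) ` carrier R.reg \<subseteq> U"
    "R.mlen \<Lambda> {\<zero>\<^bsub>\<Lambda>\<^esub>} U \<noteq> \<infinity>"
    using R.bounded_generated[OF Lambda_R R.regular_lm R.local_artinian_finite_length S(1),
        of "\<lambda>s. \<lambda>a\<in>carrier R. a \<odot>\<^bsub>\<Lambda>\<^esub> s"] R.right_mult_hom[OF Lambda_R] S(2) by blast
  interpret R: cring R by (rule R.cring_R)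
  have "s \<in> U" if "s \<in> S" for s
  proof -
    have "\<one>\<^bsub>R\<^esub> \<odot>\<^bsub>\<Lambda>\<^esub> s \<in> U" using U(2)[OF that] by auto
    then show ?thesis using R.lm_smult(1)[OF Lambda_R, of s] S(2) that by auto
  qed
  then have "carrier \<Lambda> \<subseteq> U" using R.lspan_least[OF U(1), of S] S(3) by auto
  then have "U = carrier \<Lambda>" using R.submodD(1)[OF U(1)] by auto
  then have f\<Lambda>: "R.tlen \<Lambda> \<noteq> \<infinity>" using U(3) by simp
  obtain S where S: "finite S" "S \<subseteq> carrier X" "lspan X S = carrier X"
    using fg_iff[OF X] fg by auto
  have h: "(\<lambda>a\<in>carrier \<Lambda>. a \<odot>\<^bsub>X\<^esub> s) \<in> lin_hom R \<Lambda> (rmod X)" if s: "s \<in> S" for s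
  proof (rule R.lin_homI)
    have sc: "s \<in> carrier X" using s S(2) by auto
    show "r \<odot>\<^bsub>\<Lambda>\<^esub> a \<odot>\<^bsub>X\<^esub> s = r \<odot>\<^bsub>rmod X\<^esub> (a \<odot>\<^bsub>X\<^esub> s)" if "r \<in> carrier R" "a \<in> carrier \<Lambda>" for r a
      using smult_scal(2)[OF X that sc] by simp
  qed (use s S(2) X lm_smult[OF X] Lambda_R in auto)
  obtain U where U: "R.submod (rmod X) U" "\<And>s. s \<in> S \<Longrightarrow> (\<lambda>a\<in>carrier \<Lambda>. a \<odot>\<^bsub>X\<^esub> s) ` carrier \<Lambda> \<subseteq> U"
    "R.mlen (rmod X) {\<zero>\<^bsub>rmod X\<^esub>} U \<noteq> \<infinity>"
    using R.bounded_generated[OF rmod_lm[OF X] Lambda_R f\<Lambda> S(1), of "\<lambda>s. \<lambda>a\<in>carrier \<Lambda>. a \<odot>\<^bsub>X\<^esub> s"] h by blast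
  have "x \<in> U" if "x \<in> lspan X S" for x
    using that
  proof induction
    case zero
    then show ?case using R.submodD(2)[OF U(1)] by simp
  next
    case (add a s x)
    have "a \<odot>\<^bsub>X\<^esub> s \<in> U" using U(2)[OF add(2)] add(1) by auto
    then show ?case using R.submodD(3)[OF U(1)] add by simp
  qed
  then have "U = carrier X" using S(3) R.submodD(1)[OF U(1)] by auto
  then show *: "R.tlen (rmod X) \<noteq> \<infinity>" using U(3) by simp
  have "tlen X \<le> R.tlen (rmod X)"
    using len_map_le[of "submod X" "{\<zero>\<^bsub>X\<^esub>}" "carrier X" "R.submod (rmod X)" "\<lambda>S. S", OF submod_rmod] by simp
  then show "tlen X \<noteq> \<infinity>" using * enat_ile not_infinity_eq by metis
qed

lemma Mo_fg: "X \<in> Mo \<Longrightarrow> finitely_generated \<Lambda> X"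
  by (simp add: fg_modules_def)

lemma Mo_iff: "lm X \<Longrightarrow> X \<in> Mo \<longleftrightarrow> finitely_generated \<Lambda> X"
  by (simp add: fg_modules_def)

lemma Mo_lm [simp]: "X \<in> Mo \<Longrightarrow> lm X"
  by (simp add: fg_modules_def)

lemma Mo_fin:
  assumes "X \<in> Mo" shows "tlen X \<noteq> \<infinity>" "R.tlen (rmod X) \<noteq> \<infinity>"
  using fg_finite_length(2,1)[OF Mo_lm[OF assms] Mo_fg[OF assms]] .

lemma MoI: "\<lbrakk>lm X; finite S; S \<subseteq> carrier X; lspan X S = carrier X\<rbrakk> \<Longrightarrow> X \<in> Mo"
  using fg_iff[of X] Mo_iff[of X] by blast

lemma Mo_gen:
  assumes "X \<in> Mo" obtains S where "finite S" "S \<subseteq> carrier X" "lspan X S = carrier X"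
  using that Mo_fg[OF assms] fg_iff[OF Mo_lm[OF assms]] by blast

lemma sub_Mo:
  assumes "X \<in> Mo" "submod X U" shows "X\<lparr>carrier := U\<rparr> \<in> Mo"
proof -
  obtain S where "finite S" "S \<subseteq> U" "lspan X S = U"
    using submod_fg[of X U] assms Mo_fin by auto
  then show ?thesis using assms by (intro MoI[of _ S]) (auto simp: lm_sub lspan_sub)
qed

lemma image_Mo:
  assumes "X \<in> Mo" "lm Q" "q \<in> Hom X Q" "q ` carrier X = carrier Q"
  shows "Q \<in> Mo"
proof -
  obtain S where S: "finite S" "S \<subseteq> carrier X" "lspan X S = carrier X" using Mo_gen[OF assms(1)] .
  have "lspan Q (q ` S) = carrier Q"
    using lspan_image[OF Mo_lm[OF assms(1)] assms(2,3) S(2)] S(3) assms(4) by simp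
  moreover have "q ` S \<subseteq> carrier Q" using image_mono[OF S(2), of q] assms(4) by simp
  ultimately show ?thesis using S(1) assms(2) by (intro MoI[of _ "q ` S"]) simp_all
qed

lemma quotient_Mo:
  fixes X :: "('a, 'm) module"
  assumes X: "X \<in> Mo" and U: "submod X U"
  obtains Q :: "('a, 'm) module" and q where "Q \<in> Mo" "q \<in> Hom X Q" "q ` carrier X = carrier Q"
    "\<forall>x\<in>carrier X. q x = \<zero>\<^bsub>Q\<^esub> \<longleftrightarrow> x \<in> U"
proof -
  obtain Q :: "('a, 'm) module" and q where Q: "lm Q" "q \<in> Hom X Q" "q ` carrier X = carrier Q"
    "\<And>x. x \<in> carrier X \<Longrightarrow> q x = \<zero>\<^bsub>Q\<^esub> \<longleftrightarrow> x \<in> U"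
    using quotient_lm[of X U] X U by auto
  show thesis by (rule that[OF image_Mo[OF X Q(1-3)] Q(2,3)]) (use Q(4) in simp)
qed

lemma iso_copy:
  fixes X :: "('a, 'n, 'y) module_scheme"
  assumes "lm X" "finitely_generated \<Lambda> X"
  obtains N :: "('a, (nat \<Rightarrow> 'a) set) module" and f g where "N \<in> Mo" "f \<in> Hom X N" "g \<in> Hom N X"
    "\<And>x. x \<in> carrier X \<Longrightarrow> g (f x) = x" "\<And>y. y \<in> carrier N \<Longrightarrow> f (g y) = y"
proof -
  obtain N :: "('a, (nat \<Rightarrow> 'a) set) module" and f where N: "N \<in> Mo" "f \<in> lin_iso \<Lambda> X N"
    using fg_module_representative[OF assms] by (auto simp: isomorphic_def)
  obtain g where g: "g \<in> lin_iso \<Lambda> N X" "\<And>x. x \<in> carrier X \<Longrightarrow> g (f x) = x" "\<And>y. y \<in> carrier N \<Longrightarrow> f (g y) = y"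
    using lin_iso_inv[OF assms(1) Mo_lm[OF N(1)] N(2)] by blast
  show thesis by (rule that[OF N(1)]) (use N(2) g in \<open>auto simp: lin_iso_def\<close>)
qed

text \<open>The product is formed on pairs and so leaves the element type of X and Y. Being finitely
  generated it has a copy over the type \<open>(nat \<Rightarrow> 'a) set\<close>, and the biproduct
  maps are transported to that copy.\<close>

lemma bip_ex:
  fixes X Y :: "('a, (nat \<Rightarrow> 'a) set) module"
  assumes X: "X \<in> Mo" and Y: "Y \<in> Mo"
  obtains B :: "('a, (nat \<Rightarrow> 'a) set) module" and i1 i2 p1 p2 where "B \<in> Mo" "bip B X Y i1 i2 p1 p2"
proof -
  let ?P = "prod_mod X Y"
  have l: "lm X" "lm Y" "lm ?P" using X Y prod_lm[of X Y] by auto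
  have c: "carrier ?P = carrier X \<times> carrier Y" by (simp add: prod_mod_def)
  note h = prod_homs[OF l(1,2)]
  obtain S T where S: "finite S" "S \<subseteq> carrier X" "lspan X S = carrier X"
    and T: "finite T" "T \<subseteq> carrier Y" "lspan Y T = carrier Y" using Mo_gen[OF X] Mo_gen[OF Y] by metis
  let ?a = "\<lambda>x\<in>carrier X. (x, \<zero>\<^bsub>Y\<^esub>)" and ?b = "\<lambda>y\<in>carrier Y. (\<zero>\<^bsub>X\<^esub>, y)"
  let ?G = "?a ` S \<union> ?b ` T"
  have G: "?G \<subseteq> carrier ?P" using S T l by (auto simp: c)
  have sG: "submod ?P (lspan ?P ?G)" by (rule lspan_submod[OF l(3) G])
  have "carrier ?P \<subseteq> lspan ?P ?G"
  proof
    fix u assume u: "u \<in> carrier ?P"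
    have "?a (fst u) \<in> ?a ` lspan X S" "?b (snd u) \<in> ?b ` lspan Y T" using u S(3) T(3) by (auto simp: c)
    note this[unfolded lspan_image[OF l(1,3) h(1) S(2)] lspan_image[OF l(2,3) h(2) T(2)]]
    then have "?a (fst u) \<in> lspan ?P ?G" "?b (snd u) \<in> lspan ?P ?G"
      using lspan_mono[of "?a ` S" ?G ?P] lspan_mono[of "?b ` T" ?G ?P] by auto
    then have "?a (fst u) \<oplus>\<^bsub>?P\<^esub> ?b (snd u) \<in> lspan ?P ?G" by (rule submodD(3)[OF sG])
    moreover have "?a (fst u) \<oplus>\<^bsub>?P\<^esub> ?b (snd u) = u"
      using u l by (auto simp: c) (auto simp: prod_mod_def lm_add)
    ultimately show "u \<in> lspan ?P ?G" by simp
  qed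
  then have "lspan ?P ?G = carrier ?P" using submodD(1)[OF sG] by auto
  then have "finitely_generated \<Lambda> ?P"
    using fg_iff[OF l(3)] S(1) T(1) G by (meson finite_UnI finite_imageI)
  then obtain N :: "('a, (nat \<Rightarrow> 'a) set) module" and f g where N: "N \<in> Mo" "f \<in> Hom ?P N" "g \<in> Hom N ?P"
    and gf: "\<And>x. x \<in> carrier ?P \<Longrightarrow> g (f x) = x" and fg: "\<And>y. y \<in> carrier N \<Longrightarrow> f (g y) = y"
    using iso_copy[OF l(3)] by metis
  have lN: "lm N" using N by simp
  let ?p = "\<lambda>u\<in>carrier X \<times> carrier Y. fst u" and ?q = "\<lambda>u\<in>carrier X \<times> carrier Y. snd u"
  have gN: "g x \<in> carrier X \<times> carrier Y" if "x \<in> carrier N" for x using hom_closed[OF N(3) that] c by simp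
  note fs = hom_simps[OF N(2) l(3) lN]
  have "bip N X Y (compose (carrier X) f ?a) (compose (carrier Y) f ?b) (compose (carrier N) ?p g) (compose (carrier N) ?q g)"
    unfolding bip_def
  proof (intro conjI ballI)
    show "compose (carrier X) f ?a \<in> Hom X N" "compose (carrier Y) f ?b \<in> Hom Y N"
      "compose (carrier N) ?p g \<in> Hom N X" "compose (carrier N) ?q g \<in> Hom N Y"
      using h N l lN by (auto intro: compose_hom)
    show "compose (carrier N) ?p g (compose (carrier X) f ?a a) = a"
      "compose (carrier N) ?q g (compose (carrier X) f ?a a) = \<zero>\<^bsub>Y\<^esub>" if "a \<in> carrier X" for a
      using that fs(1)[of "(a, \<zero>\<^bsub>Y\<^esub>)"] gf[of "(a, \<zero>\<^bsub>Y\<^esub>)"] l by (auto simp: c)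
    show "compose (carrier N) ?q g (compose (carrier Y) f ?b b) = b"
      "compose (carrier N) ?p g (compose (carrier Y) f ?b b) = \<zero>\<^bsub>X\<^esub>" if "b \<in> carrier Y" for b
      using that fs(1)[of "(\<zero>\<^bsub>X\<^esub>, b)"] gf[of "(\<zero>\<^bsub>X\<^esub>, b)"] l by (auto simp: c)
    show "x = compose (carrier X) f ?a (compose (carrier N) ?p g x) \<oplus>\<^bsub>N\<^esub> compose (carrier Y) f ?b (compose (carrier N) ?q g x)"
      if x: "x \<in> carrier N" for x
    proof -
      obtain a b where ab: "g x = (a, b)" "a \<in> carrier X" "b \<in> carrier Y" using gN[OF x] by auto
      have "f (a, \<zero>\<^bsub>Y\<^esub>) \<oplus>\<^bsub>N\<^esub> f (\<zero>\<^bsub>X\<^esub>, b) = f ((a, \<zero>\<^bsub>Y\<^esub>) \<oplus>\<^bsub>?P\<^esub> (\<zero>\<^bsub>X\<^esub>, b))"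
        using fs(2)[of "(a, \<zero>\<^bsub>Y\<^esub>)" "(\<zero>\<^bsub>X\<^esub>, b)"] ab l by (simp add: c)
      also have "(a, \<zero>\<^bsub>Y\<^esub>) \<oplus>\<^bsub>?P\<^esub> (\<zero>\<^bsub>X\<^esub>, b) = g x"
        using ab l by (simp add: prod_mod_def lm_add)
      also have "f (g x) = x" using fg[OF x] .
      finally show ?thesis using x ab gN[OF x] by simp
    qed
  qed
  then show thesis by (rule that[OF N(1)])
qed

text \<open>Scalars come from R only: multiplying the values of a linear map by the central element
  \<open>scal r\<close> keeps it linear, which fails for a general element of \<Lambda>.\<close>

definition hom_mod :: "('a, 'm, 'y) module_scheme \<Rightarrow> ('a, 'n, 'z) module_scheme \<Rightarrow> ('r, 'm \<Rightarrow> 'n) module" where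
  "hom_mod U X = \<lparr>carrier = Hom U X, monoid.mult = undefined, one = undefined,
      ring.zero = hom_zero U X, ring.add = hom_add U X,
      smult = (\<lambda>r h. \<lambda>u\<in>carrier U. scal r \<odot>\<^bsub>X\<^esub> h u)\<rparr>"

lemma hom_mod_simps [simp]:
  "carrier (hom_mod U X) = Hom U X" "\<zero>\<^bsub>hom_mod U X\<^esub> = hom_zero U X"
  "h \<oplus>\<^bsub>hom_mod U X\<^esub> k = hom_add U X h k" "r \<odot>\<^bsub>hom_mod U X\<^esub> h = (\<lambda>u\<in>carrier U. scal r \<odot>\<^bsub>X\<^esub> h u)"
  by (simp_all add: hom_mod_def)

lemma scal_hom:
  assumes "lm U" "lm X" "h \<in> Hom U X" "r \<in> carrier R"
  shows "(\<lambda>u\<in>carrier U. scal r \<odot>\<^bsub>X\<^esub> h u) \<in> Hom U X"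
proof (rule lin_homI)
  note hs = hom_simps[OF assms(3,1,2)] and r = scal(1)[OF assms(4)]
  show "scal r \<odot>\<^bsub>X\<^esub> h (a \<odot>\<^bsub>U\<^esub> u) = a \<odot>\<^bsub>X\<^esub> (scal r \<odot>\<^bsub>X\<^esub> h u)"
    if "a \<in> carrier \<Lambda>" "u \<in> carrier U" for a u
    using smult_scal(1)[OF assms(2,4) that(1) hs(1)[OF that(2)]] hs(3)[OF that] by simp
  show "scal r \<odot>\<^bsub>X\<^esub> h (u \<oplus>\<^bsub>U\<^esub> v) = scal r \<odot>\<^bsub>X\<^esub> h u \<oplus>\<^bsub>X\<^esub> scal r \<odot>\<^bsub>X\<^esub> h v"
    if "u \<in> carrier U" "v \<in> carrier U" for u v
    using hs that r lm_smult(4)[OF assms(2)] by simp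
qed (use assms hom_closed[OF assms(3)] scal(1) in auto)

lemma hom_mod_lm:
  assumes U: "lm U" and X: "lm X" shows "R.lm (hom_mod U X)"
proof (rule R.lmI)
  note cl = hom_closed[of _ U X]
  have ext: "h = k" if "h \<in> Hom U X" "k \<in> Hom U X" "\<And>u. u \<in> carrier U \<Longrightarrow> h u = k u" for h k
    using lin_hom_eqI that by blast
  note [simp] = add_hom[OF U X] scal_hom[OF U X] zero_hom[OF U X]
  show "abelian_group (hom_mod U X)"
  proof (rule abelian_groupI)
    show "\<exists>k\<in>carrier (hom_mod U X). k \<oplus>\<^bsub>hom_mod U X\<^esub> h = \<zero>\<^bsub>hom_mod U X\<^esub>" if "h \<in> carrier (hom_mod U X)" for h
    proof (rule bexI)
      have k: "hom_diff U X (hom_zero U X) h \<in> Hom U X" using that by (intro diff_hom U X) auto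
      then show "hom_diff U X (hom_zero U X) h \<in> carrier (hom_mod U X)" by simp
      show "hom_diff U X (hom_zero U X) h \<oplus>\<^bsub>hom_mod U X\<^esub> h = \<zero>\<^bsub>hom_mod U X\<^esub>"
        using that k X cl[of h] unfolding hom_mod_simps
        by (intro ext add_hom[OF U X] zero_hom[OF U X]) (simp_all add: lm_minus lm_add)
    qed
  qed (use X in \<open>auto intro!: ext simp: lm_ac lm_add cl\<close>)
  show "(r \<oplus>\<^bsub>R\<^esub> s) \<odot>\<^bsub>hom_mod U X\<^esub> h = r \<odot>\<^bsub>hom_mod U X\<^esub> h \<oplus>\<^bsub>hom_mod U X\<^esub> s \<odot>\<^bsub>hom_mod U X\<^esub> h"
    if rs: "r \<in> carrier R" "s \<in> carrier R" "h \<in> carrier (hom_mod U X)" for r s h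
  proof -
    interpret cring R by (rule R.cring_R)
    have "r \<oplus>\<^bsub>R\<^esub> s \<in> carrier R" using rs by simp
    then have m: "(\<lambda>u\<in>carrier U. scal (r \<oplus>\<^bsub>R\<^esub> s) \<odot>\<^bsub>X\<^esub> h u) \<in> Hom U X"
      using scal_hom[OF U X] rs(3) by simp
    show ?thesis
      unfolding hom_mod_simps
    proof (rule ext[OF m])
      show "hom_add U X (\<lambda>u\<in>carrier U. scal r \<odot>\<^bsub>X\<^esub> h u) (\<lambda>u\<in>carrier U. scal s \<odot>\<^bsub>X\<^esub> h u) \<in> Hom U X"
        using rs by simp
    qed (use rs in \<open>simp add: cl scal(1,2) lm_smult[OF X]\<close>)
  qed
  show "(r \<otimes>\<^bsub>R\<^esub> s) \<odot>\<^bsub>hom_mod U X\<^esub> h = r \<odot>\<^bsub>hom_mod U X\<^esub> (s \<odot>\<^bsub>hom_mod U X\<^esub> h)"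
    if rs: "r \<in> carrier R" "s \<in> carrier R" "h \<in> carrier (hom_mod U X)" for r s h
  proof -
    interpret cring R by (rule R.cring_R)
    have sc: "(\<lambda>u\<in>carrier U. scal s \<odot>\<^bsub>X\<^esub> h u) \<in> Hom U X"
      using scal_hom[OF U X] rs by simp
    have "r \<otimes>\<^bsub>R\<^esub> s \<in> carrier R" using rs by simp
    then have m: "(\<lambda>u\<in>carrier U. scal (r \<otimes>\<^bsub>R\<^esub> s) \<odot>\<^bsub>X\<^esub> h u) \<in> Hom U X"
      using scal_hom[OF U X] rs(3) by simp
    show ?thesis
      unfolding hom_mod_simps
      by (rule ext[OF m scal_hom[OF U X sc rs(1)]])
        (use rs in \<open>simp add: cl scal(1,3) lm_smult[OF X]\<close>)
  qed
  show "\<one>\<^bsub>R\<^esub> \<odot>\<^bsub>hom_mod U X\<^esub> h = h" if h: "h \<in> carrier (hom_mod U X)" for h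
  proof -
    interpret cring R by (rule R.cring_R)
    show ?thesis
      using h scal_hom[OF U X, of h "\<one>\<^bsub>R\<^esub>"] unfolding hom_mod_simps
      by (intro ext) (simp_all add: cl scal(4) lm_smult[OF X])
  qed
  show "r \<odot>\<^bsub>hom_mod U X\<^esub> h \<in> carrier (hom_mod U X)" if "r \<in> carrier R" "h \<in> carrier (hom_mod U X)" for r h
    using that by simp
  show "r \<odot>\<^bsub>hom_mod U X\<^esub> (h \<oplus>\<^bsub>hom_mod U X\<^esub> k) = r \<odot>\<^bsub>hom_mod U X\<^esub> h \<oplus>\<^bsub>hom_mod U X\<^esub> r \<odot>\<^bsub>hom_mod U X\<^esub> k"
    if "r \<in> carrier R" "h \<in> carrier (hom_mod U X)" "k \<in> carrier (hom_mod U X)" for r h k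
    using that unfolding hom_mod_simps
    by (intro ext[OF scal_hom[OF U X add_hom[OF U X]] add_hom[OF U X scal_hom[OF U X] scal_hom[OF U X]]])
      (auto simp: cl scal(1) lm_smult[OF X])
qed

lemma post_hom:
  assumes U: "lm U" and X: "lm X" and Y: "lm Y" and g: "g \<in> Hom X Y"
  shows "(\<lambda>h\<in>Hom U X. compose (carrier U) g h) \<in> lin_hom R (hom_mod U X) (hom_mod U Y)"
proof -
  note gs = hom_simps[OF g X Y]
  note c = compose_hom[OF _ g U]
  note [simp] = add_hom[OF U X] scal_hom[OF U X] add_hom[OF U Y] scal_hom[OF U Y]
  have "(\<lambda>h\<in>carrier (hom_mod U X). compose (carrier U) g h) \<in> lin_hom R (hom_mod U X) (hom_mod U Y)"
  proof (rule R.lin_homI)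
    show "compose (carrier U) g (h \<oplus>\<^bsub>hom_mod U X\<^esub> k) =
        compose (carrier U) g h \<oplus>\<^bsub>hom_mod U Y\<^esub> compose (carrier U) g k"
      if "h \<in> carrier (hom_mod U X)" "k \<in> carrier (hom_mod U X)" for h k
      using that unfolding hom_mod_simps
      by (intro lin_hom_eqI[where X = U and Y = Y and Y' = Y]) (auto simp: c gs hom_closed)
    show "compose (carrier U) g (r \<odot>\<^bsub>hom_mod U X\<^esub> h) = r \<odot>\<^bsub>hom_mod U Y\<^esub> compose (carrier U) g h"
      if "r \<in> carrier R" "h \<in> carrier (hom_mod U X)" for r h
      using that unfolding hom_mod_simps
      by (intro lin_hom_eqI[where X = U and Y = Y and Y' = Y]) (auto simp: c gs hom_closed scal(1))
  qed (use c hom_mod_lm[OF U X] in auto)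
  then show ?thesis by simp
qed

text \<open>A morphism is determined by its values on a finite generating set. Requiring it to
  vanish at one more generator t cuts off a layer that embeds into X by evaluation at t, hence a
  layer of finite length; after all generators only 0 is left.\<close>

lemma hom_mod_fin:
  assumes U: "U \<in> Mo" and X: "X \<in> Mo"
  shows "R.tlen (hom_mod U X) \<noteq> \<infinity>"
proof -
  have l: "lm U" "lm X" using U X by auto
  let ?H = "hom_mod U X"
  have H: "R.lm ?H" by (rule hom_mod_lm[OF l])
  obtain S where S: "finite S" "S \<subseteq> carrier U" "lspan U S = carrier U" using Mo_gen[OF U] .
  define K where "K T = {h \<in> Hom U X. \<forall>t\<in>T. h t = \<zero>\<^bsub>X\<^esub>}" for T
  have K: "R.submod ?H (K T)" if "T \<subseteq> carrier U" for T
    by (rule R.submodI) (use that l add_hom[OF l] scal_hom[OF l] zero_hom[OF l] lm_smult(6)[OF l(2), of "\<zero>\<^bsub>X\<^esub>"] scal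
        in \<open>auto simp: K_def subset_iff lm_add\<close>)
  have ev: "(\<lambda>h\<in>Hom U X. h u) \<in> lin_hom R ?H (rmod X)" if "u \<in> carrier U" for u
  proof -
    have "(\<lambda>h\<in>carrier ?H. h u) \<in> lin_hom R ?H (rmod X)"
      by (rule R.lin_homI) (use that H in \<open>auto simp: hom_closed\<close>)
    then show ?thesis by simp
  qed
  have "R.mlen ?H (K T) (Hom U X) \<noteq> \<infinity>" if "T \<subseteq> S" for T
    using finite_subset[OF that S(1)] that
  proof (induction T)
    case empty
    have "K {} = Hom U X" by (auto simp: K_def)
    moreover have "R.mlen ?H (Hom U X) (Hom U X) = 0"
      using R.len_eq_0_iff[OF H, of "Hom U X" "Hom U X"] R.submod_carrier[OF H] by simp
    ultimately show ?case by simp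
  next
    case (insert t T)
    have t: "t \<in> carrier U" "T \<subseteq> carrier U" "insert t T \<subseteq> carrier U"
      using insert S by auto
    note KT = K[OF t(2)] and KtT = K[OF t(3)]
    have sub: "K T \<subseteq> Hom U X" "K (insert t T) \<subseteq> K T" by (auto simp: K_def)
    let ?e = "restrict (\<lambda>h\<in>Hom U X. h t) (K T)"
    have e: "?e \<in> lin_hom R (?H\<lparr>carrier := K T\<rparr>) (rmod X)"
      by (rule R.restrict_hom[OF H rmod_lm[OF l(2)] ev[OF t(1)] KT])
    have C: "R.submod (rmod X) (?e ` K T)"
      using R.submod_image[OF R.lm_sub[OF H KT] rmod_lm[OF l(2)] e, of "K T"] R.submod_sub[OF KT, of "K T"] KT by simp
    have z: "{\<zero>\<^bsub>X\<^esub>} \<subseteq> ?e ` K T" using R.submodD(2)[OF C] by simp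
    have "R.mlen ?H (K (insert t T)) (K T) = R.mlen (rmod X) {\<zero>\<^bsub>X\<^esub>} (?e ` K T)"
      by (rule R.len_map[OF H rmod_lm[OF l(2)] e KT _ C z])
        (use R.submod_zero[OF rmod_lm[OF l(2)]] sub in \<open>auto simp: K_def\<close>)
    also have "\<dots> \<le> R.tlen (rmod X)"
      using R.len_mono[OF rmod_lm[OF l(2)], of "{\<zero>\<^bsub>X\<^esub>}" "{\<zero>\<^bsub>X\<^esub>}" "?e ` K T" "carrier X"]
        R.submod_zero[OF rmod_lm[OF l(2)]] R.submod_carrier[OF rmod_lm[OF l(2)]] z C R.submodD(1)[OF C] by auto
    finally have f: "R.mlen ?H (K (insert t T)) (K T) \<noteq> \<infinity>"
      using Mo_fin(2)[OF X] enat_ile not_infinity_eq by metis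
    have "R.mlen ?H (K (insert t T)) (Hom U X) = R.mlen ?H (K (insert t T)) (K T) + R.mlen ?H (K T) (Hom U X)"
      by (rule R.len_add[OF H KtT KT _ sub(2,1)]) (use R.submod_carrier[OF H] in simp)
    then show ?case using f insert by (simp add: plus_eq_infty_iff_enat)
  qed
  moreover have "K S = {hom_zero U X}"
  proof -
    have "h = hom_zero U X" if h: "h \<in> K S" for h
    proof (rule lin_hom_eqI[OF _ zero_hom[OF l]])
      show hH: "h \<in> Hom U X" using h by (simp add: K_def)
      have "submod U {u \<in> carrier U. h u = \<zero>\<^bsub>X\<^esub>}" by (rule ker_submod[OF l hH])
      then have "lspan U S \<subseteq> {u \<in> carrier U. h u = \<zero>\<^bsub>X\<^esub>}"
        by (rule lspan_least) (use h S in \<open>auto simp: K_def\<close>)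
      then show "h u = hom_zero U X u" if "u \<in> carrier U" for u using that S(3) by auto
    qed
    moreover have "hom_zero U X \<in> K S" using R.submodD(2)[OF K[OF S(2)]] by simp
    ultimately show ?thesis by blast
  qed
  ultimately show ?thesis by force
qed

end

section \<open>Retracts and the radical\<close>

context mod_base
begin

text \<open>Being a direct summand up to isomorphism, without naming a complement. The relation is
  easily composed, and \<open>retr_bip\<close> recovers a complement as the kernel of the
  retraction.\<close>

definition retr where
  "retr X Y \<longleftrightarrow> (\<exists>i\<in>lin_hom A X Y. \<exists>p\<in>lin_hom A Y X. \<forall>x\<in>carrier X. p (i x) = x)"

lemma retr_trans:
  assumes "lm X" "lm Y" "lm Z" "retr X Y" "retr Y Z" shows "retr X Z"
proof -
  obtain i p j q where ip: "i \<in> lin_hom A X Y" "p \<in> lin_hom A Y X" "\<forall>x\<in>carrier X. p (i x) = x"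
    and jq: "j \<in> lin_hom A Y Z" "q \<in> lin_hom A Z Y" "\<forall>y\<in>carrier Y. q (j y) = y"
    using assms(4,5) unfolding retr_def by blast
  have "compose (carrier X) j i \<in> lin_hom A X Z" "compose (carrier Z) p q \<in> lin_hom A Z X"
    using compose_hom[OF ip(1) jq(1) assms(1)] compose_hom[OF jq(2) ip(2) assms(3)] .
  moreover have "compose (carrier Z) p q (compose (carrier X) j i x) = x" if "x \<in> carrier X" for x
    using that hom_closed[OF ip(1) that] hom_closed[OF jq(1)] ip(3) jq(3) by simp
  ultimately show ?thesis unfolding retr_def by blast
qed

lemma bip_retr: "bip X Y Z i1 i2 p1 p2 \<Longrightarrow> retr Y X"
  unfolding retr_def using bipD by metis

lemma iso_retr: "\<lbrakk>lm X; lm Y; f \<in> lin_iso A X Y\<rbrakk> \<Longrightarrow> retr X Y"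
  by (metis (no_types, lifting) lin_iso_def lin_iso_inv mem_Collect_eq retr_def)

lemma minus_hom:
  assumes "lm X" "e \<in> lin_hom A X X"
  shows "(\<lambda>x\<in>carrier X. x \<ominus>\<^bsub>X\<^esub> e x) \<in> lin_hom A X X"
proof -
  interpret abelian_group X by (rule lm_group[OF assms(1)])
  show ?thesis
    by (rule lin_homI) (use assms(1) hom_simps[OF assms(2,1,1)] in
      \<open>auto simp: a_minus_def lm_smult minus_add a_ac\<close>)
qed

lemma retr_bip:
  assumes X: "lm X" and Y: "lm Y" and r: "retr Y X"
  obtains U i1 i2 p1 p2 where "submod X U" "bip X Y (X\<lparr>carrier := U\<rparr>) i1 i2 p1 p2"
proof -
  obtain i p where ip: "i \<in> lin_hom A Y X" "p \<in> lin_hom A X Y" "\<And>y. y \<in> carrier Y \<Longrightarrow> p (i y) = y"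
    using r unfolding retr_def by blast
  note js = hom_simps[OF ip(1) Y X] and ps = hom_simps[OF ip(2) X Y]
  define U where "U = {x \<in> carrier X. p x = \<zero>\<^bsub>Y\<^esub>}"
  have U: "submod X U" unfolding U_def by (rule ker_submod[OF X Y ip(2)])
  let ?q = "\<lambda>x\<in>carrier X. x \<ominus>\<^bsub>X\<^esub> i (p x)"
  have "(\<lambda>x\<in>carrier X. x \<ominus>\<^bsub>X\<^esub> compose (carrier X) i p x) \<in> lin_hom A X X"
    by (rule minus_hom[OF X compose_hom[OF ip(2,1) X]])
  moreover have "(\<lambda>x\<in>carrier X. x \<ominus>\<^bsub>X\<^esub> compose (carrier X) i p x) = ?q"
    by (rule restrict_ext) simp
  ultimately have "?q \<in> lin_hom A X X" by simp
  then have q: "?q \<in> lin_hom A X (X\<lparr>carrier := U\<rparr>)"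
    by (rule corestrict_hom) (use X Y js ps ip(3) in \<open>auto simp: U_def lm_add\<close>)
  have "bip X Y (X\<lparr>carrier := U\<rparr>) i (\<lambda>x\<in>U. x) p ?q"
    unfolding bip_def
  proof (intro conjI ballI)
    show "?q (i a) = \<zero>\<^bsub>X\<lparr>carrier := U\<rparr>\<^esub>" if "a \<in> carrier Y" for a
      using that js ip(3) X by (simp add: lm_add)
    show "?q ((\<lambda>x\<in>U. x) b) = b" "p ((\<lambda>x\<in>U. x) b) = \<zero>\<^bsub>Y\<^esub>" if "b \<in> carrier (X\<lparr>carrier := U\<rparr>)" for b
      using that js(4) X by (auto simp: U_def lm_add)
    show "x = i (p x) \<oplus>\<^bsub>X\<^esub> (\<lambda>x\<in>U. x) (?q x)" if "x \<in> carrier X" for x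
      using that js ps hom_closed[OF q that] lm_minus(3)[OF X that, of "i (p x)"] by simp
  qed (use ip q incl_hom[OF X U] in auto)
  then show thesis by (rule that[OF U])
qed

text \<open>For an internal direct sum of U and V, the projection to U along V sends x to the unique
  u in U with x - u in V. Uniqueness gives its linearity, and it is the identity on U.\<close>

lemma internal_bip:
  assumes X: "lm X" and U: "submod X U" and V: "submod X V" and int: "U \<inter> V \<subseteq> {\<zero>\<^bsub>X\<^esub>}"
    and sum: "\<And>x. x \<in> carrier X \<Longrightarrow> \<exists>u\<in>U. x \<ominus>\<^bsub>X\<^esub> u \<in> V"
  shows "retr (X\<lparr>carrier := U\<rparr>) X"
proof -
  interpret abelian_group X by (rule lm_group[OF X])
  note Ud = submodD[OF U] submod_neg[OF X U] and Vd = submodD[OF V] submod_neg[OF X V]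
  define p where "p x = (SOME u. u \<in> U \<and> x \<ominus>\<^bsub>X\<^esub> u \<in> V)" for x
  have p: "p x \<in> U" "x \<ominus>\<^bsub>X\<^esub> p x \<in> V" if "x \<in> carrier X" for x
    using someI_ex[of "\<lambda>u. u \<in> U \<and> x \<ominus>\<^bsub>X\<^esub> u \<in> V"] sum[OF that] unfolding p_def by blast+
  have uniq: "p x = u" if x: "x \<in> carrier X" and u: "u \<in> U" "x \<ominus>\<^bsub>X\<^esub> u \<in> V" for x u
  proof -
    note c = Ud(1)[OF u(1)] Ud(1)[OF p(1)[OF x]]
    have "(x \<ominus>\<^bsub>X\<^esub> u) \<ominus>\<^bsub>X\<^esub> (x \<ominus>\<^bsub>X\<^esub> p x) = p x \<ominus>\<^bsub>X\<^esub> u"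
    proof -
      have "x \<ominus>\<^bsub>X\<^esub> u = (p x \<ominus>\<^bsub>X\<^esub> u) \<oplus>\<^bsub>X\<^esub> (x \<ominus>\<^bsub>X\<^esub> p x)"
      proof -
        have "(p x \<ominus>\<^bsub>X\<^esub> u) \<oplus>\<^bsub>X\<^esub> (x \<ominus>\<^bsub>X\<^esub> p x) = (p x \<oplus>\<^bsub>X\<^esub> \<ominus>\<^bsub>X\<^esub> p x) \<oplus>\<^bsub>X\<^esub> (x \<ominus>\<^bsub>X\<^esub> u)"
          using c x by (simp add: a_minus_def a_ac)
        then show ?thesis using c x X by (simp add: r_neg)
      qed
      then show ?thesis
        using c x lm_minus(4)[OF X, of "p x \<ominus>\<^bsub>X\<^esub> u" "x \<ominus>\<^bsub>X\<^esub> p x"] X by simp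
    qed
    then have "p x \<ominus>\<^bsub>X\<^esub> u \<in> V" using Vd(6)[OF u(2) p(2)[OF x]] by simp
    then have "p x \<ominus>\<^bsub>X\<^esub> u = \<zero>\<^bsub>X\<^esub>"
      using int Ud(6)[OF p(1)[OF x] u(1)] by blast
    then show ?thesis using lm_minus(1)[OF X c(2,1)] by simp
  qed
  have "(\<lambda>x\<in>carrier X. p x) \<in> lin_hom A X X"
  proof (rule lin_homI)
    show "p x \<in> carrier X" if "x \<in> carrier X" for x using Ud(1) p(1) that by blast
    show "p (x \<oplus>\<^bsub>X\<^esub> y) = p x \<oplus>\<^bsub>X\<^esub> p y" if xy: "x \<in> carrier X" "y \<in> carrier X" for x y
    proof (rule uniq)
      have "(x \<oplus>\<^bsub>X\<^esub> y) \<ominus>\<^bsub>X\<^esub> (p x \<oplus>\<^bsub>X\<^esub> p y) = (x \<ominus>\<^bsub>X\<^esub> p x) \<oplus>\<^bsub>X\<^esub> (y \<ominus>\<^bsub>X\<^esub> p y)"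
        using xy p(1) Ud(1) by (simp add: a_minus_def minus_add a_ac)
      then show "(x \<oplus>\<^bsub>X\<^esub> y) \<ominus>\<^bsub>X\<^esub> (p x \<oplus>\<^bsub>X\<^esub> p y) \<in> V"
        using p(2) xy Vd(3) by simp
    qed (use p(1) xy Ud(3) in auto)
    show "p (a \<odot>\<^bsub>X\<^esub> x) = a \<odot>\<^bsub>X\<^esub> p x" if ax: "a \<in> carrier A" "x \<in> carrier X" for a x
    proof (rule uniq)
      have "a \<odot>\<^bsub>X\<^esub> x \<ominus>\<^bsub>X\<^esub> a \<odot>\<^bsub>X\<^esub> p x = a \<odot>\<^bsub>X\<^esub> (x \<ominus>\<^bsub>X\<^esub> p x)"
        using lm_smult(9)[OF X] ax Ud(1)[OF p(1)] by simp
      then show "a \<odot>\<^bsub>X\<^esub> x \<ominus>\<^bsub>X\<^esub> a \<odot>\<^bsub>X\<^esub> p x \<in> V"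
        using p(2) ax Vd(4) by simp
    qed (use p(1) ax Ud(4) X in auto)
  qed (rule X)
  then have 1: "(\<lambda>x\<in>carrier X. p x) \<in> lin_hom A X (X\<lparr>carrier := U\<rparr>)"
    by (rule corestrict_hom) (use p in auto)
  have "p u = u" if "u \<in> U" for u
    using uniq[OF Ud(1)[OF that] that] Vd(2) lm_add(3)[OF X Ud(1)[OF that]] by simp
  then show ?thesis
    unfolding retr_def using 1 incl_hom[OF X U] Ud(1)
    by (intro bexI[of _ "\<lambda>x\<in>U. x"] bexI[of _ "\<lambda>x\<in>carrier X. p x"]) auto
qed

lemma funpow_hom:
  assumes X: "lm X" and e: "e \<in> lin_hom A X X"
  shows "restrict (e ^^ n) (carrier X) \<in> lin_hom A X X"
proof (induction n)
  case 0
  then show ?case using id_hom[OF X] by (simp add: hom_id_def id_def restrict_def)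
next
  case (Suc n)
  have eq: "restrict (e ^^ Suc n) (carrier X) = compose (carrier X) e (restrict (e ^^ n) (carrier X))"
    by (auto simp: compose_def)
  show ?case unfolding eq by (rule compose_hom[OF Suc e X])
qed

lemma funpow_fixed: "e x = x \<Longrightarrow> (e ^^ n) x = x"
  by (induction n) auto

text \<open>Choose n so that the kernel of the n-th power of e has the greatest length; it then
  equals the kernel of the 2n-th power. So the n-th power f is injective on its image, hence
  bijective there by finite length, and X is the internal direct sum of image and kernel of
  f.\<close>

lemma fitting:
  assumes X: "lm X" and fin: "tlen X \<noteq> \<infinity>" and e: "e \<in> lin_hom A X X"
  obtains f n where "f \<in> lin_hom A X X" "\<forall>x\<in>carrier X. f x = (e ^^ n) x" "0 < n"
    "retr (X\<lparr>carrier := f ` carrier X\<rparr>) X"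
    "retr (X\<lparr>carrier := {x \<in> carrier X. f x = \<zero>\<^bsub>X\<^esub>}\<rparr>) X"
proof -
  define F where "F n = restrict (e ^^ n) (carrier X)" for n
  have F: "F n \<in> lin_hom A X X" for n unfolding F_def by (rule funpow_hom[OF X e])
  note Fs = hom_simps[OF F X X]
  have Fa: "F n x = (e ^^ n) x" if "x \<in> carrier X" for n x using that by (simp add: F_def)
  have Fadd: "F (m + n) x = F m (F n x)" if "x \<in> carrier X" for m n x
    using that Fs(1)[OF that] by (simp add: Fa funpow_add)
  define K where "K n = {x \<in> carrier X. F n x = \<zero>\<^bsub>X\<^esub>}" for n
  have K: "submod X (K n)" for n unfolding K_def by (rule ker_submod[OF X X F])
  have z: "{\<zero>\<^bsub>X\<^esub>} \<subseteq> K n" for n using submodD(2)[OF K] by simp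
  have mono: "K n \<subseteq> K (m + n)" for m n using Fadd Fs(4) by (auto simp: K_def)
  have le: "mlen X {\<zero>\<^bsub>X\<^esub>} (K n) \<le> tlen X" for n
    by (rule len_mono[OF X]) (use X K z submodD(1)[OF K] in auto)
  have fK: "mlen X {\<zero>\<^bsub>X\<^esub>} (K n) \<noteq> \<infinity>" for n using le[of n] fin enat_ile not_infinity_eq by metis
  obtain N where N: "tlen X = enat N" using fin by auto
  \<comment> \<open>A positive exponent is required because later e x = 0 has to imply f x =
    0.\<close>
  obtain n where n: "0 < n" "\<And>m. 0 < m \<Longrightarrow> the_enat (mlen X {\<zero>\<^bsub>X\<^esub>} (K m)) \<le> the_enat (mlen X {\<zero>\<^bsub>X\<^esub>} (K n))"
  proof -
    have "\<exists>n. 0 < n \<and> (\<forall>m. 0 < m \<longrightarrow> the_enat (mlen X {\<zero>\<^bsub>X\<^esub>} (K m)) \<le> the_enat (mlen X {\<zero>\<^bsub>X\<^esub>} (K n)))"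
    proof (rule Lattices_Big.ex_has_greatest_nat[of "\<lambda>n. 0 < n" 1 _ "Suc N"])
      show "\<forall>m. 0 < m \<longrightarrow> the_enat (mlen X {\<zero>\<^bsub>X\<^esub>} (K m)) < Suc N"
      proof (intro allI impI)
        fix m :: nat
        obtain q where "mlen X {\<zero>\<^bsub>X\<^esub>} (K m) = enat q" using fK by auto
        then show "the_enat (mlen X {\<zero>\<^bsub>X\<^esub>} (K m)) < Suc N" using le[of m] N by simp
      qed
    qed simp
    then show thesis using that by blast
  qed
  have KK: "K (n + n) = K n"
  proof -
    obtain a b where ab: "mlen X {\<zero>\<^bsub>X\<^esub>} (K n) = enat a" "mlen X {\<zero>\<^bsub>X\<^esub>} (K (n + n)) = enat b"
      using fK[of n] fK[of "n + n"] by auto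
    have "mlen X {\<zero>\<^bsub>X\<^esub>} (K (n + n)) = mlen X {\<zero>\<^bsub>X\<^esub>} (K n) + mlen X (K n) (K (n + n))"
      by (rule len_add[OF X submod_zero[OF X] K K z mono])
    moreover have "b \<le> a" using n(2)[of "n + n"] n(1) ab by simp
    ultimately have "mlen X (K n) (K (n + n)) = 0"
      unfolding ab by (cases "mlen X (K n) (K (n + n))") (auto simp: zero_enat_def)
    then show ?thesis using len_eq_0_iff[OF X K K mono, of n n] by simp
  qed
  let ?f = "F n"
  have sq: "?f x = \<zero>\<^bsub>X\<^esub>" if "x \<in> carrier X" "?f (?f x) = \<zero>\<^bsub>X\<^esub>" for x
  proof -
    have "x \<in> K (n + n)" using that Fadd[OF that(1), of n n] by (simp add: K_def)
    then show ?thesis unfolding KK by (simp add: K_def)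
  qed
  let ?I = "?f ` carrier X"
  have I: "submod X ?I" by (rule submod_image[OF X X F submod_carrier[OF X]])
  have lI: "lm (X\<lparr>carrier := ?I\<rparr>)" by (rule lm_sub[OF X I])
  have Ic: "?I \<subseteq> carrier X" using Fs(1) by auto
  have int: "x = \<zero>\<^bsub>X\<^esub>" if "x \<in> ?I" "x \<in> K n" for x using that sq by (auto simp: K_def)
  have fI: "restrict ?f ?I \<in> lin_hom A (X\<lparr>carrier := ?I\<rparr>) (X\<lparr>carrier := ?I\<rparr>)"
    by (rule corestrict_hom[OF restrict_hom[OF X X F I]]) (use Ic in auto)
  have "mlen X {\<zero>\<^bsub>X\<^esub>} ?I \<le> tlen X"
    by (rule len_mono[OF X]) (use X I Ic submodD(2)[OF I] in auto)
  then have "mlen X {\<zero>\<^bsub>X\<^esub>} ?I \<noteq> \<infinity>"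
    using fin enat_ile not_infinity_eq by metis
  then have fin': "tlen (X\<lparr>carrier := ?I\<rparr>) \<noteq> \<infinity>"
    using len_restrict[OF X I submod_zero[OF X]] submodD(2)[OF I] by simp
  have "restrict ?f ?I \<in> lin_iso A (X\<lparr>carrier := ?I\<rparr>) (X\<lparr>carrier := ?I\<rparr>)"
    by (rule inj_endo_surj[OF lI fI fin']) (use sq in auto)
  then have surj: "?f ` ?I = ?I" by (simp add: lin_iso_def bij_betw_def)
  have dec: "\<exists>u\<in>?I. x \<ominus>\<^bsub>X\<^esub> u \<in> K n" if x: "x \<in> carrier X" for x
  proof -
    have "?f x \<in> ?I" using x by auto
    then have "?f x \<in> ?f ` ?I" using surj by simp
    then obtain u where u: "u \<in> ?I" "?f x = ?f u" by blast
    have uc: "u \<in> carrier X" using u(1) Ic by auto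
    have "?f (x \<ominus>\<^bsub>X\<^esub> u) = \<zero>\<^bsub>X\<^esub>"
      using Fs(6)[OF x uc] u(2) lm_add(3)[OF X Fs(1)[OF uc]] by simp
    then have "x \<ominus>\<^bsub>X\<^esub> u \<in> K n" using x uc X by (simp add: K_def)
    then show ?thesis using u(1) by blast
  qed
  have 1: "retr (X\<lparr>carrier := ?I\<rparr>) X"
    by (rule internal_bip[OF X I K[of n]]) (use int dec in auto)
  have 2: "retr (X\<lparr>carrier := K n\<rparr>) X"
  proof (rule internal_bip[OF X K I])
    show "K n \<inter> ?I \<subseteq> {\<zero>\<^bsub>X\<^esub>}" using int by auto
    show "\<exists>u\<in>K n. x \<ominus>\<^bsub>X\<^esub> u \<in> ?I" if x: "x \<in> carrier X" for x
    proof -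
      obtain u where u: "u \<in> ?I" "x \<ominus>\<^bsub>X\<^esub> u \<in> K n" using dec[OF x] by blast
      have "x \<ominus>\<^bsub>X\<^esub> (x \<ominus>\<^bsub>X\<^esub> u) = u"
        using lm_minus(6)[OF X x] u(1) Ic by blast
      then show ?thesis using u by (intro bexI[OF _ u(2)]) simp
    qed
  qed
  show thesis
    by (rule that[OF F _ n(1) 1 2[unfolded K_def]]) (simp add: Fa)
qed

end

section \<open>Indecomposable objects\<close>

context artin_setup
begin

text \<open>On a module of finite length 1 - g f is invertible as soon as it is injective, that is,
  as soon as g f has no nonzero fixed point. Most later arguments use this criterion in place of
  invertibility.\<close>

lemma radical_iff:
  assumes X: "X \<in> Mo" and Y: "Y \<in> Mo"
  shows "f \<in> radical \<Lambda> X Y \<longleftrightarrow>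
    f \<in> Hom X Y \<and> (\<forall>g\<in>Hom Y X. \<forall>x\<in>carrier X. g (f x) = x \<longrightarrow> x = \<zero>\<^bsub>X\<^esub>)"
proof -
  have l: "lm X" "lm Y" using X Y by auto
  have "hom_diff X X (hom_id X) (compose (carrier X) g f) \<in> lin_iso \<Lambda> X X \<longleftrightarrow>
      (\<forall>x\<in>carrier X. g (f x) = x \<longrightarrow> x = \<zero>\<^bsub>X\<^esub>)" (is "?d \<in> _ \<longleftrightarrow> ?P")
    if fg: "f \<in> Hom X Y" "g \<in> Hom Y X" for g
  proof -
    have d: "?d \<in> Hom X X" by (rule diff_hom[OF l(1,1) id_hom[OF l(1)] compose_hom[OF fg l(1)]])
    have v: "?d x = \<zero>\<^bsub>X\<^esub> \<longleftrightarrow> g (f x) = x" if "x \<in> carrier X" for x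
      using that lm_minus(1)[OF l(1) that, of "g (f x)"] hom_closed[OF fg(1) that] hom_closed[OF fg(2)]
      by (auto simp: eq_commute)
    show ?thesis
    proof
      assume "?d \<in> lin_iso \<Lambda> X X"
      then have "inj_on ?d (carrier X)" by (simp add: lin_iso_def bij_betw_def)
      then show ?P using hom_inj_iff[OF l(1,1) d] v by simp
    next
      assume ?P
      then show "?d \<in> lin_iso \<Lambda> X X"
        using inj_endo_surj[OF l(1) d Mo_fin(1)[OF X]] v by simp
    qed
  qed
  then show ?thesis unfolding radical_def by auto
qed

lemma radicalD:
  assumes "X \<in> Mo" "Y \<in> Mo" "f \<in> radical \<Lambda> X Y"
  shows "f \<in> Hom X Y" "\<lbrakk>g \<in> Hom Y X; x \<in> carrier X; g (f x) = x\<rbrakk> \<Longrightarrow> x = \<zero>\<^bsub>X\<^esub>"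
  using assms(3) radical_iff[OF assms(1,2)] by auto

lemma radical_post:
  assumes "X \<in> Mo" "Y \<in> Mo" "Z \<in> Mo" "f \<in> radical \<Lambda> X Y" "k \<in> Hom Y Z"
  shows "compose (carrier X) k f \<in> radical \<Lambda> X Z"
proof -
  have l: "lm X" "lm Y" "lm Z" using assms by auto
  note f = radicalD[OF assms(1,2,4)]
  have "x = \<zero>\<^bsub>X\<^esub>" if g: "g \<in> Hom Z X" "x \<in> carrier X" "g (compose (carrier X) k f x) = x" for g x
    using f(2)[OF compose_hom[OF assms(5) g(1) l(2)] g(2)] g hom_closed[OF f(1) g(2)] by simp
  then show ?thesis
    using compose_hom[OF f(1) assms(5) l(1)] radical_iff[OF assms(1,3)] by auto
qed

text \<open>If g f k fixes x, then k g f fixes k x. As f is radical, k x = 0, and therefore x = g f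
  k x = 0.\<close>

lemma radical_pre:
  assumes "X \<in> Mo" "Y \<in> Mo" "Z \<in> Mo" "f \<in> radical \<Lambda> Y Z" "k \<in> Hom X Y"
  shows "compose (carrier X) f k \<in> radical \<Lambda> X Z"
proof -
  have l: "lm X" "lm Y" "lm Z" using assms by auto
  note f = radicalD[OF assms(2,3,4)]
  have "x = \<zero>\<^bsub>X\<^esub>" if g: "g \<in> Hom Z X" "x \<in> carrier X" "g (compose (carrier X) f k x) = x" for g x
  proof -
    have kx: "k x \<in> carrier Y" by (rule hom_closed[OF assms(5) g(2)])
    have "compose (carrier Z) k g (f (k x)) = k x"
      using g hom_closed[OF f(1) kx] by simp
    then have "k x = \<zero>\<^bsub>Y\<^esub>" by (rule f(2)[OF compose_hom[OF g(1) assms(5) l(3)] kx])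
    then show ?thesis
      using g hom_simps(4)[OF f(1) l(2,3)] hom_simps(4)[OF g(1) l(3,1)] by simp
  qed
  then show ?thesis
    using compose_hom[OF assms(5) f(1) l(1)] radical_iff[OF assms(1,3)] by auto
qed

text \<open>If g f + g h fixes x, then g h x = (1 - g f) x. Multiplying by the inverse u of 1 - g f
  shows that u g h fixes x, so x = 0 because h is radical.\<close>

lemma radical_add:
  assumes X: "X \<in> Mo" and Y: "Y \<in> Mo" and f: "f \<in> radical \<Lambda> X Y" and h: "h \<in> radical \<Lambda> X Y"
  shows "hom_add X Y f h \<in> radical \<Lambda> X Y"
proof -
  have l: "lm X" "lm Y" using assms by auto
  note fD = radicalD[OF X Y f] and hD = radicalD[OF X Y h]
  have a: "hom_add X Y f h \<in> Hom X Y" by (rule add_hom[OF l fD(1) hD(1)])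
  have "x = \<zero>\<^bsub>X\<^esub>" if g: "g \<in> Hom Y X" and x: "x \<in> carrier X" "g (hom_add X Y f h x) = x" for g x
  proof -
    note gs = hom_simps[OF g l(2,1)] and fs = hom_simps[OF fD(1) l] and hs = hom_simps[OF hD(1) l]
    let ?d = "hom_diff X X (hom_id X) (compose (carrier X) g f)"
    have d: "?d \<in> lin_iso \<Lambda> X X" using f g by (simp add: radical_def)
    then have dH: "?d \<in> Hom X X" by (simp add: lin_iso_def)
    obtain u where u: "u \<in> lin_iso \<Lambda> X X" "\<And>x. x \<in> carrier X \<Longrightarrow> u (?d x) = x"
      using lin_iso_inv[OF l(1,1) d] by metis
    have uH: "u \<in> Hom X X" using u(1) by (simp add: lin_iso_def)
    have "g (f x) \<oplus>\<^bsub>X\<^esub> g (h x) = x" using x gs fs hs by simp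
    then have "?d x = g (h x)"
      using lm_minus(5)[OF l(1), of "g (f x)" "g (h x)"] x gs fs hs by simp
    then have "compose (carrier Y) u g (h x) = x" using u(2)[OF x(1)] hs(1)[OF x(1)] by simp
    then show ?thesis by (rule hD(2)[OF compose_hom[OF g uH l(2)] x(1)])
  qed
  then show ?thesis using a radical_iff[OF X Y] by auto
qed

lemma radical_submod:
  assumes X: "X \<in> Mo" and Y: "Y \<in> Mo"
  shows "R.submod (hom_mod X Y) (radical \<Lambda> X Y)"
proof (rule R.submodI)
  have l: "lm X" "lm Y" using assms by auto
  show "radical \<Lambda> X Y \<subseteq> carrier (hom_mod X Y)" by (auto simp: radical_def)
  show "\<zero>\<^bsub>hom_mod X Y\<^esub> \<in> radical \<Lambda> X Y"
    using radical_iff[OF X Y] zero_hom[OF l] hom_simps(4)[OF _ l(2,1)] by auto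
  show "h \<oplus>\<^bsub>hom_mod X Y\<^esub> k \<in> radical \<Lambda> X Y" if "h \<in> radical \<Lambda> X Y" "k \<in> radical \<Lambda> X Y" for h k
    using radical_add[OF X Y that] by simp
  show "r \<odot>\<^bsub>hom_mod X Y\<^esub> h \<in> radical \<Lambda> X Y" if rh: "r \<in> carrier R" "h \<in> radical \<Lambda> X Y" for r h
  proof -
    have hH: "h \<in> Hom X Y" using rh(2) by (simp add: radical_def)
    have idr: "(\<lambda>u\<in>carrier Y. scal r \<odot>\<^bsub>Y\<^esub> hom_id Y u) \<in> Hom Y Y"
      by (rule scal_hom[OF l(2,2) id_hom[OF l(2)] rh(1)])
    have "compose (carrier X) (\<lambda>u\<in>carrier Y. scal r \<odot>\<^bsub>Y\<^esub> hom_id Y u) h = r \<odot>\<^bsub>hom_mod X Y\<^esub> h"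
      unfolding hom_mod_simps
      by (rule lin_hom_eqI[OF compose_hom[OF hH idr l(1)] scal_hom[OF l hH rh(1)]])
        (simp add: hom_closed[OF hH])
    then show ?thesis using radical_post[OF X Y Y rh(2) idr] by simp
  qed
qed

text \<open>A family \<open>T\<close> of subgroups of \<open>Hom W X\<close> that is stable under composition is additive in \<open>X\<close>, hence
  so is the length of \<open>Hom W X / T X\<close>. This is used for \<open>T = 0\<close> and for the radical.\<close>

definition stable_family :: "('a, 'm) module \<Rightarrow> (('a, 'm) module \<Rightarrow> ('m \<Rightarrow> 'm) set) \<Rightarrow> bool" where
  "stable_family W T \<longleftrightarrow> (\<forall>X\<in>Mo. R.submod (hom_mod W X) (T X)) \<and>
    (\<forall>X\<in>Mo. \<forall>Y\<in>Mo. \<forall>h\<in>T X. \<forall>k\<in>Hom X Y. compose (carrier W) k h \<in> T Y)"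

definition colen :: "('a, 'm) module \<Rightarrow> (('a, 'm) module \<Rightarrow> ('m \<Rightarrow> 'm) set) \<Rightarrow> ('a, 'm) module \<Rightarrow> enat" where
  "colen W T X = R.mlen (hom_mod W X) (T X) (Hom W X)"

lemma stable_radical: "W \<in> Mo \<Longrightarrow> stable_family W (radical \<Lambda> W)"
  unfolding stable_family_def using radical_submod radical_post by blast

lemma stable_zero:
  fixes W :: "('a, 'm) module"
  assumes "W \<in> Mo" shows "stable_family W (\<lambda>X. {hom_zero W X})"
proof -
  have "compose (carrier W) k (hom_zero W X) = hom_zero W Y" if "X \<in> Mo" "Y \<in> Mo" "k \<in> Hom X Y" for X Y :: "('a, 'm) module" and k
    by (rule lin_hom_eqI[OF compose_hom[OF zero_hom _ ] zero_hom])
      (use that assms hom_simps(4)[OF that(3)] in auto)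
  moreover have "R.submod (hom_mod W X) {hom_zero W X}" if "X \<in> Mo" for X :: "('a, 'm) module"
    using R.submod_zero[OF hom_mod_lm, of W X] assms that by simp
  ultimately show ?thesis unfolding stable_family_def by simp
qed

text \<open>The submodule \<open>M1\<close> of morphisms whose first component lies in
  \<open>T Y\<close> splits the length in two: the layer above it is Hom(W,Y) modulo
  \<open>T Y\<close>, the layer from \<open>T X\<close> up to it is Hom(W,Z) modulo
  \<open>T Z\<close>. Stability of T under all four biproduct maps ensures that membership in T can
  be tested on components.\<close>

lemma colen_bip:
  assumes T: "stable_family W T" and W: "W \<in> Mo" and X: "X \<in> Mo" and Y: "Y \<in> Mo" and Z: "Z \<in> Mo"
    and b: "bip X Y Z i1 i2 p1 p2"
  shows "colen W T X = colen W T Y + colen W T Z"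
proof -
  note l = Mo_lm[OF W] Mo_lm[OF X] Mo_lm[OF Y] Mo_lm[OF Z]
  note bD = bipD[OF b]
  have Ts: "R.submod (hom_mod W V) (T V)" if "V \<in> Mo" for V using T that by (simp add: stable_family_def)
  have Tc: "compose (carrier W) k h \<in> T V'" if "V \<in> Mo" "V' \<in> Mo" "h \<in> T V" "k \<in> Hom V V'" for V V' h k
    using T that unfolding stable_family_def by blast
  have TH: "T V \<subseteq> Hom W V" if "V \<in> Mo" for V using R.submodD(1)[OF Ts[OF that]] by auto
  let ?H = "hom_mod W X"
  have H: "R.lm ?H" "R.lm (hom_mod W Y)" "R.lm (hom_mod W Z)" using hom_mod_lm l by auto
  let ?f = "\<lambda>h\<in>Hom W X. compose (carrier W) p1 h" and ?g = "\<lambda>h\<in>Hom W X. compose (carrier W) p2 h"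
  have f: "?f \<in> lin_hom R ?H (hom_mod W Y)" and g: "?g \<in> lin_hom R ?H (hom_mod W Z)"
    using post_hom[OF l(1,2) l(3) bD(3)] post_hom[OF l(1,2) l(4) bD(4)] .
  define M1 where "M1 = {h \<in> Hom W X. ?f h \<in> T Y}"
  have M1: "R.submod ?H M1"
    using R.submod_vimage[OF H(1,2) f R.submod_carrier[OF H(1)] Ts[OF Y]] by (simp add: M1_def)
  have i1h: "compose (carrier W) i1 k \<in> Hom W X" "compose (carrier W) p1 (compose (carrier W) i1 k) = k"
    if k: "k \<in> Hom W Y" for k
  proof -
    show c: "compose (carrier W) i1 k \<in> Hom W X" by (rule compose_hom[OF k bD(1) l(1)])
    show "compose (carrier W) p1 (compose (carrier W) i1 k) = k"
      by (rule lin_hom_eqI[OF compose_hom[OF c bD(3) l(1)] k]) (simp add: bD(5) hom_closed[OF k])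
  qed
  have i2h: "compose (carrier W) i2 k \<in> Hom W X" "compose (carrier W) p2 (compose (carrier W) i2 k) = k"
    "compose (carrier W) p1 (compose (carrier W) i2 k) = hom_zero W Y"
    if k: "k \<in> Hom W Z" for k
  proof -
    show c: "compose (carrier W) i2 k \<in> Hom W X" by (rule compose_hom[OF k bD(2) l(1)])
    show "compose (carrier W) p2 (compose (carrier W) i2 k) = k"
      by (rule lin_hom_eqI[OF compose_hom[OF c bD(4) l(1)] k]) (simp add: bD(7) hom_closed[OF k])
    show "compose (carrier W) p1 (compose (carrier W) i2 k) = hom_zero W Y"
      by (rule lin_hom_eqI[OF compose_hom[OF c bD(3) l(1)] zero_hom[OF l(1,3)]])
        (simp add: bD(8) hom_closed[OF k])
  qed
  have dec: "h = hom_add W X (compose (carrier W) i1 (compose (carrier W) p1 h)) (compose (carrier W) i2 (compose (carrier W) p2 h))"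
    if h: "h \<in> Hom W X" for h
    by (rule lin_hom_eqI[OF h add_hom[OF l(1,2) compose_hom[OF compose_hom[OF h bD(3) l(1)] bD(1) l(1)]
      compose_hom[OF compose_hom[OF h bD(4) l(1)] bD(2) l(1)]]])
      (simp add: bD(9) hom_closed[OF h])
  have TX: "T X \<subseteq> M1" using Tc[OF X Y _ bD(3)] TH[OF X] by (auto simp: M1_def)
  have M1H: "M1 \<subseteq> Hom W X" by (auto simp: M1_def)
  have 1: "R.mlen ?H M1 (Hom W X) = R.mlen (hom_mod W Y) (T Y) (Hom W Y)"
  proof (rule R.len_map[OF H(1,2), where f = ?f])
    show "?f ` Hom W X = Hom W Y"
    proof (intro equalityI subsetI)
      show "k \<in> ?f ` Hom W X" if "k \<in> Hom W Y" for k
        using i1h[OF that] by (intro image_eqI[of _ _ "compose (carrier W) i1 k"]) auto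
    qed (use compose_hom[OF _ bD(3) l(1)] in auto)
    show "?f \<in> lin_hom R (?H\<lparr>carrier := Hom W X\<rparr>) (hom_mod W Y)"
      using f by (simp add: hom_mod_def)
  qed (use M1_def TH[OF Y] Ts[OF Y] R.submod_carrier[OF H(1)] R.submod_carrier[OF H(2)] in auto)
  have 2: "R.mlen ?H (T X) M1 = R.mlen (hom_mod W Z) (T Z) (Hom W Z)"
  proof (rule R.len_map[OF H(1,3), where f = "restrict ?g M1"])
    show "restrict ?g M1 \<in> lin_hom R (?H\<lparr>carrier := M1\<rparr>) (hom_mod W Z)"
      by (rule R.restrict_hom[OF H(1,3) g M1])
    show "restrict ?g M1 ` M1 = Hom W Z"
    proof (intro equalityI subsetI)
      show "k \<in> restrict ?g M1 ` M1" if "k \<in> Hom W Z" for k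
      proof (rule image_eqI[of _ _ "compose (carrier W) i2 k"])
        show m: "compose (carrier W) i2 k \<in> M1"
          using i2h[OF that] R.submodD(2)[OF Ts[OF Y]] by (simp add: M1_def)
        show "k = restrict ?g M1 (compose (carrier W) i2 k)" using i2h[OF that] m by simp
      qed
    qed (use M1H compose_hom[OF _ bD(4) l(1)] in auto)
    have "h \<in> T X" if h: "h \<in> M1" "?g h \<in> T Z" for h
    proof -
      have hH: "h \<in> Hom W X" using h M1H by auto
      have "compose (carrier W) p1 h \<in> T Y" "compose (carrier W) p2 h \<in> T Z"
        using h hH by (auto simp: M1_def)
      then have "compose (carrier W) i1 (compose (carrier W) p1 h) \<in> T X" "compose (carrier W) i2 (compose (carrier W) p2 h) \<in> T X"
        using Tc[OF Y X _ bD(1)] Tc[OF Z X _ bD(2)] by auto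
      then have "hom_add W X (compose (carrier W) i1 (compose (carrier W) p1 h))
          (compose (carrier W) i2 (compose (carrier W) p2 h)) \<in> T X"
        using R.submodD(3)[OF Ts[OF X]] by simp
      then show ?thesis by (subst dec[OF hH])
    qed
    then show "T X = {h \<in> M1. restrict ?g M1 h \<in> T Z}"
      using TX Tc[OF X Z _ bD(4)] M1H by auto
  qed (use M1 TH[OF Z] Ts[OF Z] R.submod_carrier[OF H(3)] in auto)
  have "R.mlen ?H (T X) (Hom W X) = R.mlen ?H (T X) M1 + R.mlen ?H M1 (Hom W X)"
    by (rule R.len_add[OF H(1) Ts[OF X] M1 _ TX M1H]) (use R.submod_carrier[OF H(1)] in simp)
  then show ?thesis using 1 2 by (simp add: colen_def add.commute)
qed

lemma colen_zero:
  assumes T: "stable_family W T" and W: "W \<in> Mo" and X: "X \<in> Mo" "carrier X = {\<zero>\<^bsub>X\<^esub>}"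
  shows "colen W T X = 0"
proof -
  have Ts: "R.submod (hom_mod W X) (T X)" using T X by (simp add: stable_family_def)
  have "h = hom_zero W X" if "h \<in> Hom W X" for h
    by (rule lin_hom_eqI[OF that zero_hom]) (use W X hom_closed[OF that] in auto)
  then have "T X = Hom W X"
    using R.submodD(1)[OF Ts] R.submodD(2)[OF Ts] by auto
  then show ?thesis
    using R.len_eq_0_iff[OF hom_mod_lm, of W X "T X" "Hom W X"] Ts W X by (simp add: colen_def)
qed

lemma colen_fin:
  assumes T: "stable_family W T" and W: "W \<in> Mo" and X: "X \<in> Mo"
  shows "colen W T X \<noteq> \<infinity>"
proof -
  have H: "R.lm (hom_mod W X)" by (rule hom_mod_lm[OF Mo_lm[OF W] Mo_lm[OF X]])
  have Ts: "R.submod (hom_mod W X) (T X)" using T X by (simp add: stable_family_def)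
  have "colen W T X \<le> R.tlen (hom_mod W X)" unfolding colen_def
    using R.len_mono[OF H R.submod_zero[OF H] Ts R.submod_carrier[OF H] R.submod_carrier[OF H]]
      R.submodD(1,2)[OF Ts] by auto
  then show ?thesis using hom_mod_fin[OF W X] enat_ile not_infinity_eq by metis
qed

lemma colen_iso:
  assumes T: "stable_family W T" and W: "W \<in> Mo" and X: "X \<in> Mo" and Y: "Y \<in> Mo"
    and f: "isomorphic \<Lambda> X Y"
  shows "colen W T X = colen W T Y"
proof -
  obtain g where g: "g \<in> lin_iso \<Lambda> X Y" using f by (auto simp: isomorphic_def)
  let ?Z = "X\<lparr>carrier := {\<zero>\<^bsub>X\<^esub>}\<rparr>"
  have Z: "?Z \<in> Mo" using sub_Mo[OF X] X by simp
  obtain i1 i2 p1 p2 where "bip X Y ?Z i1 i2 p1 p2"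
    by (rule bip_zero[OF Mo_lm[OF X] Mo_lm[OF Y] Mo_lm[OF Z] _ g]) simp
  then have "colen W T X = colen W T Y + colen W T ?Z" by (rule colen_bip[OF T W X Y Z])
  then show ?thesis using colen_zero[OF T W Z] by simp
qed

lemma direct_sum_ConsD_Mo:
  fixes X :: "('a, 'm) module"
  assumes X: "X \<in> Mo" and Y: "Y \<in> Mo" and Ys: "set Ys \<subseteq> Mo" and ds: "direct_sum \<Lambda> X (Y # Ys)"
  obtains B i1 i2 p1 p2 where "B \<in> Mo" "bip X Y B i1 i2 p1 p2" "direct_sum \<Lambda> B Ys"
proof -
  have "\<And>Z. Z \<in> set Ys \<Longrightarrow> lm Z" using Ys by auto
  from direct_sum_ConsD[OF Mo_lm[OF X] Mo_lm[OF Y] this ds]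
  obtain U i1 i2 p1 p2 where "submod X U" "bip X Y (X\<lparr>carrier := U\<rparr>) i1 i2 p1 p2"
    "direct_sum \<Lambda> (X\<lparr>carrier := U\<rparr>) Ys" by metis
  then show thesis using that sub_Mo[OF X] by blast
qed

lemma colen_direct_sum:
  assumes T: "stable_family W T" and W: "W \<in> Mo"
  shows "\<lbrakk>X \<in> Mo; set Xs \<subseteq> Mo; direct_sum \<Lambda> X Xs\<rbrakk> \<Longrightarrow> colen W T X = (\<Sum>Y\<leftarrow>Xs. colen W T Y)"
proof (induction Xs arbitrary: X)
  case Nil
  then show ?case using colen_zero[OF T W] direct_sum_Nil[of X] by simp
next
  case (Cons Y Ys)
  have Y: "Y \<in> Mo" "set Ys \<subseteq> Mo" using Cons.prems by auto
  obtain B i1 i2 p1 p2 where B: "B \<in> Mo" "bip X Y B i1 i2 p1 p2" "direct_sum \<Lambda> B Ys"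
    using direct_sum_ConsD_Mo[OF Cons.prems(1) Y Cons.prems(3)] by metis
  show ?case
    using colen_bip[OF T W Cons.prems(1) Y(1) B(1,2)] Cons.IH[OF B(1) Y(2) B(3)] by simp
qed

end

section \<open>The Krull-Schmidt theorem\<close>

context mod_base
begin

lemma tlen_bip:
  assumes X: "lm X" and Y: "lm Y" and Z: "lm Z" and b: "bip X Y Z i1 i2 p1 p2"
  shows "tlen X = tlen Y + tlen Z"
proof -
  note bD = bipD[OF b]
  let ?K = "{x \<in> carrier X. p1 x = \<zero>\<^bsub>Y\<^esub>}"
  have im: "p1 ` carrier X = carrier Y"
  proof (intro equalityI subsetI)
    show "y \<in> p1 ` carrier X" if "y \<in> carrier Y" for y
      by (rule rev_image_eqI[OF hom_closed[OF bD(1) that]]) (simp add: bD(5)[OF that])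
  qed (use hom_closed[OF bD(3)] in auto)
  have K: "i2 ` carrier Z = ?K"
  proof (intro equalityI subsetI)
    fix x assume x: "x \<in> ?K"
    then have "x = i2 (p2 x)"
      using bD(9)[of x] hom_simps(4)[OF bD(1) Y X] lm_add(1)[OF X] hom_closed[OF bD(2)] hom_closed[OF bD(4)] by auto
    then show "x \<in> i2 ` carrier Z" using x hom_closed[OF bD(4)] by blast
  qed (use bD(8) hom_closed[OF bD(2)] in auto)
  have "mlen Z {\<zero>\<^bsub>Z\<^esub>} (carrier Z) = mlen X {\<zero>\<^bsub>X\<^esub>} ?K"
  proof (rule len_map[OF Z X, where f = i2])
    show "{\<zero>\<^bsub>Z\<^esub>} = {x \<in> carrier Z. i2 x \<in> {\<zero>\<^bsub>X\<^esub>}}"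
    proof (intro equalityI subsetI)
      fix x assume "x \<in> {x \<in> carrier Z. i2 x \<in> {\<zero>\<^bsub>X\<^esub>}}"
      then show "x \<in> {\<zero>\<^bsub>Z\<^esub>}" using bD(7)[of x] hom_simps(4)[OF bD(4) X Z] by simp
    qed (use hom_simps(4)[OF bD(2) Z X] Z in simp)
    show "submod X ?K" by (rule ker_submod[OF X Y bD(3)])
    show "{\<zero>\<^bsub>X\<^esub>} \<subseteq> ?K" using X hom_simps(4)[OF bD(3) X Y] by auto
  qed (use bD Z X K in auto)
  then show ?thesis using len_hom[OF X Y bD(3)] im by (simp add: add.commute)
qed

lemma tlen_zero_iff: "lm X \<Longrightarrow> tlen X = 0 \<longleftrightarrow> carrier X = {\<zero>\<^bsub>X\<^esub>}"
  using len_eq_0_iff[of X "{\<zero>\<^bsub>X\<^esub>}" "carrier X"] by auto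

end

text \<open>The element type is one over which every finitely generated module has a copy, so
  biproducts of objects of \<open>\<E>\<close> can again be formed over it.\<close>

locale resolving_setup = artin_setup R \<Lambda>
  for R :: "'r ring" and \<Lambda> :: "('r, 'a) module" +
  fixes \<E> :: "('a, (nat \<Rightarrow> 'a) set) module set"
  assumes res: "resolving \<Lambda> \<E>"
begin

lemma add_sub: "additive_subcategory \<Lambda> \<E>"
  using res unfolding resolving_def by blast

lemma E_Mo: "X \<in> \<E> \<Longrightarrow> X \<in> Mo"
  using add_sub unfolding additive_subcategory_def by blast

lemma E_lm [simp]: "X \<in> \<E> \<Longrightarrow> lm X"
  using E_Mo Mo_lm by blast

lemma E_direct_sum: "\<lbrakk>set Xs \<subseteq> \<E>; X \<in> Mo; direct_sum \<Lambda> X Xs\<rbrakk> \<Longrightarrow> X \<in> \<E>"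
  using add_sub unfolding additive_subcategory_def by blast

lemma E_ext: "\<lbrakk>X \<in> \<E>; Y \<in> Mo; Z \<in> \<E>; short_exact \<Lambda> X f Y g Z\<rbrakk> \<Longrightarrow> Y \<in> \<E>"
  using res unfolding resolving_def by blast

lemma E_ker: "\<lbrakk>X \<in> Mo; Y \<in> \<E>; Z \<in> \<E>; short_exact \<Lambda> X f Y g Z\<rbrakk> \<Longrightarrow> X \<in> \<E>"
  using res unfolding resolving_def by blast

lemma E_bip:
  assumes "X \<in> Mo" "Y \<in> \<E>" "Z \<in> \<E>" "bip X Y Z i1 i2 p1 p2" shows "X \<in> \<E>"
proof -
  have "direct_sum \<Lambda> X [Y, Z]"
    using direct_sum_pair[of X Y Z] assms by auto
  then show ?thesis using E_direct_sum[of "[Y, Z]" X] assms by simp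
qed

lemma E_retr:
  assumes Y: "Y \<in> \<E>" and X: "X \<in> Mo" and r: "retr X Y" shows "X \<in> \<E>"
proof -
  have l: "lm X" "lm Y" using X Y by simp_all
  obtain U i1 i2 p1 p2 where U: "submod Y U" "bip Y X (Y\<lparr>carrier := U\<rparr>) i1 i2 p1 p2"
    by (rule retr_bip[OF l(2,1) r])
  have UM: "Y\<lparr>carrier := U\<rparr> \<in> Mo" by (rule sub_Mo[OF E_Mo[OF Y] U(1)])
  have "direct_sum \<Lambda> Y [X, Y\<lparr>carrier := U\<rparr>]"
    using direct_sum_pair[OF l(2,1) Mo_lm[OF UM]] U(2) by auto
  then show ?thesis using res X Y UM unfolding resolving_def by blast
qed

lemma E_zero: "\<lbrakk>X \<in> Mo; carrier X = {\<zero>\<^bsub>X\<^esub>}\<rbrakk> \<Longrightarrow> X \<in> \<E>"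
  using E_direct_sum[of "[]" X] direct_sum_Nil[of X] by simp

abbreviation indec where "indec \<equiv> indecomposable \<Lambda> \<E>"

lemma indecD:
  assumes "indec X"
  shows "X \<in> \<E>" "carrier X \<noteq> {\<zero>\<^bsub>X\<^esub>}" "X \<in> Mo" "lm X"
    "\<lbrakk>Y \<in> \<E>; Z \<in> \<E>; bip X Y Z i1 i2 p1 p2\<rbrakk> \<Longrightarrow> carrier Y = {\<zero>\<^bsub>Y\<^esub>} \<or> carrier Z = {\<zero>\<^bsub>Z\<^esub>}"
proof -
  show X: "X \<in> \<E>" and "carrier X \<noteq> {\<zero>\<^bsub>X\<^esub>}"
    using assms by (simp_all add: indecomposable_def)
  then show "X \<in> Mo" "lm X" using E_Mo by simp_all
  assume YZ: "Y \<in> \<E>" "Z \<in> \<E>" "bip X Y Z i1 i2 p1 p2"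
  then have "direct_sum \<Lambda> X [Y, Z]"
    using direct_sum_pair[of X Y Z] X by auto
  then show "carrier Y = {\<zero>\<^bsub>Y\<^esub>} \<or> carrier Z = {\<zero>\<^bsub>Z\<^esub>}"
    using assms YZ unfolding indecomposable_def by blast
qed

text \<open>By Fitting's lemma the kernel of a power of e is a direct summand, and summands of X
  again lie in \<open>\<E>\<close>; so the kernel is 0 or X. In the first case e is injective, hence
  invertible. In the second e is nilpotent and has no nonzero fixed point. This is locality of the
  endomorphism ring, in the form matching \<open>radical_iff\<close>.\<close>

lemma indec_local:
  assumes W: "indec X" and e: "e \<in> Hom X X"
  shows "e \<in> lin_iso \<Lambda> X X \<or> (\<forall>x\<in>carrier X. e x = x \<longrightarrow> x = \<zero>\<^bsub>X\<^esub>)"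
proof -
  note X = indecD(3,4)[OF W]
  note fin = Mo_fin(1)[OF X(1)]
  obtain f n where f: "f \<in> Hom X X" "\<forall>x\<in>carrier X. f x = (e ^^ n) x" "0 < n"
    "retr (X\<lparr>carrier := f ` carrier X\<rparr>) X"
    "retr (X\<lparr>carrier := {x \<in> carrier X. f x = \<zero>\<^bsub>X\<^esub>}\<rparr>) X"
    by (rule fitting[OF X(2) fin e])
  define K where "K = {x \<in> carrier X. f x = \<zero>\<^bsub>X\<^esub>}"
  have K: "submod X K" unfolding K_def by (rule ker_submod[OF X(2,2) f(1)])
  let ?K = "X\<lparr>carrier := K\<rparr>"
  have KM: "?K \<in> Mo" by (rule sub_Mo[OF X(1) K])
  have r: "retr ?K X" using f(5) by (simp add: K_def)
  have KE: "?K \<in> \<E>" by (rule E_retr[OF indecD(1)[OF W] KM r])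
  obtain U i1 i2 p1 p2 where U: "submod X U" "bip X ?K (X\<lparr>carrier := U\<rparr>) i1 i2 p1 p2"
    by (rule retr_bip[OF X(2) Mo_lm[OF KM] r])
  let ?U = "X\<lparr>carrier := U\<rparr>"
  have UM: "?U \<in> Mo" by (rule sub_Mo[OF X(1) U(1)])
  have UE: "?U \<in> \<E>"
    by (rule E_retr[OF indecD(1)[OF W] UM bip_retr[OF bip_sym[OF X(2) U(2)]]])
  consider "carrier ?K = {\<zero>\<^bsub>?K\<^esub>}" | "carrier ?U = {\<zero>\<^bsub>?U\<^esub>}"
    using indecD(5)[OF W KE UE U(2)] by blast
  then show ?thesis
  proof cases
    case 1
    have "x = \<zero>\<^bsub>X\<^esub>" if x: "x \<in> carrier X" "e x = \<zero>\<^bsub>X\<^esub>" for x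
    proof -
      have ez: "(e ^^ m) \<zero>\<^bsub>X\<^esub> = \<zero>\<^bsub>X\<^esub>" for m
        by (rule funpow_fixed) (use hom_simps(4)[OF e X(2,2)] in simp)
      obtain m where "n = Suc m" using f(3) by (cases n) auto
      then have "f x = (e ^^ m) (e x)" using f(2) x(1) by (simp add: funpow_swap1)
      then have "f x = \<zero>\<^bsub>X\<^esub>" using x ez by simp
      then have "x \<in> K" using x by (simp add: K_def)
      then show ?thesis using 1 by simp
    qed
    then have "e \<in> lin_iso \<Lambda> X X" by (intro inj_endo_surj[OF X(2) e fin])
    then show ?thesis ..
  next
    case 2
    have "tlen ?U = 0" using tlen_zero_iff[OF Mo_lm[OF UM]] 2 by simp
    then have "tlen X = tlen ?K" using tlen_bip[OF X(2) Mo_lm[OF KM] Mo_lm[OF UM] U(2)] by simp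
    also have "\<dots> = mlen X {\<zero>\<^bsub>X\<^esub>} K"
      using len_restrict[OF X(2) K submod_zero[OF X(2)]] submodD(2)[OF K] by simp
    finally have "mlen X {\<zero>\<^bsub>X\<^esub>} K = tlen X" ..
    moreover have Kc: "K \<subseteq> carrier X" by (auto simp: K_def)
    have "tlen X = mlen X {\<zero>\<^bsub>X\<^esub>} K + mlen X K (carrier X)"
      by (rule len_add[OF X(2) submod_zero[OF X(2)] K submod_carrier[OF X(2)] _ Kc])
        (use submodD(2)[OF K] in simp)
    ultimately have "mlen X K (carrier X) = 0" using fin enat_add_le_imp by metis
    then have "K = carrier X" using len_eq_0_iff[OF X(2) K submod_carrier[OF X(2)] Kc] by simp
    moreover have "f x = x" if "x \<in> carrier X" "e x = x" for x
      using f(2) that(1) funpow_fixed[of e x n] that(2) by simp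
    ultimately show ?thesis unfolding K_def by auto
  qed
qed

text \<open>Failure of the radical condition gives g such that g h has a nonzero fixed point. By
  \<open>indec_local\<close> the endomorphism g h is invertible, and its inverse turns g into a
  retraction of h.\<close>

lemma nonradical_split_mono:
  assumes W: "indec W" and X: "X \<in> Mo" and h: "h \<in> Hom W X" "h \<notin> radical \<Lambda> W X"
  obtains g where "g \<in> Hom X W" "\<forall>w\<in>carrier W. g (h w) = w"
proof -
  note l = indecD(4)[OF W] Mo_lm[OF X]
  obtain g w where g: "g \<in> Hom X W" "w \<in> carrier W" "g (h w) = w" "w \<noteq> \<zero>\<^bsub>W\<^esub>"
    using h radical_iff[OF indecD(3)[OF W] X] by auto
  let ?e = "compose (carrier W) g h"
  have e: "?e \<in> Hom W W" by (rule compose_hom[OF h(1) g(1) l(1)])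
  have ei: "?e \<in> lin_iso \<Lambda> W W" using indec_local[OF W e] g by auto
  obtain u where u: "u \<in> lin_iso \<Lambda> W W" "\<And>w. w \<in> carrier W \<Longrightarrow> u (?e w) = w"
    "\<And>w. w \<in> carrier W \<Longrightarrow> ?e (u w) = w"
    by (rule lin_iso_inv[OF l(1,1) ei]) (rule that; blast)
  have uH: "u \<in> Hom W W" using u(1) by (simp add: lin_iso_def)
  show thesis
    by (rule that[OF compose_hom[OF g(1) uH l(2)]]) (use u(2) hom_closed[OF h(1)] in auto)
qed

text \<open>As in the split mono case, with h g in place of g h: if g h fixes x, then h g fixes h x,
  and h x is nonzero.\<close>

lemma nonradical_split_epi:
  assumes Z: "indec Z" and X: "X \<in> Mo" and h: "h \<in> Hom X Z" "h \<notin> radical \<Lambda> X Z"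
  obtains s where "s \<in> Hom Z X" "\<forall>z\<in>carrier Z. h (s z) = z"
proof -
  note l = indecD(4)[OF Z] Mo_lm[OF X]
  obtain g x where g: "g \<in> Hom Z X" "x \<in> carrier X" "g (h x) = x" "x \<noteq> \<zero>\<^bsub>X\<^esub>"
    using h radical_iff[OF X indecD(3)[OF Z]] by auto
  let ?e = "compose (carrier Z) h g"
  have e: "?e \<in> Hom Z Z" by (rule compose_hom[OF g(1) h(1) l(1)])
  have hx: "h x \<in> carrier Z" by (rule hom_closed[OF h(1) g(2)])
  have "?e (h x) = h x" using g hx by simp
  moreover have "h x \<noteq> \<zero>\<^bsub>Z\<^esub>" using g hom_simps(4)[OF g(1) l] by auto
  ultimately have ei: "?e \<in> lin_iso \<Lambda> Z Z" using indec_local[OF Z e] hx by auto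
  obtain u where u: "u \<in> lin_iso \<Lambda> Z Z" "\<And>z. z \<in> carrier Z \<Longrightarrow> u (?e z) = z"
    "\<And>z. z \<in> carrier Z \<Longrightarrow> ?e (u z) = z"
    by (rule lin_iso_inv[OF l(1,1) ei]) (rule that; blast)
  have uH: "u \<in> Hom Z Z" using u(1) by (simp add: lin_iso_def)
  have "h (compose (carrier Z) g u z) = z" if "z \<in> carrier Z" for z
    using u(3)[OF that] hom_closed[OF uH that] that by simp
  then show thesis by (intro that[OF compose_hom[OF uH g(1) l(1)]] ballI)
qed

lemma indec_nonradical_iso:
  assumes W: "indec W" and X: "indec X" and h: "h \<in> Hom W X" "h \<notin> radical \<Lambda> W X"
  shows "h \<in> lin_iso \<Lambda> W X"
proof -
  obtain g where g: "g \<in> Hom X W" "\<forall>w\<in>carrier W. g (h w) = w"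
    by (rule nonradical_split_mono[OF W indecD(3)[OF X] h])
  obtain s where s: "s \<in> Hom X W" "\<forall>z\<in>carrier X. h (s z) = z"
    by (rule nonradical_split_epi[OF X indecD(3)[OF W] h])
  have "h ` carrier W = carrier X"
  proof (intro equalityI subsetI)
    show "x \<in> h ` carrier W" if "x \<in> carrier X" for x
      by (rule rev_image_eqI[OF hom_closed[OF s(1) that]]) (simp add: s(2)[rule_format, OF that])
  qed (use hom_closed[OF h(1)] in auto)
  then show ?thesis using h(1) inj_on_inverseI[of "carrier W" g h] g by (auto simp: lin_iso_def bij_betw_def)
qed

lemma id_nonradical:
  assumes "indec W" shows "hom_id W \<notin> radical \<Lambda> W W"
proof
  note l = indecD(2,3,4)[OF assms]
  assume "hom_id W \<in> radical \<Lambda> W W"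
  note r = radicalD(2)[OF l(2,2) this id_hom[OF l(3)]]
  have "carrier W = {\<zero>\<^bsub>W\<^esub>}" using r l(3) by auto
  then show False using l(1) by simp
qed

text \<open>A nonzero retract of least length works, because a proper nonzero summand of it would be
  a shorter retract.\<close>

lemma indec_retract_ex:
  assumes X: "X \<in> \<E>" and nz: "carrier X \<noteq> {\<zero>\<^bsub>X\<^esub>}"
  obtains W where "indec W" "retr W X"
proof -
  have lX: "lm X" using X by simp
  define Q where "Q Y \<longleftrightarrow> Y \<in> Mo \<and> carrier Y \<noteq> {\<zero>\<^bsub>Y\<^esub>} \<and> retr Y X" for Y :: "('a, (nat \<Rightarrow> 'a) set) module"
  have "retr X X" unfolding retr_def using id_hom[OF lX] by (intro bexI[of _ "hom_id X"]) auto
  then have "Q X" using X nz E_Mo by (simp add: Q_def)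
  then obtain W where W: "Q W" and min: "\<And>Y. Q Y \<Longrightarrow> the_enat (tlen W) \<le> the_enat (tlen Y)"
    using ex_has_least_nat[of Q X "\<lambda>Y. the_enat (tlen Y)"] by metis
  have WM: "W \<in> Mo" "retr W X" "carrier W \<noteq> {\<zero>\<^bsub>W\<^esub>}"
    using W by (simp_all add: Q_def)
  have WE: "W \<in> \<E>" by (rule E_retr[OF X WM(1,2)])
  have "carrier Y = {\<zero>\<^bsub>Y\<^esub>} \<or> carrier Z = {\<zero>\<^bsub>Z\<^esub>}" if YZ: "Y \<in> \<E>" "Z \<in> \<E>" "direct_sum \<Lambda> W [Y, Z]" for Y Z
  proof (rule ccontr)
    assume n: "\<not> ?thesis"
    have l: "lm Y" "lm Z" "lm W" using YZ WE by simp_all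
    obtain i1 i2 p1 p2 where b: "bip W Y Z i1 i2 p1 p2"
      using direct_sum_pair[OF l(3,1,2)] YZ(3) by auto
    have "Q Y" unfolding Q_def
      using n E_Mo[OF YZ(1)] retr_trans[OF l(1,3) lX bip_retr[OF b] WM(2)] by simp
    then have "the_enat (tlen W) \<le> the_enat (tlen Y)" by (rule min)
    moreover have "tlen W = tlen Y + tlen Z" by (rule tlen_bip[OF l(3,1,2) b])
    moreover have "tlen Z \<noteq> 0" using tlen_zero_iff[OF l(2)] n by simp
    ultimately show False using Mo_fin(1)[OF E_Mo[OF YZ(1)]] Mo_fin(1)[OF E_Mo[OF YZ(2)]]
      by (cases "tlen Y"; cases "tlen Z") (auto simp: zero_enat_def)
  qed
  then have "indec W" using WE WM(3) unfolding indecomposable_def by blast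
  then show thesis using that WM(2) by blast
qed

lemma decomposition_ex:
  "X \<in> \<E> \<Longrightarrow> \<exists>Xs. (\<forall>Y\<in>set Xs. indec Y) \<and> direct_sum \<Lambda> X Xs"
proof (induction "the_enat (tlen X)" arbitrary: X rule: less_induct)
  case less
  have lX: "lm X" using less.prems by simp
  show ?case
  proof (cases "carrier X = {\<zero>\<^bsub>X\<^esub>}")
    case True
    then show ?thesis using direct_sum_Nil[OF lX] by (intro exI[of _ "[]"]) simp
  next
    case False
    obtain W where W: "indec W" "retr W X" by (rule indec_retract_ex[OF less.prems False])
    obtain U i1 i2 p1 p2 where U: "submod X U" "bip X W (X\<lparr>carrier := U\<rparr>) i1 i2 p1 p2"
      by (rule retr_bip[OF lX indecD(4)[OF W(1)] W(2)])
    let ?U = "X\<lparr>carrier := U\<rparr>"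
    have UM: "?U \<in> Mo" by (rule sub_Mo[OF E_Mo[OF less.prems] U(1)])
    have UE: "?U \<in> \<E>" by (rule E_retr[OF less.prems UM bip_retr[OF bip_sym[OF lX U(2)]]])
    have "tlen X = tlen W + tlen ?U" by (rule tlen_bip[OF lX indecD(4)[OF W(1)] Mo_lm[OF UM] U(2)])
    moreover have "tlen W \<noteq> 0" using tlen_zero_iff[OF indecD(4)[OF W(1)]] indecD(2)[OF W(1)] by simp
    ultimately have "the_enat (tlen ?U) < the_enat (tlen X)"
      using Mo_fin(1)[OF UM] Mo_fin(1)[OF indecD(3)[OF W(1)]]
      by (cases "tlen W"; cases "tlen ?U") (auto simp: zero_enat_def)
    then obtain Xs where Xs: "\<forall>Y\<in>set Xs. indec Y" "direct_sum \<Lambda> ?U Xs"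
      using less.hyps UE by blast
    have "direct_sum \<Lambda> X (W # Xs)"
      by (rule direct_sum_ConsI[OF lX indecD(4)[OF W(1)] Mo_lm[OF UM] _ U(2) Xs(2)])
        (use Xs(1) indecD(4) in blast)
    then show ?thesis using Xs(1) W(1) by (intro exI[of _ "W # Xs"]) simp
  qed
qed

text \<open>Up to the factor \<open>mult W W\<close> this counts how often W occurs in X. Since it
  is additive on biproducts, uniqueness in the Krull-Schmidt theorem follows without exchange
  arguments.\<close>

abbreviation mult where "mult W \<equiv> colen W (radical \<Lambda> W)"

abbreviation cls where "cls \<equiv> iso_class \<Lambda> \<E>"

lemma cls_eq_iff:
  assumes X: "X \<in> \<E>" and Y: "Y \<in> \<E>"
  shows "cls X = cls Y \<longleftrightarrow> isomorphic \<Lambda> X Y"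
proof
  show "isomorphic \<Lambda> X Y" if "cls X = cls Y"
    using that Y isomorphic_refl[of Y] by (auto simp: iso_class_def)
  assume i: "isomorphic \<Lambda> X Y"
  have "isomorphic \<Lambda> X Z \<longleftrightarrow> isomorphic \<Lambda> Y Z" if "Z \<in> \<E>" for Z
    using isomorphic_trans[of X Y Z] isomorphic_trans[of Y X Z] isomorphic_sym[of X Y] i X Y that by auto
  then show "cls X = cls Y" by (auto simp: iso_class_def)
qed

lemma mult_indec:
  assumes W: "indec W" and X: "indec X"
  shows "mult W X = (if cls X = cls W then mult W W else 0)"
proof (cases "isomorphic \<Lambda> X W")
  case True
  then show ?thesis
    using colen_iso[OF stable_radical _ _ _ True] indecD(1,3)[OF W] indecD(1,3)[OF X] cls_eq_iff by simp
next
  case False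
  note l = indecD(1,3,4)[OF W] indecD(1,3,4)[OF X]
  have "h \<in> radical \<Lambda> W X" if "h \<in> Hom W X" for h
    using indec_nonradical_iso[OF W X that] False isomorphic_sym[OF l(3,6)] by (auto simp: isomorphic_def)
  then have "radical \<Lambda> W X = Hom W X" by (auto simp: radical_def)
  then have "mult W X = 0"
    using R.len_eq_0_iff[OF hom_mod_lm[OF l(3,6)] radical_submod[OF l(2,5)], of "Hom W X"]
      R.submod_carrier[OF hom_mod_lm[OF l(3,6)]] by (simp add: colen_def)
  then show ?thesis using False cls_eq_iff l by simp
qed

text \<open>The identity of an indecomposable module is not radical. Positivity and finiteness allow
  the factor \<open>mult W W\<close> to be cancelled.\<close>

lemma mult_self:
  assumes W: "indec W"
  obtains d where "mult W W = enat d" "0 < d"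
proof -
  note l = indecD(3,4)[OF W]
  have "radical \<Lambda> W W \<noteq> Hom W W" using id_nonradical[OF W] id_hom[OF l(2)] by auto
  then have "mult W W \<noteq> 0"
    using R.len_eq_0_iff[OF hom_mod_lm[OF l(2,2)] radical_submod[OF l(1,1)], of "Hom W W"]
      R.submod_carrier[OF hom_mod_lm[OF l(2,2)]] R.submodD(1)[OF radical_submod[OF l(1,1)]]
    by (auto simp: colen_def)
  moreover have "mult W W \<noteq> \<infinity>" by (rule colen_fin[OF stable_radical[OF l(1)] l(1,1)])
  ultimately show thesis using that by (cases "mult W W") (auto simp: zero_enat_def)
qed

definition k0 where "k0 Xs = (\<Sum>Y\<leftarrow>Xs. frag_of (cls Y))"

lemma lookup_k0:
  "Poly_Mapping.lookup (k0 Xs) s = int (length (filter (\<lambda>Y. cls Y = s) Xs))"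
  by (induction Xs) (auto simp: k0_def lookup_add lookup_single when_def)

lemma mult_decomposition:
  assumes X: "X \<in> \<E>" and W: "indec W" and Xs: "\<forall>Y\<in>set Xs. indec Y" and ds: "direct_sum \<Lambda> X Xs"
  shows "mult W X = enat (nat (Poly_Mapping.lookup (k0 Xs) (cls W))) * mult W W"
proof -
  have "mult W X = (\<Sum>Y\<leftarrow>Xs. mult W Y)"
    by (rule colen_direct_sum[OF stable_radical[OF indecD(3)[OF W]] indecD(3)[OF W] E_Mo[OF X] _ ds])
      (use Xs indecD(3) in auto)
  also have "\<dots> = (\<Sum>Y\<leftarrow>Xs. if cls Y = cls W then mult W W else 0)"
    using Xs mult_indec[OF W] by (intro arg_cong[of _ _ sum_list] map_cong) auto
  also have "\<dots> = enat (length (filter (\<lambda>Y. cls Y = cls W) Xs)) * mult W W"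
    by (induction Xs) (auto simp: zero_enat_def[symmetric] eSuc_enat[symmetric] mult_eSuc)
  finally show ?thesis by (simp add: lookup_k0)
qed

text \<open>By \<open>mult_decomposition\<close> the coefficient at the class of W, multiplied by
  \<open>mult W W\<close>, equals \<open>mult W X\<close>, which does not refer to a decomposition.
  This justifies the definite description in \<open>K0_class\<close>.\<close>

lemma k0_unique:
  assumes X: "X \<in> \<E>" and Xs: "\<forall>Y\<in>set Xs. indec Y" "direct_sum \<Lambda> X Xs"
    and Ys: "\<forall>Y\<in>set Ys. indec Y" "direct_sum \<Lambda> X Ys"
  shows "k0 Xs = k0 Ys"
proof (rule poly_mapping_eqI)
  fix s
  show "Poly_Mapping.lookup (k0 Xs) s = Poly_Mapping.lookup (k0 Ys) s"
  proof (cases "\<exists>W. indec W \<and> s = cls W")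
    case True
    then obtain W where W: "indec W" "s = cls W" by blast
    obtain d where d: "mult W W = enat d" "0 < d" by (rule mult_self[OF W(1)])
    have "enat (nat (Poly_Mapping.lookup (k0 Xs) s)) * enat d = enat (nat (Poly_Mapping.lookup (k0 Ys) s)) * enat d"
      using mult_decomposition[OF X W(1) Xs] mult_decomposition[OF X W(1) Ys] W(2) d by simp
    then show ?thesis using d(2) by (simp add: lookup_k0)
  next
    case False
    then have "filter (\<lambda>Y. cls Y = s) Xs = []" "filter (\<lambda>Y. cls Y = s) Ys = []"
      using Xs(1) Ys(1) by (auto simp: filter_empty_conv)
    then show ?thesis by (simp add: lookup_k0)
  qed
qed

abbreviation K0 where "K0 \<equiv> K0_class \<Lambda> \<E>"

lemma K0_eq:
  assumes X: "X \<in> \<E>" and Xs: "\<forall>Y\<in>set Xs. indec Y" "direct_sum \<Lambda> X Xs"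
  shows "K0 X = k0 Xs"
  unfolding K0_class_def
proof (rule the_equality)
  show "\<exists>Xs'. (\<forall>Y \<in> set Xs'. indec Y) \<and> direct_sum \<Lambda> X Xs' \<and> k0 Xs = (\<Sum>Y\<leftarrow>Xs'. frag_of (cls Y))"
    using Xs by (intro exI[of _ Xs]) (simp add: k0_def)
  show "c = k0 Xs" if "\<exists>Xs'. (\<forall>Y \<in> set Xs'. indec Y) \<and> direct_sum \<Lambda> X Xs' \<and> c = (\<Sum>Y\<leftarrow>Xs'. frag_of (cls Y))" for c
    using that k0_unique[OF X _ _ Xs] unfolding k0_def by blast
qed

lemma K0_lookup:
  assumes X: "X \<in> \<E>" and W: "indec W"
  shows "mult W X = enat (nat (Poly_Mapping.lookup (K0 X) (cls W))) * mult W W"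
    "0 \<le> Poly_Mapping.lookup (K0 X) s"
  using decomposition_ex[OF X] K0_eq[OF X] mult_decomposition[OF X W] lookup_k0 by auto

lemma K0_keys:
  assumes X: "X \<in> \<E>" and s: "s \<notin> cls ` {W. indec W}"
  shows "Poly_Mapping.lookup (K0 X) s = 0"
proof -
  obtain Xs where Xs: "\<forall>Y\<in>set Xs. indec Y" "direct_sum \<Lambda> X Xs"
    using decomposition_ex[OF X] by blast
  have "filter (\<lambda>Y. cls Y = s) Xs = []" using Xs(1) s by (auto simp: filter_empty_conv)
  then show ?thesis using K0_eq[OF X Xs] by (simp add: lookup_k0)
qed

text \<open>Coefficients are compared through the additivity of \<open>mult\<close>, which avoids
  concatenating decompositions. Away from the classes of indecomposables all coefficients are
  0.\<close>

lemma K0_bip: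
  assumes X: "X \<in> \<E>" and Y: "Y \<in> \<E>" and Z: "Z \<in> \<E>" and b: "bip X Y Z i1 i2 p1 p2"
  shows "K0 X = K0 Y + K0 Z"
proof (rule poly_mapping_eqI)
  fix s
  show "Poly_Mapping.lookup (K0 X) s = Poly_Mapping.lookup (K0 Y + K0 Z) s"
  proof (cases "s \<in> cls ` {W. indec W}")
    case True
    then obtain W where W: "indec W" "s = cls W" by blast
    obtain d where d: "mult W W = enat d" "0 < d" by (rule mult_self[OF W(1)])
    have "mult W X = mult W Y + mult W Z"
      by (rule colen_bip[OF stable_radical[OF indecD(3)[OF W(1)]] indecD(3)[OF W(1)] E_Mo[OF X] E_Mo[OF Y] E_Mo[OF Z] b])
    then have "nat (Poly_Mapping.lookup (K0 X) s) * d
        = nat (Poly_Mapping.lookup (K0 Y) s) * d + nat (Poly_Mapping.lookup (K0 Z) s) * d"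
      using K0_lookup(1)[OF X W(1)] K0_lookup(1)[OF Y W(1)] K0_lookup(1)[OF Z W(1)] d W(2) by simp
    then have "nat (Poly_Mapping.lookup (K0 X) s)
        = nat (Poly_Mapping.lookup (K0 Y) s) + nat (Poly_Mapping.lookup (K0 Z) s)"
      using d(2) by (simp flip: add_mult_distrib)
    then show ?thesis
      using K0_lookup(2)[OF X W(1), of s] K0_lookup(2)[OF Y W(1), of s] K0_lookup(2)[OF Z W(1), of s]
      by (simp add: lookup_add)
  qed (use K0_keys X Y Z in \<open>simp add: lookup_add\<close>)
qed

lemma K0_zero:
  assumes X: "X \<in> \<E>" "carrier X = {\<zero>\<^bsub>X\<^esub>}" shows "K0 X = 0"
  using K0_eq[OF X(1), of "[]"] direct_sum_Nil[of X] X by (simp add: k0_def)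

lemma K0_iso:
  assumes X: "X \<in> \<E>" and Y: "Y \<in> \<E>" and g: "g \<in> lin_iso \<Lambda> X Y"
  shows "K0 X = K0 Y"
proof -
  let ?Z = "X\<lparr>carrier := {\<zero>\<^bsub>X\<^esub>}\<rparr>"
  have Z: "?Z \<in> Mo" using sub_Mo[OF E_Mo[OF X]] X by simp
  have ZE: "?Z \<in> \<E>" using E_zero[OF Z] by simp
  obtain i1 i2 p1 p2 where "bip X Y ?Z i1 i2 p1 p2"
    by (rule bip_zero[OF E_lm[OF X] E_lm[OF Y] Mo_lm[OF Z] _ g]) simp
  then show ?thesis using K0_bip[OF X Y ZE] K0_zero[OF ZE] by simp
qed

end

section \<open>Short exact sequences\<close>

context mod_base
begin

lemma ker_lift:
  assumes W: "lm W" and X: "lm X" and Y: "lm Y" and f: "f \<in> lin_hom A X Y" "inj_on f (carrier X)"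
    and h: "h \<in> lin_hom A W Y" and im: "\<And>w. w \<in> carrier W \<Longrightarrow> h w \<in> f ` carrier X"
  obtains k where "k \<in> lin_hom A W X" "\<forall>w\<in>carrier W. f (k w) = h w"
proof -
  note fs = hom_simps[OF f(1) X Y] and hs = hom_simps[OF h W Y]
  define k where "k w = inv_into (carrier X) f (h w)" for w
  have k: "k w \<in> carrier X" "f (k w) = h w" if "w \<in> carrier W" for w
    using im[OF that] by (simp_all add: k_def inv_into_into f_inv_into_f)
  have inj: "x = y" if "x \<in> carrier X" "y \<in> carrier X" "f x = f y" for x y
    using f(2) that by (simp add: inj_on_eq_iff)
  have "(\<lambda>w\<in>carrier W. k w) \<in> lin_hom A W X"
  proof (rule lin_homI)
    show "k (w \<oplus>\<^bsub>W\<^esub> v) = k w \<oplus>\<^bsub>X\<^esub> k v" if "w \<in> carrier W" "v \<in> carrier W" for w v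
      by (rule inj) (use that k fs hs W X in auto)
    show "k (a \<odot>\<^bsub>W\<^esub> w) = a \<odot>\<^bsub>X\<^esub> k w" if "a \<in> carrier A" "w \<in> carrier W" for a w
      by (rule inj) (use that k fs hs W X in auto)
  qed (use k W in auto)
  then show thesis by (rule that) (simp add: k)
qed

lemma coker_factor:
  assumes B: "lm B" and Q: "lm Q" and Z: "lm Z" and \<pi>: "\<pi> \<in> lin_hom A B Q" "\<pi> ` carrier B = carrier Q"
    and r: "r \<in> lin_hom A B Z" and ker: "\<And>b. \<lbrakk>b \<in> carrier B; \<pi> b = \<zero>\<^bsub>Q\<^esub>\<rbrakk> \<Longrightarrow> r b = \<zero>\<^bsub>Z\<^esub>"
  obtains q where "q \<in> lin_hom A Q Z" "\<forall>b\<in>carrier B. q (\<pi> b) = r b"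
proof -
  note ps = hom_simps[OF \<pi>(1) B Q] and rs = hom_simps[OF r B Z]
  define c where "c u = inv_into (carrier B) \<pi> u" for u
  have c: "c u \<in> carrier B" "\<pi> (c u) = u" if "u \<in> carrier Q" for u
    using that \<pi>(2) by (auto simp: c_def inv_into_into f_inv_into_f)
  have eq: "r b = r b'" if "b \<in> carrier B" "b' \<in> carrier B" "\<pi> b = \<pi> b'" for b b'
  proof -
    have "\<pi> (b \<ominus>\<^bsub>B\<^esub> b') = \<zero>\<^bsub>Q\<^esub>"
      using that ps Q lm_add(3)[OF Q] by simp
    then have "r (b \<ominus>\<^bsub>B\<^esub> b') = \<zero>\<^bsub>Z\<^esub>" using ker that B by simp
    then show ?thesis using that rs lm_minus(1)[OF Z, of "r b" "r b'"] by simp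
  qed
  have "(\<lambda>u\<in>carrier Q. r (c u)) \<in> lin_hom A Q Z"
  proof (rule lin_homI)
    show "r (c (u \<oplus>\<^bsub>Q\<^esub> v)) = r (c u) \<oplus>\<^bsub>Z\<^esub> r (c v)" if "u \<in> carrier Q" "v \<in> carrier Q" for u v
      using eq[of "c (u \<oplus>\<^bsub>Q\<^esub> v)" "c u \<oplus>\<^bsub>B\<^esub> c v"] that c ps rs B Q by simp
    show "r (c (a \<odot>\<^bsub>Q\<^esub> u)) = a \<odot>\<^bsub>Z\<^esub> r (c u)" if "a \<in> carrier A" "u \<in> carrier Q" for a u
      using eq[of "c (a \<odot>\<^bsub>Q\<^esub> u)" "a \<odot>\<^bsub>B\<^esub> c u"] that c ps rs B Q by simp
  qed (use c rs Q in auto)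
  moreover have "\<forall>b\<in>carrier B. (\<lambda>u\<in>carrier Q. r (c u)) (\<pi> b) = r b"
  proof
    fix b assume b: "b \<in> carrier B"
    note pb = ps(1)[OF b]
    show "(\<lambda>u\<in>carrier Q. r (c u)) (\<pi> b) = r b" using eq[OF c(1)[OF pb] b c(2)[OF pb]] pb by simp
  qed
  ultimately show thesis by (rule that)
qed

text \<open>Serves to identify a kernel, computed as a concrete submodule, with the given first term
  of a conflation.\<close>

lemma iso_same_image:
  assumes X: "lm X" and K: "lm K" and Y: "lm Y" and f: "f \<in> lin_hom A X Y" "inj_on f (carrier X)"
    and h: "h \<in> lin_hom A K Y" "inj_on h (carrier K)" and im: "f ` carrier X = h ` carrier K"
  obtains k where "k \<in> lin_iso A K X"
proof -
  have i1: "h x \<in> f ` carrier X" if "x \<in> carrier K" for x using im that by blast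
  obtain k where k: "k \<in> lin_hom A K X" "\<forall>w\<in>carrier K. f (k w) = h w"
    by (rule ker_lift[OF K X Y f h(1) i1])
  have "inj_on k (carrier K)" using k(2) h(2) by (metis inj_onD inj_onI)
  moreover have "k ` carrier K = carrier X"
  proof (intro equalityI subsetI)
    fix x assume x: "x \<in> carrier X"
    then obtain u where u: "u \<in> carrier K" "f x = h u" using im by blast
    then have "f (k u) = f x" using k(2) by simp
    then have "k u = x" using f(2) hom_closed[OF k(1) u(1)] x by (simp add: inj_on_eq_iff)
    then show "x \<in> k ` carrier K" using u(1) by blast
  qed (use hom_closed[OF k(1)] in auto)
  ultimately show thesis using that k(1) by (simp add: lin_iso_def bij_betw_def)
qed

lemma short_exactD:
  assumes "short_exact A X f Y g Z"
  shows "f \<in> lin_hom A X Y" "g \<in> lin_hom A Y Z" "inj_on f (carrier X)"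
    "f ` carrier X = {y \<in> carrier Y. g y = \<zero>\<^bsub>Z\<^esub>}" "g ` carrier Y = carrier Z"
    "x \<in> carrier X \<Longrightarrow> g (f x) = \<zero>\<^bsub>Z\<^esub>" "\<lbrakk>y \<in> carrier Y; g y = \<zero>\<^bsub>Z\<^esub>\<rbrakk> \<Longrightarrow> y \<in> f ` carrier X"
  using assms unfolding short_exact_def by auto

lemma short_exact_ker:
  assumes "lm Y" "lm Z" "g \<in> lin_hom A Y Z" "g ` carrier Y = carrier Z"
  defines "K \<equiv> {y \<in> carrier Y. g y = \<zero>\<^bsub>Z\<^esub>}"
  shows "submod Y K" "short_exact A (Y\<lparr>carrier := K\<rparr>) (\<lambda>x\<in>K. x) Y g Z"
proof -
  show K: "submod Y K" unfolding K_def by (rule ker_submod[OF assms(1-3)])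
  show "short_exact A (Y\<lparr>carrier := K\<rparr>) (\<lambda>x\<in>K. x) Y g Z"
    unfolding short_exact_def using incl_hom[OF assms(1) K] assms(3,4) by (auto simp: K_def inj_on_def)
qed

text \<open>The endomorphism 1 - f r of Y vanishes on the image of f, which is the kernel of g. It
  therefore factors through g, and the factor is a section.\<close>

lemma section_if_retraction:
  assumes X: "lm X" and Y: "lm Y" and Z: "lm Z" and se: "short_exact A X f Y g Z"
    and r: "r \<in> lin_hom A Y X" "\<And>x. x \<in> carrier X \<Longrightarrow> r (f x) = x"
  obtains s where "s \<in> lin_hom A Z Y" "\<forall>z\<in>carrier Z. g (s z) = z"
proof -
  note sd = short_exactD[OF se]
  note fs = hom_simps[OF sd(1) X Y] and gs = hom_simps[OF sd(2) Y Z] and rs = hom_simps[OF r(1) Y X]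
  let ?d = "hom_diff Y Y (hom_id Y) (compose (carrier Y) f r)"
  have d: "?d \<in> lin_hom A Y Y" by (rule diff_hom[OF Y Y id_hom[OF Y] compose_hom[OF r(1) sd(1) Y]])
  have ker: "?d y = \<zero>\<^bsub>Y\<^esub>" if y: "y \<in> carrier Y" "g y = \<zero>\<^bsub>Z\<^esub>" for y
  proof -
    obtain x where x: "x \<in> carrier X" "y = f x" using sd(7)[OF y] by blast
    then show ?thesis using fs r(2)[OF x(1)] lm_add(3)[OF Y] by simp
  qed
  obtain s where s: "s \<in> lin_hom A Z Y" "\<forall>y\<in>carrier Y. s (g y) = ?d y"
    by (rule coker_factor[OF Y Z Y sd(2,5) d ker])
  have "g (s z) = z" if z: "z \<in> carrier Z" for z
  proof -
    obtain y where y: "y \<in> carrier Y" "z = g y" using z sd(5) by auto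
    have "g (s z) = g (y \<ominus>\<^bsub>Y\<^esub> f (r y))" using s(2) y by simp
    also have "\<dots> = z" using y fs rs gs sd(6)[of "r y"] lm_add(4)[OF Z, of "g y"] by simp
    finally show ?thesis .
  qed
  then show thesis using that s(1) by blast
qed

end

context resolving_setup
begin

lemma conflationD:
  assumes "conflation \<Lambda> \<E> X f Y g Z"
  shows "X \<in> \<E>" "Y \<in> \<E>" "Z \<in> \<E>" "short_exact \<Lambda> X f Y g Z"
  using assms by (auto simp: conflation_def)

text \<open>The kernel of a surjection between objects of \<open>\<E>\<close> lies in
  \<open>\<E>\<close>, so the surjection is a deflation. The first term is given as a concrete
  submodule of Y, so that later arguments can compute with its elements.\<close>

lemma conflation_ker:
  assumes Y: "Y \<in> \<E>" and Z: "Z \<in> \<E>" and g: "g \<in> Hom Y Z" "g ` carrier Y = carrier Z"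
  obtains X f where "conflation \<Lambda> \<E> X f Y g Z"
    "carrier X = {y \<in> carrier Y. g y = \<zero>\<^bsub>Z\<^esub>}" "X = Y\<lparr>carrier := {y \<in> carrier Y. g y = \<zero>\<^bsub>Z\<^esub>}\<rparr>"
proof -
  have l: "lm Y" "lm Z" using Y Z by simp_all
  note k = short_exact_ker[OF l g]
  have "Y\<lparr>carrier := {y \<in> carrier Y. g y = \<zero>\<^bsub>Z\<^esub>}\<rparr> \<in> \<E>"
    by (rule E_ker[OF sub_Mo[OF E_Mo[OF Y] k(1)] Y Z k(2)])
  then show thesis using that k(2) Y Z by (simp add: conflation_def)
qed

text \<open>The map (s, f') from Y \<oplus> X' to Y' is split by (t, k), where k satisfies f' k = 1
  - s t. Its kernel is isomorphic to X, so Y \<oplus> X' is isomorphic to Y' \<oplus> X. Mutual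
  factorisation of the two deflations takes the place of projectivity in the classical
  lemma.\<close>

lemma K0_schanuel:
  assumes c: "conflation \<Lambda> \<E> X f Y g Z" and c': "conflation \<Lambda> \<E> X' f' Y' g' Z"
    and s: "s \<in> Hom Y Y'" "\<And>y. y \<in> carrier Y \<Longrightarrow> g' (s y) = g y"
    and t: "t \<in> Hom Y' Y" "\<And>y. y \<in> carrier Y' \<Longrightarrow> g (t y) = g' y"
  shows "K0 X + K0 Y' = K0 X' + K0 Y"
proof -
  note cD = conflationD[OF c] and cD' = conflationD[OF c']
  note sd = short_exactD[OF cD(4)] and sd' = short_exactD[OF cD'(4)]
  have l: "lm X" "lm Y" "lm Z" "lm X'" "lm Y'" using cD cD' by simp_all
  obtain B :: "('a, (nat \<Rightarrow> 'a) set) module" and i1 i2 p1 p2 where B: "B \<in> Mo" "bip B Y X' i1 i2 p1 p2"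
    by (rule bip_ex[OF E_Mo[OF cD(2)] E_Mo[OF cD'(1)]])
  note bD = bipD[OF B(2)]
  have lB: "lm B" using B(1) by simp
  have BE: "B \<in> \<E>" by (rule E_bip[OF B(1) cD(2) cD'(1) B(2)])
  note fs = hom_simps[OF sd(1) l(1,2)] and gs = hom_simps[OF sd(2) l(2,3)]
    and fs' = hom_simps[OF sd'(1) l(4,5)] and gs' = hom_simps[OF sd'(2) l(5,3)]
    and ss = hom_simps[OF s(1) l(2,5)] and ts = hom_simps[OF t(1) l(5,2)]
    and i1s = hom_simps[OF bD(1) l(2) lB] and i2s = hom_simps[OF bD(2) l(4) lB]
    and p1s = hom_simps[OF bD(3) lB l(2)] and p2s = hom_simps[OF bD(4) lB l(4)]
  let ?q = "hom_add B Y' (compose (carrier B) s p1) (compose (carrier B) f' p2)"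
  have q: "?q \<in> Hom B Y'"
    by (rule add_hom[OF lB l(5) compose_hom[OF bD(3) s(1) lB] compose_hom[OF bD(4) sd'(1) lB]])
  have qb: "?q b = s (p1 b) \<oplus>\<^bsub>Y'\<^esub> f' (p2 b)" if "b \<in> carrier B" for b using that by simp
  \<comment> \<open>Because g' s = g and g t = g', the endomorphism 1 - s t is killed by g' and
    lifts along f'. The lift k is the second component of the splitting.\<close>
  let ?d = "hom_diff Y' Y' (hom_id Y') (compose (carrier Y') s t)"
  have d: "?d \<in> Hom Y' Y'" by (rule diff_hom[OF l(5,5) id_hom[OF l(5)] compose_hom[OF t(1) s(1) l(5)]])
  have dim: "?d y \<in> f' ` carrier X'" if y: "y \<in> carrier Y'" for y
    by (rule sd'(7)) (use y ss ts gs' s(2) t(2) lm_add(3)[OF l(3)] l in auto)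
  obtain k where k: "k \<in> Hom Y' X'" "\<forall>y\<in>carrier Y'. f' (k y) = ?d y"
    by (rule ker_lift[OF l(5,4,5) sd'(1,3) d dim])
  let ?j = "hom_add Y' B (compose (carrier Y') i1 t) (compose (carrier Y') i2 k)"
  have j: "?j \<in> Hom Y' B"
    by (rule add_hom[OF l(5) lB compose_hom[OF t(1) bD(1) l(5)] compose_hom[OF k(1) bD(2) l(5)]])
  have qj: "?q (?j y) = y" if y: "y \<in> carrier Y'" for y
  proof -
    have c: "t y \<in> carrier Y" "k y \<in> carrier X'" using y ts hom_closed[OF k(1)] by auto
    have "p1 (?j y) = t y" "p2 (?j y) = k y"
      using y c bD(5-8) p1s p2s i1s i2s lm_add[OF l(2)] lm_add[OF l(4)] by auto
    then have "?q (?j y) = s (t y) \<oplus>\<^bsub>Y'\<^esub> (y \<ominus>\<^bsub>Y'\<^esub> s (t y))"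
      using qb[OF hom_closed[OF j y]] k(2) y by simp
    then show ?thesis using lm_minus(3)[OF l(5) y] ss c by simp
  qed
  define K where "K = {b \<in> carrier B. ?q b = \<zero>\<^bsub>Y'\<^esub>}"
  have surj: "?q ` carrier B = carrier Y'"
  proof (intro equalityI subsetI)
    show "y \<in> ?q ` carrier B" if "y \<in> carrier Y'" for y
      by (rule rev_image_eqI[OF hom_closed[OF j that]]) (simp only: qj[OF that])
  qed (use hom_closed[OF q] in auto)
  have Ks: "submod B K" unfolding K_def by (rule ker_submod[OF lB l(5) q])
  let ?K = "B\<lparr>carrier := K\<rparr>"
  have lK: "lm ?K" by (rule lm_sub[OF lB Ks])
  have KE: "?K \<in> \<E>"
    using E_ker[OF sub_Mo[OF B(1) Ks] BE cD'(2)] short_exact_ker(2)[OF lB l(5) q surj] by (simp add: K_def)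
  have "retr Y' B" unfolding retr_def using q j qj by blast
  have bK: "bip B Y' ?K ?j (\<lambda>x\<in>K. x) ?q (\<lambda>b\<in>carrier B. b \<ominus>\<^bsub>B\<^esub> ?j (?q b))"
    unfolding bip_def
  proof (intro conjI ballI)
    note js = hom_simps[OF j l(5) lB] and qs = hom_simps[OF q lB l(5)]
    have "(\<lambda>b\<in>carrier B. b \<ominus>\<^bsub>B\<^esub> compose (carrier B) ?j ?q b) \<in> Hom B B"
      by (rule minus_hom[OF lB compose_hom[OF q j lB]])
    moreover have "(\<lambda>b\<in>carrier B. b \<ominus>\<^bsub>B\<^esub> compose (carrier B) ?j ?q b) = (\<lambda>b\<in>carrier B. b \<ominus>\<^bsub>B\<^esub> ?j (?q b))"
      by (rule restrict_ext) simp
    ultimately have h: "(\<lambda>b\<in>carrier B. b \<ominus>\<^bsub>B\<^esub> ?j (?q b)) \<in> Hom B B"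
      by simp
    show r: "(\<lambda>b\<in>carrier B. b \<ominus>\<^bsub>B\<^esub> ?j (?q b)) \<in> Hom B ?K"
    proof (rule corestrict_hom[OF h])
      fix b assume b: "b \<in> carrier B"
      have "?q (b \<ominus>\<^bsub>B\<^esub> ?j (?q b)) = ?q b \<ominus>\<^bsub>Y'\<^esub> ?q (?j (?q b))"
        by (rule qs(6)[OF b js(1)[OF qs(1)[OF b]]])
      also have "\<dots> = \<zero>\<^bsub>Y'\<^esub>"
        unfolding qj[OF qs(1)[OF b]] by (rule lm_add(3)[OF l(5) qs(1)[OF b]])
      finally have "b \<ominus>\<^bsub>B\<^esub> ?j (?q b) \<in> K"
        using lm_closed(4)[OF lB b js(1)[OF qs(1)[OF b]]] unfolding K_def by blast
      then show "(\<lambda>b\<in>carrier B. b \<ominus>\<^bsub>B\<^esub> ?j (?q b)) b \<in> K"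
        using b by (simp only: restrict_apply if_True)
    qed
    show "?q (?j a) = a" if "a \<in> carrier Y'" for a by (rule qj[OF that])
    show "(\<lambda>b\<in>carrier B. b \<ominus>\<^bsub>B\<^esub> ?j (?q b)) (?j a) = \<zero>\<^bsub>?K\<^esub>" if a: "a \<in> carrier Y'" for a
    proof -
      have "?j a \<ominus>\<^bsub>B\<^esub> ?j (?q (?j a)) = \<zero>\<^bsub>B\<^esub>"
        unfolding qj[OF a] by (rule lm_add(3)[OF lB js(1)[OF a]])
      then show ?thesis using js(1)[OF a] by (simp only: restrict_apply if_True) simp
    qed
    fix b assume b: "b \<in> carrier ?K"
    then have bb: "b \<in> K" "b \<in> carrier B" "?q b = \<zero>\<^bsub>Y'\<^esub>" unfolding K_def by simp_all
    have "b \<ominus>\<^bsub>B\<^esub> ?j (?q b) = b" unfolding bb(3) js(4) by (rule lm_add(4)[OF lB bb(2)])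
    then show "(\<lambda>b\<in>carrier B. b \<ominus>\<^bsub>B\<^esub> ?j (?q b)) ((\<lambda>x\<in>K. x) b) = b"
      using bb(1,2) by (simp only: restrict_apply if_True)
    show "?q ((\<lambda>x\<in>K. x) b) = \<zero>\<^bsub>Y'\<^esub>"
      using bb(1,3) by (simp only: restrict_apply if_True)
  next
    note js = hom_simps[OF j l(5) lB] and qs = hom_simps[OF q lB l(5)]
    fix b assume b: "b \<in> carrier B"
    have "?q (b \<ominus>\<^bsub>B\<^esub> ?j (?q b)) = ?q b \<ominus>\<^bsub>Y'\<^esub> ?q (?j (?q b))"
      by (rule qs(6)[OF b js(1)[OF qs(1)[OF b]]])
    also have "\<dots> = \<zero>\<^bsub>Y'\<^esub>"
      unfolding qj[OF qs(1)[OF b]] by (rule lm_add(3)[OF l(5) qs(1)[OF b]])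
    finally have m: "b \<ominus>\<^bsub>B\<^esub> ?j (?q b) \<in> K"
      using lm_closed(4)[OF lB b js(1)[OF qs(1)[OF b]]] unfolding K_def by blast
    have "?j (?q b) \<oplus>\<^bsub>B\<^esub> (b \<ominus>\<^bsub>B\<^esub> ?j (?q b)) = b"
      by (rule lm_minus(3)[OF lB b js(1)[OF qs(1)[OF b]]])
    then show "b = ?j (?q b) \<oplus>\<^bsub>B\<^esub> (\<lambda>x\<in>K. x) ((\<lambda>b\<in>carrier B. b \<ominus>\<^bsub>B\<^esub> ?j (?q b)) b)"
      using b m by (simp only: restrict_apply if_True)
  qed (use q j incl_hom[OF lB Ks] in auto)
  have "K0 B = K0 Y' + K0 ?K" by (rule K0_bip[OF BE cD'(2) KE bK])
  moreover have "K0 B = K0 Y + K0 X'" by (rule K0_bip[OF BE cD(2) cD'(1) B(2)])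
  moreover have "K0 ?K = K0 X"
  proof -
    \<comment> \<open>A pair in the kernel K is determined by its first component y, and y occurs
      exactly when g y = 0: then s y is killed by g' and has a unique preimage under f', whose
      negative completes the pair.\<close>
    let ?h = "restrict p1 K"
    have h: "?h \<in> Hom ?K Y" by (rule restrict_hom[OF lB l(2) bD(3) Ks])
    have z: "b = \<zero>\<^bsub>B\<^esub>" if b: "b \<in> K" "p1 b = \<zero>\<^bsub>Y\<^esub>" for b
    proof -
      have bB: "b \<in> carrier B" using b(1) by (simp add: K_def)
      have "f' (p2 b) = \<zero>\<^bsub>Y'\<^esub>"
        using b qb[OF bB] ss(4) fs'(1)[OF p2s(1)[OF bB]] lm_add(1)[OF l(5)] by (simp add: K_def)
      then have "p2 b = \<zero>\<^bsub>X'\<^esub>"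
        using sd'(3) hom_inj_iff[OF l(4,5) sd'(1)] p2s(1)[OF bB] by auto
      then show ?thesis using bD(9)[OF bB] b(2) i1s(4) i2s(4) lB by simp
    qed
    have hinj: "inj_on ?h (carrier ?K)" using hom_inj_iff[OF lK l(2) h] z by auto
    have im: "f ` carrier X = ?h ` carrier ?K"
    proof (intro equalityI subsetI)
      fix y assume "y \<in> f ` carrier X"
      then have y: "y \<in> carrier Y" "g y = \<zero>\<^bsub>Z\<^esub>" using sd(4) by auto
      then have "s y \<in> f' ` carrier X'" using sd'(7)[of "s y"] ss s(2) by simp
      then obtain x where x: "x \<in> carrier X'" "s y = f' x" by blast
      let ?b = "i1 y \<oplus>\<^bsub>B\<^esub> i2 (\<ominus>\<^bsub>X'\<^esub> x)"
      have bB: "?b \<in> carrier B" using y x i1s i2s lB l by simp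
      have pb: "p1 ?b = y" "p2 ?b = \<ominus>\<^bsub>X'\<^esub> x"
      proof -
        have v: "\<ominus>\<^bsub>X'\<^esub> x \<in> carrier X'" using x(1) l by simp
        show "p1 ?b = y" "p2 ?b = \<ominus>\<^bsub>X'\<^esub> x"
          using bD(5,6)[OF y(1)] bD(7,8)[OF v] lm_add(2)[OF l(2) y(1)] lm_add(1)[OF l(4) v]
            p1s(2)[OF i1s(1)[OF y(1)] i2s(1)[OF v]] p2s(2)[OF i1s(1)[OF y(1)] i2s(1)[OF v]] by simp_all
      qed
      have "?q ?b = s y \<oplus>\<^bsub>Y'\<^esub> f' (\<ominus>\<^bsub>X'\<^esub> x)"
        using qb[OF bB] pb by simp
      also have "\<dots> = \<zero>\<^bsub>Y'\<^esub>" using x fs' lm_add(6)[OF l(5)] by simp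
      finally have "?b \<in> K" using bB unfolding K_def by blast
      then show "y \<in> ?h ` carrier ?K" using pb(1) by (intro image_eqI[of _ _ ?b]) simp_all
    next
      fix y assume "y \<in> ?h ` carrier ?K"
      then obtain b where b: "b \<in> K" "y = p1 b" by auto
      have bB: "b \<in> carrier B" using b(1) by (simp add: K_def)
      have "?q b = \<zero>\<^bsub>Y'\<^esub>" using b(1) unfolding K_def by blast
      then have "s (p1 b) \<oplus>\<^bsub>Y'\<^esub> f' (p2 b) = \<zero>\<^bsub>Y'\<^esub>"
        by (rule trans[OF qb[OF bB, symmetric]])
      then have "g' (s (p1 b) \<oplus>\<^bsub>Y'\<^esub> f' (p2 b)) = \<zero>\<^bsub>Z\<^esub>"
        using gs'(4) by simp
      then have "g (p1 b) = \<zero>\<^bsub>Z\<^esub>"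
        using s(2) p1s(1)[OF bB] p2s(1)[OF bB] gs gs' ss fs' sd'(6) lm_add(2)[OF l(3)] by simp
      then show "y \<in> f ` carrier X" using sd(7) b(2) p1s(1)[OF bB] by simp
    qed
    obtain k where "k \<in> lin_iso \<Lambda> ?K X"
      by (rule iso_same_image[OF l(1) lK l(2) sd(1,3) h hinj im])
    then show ?thesis by (rule K0_iso[OF KE cD(1)])
  qed
  ultimately show ?thesis by (simp add: add.commute)
qed

text \<open>Q is the quotient of W \<oplus> Y by all pairs (h x, - f x). It belongs to
  \<open>\<E>\<close> because it is an extension of Z by W.\<close>

lemma pushout:
  assumes c: "conflation \<Lambda> \<E> X f Y g Z" and W: "W \<in> \<E>" and h: "h \<in> Hom X W"
  obtains Q w y q where "Q \<in> \<E>" "w \<in> Hom W Q" "y \<in> Hom Y Q" "q \<in> Hom Q Z"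
    "short_exact \<Lambda> W w Q q Z" "\<forall>x\<in>carrier X. y (f x) = w (h x)" "\<forall>u\<in>carrier Y. q (y u) = g u"
proof -
  note cD = conflationD[OF c]
  note sd = short_exactD[OF cD(4)]
  have l: "lm X" "lm Y" "lm Z" "lm W" using cD W by simp_all
  obtain B :: "('a, (nat \<Rightarrow> 'a) set) module" and i1 i2 p1 p2 where B: "B \<in> Mo" "bip B W Y i1 i2 p1 p2"
    by (rule bip_ex[OF E_Mo[OF W] E_Mo[OF cD(2)]])
  note bD = bipD[OF B(2)]
  have lB: "lm B" using B(1) by simp
  note fs = hom_simps[OF sd(1) l(1,2)] and gs = hom_simps[OF sd(2) l(2,3)] and hs = hom_simps[OF h l(1,4)]
    and i1s = hom_simps[OF bD(1) l(4) lB] and i2s = hom_simps[OF bD(2) l(2) lB]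
    and p1s = hom_simps[OF bD(3) lB l(4)] and p2s = hom_simps[OF bD(4) lB l(2)]
  let ?n = "hom_diff X B (compose (carrier X) i1 h) (compose (carrier X) i2 f)"
  have n: "?n \<in> Hom X B"
    by (rule diff_hom[OF l(1) lB compose_hom[OF h bD(1) l(1)] compose_hom[OF sd(1) bD(2) l(1)]])
  have N: "submod B (?n ` carrier X)" by (rule submod_image[OF l(1) lB n submod_carrier[OF l(1)]])
  have p2n: "p2 (?n x) = \<ominus>\<^bsub>Y\<^esub> f x" if "x \<in> carrier X" for x
    using that p2s i1s i2s hs fs bD(6,7) lm_add(9)[OF l(2)] by simp
  obtain Q :: "('a, (nat \<Rightarrow> 'a) set) module" and \<pi> where Q: "Q \<in> Mo" "\<pi> \<in> Hom B Q" "\<pi> ` carrier B = carrier Q"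
    "\<forall>b\<in>carrier B. \<pi> b = \<zero>\<^bsub>Q\<^esub> \<longleftrightarrow> b \<in> ?n ` carrier X"
    by (rule quotient_Mo[OF B(1) N])
  have lQ: "lm Q" using Q(1) by simp
  note ps = hom_simps[OF Q(2) lB lQ]
  let ?r = "compose (carrier B) g p2"
  have r: "?r \<in> Hom B Z" by (rule compose_hom[OF bD(4) sd(2) lB])
  have rker: "?r b = \<zero>\<^bsub>Z\<^esub>" if b: "b \<in> carrier B" "\<pi> b = \<zero>\<^bsub>Q\<^esub>" for b
  proof -
    obtain x where x: "x \<in> carrier X" "b = ?n x" using Q(4) b by blast
    have "?r b = g (\<ominus>\<^bsub>Y\<^esub> f x)" using b(1) p2n[OF x(1)] x(2) by (simp only: compose_apply)
    then show ?thesis using x(1) fs(1) gs(5) sd(6) lm_add(8)[OF l(3) lm_closed(1)[OF l(3)]] by simp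
  qed
  obtain q where q: "q \<in> Hom Q Z" "\<forall>b\<in>carrier B. q (\<pi> b) = ?r b"
    by (rule coker_factor[OF lB lQ l(3) Q(2,3) r rker])
  note qs = hom_simps[OF q(1) lQ l(3)]
  let ?w = "compose (carrier W) \<pi> i1" and ?y = "compose (carrier Y) \<pi> i2"
  have w: "?w \<in> Hom W Q" and y: "?y \<in> Hom Y Q"
    using compose_hom[OF bD(1) Q(2) l(4)] compose_hom[OF bD(2) Q(2) l(2)] .
  have qy: "\<forall>u\<in>carrier Y. q (?y u) = g u" using q(2) i2s bD(7) by simp
  have yf: "\<forall>x\<in>carrier X. ?y (f x) = ?w (h x)"
  proof
    fix x assume x: "x \<in> carrier X"
    have "\<pi> (?n x) = \<zero>\<^bsub>Q\<^esub>" using Q(4) hom_closed[OF n x] x by blast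
    then have "\<pi> (i1 (h x)) \<ominus>\<^bsub>Q\<^esub> \<pi> (i2 (f x)) = \<zero>\<^bsub>Q\<^esub>"
      using x i1s i2s hs fs ps by simp
    then have "\<pi> (i1 (h x)) = \<pi> (i2 (f x))"
      using lm_minus(1)[OF lQ, of "\<pi> (i1 (h x))" "\<pi> (i2 (f x))"] x i1s i2s hs fs ps by simp
    then show "?y (f x) = ?w (h x)" using x hs fs by simp
  qed
  have "short_exact \<Lambda> W ?w Q q Z"
    unfolding short_exact_def
  proof (intro conjI w q(1))
    show "inj_on ?w (carrier W)"
      unfolding hom_inj_iff[OF l(4) lQ w]
    proof (intro ballI impI)
      fix a assume a: "a \<in> carrier W" "?w a = \<zero>\<^bsub>Q\<^esub>"
      have "\<pi> (i1 a) = \<zero>\<^bsub>Q\<^esub>" using a by simp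
      then have "i1 a \<in> ?n ` carrier X" using Q(4) i1s(1)[OF a(1)] by blast
      then obtain x where x: "x \<in> carrier X" "i1 a = ?n x" by blast
      have "\<zero>\<^bsub>Y\<^esub> = \<ominus>\<^bsub>Y\<^esub> f x"
        using p2n[OF x(1)] bD(6)[OF a(1)] x(2) by simp
      then have "f x = \<zero>\<^bsub>Y\<^esub>" using lm_add(7,8)[OF l(2) fs(1)[OF x(1)]] by simp
      then have "x = \<zero>\<^bsub>X\<^esub>" using sd(3) hom_inj_iff[OF l(1,2) sd(1)] x(1) by auto
      then have "i1 a = \<zero>\<^bsub>B\<^esub>" using x(2) hom_simps(4)[OF n l(1) lB] by simp
      then show "a = \<zero>\<^bsub>W\<^esub>" using bD(5)[OF a(1)] p1s(4) by simp
    qed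
    show "q ` carrier Q = carrier Z"
    proof (intro equalityI subsetI)
      fix z assume "z \<in> carrier Z"
      then obtain u where u: "u \<in> carrier Y" "z = g u" using sd(5) by auto
      then show "z \<in> q ` carrier Q" using qy hom_closed[OF y u(1)] by (intro rev_image_eqI[of "?y u"]) auto
    qed (use qs in auto)
    show "?w ` carrier W = {u \<in> carrier Q. q u = \<zero>\<^bsub>Z\<^esub>}"
    proof (intro equalityI subsetI)
      fix u assume "u \<in> ?w ` carrier W"
      then obtain a where a: "a \<in> carrier W" "u = ?w a" by blast
      have "q u = \<zero>\<^bsub>Z\<^esub>" using a q(2) i1s(1)[OF a(1)] bD(6)[OF a(1)] gs(4) by simp
      then show "u \<in> {u \<in> carrier Q. q u = \<zero>\<^bsub>Z\<^esub>}" using a hom_closed[OF w] by blast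
    next
      fix u assume "u \<in> {u \<in> carrier Q. q u = \<zero>\<^bsub>Z\<^esub>}"
      then have uq: "u \<in> \<pi> ` carrier B" "q u = \<zero>\<^bsub>Z\<^esub>" using Q(3) by simp_all
      then obtain b where b: "b \<in> carrier B" "u = \<pi> b" by blast
      then have "g (p2 b) = \<zero>\<^bsub>Z\<^esub>" using q(2) uq(2) by simp
      then obtain x where x: "x \<in> carrier X" "p2 b = f x" using sd(7)[OF p2s(1)[OF b(1)]] by blast
      have "u = \<pi> (i1 (p1 b)) \<oplus>\<^bsub>Q\<^esub> \<pi> (i2 (p2 b))"
        using b(2) bD(9)[OF b(1)] ps(2)[OF i1s(1)[OF p1s(1)[OF b(1)]] i2s(1)[OF p2s(1)[OF b(1)]]] by simp
      also have "\<pi> (i2 (p2 b)) = \<pi> (i1 (h x))" using yf x fs hs by simp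
      also have "\<pi> (i1 (p1 b)) \<oplus>\<^bsub>Q\<^esub> \<pi> (i1 (h x)) = ?w (p1 b \<oplus>\<^bsub>W\<^esub> h x)"
        using i1s ps p1s(1)[OF b(1)] hs(1)[OF x(1)] l(4) by simp
      finally show "u \<in> ?w ` carrier W" using p1s(1)[OF b(1)] hs(1)[OF x(1)] l(4) by simp
    qed
  qed
  then show thesis
    using that[OF E_ext[OF W Q(1) cD(3)] w y q(1) _ yf qy] by blast
qed

end

section \<open>Almost split sequences\<close>

context resolving_setup
begin

text \<open>A nonsplit conflation that is almost split on the right, with no condition on its left
  end. The left conditions follow once the middle term is minimal, see
  \<open>minimal_almost_AR\<close>.\<close>

definition almost where
  "almost X f Y g Z \<longleftrightarrow> conflation \<Lambda> \<E> X f Y g Z \<and> indec Z \<and>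
    (\<forall>s\<in>Hom Z Y. \<exists>z\<in>carrier Z. g (s z) \<noteq> z) \<and>
    (\<forall>W\<in>\<E>. \<forall>h\<in>radical \<Lambda> W Z. \<exists>k\<in>Hom W Y. \<forall>w\<in>carrier W. g (k w) = h w)"

lemma almostD:
  assumes "almost X f Y g Z"
  shows "conflation \<Lambda> \<E> X f Y g Z" "indec Z" "X \<in> \<E>" "Y \<in> \<E>" "Z \<in> \<E>" "short_exact \<Lambda> X f Y g Z"
    "s \<in> Hom Z Y \<Longrightarrow> \<exists>z\<in>carrier Z. g (s z) \<noteq> z"
    "\<lbrakk>W \<in> \<E>; h \<in> radical \<Lambda> W Z\<rbrakk> \<Longrightarrow> \<exists>k\<in>Hom W Y. \<forall>w\<in>carrier W. g (k w) = h w"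
  using assms conflationD[of X f Y g Z] unfolding almost_def by simp_all

lemma nonsection_radical:
  assumes Z: "indec Z" and Y: "Y \<in> \<E>" and g: "g \<in> Hom Y Z"
    and ns: "\<And>s. s \<in> Hom Z Y \<Longrightarrow> \<exists>z\<in>carrier Z. g (s z) \<noteq> z"
  shows "g \<in> radical \<Lambda> Y Z"
proof (rule ccontr)
  assume n: "g \<notin> radical \<Lambda> Y Z"
  obtain s where "s \<in> Hom Z Y" "\<forall>z\<in>carrier Z. g (s z) = z"
    by (rule nonradical_split_epi[OF Z E_Mo[OF Y] g n])
  then show False using ns by blast
qed

text \<open>Take a middle term Y of least length. If e is an endomorphism over Z, then so is its
  Fitting power F, and the image of F is a summand of Y that carries a conflation of the same kind.
  By the choice of Y the image is no shorter than Y, so F, and with it e, is injective.\<close>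

lemma almost_minimal:
  assumes "almost X0 f0 Y0 g0 Z"
  obtains X f Y g where "almost X f Y g Z"
    "\<forall>e\<in>Hom Y Y. (\<forall>y\<in>carrier Y. g (e y) = g y) \<longrightarrow> e \<in> lin_iso \<Lambda> Y Y"
proof -
  define Q where "Q Y \<longleftrightarrow> (\<exists>X f g. almost X f Y g Z)" for Y
  have "Q Y0" using assms unfolding Q_def by blast
  then have "\<exists>Y. Q Y \<and> (\<forall>Y'. Q Y' \<longrightarrow> the_enat (tlen Y) \<le> the_enat (tlen Y'))"
    by (rule ex_has_least_nat)
  then obtain Y where Y: "Q Y" and min: "\<And>Y'. Q Y' \<Longrightarrow> the_enat (tlen Y) \<le> the_enat (tlen Y')"
    by blast
  obtain X f g where al: "almost X f Y g Z" using Y unfolding Q_def by blast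
  note aD = almostD[OF al]
  have l: "lm Y" "lm Z" using aD by simp_all
  note fin = Mo_fin(1)[OF E_Mo[OF aD(4)]]
  have gH: "g \<in> Hom Y Z" and gs: "g ` carrier Y = carrier Z" using short_exactD[OF aD(6)] by simp_all
  have "e \<in> lin_iso \<Lambda> Y Y" if e: "e \<in> Hom Y Y" "\<forall>y\<in>carrier Y. g (e y) = g y" for e
  proof -
    obtain F n where F: "F \<in> Hom Y Y" "\<forall>x\<in>carrier Y. F x = (e ^^ n) x" "0 < n"
      "retr (Y\<lparr>carrier := F ` carrier Y\<rparr>) Y"
      "retr (Y\<lparr>carrier := {x \<in> carrier Y. F x = \<zero>\<^bsub>Y\<^esub>}\<rparr>) Y"
      by (rule fitting[OF l(1) fin e(1)])
    note Fs = hom_simps[OF F(1) l(1,1)]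
    have ec: "e y \<in> carrier Y" if "y \<in> carrier Y" for y by (rule hom_closed[OF e(1) that])
    have gen: "(e ^^ m) y \<in> carrier Y \<and> g ((e ^^ m) y) = g y" if "y \<in> carrier Y" for m y
      using that by (induction m) (simp_all add: ec e(2))
    have gF: "g (F y) = g y" if "y \<in> carrier Y" for y using F(2) gen[OF that] that by simp
    let ?I = "F ` carrier Y"
    have I: "submod Y ?I" by (rule submod_image[OF l(1,1) F(1) submod_carrier[OF l(1)]])
    let ?Y = "Y\<lparr>carrier := ?I\<rparr>"
    have IE: "?Y \<in> \<E>" by (rule E_retr[OF aD(4) sub_Mo[OF E_Mo[OF aD(4)] I] F(4)])
    have Ic: "?I \<subseteq> carrier Y" using Fs(1) by auto
    let ?g = "restrict g ?I"
    have g': "?g \<in> Hom ?Y Z" by (rule restrict_hom[OF l(1,2) gH I])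
    have surj: "?g ` carrier ?Y = carrier Z"
    proof (intro equalityI subsetI)
      fix z assume "z \<in> carrier Z"
      then obtain y where y: "y \<in> carrier Y" "z = g y" using gs by auto
      then show "z \<in> ?g ` carrier ?Y" using gF[OF y(1)] by (intro rev_image_eqI[of "F y"]) auto
    qed (use hom_closed[OF g'] in auto)
    obtain X' f' where c': "conflation \<Lambda> \<E> X' f' ?Y ?g Z"
      "carrier X' = {y \<in> carrier ?Y. ?g y = \<zero>\<^bsub>Z\<^esub>}" "X' = ?Y\<lparr>carrier := {y \<in> carrier ?Y. ?g y = \<zero>\<^bsub>Z\<^esub>}\<rparr>"
      by (rule conflation_ker[OF IE aD(5) g' surj])
    have "almost X' f' ?Y ?g Z"
      unfolding almost_def
    proof (intro conjI c'(1) aD(2) ballI)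
      fix s assume s: "s \<in> Hom Z ?Y"
      have "compose (carrier Z) (\<lambda>x\<in>?I. x) s \<in> Hom Z Y"
        by (rule compose_hom[OF s incl_hom[OF l(1) I] l(2)])
      then obtain z where z: "z \<in> carrier Z" "g (compose (carrier Z) (\<lambda>x\<in>?I. x) s z) \<noteq> z"
        using aD(7) by blast
      then show "\<exists>z\<in>carrier Z. ?g (s z) \<noteq> z"
        using hom_closed[OF s z(1)] by (intro bexI[of _ z]) simp_all
    next
      fix W h assume W: "W \<in> \<E>" "h \<in> radical \<Lambda> W Z"
      obtain k where k: "k \<in> Hom W Y" "\<forall>w\<in>carrier W. g (k w) = h w" using aD(8)[OF W] by blast
      have "compose (carrier W) F k \<in> Hom W ?Y"
        by (rule corestrict_hom[OF compose_hom[OF k(1) F(1) E_lm[OF W(1)]]]) (use hom_closed[OF k(1)] in simp)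
      moreover have "?g (compose (carrier W) F k w) = h w" if "w \<in> carrier W" for w
        using that hom_closed[OF k(1) that] gF k(2) by simp
      ultimately show "\<exists>k\<in>Hom W ?Y. \<forall>w\<in>carrier W. ?g (k w) = h w" by blast
    qed
    then have "Q ?Y" unfolding Q_def by blast
    then have "the_enat (tlen Y) \<le> the_enat (tlen ?Y)" by (rule min)
    moreover have "tlen ?Y = mlen Y {\<zero>\<^bsub>Y\<^esub>} ?I"
      using len_restrict[OF l(1) I submod_zero[OF l(1)]] submodD(2)[OF I] by simp
    moreover have "tlen Y = mlen Y {\<zero>\<^bsub>Y\<^esub>} {x \<in> carrier Y. F x = \<zero>\<^bsub>Y\<^esub>} + mlen Y {\<zero>\<^bsub>Y\<^esub>} ?I"
      by (rule len_hom[OF l(1,1) F(1)])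
    ultimately have "mlen Y {\<zero>\<^bsub>Y\<^esub>} {x \<in> carrier Y. F x = \<zero>\<^bsub>Y\<^esub>} = 0"
      using fin by (cases "mlen Y {\<zero>\<^bsub>Y\<^esub>} {x \<in> carrier Y. F x = \<zero>\<^bsub>Y\<^esub>}"; cases "mlen Y {\<zero>\<^bsub>Y\<^esub>} ?I")
        (auto simp: zero_enat_def)
    then have "{x \<in> carrier Y. F x = \<zero>\<^bsub>Y\<^esub>} = {\<zero>\<^bsub>Y\<^esub>}"
      using len_eq_0_iff[OF l(1) submod_zero[OF l(1)] ker_submod[OF l(1,1) F(1)]] Fs(4) l(1) by auto
    then have Finj: "y = \<zero>\<^bsub>Y\<^esub>" if "y \<in> carrier Y" "F y = \<zero>\<^bsub>Y\<^esub>" for y using that by blast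
    show ?thesis
    proof (rule inj_endo_surj[OF l(1) e(1) fin])
      fix y assume y: "y \<in> carrier Y" "e y = \<zero>\<^bsub>Y\<^esub>"
      obtain m where m: "n = Suc m" using F(3) by (cases n) auto
      have "(e ^^ m) \<zero>\<^bsub>Y\<^esub> = \<zero>\<^bsub>Y\<^esub>"
        by (rule funpow_fixed) (rule hom_simps(4)[OF e(1) l(1,1)])
      then have "F y = \<zero>\<^bsub>Y\<^esub>" using F(2) y m by (simp add: funpow_swap1)
      then show "y = \<zero>\<^bsub>Y\<^esub>" using Finj y by blast
    qed
  qed
  then show thesis using that al by blast
qed

text \<open>Compare a morphism \<open>h\<close> out of \<open>X\<close> with \<open>f\<close> by forming the pushout of the conflation along \<open>h\<close>.\<close>

lemma almost_split_or_factor: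
  assumes al: "almost X f Y g Z"
    and min: "\<forall>e\<in>Hom Y Y. (\<forall>y\<in>carrier Y. g (e y) = g y) \<longrightarrow> e \<in> lin_iso \<Lambda> Y Y"
    and W: "W \<in> \<E>" and h: "h \<in> Hom X W"
  shows "(\<exists>k\<in>Hom Y W. \<forall>x\<in>carrier X. k (f x) = h x) \<or> (\<exists>r\<in>Hom W X. \<forall>x\<in>carrier X. r (h x) = x)"
proof -
  note aD = almostD[OF al] and sd = short_exactD[OF almostD(6)[OF al]]
  obtain Q w y q where Q: "Q \<in> \<E>" and w: "w \<in> Hom W Q" and y: "y \<in> Hom Y Q" and q: "q \<in> Hom Q Z"
    and se: "short_exact \<Lambda> W w Q q Z" and yf: "\<forall>x\<in>carrier X. y (f x) = w (h x)"
    and qy: "\<forall>u\<in>carrier Y. q (y u) = g u"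
    by (rule pushout[OF aD(1) W h])
  have l: "lm X" "lm Y" "lm Z" "lm W" "lm Q" using aD W Q by simp_all
  note sq = short_exactD[OF se]
  note fs = hom_simps[OF sd(1) l(1,2)] and gs = hom_simps[OF sd(2) l(2,3)] and hs = hom_simps[OF h l(1,4)]
    and ws = hom_simps[OF w l(4,5)] and ys = hom_simps[OF y l(2,5)] and qs = hom_simps[OF q l(5,3)]
  show ?thesis
  proof (cases "\<exists>s\<in>Hom Z Q. \<forall>z\<in>carrier Z. q (s z) = z")
    case True
    then obtain s where s: "s \<in> Hom Z Q" "\<forall>z\<in>carrier Z. q (s z) = z" by blast
    note ss = hom_simps[OF s(1) l(3,5)]
    \<comment> \<open>The section s makes the pushout split: 1 - s q takes values in the kernel of
      q, and its lift \<open>\<rho>\<close> along w is a retraction of w. Then \<open>\<rho>\<close>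
      after y extends h along f.\<close>
    let ?d = "hom_diff Q Q (hom_id Q) (compose (carrier Q) s q)"
    have d: "?d \<in> Hom Q Q" by (rule diff_hom[OF l(5,5) id_hom[OF l(5)] compose_hom[OF q s(1) l(5)]])
    have dim: "?d u \<in> w ` carrier W" if u: "u \<in> carrier Q" for u
      by (rule sq(7)) (use u ss qs s(2) lm_add(3)[OF l(3)] l in auto)
    obtain \<rho> where \<rho>: "\<rho> \<in> Hom Q W" "\<forall>u\<in>carrier Q. w (\<rho> u) = ?d u"
      by (rule ker_lift[OF l(5,4,5) w sq(3) d dim])
    have "compose (carrier Y) \<rho> y (f x) = h x" if x: "x \<in> carrier X" for x
    proof -
      have c: "y (f x) \<in> carrier Q" "f x \<in> carrier Y" "h x \<in> carrier W" using x fs ys hs by simp_all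
      have "q (y (f x)) = \<zero>\<^bsub>Z\<^esub>" using qy c(2) sd(6)[OF x] by simp
      then have "w (\<rho> (y (f x))) = y (f x)" using \<rho>(2) c ss(4) lm_add(4)[OF l(5) c(1)] by simp
      then have "w (\<rho> (y (f x))) = w (h x)" using yf x by simp
      then have "\<rho> (y (f x)) = h x"
        using sq(3) hom_closed[OF \<rho>(1) c(1)] c(3) by (simp add: inj_on_eq_iff)
      then show ?thesis using c by simp
    qed
    then show ?thesis using compose_hom[OF y \<rho>(1) l(2)] by blast
  next
    case False
    \<comment> \<open>Without a section q is radical and lifts along g to t. The endomorphism t y
      lies over Z, so it is invertible by minimality. The map r that t induces on the kernels
      therefore makes r h injective, hence invertible, and its inverse corrects r to a retraction of
      h.\<close>
    have qr: "q \<in> radical \<Lambda> Q Z"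
      by (rule nonsection_radical[OF aD(2) Q q]) (use False in blast)
    obtain t where t: "t \<in> Hom Q Y" "\<forall>u\<in>carrier Q. g (t u) = q u" using aD(8)[OF Q qr] by blast
    note ts = hom_simps[OF t(1) l(5,2)]
    let ?e = "compose (carrier Y) t y"
    have e: "?e \<in> Hom Y Y" by (rule compose_hom[OF y t(1) l(2)])
    have "?e \<in> lin_iso \<Lambda> Y Y" using min e t(2) ys qy by simp
    then have einj: "inj_on ?e (carrier Y)" by (simp add: lin_iso_def bij_betw_def)
    have tw: "compose (carrier W) t w \<in> Hom W Y" by (rule compose_hom[OF w t(1) l(4)])
    have im: "compose (carrier W) t w a \<in> f ` carrier X" if a: "a \<in> carrier W" for a
      by (rule sd(7)) (use a ws ts t(2) sq(6) in simp_all)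
    obtain r where r: "r \<in> Hom W X" "\<forall>a\<in>carrier W. f (r a) = compose (carrier W) t w a"
      by (rule ker_lift[OF l(4,1,2) sd(1,3) tw im])
    note rs = hom_simps[OF r(1) l(4,1)]
    let ?k = "compose (carrier X) r h"
    have k: "?k \<in> Hom X X" by (rule compose_hom[OF h r(1) l(1)])
    have ki: "?k \<in> lin_iso \<Lambda> X X"
    proof (rule inj_endo_surj[OF l(1) k Mo_fin(1)[OF E_Mo[OF aD(3)]]])
      fix x assume x: "x \<in> carrier X" "?k x = \<zero>\<^bsub>X\<^esub>"
      have "f (r (h x)) = ?e (f x)" using r(2) x(1) hs fs yf by simp
      then have "?e (f x) = \<zero>\<^bsub>Y\<^esub>" using x fs(4) by simp
      then have "f x = \<zero>\<^bsub>Y\<^esub>" using einj hom_inj_iff[OF l(2,2) e] fs(1)[OF x(1)] by blast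
      then show "x = \<zero>\<^bsub>X\<^esub>" using sd(3) hom_inj_iff[OF l(1,2) sd(1)] x(1) by blast
    qed
    obtain v where v: "v \<in> lin_iso \<Lambda> X X" "\<And>x. x \<in> carrier X \<Longrightarrow> v (?k x) = x"
      "\<And>x. x \<in> carrier X \<Longrightarrow> ?k (v x) = x"
      by (rule lin_iso_inv[OF l(1,1) ki]) (rule that; blast)
    have vH: "v \<in> Hom X X" using v(1) by (simp add: lin_iso_def)
    have "compose (carrier W) v r (h x) = x" if "x \<in> carrier X" for x
      using v(2)[OF that] that hs(1)[OF that] by simp
    then show ?thesis using compose_hom[OF r(1) vH l(4)] by blast
  qed
qed

lemma almost_no_retraction:
  assumes al: "almost X f Y g Z" and r: "r \<in> Hom Y X"
  shows "\<exists>x\<in>carrier X. r (f x) \<noteq> x"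
proof (rule ccontr)
  note aD = almostD[OF al]
  assume "\<not> ?thesis"
  then have rf: "r (f x) = x" if "x \<in> carrier X" for x using that by blast
  obtain s where "s \<in> Hom Z Y" "\<forall>z\<in>carrier Z. g (s z) = z"
    by (rule section_if_retraction[OF E_lm[OF aD(3)] E_lm[OF aD(4)] E_lm[OF aD(5)] aD(6) r rf])
  then show False using aD(7) by blast
qed

text \<open>The left half comes from the dichotomy \<open>almost_split_or_factor\<close>: a radical
  morphism out of the nonzero module X has no retraction, so it extends along f.\<close>

lemma minimal_almost_AR:
  assumes al: "almost X f Y g Z"
    and min: "\<forall>e\<in>Hom Y Y. (\<forall>y\<in>carrier Y. g (e y) = g y) \<longrightarrow> e \<in> lin_iso \<Lambda> Y Y"
  shows "AR_conflation \<Lambda> \<E> X f Y g Z"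
proof -
  note aD = almostD[OF al] and sd = short_exactD[OF almostD(6)[OF al]]
  have l: "lm X" "lm Y" "lm Z" using aD by simp_all
  note dich = almost_split_or_factor[OF al min]
  have nz: "carrier X \<noteq> {\<zero>\<^bsub>X\<^esub>}"
  proof
    assume z: "carrier X = {\<zero>\<^bsub>X\<^esub>}"
    obtain x where "x \<in> carrier X" "hom_zero Y X (f x) \<noteq> x"
      using almost_no_retraction[OF al zero_hom[OF l(2,1)]] by blast
    then show False using z hom_closed[OF sd(1)] by simp
  qed
  \<comment> \<open>For a decomposition of X into two nonzero summands, neither projection has a
    left inverse. Both therefore extend along f, and the extensions combine to a retraction of f,
    which would split the conflation.\<close>
  have "carrier U = {\<zero>\<^bsub>U\<^esub>} \<or> carrier V = {\<zero>\<^bsub>V\<^esub>}" if UV: "U \<in> \<E>" "V \<in> \<E>" "direct_sum \<Lambda> X [U, V]" for U V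
  proof (rule ccontr)
    assume n: "\<not> ?thesis"
    have lU: "lm U" "lm V" using UV by simp_all
    obtain i1 i2 p1 p2 where b: "bip X U V i1 i2 p1 p2"
      using direct_sum_pair[OF l(1) lU] UV(3) by auto
    note bD = bipD[OF b]
    note i1s = hom_simps[OF bD(1) lU(1) l(1)] and i2s = hom_simps[OF bD(2) lU(2) l(1)]
    have "\<not> (\<exists>r\<in>Hom U X. \<forall>x\<in>carrier X. r (p1 x) = x)"
    proof
      assume "\<exists>r\<in>Hom U X. \<forall>x\<in>carrier X. r (p1 x) = x"
      then obtain r where r: "r \<in> Hom U X" "\<forall>x\<in>carrier X. r (p1 x) = x" by blast
      have "v = \<zero>\<^bsub>V\<^esub>" if v: "v \<in> carrier V" for v
      proof -
        have "i2 v = r (p1 (i2 v))" using r(2) i2s(1)[OF v] by simp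
        also have "\<dots> = \<zero>\<^bsub>X\<^esub>"
          using bD(8)[OF v] hom_simps(4)[OF r(1) lU(1) l(1)] by simp
        finally show ?thesis using bD(7)[OF v] hom_simps(4)[OF bD(4) l(1) lU(2)] by simp
      qed
      then show False using n lU by auto
    qed
    then obtain k1 where k1: "k1 \<in> Hom Y U" "\<forall>x\<in>carrier X. k1 (f x) = p1 x"
      using dich[OF UV(1) bD(3)] by blast
    have "\<not> (\<exists>r\<in>Hom V X. \<forall>x\<in>carrier X. r (p2 x) = x)"
    proof
      assume "\<exists>r\<in>Hom V X. \<forall>x\<in>carrier X. r (p2 x) = x"
      then obtain r where r: "r \<in> Hom V X" "\<forall>x\<in>carrier X. r (p2 x) = x" by blast
      have "v = \<zero>\<^bsub>U\<^esub>" if v: "v \<in> carrier U" for v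
      proof -
        have "i1 v = r (p2 (i1 v))" using r(2) i1s(1)[OF v] by simp
        also have "\<dots> = \<zero>\<^bsub>X\<^esub>"
          using bD(6)[OF v] hom_simps(4)[OF r(1) lU(2) l(1)] by simp
        finally show ?thesis using bD(5)[OF v] hom_simps(4)[OF bD(3) l(1) lU(1)] by simp
      qed
      then show False using n lU by auto
    qed
    then obtain k2 where k2: "k2 \<in> Hom Y V" "\<forall>x\<in>carrier X. k2 (f x) = p2 x"
      using dich[OF UV(2) bD(4)] by blast
    let ?r = "hom_add Y X (compose (carrier Y) i1 k1) (compose (carrier Y) i2 k2)"
    have r: "?r \<in> Hom Y X"
      by (rule add_hom[OF l(2,1) compose_hom[OF k1(1) bD(1) l(2)] compose_hom[OF k2(1) bD(2) l(2)]])
    obtain x where "x \<in> carrier X" "?r (f x) \<noteq> x" using almost_no_retraction[OF al r] by blast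
    then show False using hom_closed[OF sd(1)] k1(2) k2(2) bD(9) by simp
  qed
  then have X: "indec X" using nz aD(3) unfolding indecomposable_def by blast
  have fr: "f \<in> radical \<Lambda> X Y"
  proof (rule ccontr)
    assume n: "f \<notin> radical \<Lambda> X Y"
    obtain r where "r \<in> Hom Y X" "\<forall>w\<in>carrier X. r (f w) = w"
      by (rule nonradical_split_mono[OF X E_Mo[OF aD(4)] sd(1) n])
    then show False using almost_no_retraction[OF al] by blast
  qed
  have gr: "g \<in> radical \<Lambda> Y Z" by (rule nonsection_radical[OF aD(2,4) sd(2) aD(7)])
  have left: "\<exists>k\<in>Hom Y W. h = compose (carrier X) k f" if W: "W \<in> \<E>" and h: "h \<in> radical \<Lambda> X W" for W h
  proof -
    note rD = radicalD[OF E_Mo[OF aD(3)] E_Mo[OF W] h]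
    have "\<not> (\<exists>r\<in>Hom W X. \<forall>x\<in>carrier X. r (h x) = x)"
    proof
      assume "\<exists>r\<in>Hom W X. \<forall>x\<in>carrier X. r (h x) = x"
      then have "\<forall>x\<in>carrier X. x = \<zero>\<^bsub>X\<^esub>" using rD(2) by blast
      then show False using nz l(1) by auto
    qed
    then obtain k where k: "k \<in> Hom Y W" "\<forall>x\<in>carrier X. k (f x) = h x"
      using dich[OF W rD(1)] by blast
    have "h = compose (carrier X) k f"
      by (rule lin_hom_eqI[OF rD(1) compose_hom[OF sd(1) k(1) l(1)]]) (simp add: k(2))
    then show ?thesis using k(1) by blast
  qed
  have right: "\<exists>k\<in>Hom W Y. h = compose (carrier W) g k" if W: "W \<in> \<E>" and h: "h \<in> radical \<Lambda> W Z" for W h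
  proof -
    obtain k where k: "k \<in> Hom W Y" "\<forall>w\<in>carrier W. g (k w) = h w" using aD(8)[OF W h] by blast
    have "h = compose (carrier W) g k"
      by (rule lin_hom_eqI[OF radicalD(1)[OF E_Mo[OF W] E_Mo[OF aD(5)] h] compose_hom[OF k(1) sd(2) E_lm[OF W]]])
        (simp add: k(2))
    then show ?thesis using k(1) by blast
  qed
  show ?thesis
    unfolding AR_conflation_def left_almost_split_def right_almost_split_def
    using aD(1,2,4) X fr gr left right by blast
qed

subsection \<open>The subgroups of the Grothendieck group\<close>

lemma K0_split_simps:
  "c \<in> carrier (K0_split \<Lambda> \<E>) \<longleftrightarrow> (\<forall>s. s \<notin> cls ` {W. indec W} \<longrightarrow> Poly_Mapping.lookup c s = 0)"
  "monoid.mult (K0_split \<Lambda> \<E>) = (+)" "\<one>\<^bsub>K0_split \<Lambda> \<E>\<^esub> = 0" "group (K0_split \<Lambda> \<E>)"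
  unfolding K0_split_def by (auto simp: free_Abelian_group_def in_keys_iff) (auto simp flip: free_Abelian_group_def)

abbreviation defect where "defect X Y Z \<equiv> K0 X - K0 Y + K0 Z"

lemma defect_carrier:
  "\<lbrakk>X \<in> \<E>; Y \<in> \<E>; Z \<in> \<E>\<rbrakk> \<Longrightarrow> defect X Y Z \<in> carrier (K0_split \<Lambda> \<E>)"
  unfolding K0_split_simps(1) using K0_keys by (simp add: lookup_add lookup_minus)

lemma AR_subgroup: "subgroup (AR_group \<Lambda> \<E>) (K0_split \<Lambda> \<E>)"
  unfolding AR_group_def
  by (rule group.generate_is_subgroup[OF K0_split_simps(4)])
    (auto simp: AR_conflation_def conflation_def intro!: defect_carrier)

lemma AR_zero: "0 \<in> AR_group \<Lambda> \<E>"
  using subgroup.one_closed[OF AR_subgroup] by (simp add: K0_split_simps)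

lemma AR_add: "\<lbrakk>a \<in> AR_group \<Lambda> \<E>; b \<in> AR_group \<Lambda> \<E>\<rbrakk> \<Longrightarrow> a + b \<in> AR_group \<Lambda> \<E>"
  using subgroup.m_closed[OF AR_subgroup] by (simp add: K0_split_simps)

text \<open>Neither the given deflation nor that of a minimal conflation with the same end splits.
  Both are thus radical and factor through each other, so Schanuel's lemma equates the two classes,
  and the minimal conflation is an AR conflation.\<close>

lemma almost_defect:
  assumes al: "almost X f Y g Z"
  shows "defect X Y Z \<in> AR_group \<Lambda> \<E>"
proof -
  obtain X' f' Y' g' where al': "almost X' f' Y' g' Z"
    and min: "\<forall>e\<in>Hom Y' Y'. (\<forall>y\<in>carrier Y'. g' (e y) = g' y) \<longrightarrow> e \<in> lin_iso \<Lambda> Y' Y'"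
    by (rule almost_minimal[OF al])
  note aD = almostD[OF al] and aD' = almostD[OF al']
  have "g \<in> radical \<Lambda> Y Z" by (rule nonsection_radical[OF aD(2,4) short_exactD(2)[OF aD(6)] aD(7)])
  then obtain s where s: "s \<in> Hom Y Y'" "\<forall>y\<in>carrier Y. g' (s y) = g y"
    using aD'(8)[OF aD(4)] by blast
  have "g' \<in> radical \<Lambda> Y' Z"
    by (rule nonsection_radical[OF aD'(2,4) short_exactD(2)[OF aD'(6)] aD'(7)])
  then obtain t where t: "t \<in> Hom Y' Y" "\<forall>y\<in>carrier Y'. g (t y) = g' y"
    using aD(8)[OF aD'(4)] by blast
  have "K0 X + K0 Y' = K0 X' + K0 Y"
    by (rule K0_schanuel[OF aD(1) aD'(1) s(1) _ t(1)]) (use s t in auto)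
  then have "K0 X = K0 X' + K0 Y - K0 Y'" by (simp add: eq_diff_eq)
  then have "defect X Y Z = defect X' Y' Z" by simp
  moreover have "defect X' Y' Z \<in> AR_group \<Lambda> \<E>"
    unfolding AR_group_def
    by (rule generate.incl) (use minimal_almost_AR[OF al' min] in blast)
  ultimately show ?thesis by simp
qed

end

section \<open>Filtrations of a representable functor\<close>

context resolving_setup
begin

text \<open>Subfunctors of the functor represented by Z, as families of subsets of Hom-sets.
  Negatives come from composition with -1, see \<open>subf_subfunctor\<close>. Filtrations of a
  quotient functor are handled as chains of such families, which avoids cosets.\<close>

definition subf :: "('a, (nat \<Rightarrow> 'a) set) module \<Rightarrow> (('a, (nat \<Rightarrow> 'a) set) module \<Rightarrow> ((nat \<Rightarrow> 'a) set \<Rightarrow> (nat \<Rightarrow> 'a) set) set) \<Rightarrow> bool" where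
  "subf Z V \<longleftrightarrow> (\<forall>U\<in>\<E>. V U \<subseteq> Hom U Z \<and> hom_zero U Z \<in> V U \<and>
    (\<forall>h\<in>V U. \<forall>k\<in>V U. hom_add U Z h k \<in> V U) \<and>
    (\<forall>U'\<in>\<E>. \<forall>k\<in>Hom U' U. \<forall>h\<in>V U. compose (carrier U') h k \<in> V U'))"

lemma subfD:
  assumes "subf Z V" "U \<in> \<E>"
  shows "h \<in> V U \<Longrightarrow> h \<in> Hom U Z" "hom_zero U Z \<in> V U" "\<lbrakk>h \<in> V U; k \<in> V U\<rbrakk> \<Longrightarrow> hom_add U Z h k \<in> V U"
    "\<lbrakk>U' \<in> \<E>; k \<in> Hom U' U; h \<in> V U\<rbrakk> \<Longrightarrow> compose (carrier U') h k \<in> V U'"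
  using assms unfolding subf_def by blast+

text \<open>The value at U of the image of the transformation induced by g; equivalently, the kernel
  of the projection from Hom(U,Z) to the cokernel functor.\<close>

definition im_f where
  "im_f Y g U = (\<lambda>k. compose (carrier U) g k) ` Hom U Y"

lemma im_f_subf:
  assumes Y: "Y \<in> \<E>" and Z: "Z \<in> \<E>" and g: "g \<in> Hom Y Z"
  shows "subf Z (im_f Y g)"
  unfolding subf_def
proof (intro ballI conjI subsetI)
  fix U assume U: "U \<in> \<E>"
  have l: "lm Y" "lm Z" "lm U" using Y Z U by simp_all
  note gs = hom_simps[OF g l(1,2)]
  show "h \<in> Hom U Z" if "h \<in> im_f Y g U" for h
    using that compose_hom[OF _ g l(3)] by (auto simp: im_f_def)
  have "hom_zero U Z = compose (carrier U) g (hom_zero U Y)"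
    by (rule lin_hom_eqI[OF zero_hom[OF l(3,2)] compose_hom[OF zero_hom[OF l(3,1)] g l(3)]]) (simp add: gs(4))
  then show "hom_zero U Z \<in> im_f Y g U" using zero_hom[OF l(3,1)] by (auto simp: im_f_def)
  fix h assume "h \<in> im_f Y g U"
  then obtain m where m: "m \<in> Hom U Y" "h = compose (carrier U) g m" by (auto simp: im_f_def)
  show "hom_add U Z h k \<in> im_f Y g U" if k: "k \<in> im_f Y g U" for k
  proof -
    obtain n where n: "n \<in> Hom U Y" "k = compose (carrier U) g n" using k by (auto simp: im_f_def)
    have s: "hom_add U Y m n \<in> Hom U Y" by (rule add_hom[OF l(3,1) m(1) n(1)])
    have "hom_add U Z h k = compose (carrier U) g (hom_add U Y m n)"
      unfolding m(2) n(2)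
      by (rule lin_hom_eqI[OF add_hom[OF l(3,2) compose_hom[OF m(1) g l(3)] compose_hom[OF n(1) g l(3)]]
        compose_hom[OF s g l(3)]]) (simp add: gs(2) hom_closed[OF m(1)] hom_closed[OF n(1)])
    then show ?thesis using s by (auto simp: im_f_def)
  qed
  show "compose (carrier U') h k \<in> im_f Y g U'" if k: "U' \<in> \<E>" "k \<in> Hom U' U" for U' k
  proof -
    have l': "lm U'" using k by simp
    have c: "compose (carrier U') m k \<in> Hom U' Y" by (rule compose_hom[OF k(2) m(1) l'])
    have "compose (carrier U') h k = compose (carrier U') g (compose (carrier U') m k)"
      unfolding m(2)
      by (rule lin_hom_eqI[OF compose_hom[OF k(2) compose_hom[OF m(1) g l(3)] l'] compose_hom[OF c g l']])
        (simp add: hom_closed[OF k(2)])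
    then show ?thesis using c by (auto simp: im_f_def)
  qed
qed

text \<open>Simplicity of the functor T/S, expressed without forming the quotient. Comparisons are
  made on objects of \<open>\<E>\<close> only, since values elsewhere carry no meaning.\<close>

definition simple_step where
  "simple_step Z S T \<longleftrightarrow> (\<forall>U\<in>\<E>. S U \<subseteq> T U) \<and> (\<exists>U\<in>\<E>. S U \<noteq> T U) \<and>
    (\<forall>V. subf Z V \<longrightarrow> (\<forall>U\<in>\<E>. S U \<subseteq> V U \<and> V U \<subseteq> T U) \<longrightarrow> (\<forall>U\<in>\<E>. V U = S U) \<or> (\<forall>U\<in>\<E>. V U = T U))"

lemma simple_stepD:
  assumes "simple_step Z S T"
  shows "U \<in> \<E> \<Longrightarrow> S U \<subseteq> T U" "\<exists>U\<in>\<E>. S U \<noteq> T U"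
    "\<lbrakk>subf Z V; \<And>U. U \<in> \<E> \<Longrightarrow> S U \<subseteq> V U; \<And>U. U \<in> \<E> \<Longrightarrow> V U \<subseteq> T U; U0 \<in> \<E>; V U0 \<noteq> S U0; U \<in> \<E>\<rbrakk> \<Longrightarrow> V U = T U"
  using assms unfolding simple_step_def by (blast, blast, metis)

text \<open>Take an object W of least length at which S and T differ. If W decomposed, a morphism in
  \<open>T W\<close> would be the sum of its components through the two shorter summands, where S
  and T agree, and so would already lie in \<open>S W\<close>.\<close>

lemma step_indecomposable:
  assumes S: "subf Z S" and T: "subf Z T" and Z: "Z \<in> \<E>" and st: "\<And>U. U \<in> \<E> \<Longrightarrow> S U \<subseteq> T U"
    and ne: "\<exists>U\<in>\<E>. S U \<noteq> T U"
  obtains W h where "indec W" "h \<in> T W" "h \<notin> S W"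
proof -
  define Q where "Q U \<longleftrightarrow> U \<in> \<E> \<and> S U \<noteq> T U" for U
  obtain U0 where "Q U0" using ne unfolding Q_def by blast
  then have "\<exists>W. Q W \<and> (\<forall>U. Q U \<longrightarrow> the_enat (tlen W) \<le> the_enat (tlen U))"
    by (rule ex_has_least_nat)
  then obtain W where W: "Q W" and min: "\<And>U. Q U \<Longrightarrow> the_enat (tlen W) \<le> the_enat (tlen U)"
    by blast
  have WE: "W \<in> \<E>" using W by (simp add: Q_def)
  have lW: "lm W" "lm Z" using WE Z by simp_all
  obtain h where h: "h \<in> T W" "h \<notin> S W" using W st[OF WE] by (auto simp: Q_def)
  have hH: "h \<in> Hom W Z" by (rule subfD(1)[OF T WE h(1)])
  have nz: "carrier W \<noteq> {\<zero>\<^bsub>W\<^esub>}"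
  proof
    assume z: "carrier W = {\<zero>\<^bsub>W\<^esub>}"
    have "h = hom_zero W Z"
      by (rule lin_hom_eqI[OF hH zero_hom[OF lW]]) (use z hom_simps(4)[OF hH lW] in simp)
    then show False using h subfD(2)[OF S WE] by simp
  qed
  have "carrier U = {\<zero>\<^bsub>U\<^esub>} \<or> carrier V = {\<zero>\<^bsub>V\<^esub>}" if UV: "U \<in> \<E>" "V \<in> \<E>" "direct_sum \<Lambda> W [U, V]" for U V
  proof (rule ccontr)
    assume n: "\<not> ?thesis"
    have lU: "lm U" "lm V" using UV by simp_all
    obtain i1 i2 p1 p2 where b: "bip W U V i1 i2 p1 p2"
      using direct_sum_pair[OF lW(1) lU] UV(3) by auto
    note bD = bipD[OF b]
    have "tlen W = tlen U + tlen V" by (rule tlen_bip[OF lW(1) lU b])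
    moreover have "tlen U \<noteq> 0" "tlen V \<noteq> 0"
      using tlen_zero_iff[OF lU(1)] tlen_zero_iff[OF lU(2)] n by auto
    ultimately have "the_enat (tlen U) < the_enat (tlen W)" "the_enat (tlen V) < the_enat (tlen W)"
      using Mo_fin(1)[OF E_Mo[OF UV(1)]] Mo_fin(1)[OF E_Mo[OF UV(2)]]
      by (cases "tlen U"; cases "tlen V"; auto simp: zero_enat_def)+
    then have "\<not> Q U" "\<not> Q V" using min by force+
    then have eq: "S U = T U" "S V = T V" using UV by (auto simp: Q_def)
    let ?h1 = "compose (carrier W) (compose (carrier U) h i1) p1" and ?h2 = "compose (carrier W) (compose (carrier V) h i2) p2"
    have m: "?h1 \<in> S W" "?h2 \<in> S W"
      using subfD(4)[OF S UV(1) WE bD(3)] subfD(4)[OF T WE UV(1) bD(1) h(1)]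
        subfD(4)[OF S UV(2) WE bD(4)] subfD(4)[OF T WE UV(2) bD(2) h(1)] eq by simp_all
    have a: "hom_add W Z ?h1 ?h2 \<in> S W" by (rule subfD(3)[OF S WE m])
    have "h = hom_add W Z ?h1 ?h2"
    proof (rule lin_hom_eqI[OF hH subfD(1)[OF S WE a]])
      fix x assume x: "x \<in> carrier W"
      have c: "p1 x \<in> carrier U" "p2 x \<in> carrier V"
        using x hom_closed[OF bD(3)] hom_closed[OF bD(4)] by blast+
      have "h x = h (i1 (p1 x) \<oplus>\<^bsub>W\<^esub> i2 (p2 x))" using bD(9)[OF x] by simp
      also have "\<dots> = h (i1 (p1 x)) \<oplus>\<^bsub>Z\<^esub> h (i2 (p2 x))"
        by (rule hom_simps(2)[OF hH lW hom_closed[OF bD(1) c(1)] hom_closed[OF bD(2) c(2)]])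
      finally show "h x = hom_add W Z ?h1 ?h2 x" using x c by simp
    qed
    then show False using a h(2) by simp
  qed
  then have "indec W" using WE nz unfolding indecomposable_def by blast
  then show thesis using h by (rule that)
qed

text \<open>The pullback \<open>P\<close> of \<open>g\<close> along \<open>h\<close> yields a conflation ending in \<open>W\<close> whose cokernel functor is
  the image of \<open>h\<close> in the first factor of the filtration.\<close>

lemma chain_step:
  assumes c: "conflation \<Lambda> \<E> X f Y g Z" and T: "subf Z T"
    and ss: "simple_step Z S T" and S: "\<And>U. U \<in> \<E> \<Longrightarrow> S U = im_f Y g U"
  obtains P fP B gB W where "conflation \<Lambda> \<E> P fP B gB Z" "\<forall>U\<in>\<E>. im_f B gB U = T U"
    "W \<in> \<E>" "defect X P W \<in> AR_group \<Lambda> \<E>" "K0 B = K0 Y + K0 W"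
proof -
  note cD = conflationD[OF c] and sd = short_exactD[OF conflationD(4)[OF c]]
  have subS: "subf Z S" using im_f_subf[OF cD(2,3) sd(2)] S unfolding subf_def by simp
  obtain W h where W: "indec W" and h: "h \<in> T W" "h \<notin> S W"
    by (rule step_indecomposable[OF subS T cD(3) simple_stepD(1,2)[OF ss]])
  note WE = indecD(1)[OF W]
  have l: "lm X" "lm Y" "lm Z" "lm W" using cD WE by simp_all
  have hH: "h \<in> Hom W Z" by (rule subfD(1)[OF T WE h(1)])
  obtain B :: "('a, (nat \<Rightarrow> 'a) set) module" and i1 i2 p1 p2 where B: "B \<in> Mo" "bip B Y W i1 i2 p1 p2"
    by (rule bip_ex[OF E_Mo[OF cD(2)] E_Mo[OF WE]])
  note bD = bipD[OF B(2)]
  have lB: "lm B" using B(1) by simp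
  have BE: "B \<in> \<E>" by (rule E_bip[OF B(1) cD(2) WE B(2)])
  note fs = hom_simps[OF sd(1) l(1,2)] and gs = hom_simps[OF sd(2) l(2,3)] and hs = hom_simps[OF hH l(4,3)]
    and i1s = hom_simps[OF bD(1) l(2) lB] and i2s = hom_simps[OF bD(2) l(4) lB]
    and p1s = hom_simps[OF bD(3) lB l(2)] and p2s = hom_simps[OF bD(4) lB l(4)]
  \<comment> \<open>The kernel P of (g, h) on Y \<oplus> W is, up to a sign, the pullback of g along
    h. It plays two roles: first term of the next conflation, with deflation g', and middle term of
    the conflation ending in W.\<close>
  define g' where "g' = hom_add B Z (compose (carrier B) g p1) (compose (carrier B) h p2)"
  have g'H: "g' \<in> Hom B Z" unfolding g'_def
    by (rule add_hom[OF lB l(3) compose_hom[OF bD(3) sd(2) lB] compose_hom[OF bD(4) hH lB]])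
  have g'v: "g' b = g (p1 b) \<oplus>\<^bsub>Z\<^esub> h (p2 b)" if "b \<in> carrier B" for b using that by (simp add: g'_def)
  have g'1: "g' (i1 y) = g y" if "y \<in> carrier Y" for y
    using that g'v[OF i1s(1)[OF that]] bD(5,6)[OF that] hs(4) gs(1) lm_add(2)[OF l(3)] by simp
  have g'2: "g' (i2 w) = h w" if "w \<in> carrier W" for w
    using that g'v[OF i2s(1)[OF that]] bD(7,8)[OF that] gs(4) hs(1) lm_add(1)[OF l(3)] by simp
  have g'surj: "g' ` carrier B = carrier Z"
  proof (intro equalityI subsetI)
    fix z assume "z \<in> carrier Z"
    then obtain y where y: "y \<in> carrier Y" "z = g y" using sd(5) by auto
    then show "z \<in> g' ` carrier B" using g'1 i1s(1) by (intro rev_image_eqI[of "i1 y"]) auto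
  qed (use hom_closed[OF g'H] in auto)
  define K where "K = {b \<in> carrier B. g' b = \<zero>\<^bsub>Z\<^esub>}"
  have Ks: "submod B K" unfolding K_def by (rule ker_submod[OF lB l(3) g'H])
  obtain P fP where P: "conflation \<Lambda> \<E> P fP B g' Z" "carrier P = K" "P = B\<lparr>carrier := K\<rparr>"
    unfolding K_def by (rule conflation_ker[OF BE cD(3) g'H g'surj])
  have PE: "P \<in> \<E>" using conflationD(1)[OF P(1)] .
  have lP: "lm P" using PE by simp
  have inclP: "(\<lambda>x\<in>K. x) \<in> Hom P B" unfolding P(3) by (rule incl_hom[OF lB Ks])
  \<comment> \<open>The image of g' lies between S and T and contains h, which is not in S.
    Simplicity of the step leaves only T.\<close>
  have imB: "\<forall>U\<in>\<E>. im_f B g' U = T U"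
  proof -
    have sub: "subf Z (im_f B g')" by (rule im_f_subf[OF BE cD(3) g'H])
    have lo: "S U \<subseteq> im_f B g' U" if U: "U \<in> \<E>" for U
    proof
      fix u assume "u \<in> S U"
      then obtain m where m: "m \<in> Hom U Y" "u = compose (carrier U) g m"
        using S[OF U] by (auto simp: im_f_def)
      have lU: "lm U" using U by simp
      have cm: "compose (carrier U) i1 m \<in> Hom U B" by (rule compose_hom[OF m(1) bD(1) lU])
      have "u = compose (carrier U) g' (compose (carrier U) i1 m)"
        unfolding m(2)
        by (rule lin_hom_eqI[OF compose_hom[OF m(1) sd(2) lU] compose_hom[OF cm g'H lU]])
          (simp add: g'1 hom_closed[OF m(1)])
      then show "u \<in> im_f B g' U" using cm by (auto simp: im_f_def)
    qed
    have up: "im_f B g' U \<subseteq> T U" if U: "U \<in> \<E>" for U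
    proof
      fix u assume "u \<in> im_f B g' U"
      then obtain m where m: "m \<in> Hom U B" "u = compose (carrier U) g' m" by (auto simp: im_f_def)
      have lU: "lm U" using U by simp
      let ?a = "compose (carrier U) g (compose (carrier U) p1 m)" and ?b = "compose (carrier U) h (compose (carrier U) p2 m)"
      have c1: "compose (carrier U) p1 m \<in> Hom U Y" and c2: "compose (carrier U) p2 m \<in> Hom U W"
        using compose_hom[OF m(1) bD(3) lU] compose_hom[OF m(1) bD(4) lU] .
      have "?a \<in> S U" using c1 S[OF U] by (auto simp: im_f_def)
      then have a: "?a \<in> T U" using simple_stepD(1)[OF ss U] by blast
      have b: "?b \<in> T U" by (rule subfD(4)[OF T WE U c2 h(1)])
      have "u = hom_add U Z ?a ?b"
        unfolding m(2)
        by (rule lin_hom_eqI[OF compose_hom[OF m(1) g'H lU] add_hom[OF lU l(3) compose_hom[OF c1 sd(2) lU] compose_hom[OF c2 hH lU]]])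
          (simp add: g'v hom_closed[OF m(1)])
      then show "u \<in> T U" using subfD(3)[OF T U a b] by simp
    qed
    have "h = compose (carrier W) g' i2"
      by (rule lin_hom_eqI[OF hH compose_hom[OF bD(2) g'H l(4)]]) (simp add: g'2)
    then have "h \<in> im_f B g' W" using bD(2) by (auto simp: im_f_def)
    then have ne: "im_f B g' W \<noteq> S W" using h(2) by auto
    show ?thesis using simple_stepD(3)[OF ss sub lo up WE ne] by blast
  qed
  let ?p = "restrict p2 K"
  have p: "?p \<in> Hom P W" unfolding P(3) by (rule restrict_hom[OF lB l(4) bD(4) Ks])
  have ptK: "i1 y \<oplus>\<^bsub>B\<^esub> i2 w \<in> K" if yw: "y \<in> carrier Y" "w \<in> carrier W" "g y \<oplus>\<^bsub>Z\<^esub> h w = \<zero>\<^bsub>Z\<^esub>" for y w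
  proof -
    have c: "i1 y \<in> carrier B" "i2 w \<in> carrier B" using yw i1s i2s by auto
    have "g' (i1 y \<oplus>\<^bsub>B\<^esub> i2 w) = \<zero>\<^bsub>Z\<^esub>"
      using hom_simps(2)[OF g'H lB l(3) c] g'1 g'2 yw by simp
    then show ?thesis using c lB by (simp add: K_def)
  qed
  have psurj: "?p ` carrier P = carrier W"
  proof (intro equalityI subsetI)
    fix w assume w: "w \<in> carrier W"
    then have "\<ominus>\<^bsub>Z\<^esub> h w \<in> carrier Z" using hs(1) l(3) by simp
    then have "\<ominus>\<^bsub>Z\<^esub> h w \<in> g ` carrier Y" using sd(5) by simp
    then obtain y where y: "y \<in> carrier Y" "g y = \<ominus>\<^bsub>Z\<^esub> h w" by auto
    have "g y \<oplus>\<^bsub>Z\<^esub> h w = \<zero>\<^bsub>Z\<^esub>"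
      using y(2) lm_add(5)[OF l(3) hs(1)[OF w]] by simp
    then have m: "i1 y \<oplus>\<^bsub>B\<^esub> i2 w \<in> K" using ptK y w by blast
    have "p2 (i1 y \<oplus>\<^bsub>B\<^esub> i2 w) = w"
      using p2s(2)[OF i1s(1)[OF y(1)] i2s(1)[OF w]] bD(6)[OF y(1)] bD(7)[OF w] lm_add(1)[OF l(4) w] by simp
    then show "w \<in> ?p ` carrier P"
      using m by (intro rev_image_eqI[of "i1 y \<oplus>\<^bsub>B\<^esub> i2 w"]) (auto simp: P(2))
  qed (use hom_closed[OF p] in blast)
  obtain X' f' where c': "conflation \<Lambda> \<E> X' f' P ?p W"
    "carrier X' = {b \<in> carrier P. ?p b = \<zero>\<^bsub>W\<^esub>}" "X' = P\<lparr>carrier := {b \<in> carrier P. ?p b = \<zero>\<^bsub>W\<^esub>}\<rparr>"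
    by (rule conflation_ker[OF PE WE p psurj])
  have X'E: "X' \<in> \<E>" using conflationD(1)[OF c'(1)] .
  \<comment> \<open>The kernel of the projection from P to W consists of the pairs (y, 0) with g y =
    0, and \<open>i1\<close> after f identifies X with it.\<close>
  have "K0 X' = K0 X"
  proof -
    let ?a = "compose (carrier X) i1 f"
    have a: "?a \<in> Hom X B" by (rule compose_hom[OF sd(1) bD(1) l(1)])
    have ainj: "inj_on ?a (carrier X)"
    proof (rule inj_onI)
      fix x x' assume x: "x \<in> carrier X" "x' \<in> carrier X" "?a x = ?a x'"
      then have "p1 (i1 (f x)) = p1 (i1 (f x'))" by simp
      then have "f x = f x'" using bD(5) fs(1) x by simp
      then show "x = x'" using sd(3) x by (simp add: inj_on_eq_iff)
    qed
    define L where "L = {b \<in> carrier B. p2 b = \<zero>\<^bsub>W\<^esub> \<and> g' b = \<zero>\<^bsub>Z\<^esub>}"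
    have cX': "carrier X' = L" unfolding c'(2) P(2) L_def K_def by auto
    have X'B: "X' = B\<lparr>carrier := L\<rparr>" using c'(3) cX' unfolding P(3) by simp
    have lX': "lm X'" using X'E by simp
    have Ls: "submod B L"
    proof (rule submodI)
      show "L \<subseteq> carrier B" by (auto simp: L_def)
      show "\<zero>\<^bsub>B\<^esub> \<in> L" using lm_closed(1)[OF lX'] by (simp add: X'B)
      show "x \<oplus>\<^bsub>B\<^esub> y \<in> L" if "x \<in> L" "y \<in> L" for x y using lm_closed(2)[OF lX', of x y] that by (simp add: X'B)
      show "r \<odot>\<^bsub>B\<^esub> x \<in> L" if "r \<in> carrier \<Lambda>" "x \<in> L" for r x using lm_closed(5)[OF lX', of r x] that by (simp add: X'B)
    qed
    have b: "(\<lambda>x\<in>L. x) \<in> Hom X' B" unfolding X'B by (rule incl_hom[OF lB Ls])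
    have binj: "inj_on (\<lambda>x\<in>L. x) (carrier X')" unfolding cX' by (auto simp: inj_on_def)
    have im: "?a ` carrier X = (\<lambda>x\<in>L. x) ` carrier X'"
    proof (intro equalityI subsetI)
      fix u assume "u \<in> ?a ` carrier X"
      then obtain x where x: "x \<in> carrier X" "u = i1 (f x)" by auto
      have "u \<in> L" using x fs(1)[OF x(1)] bD(6) g'1 sd(6)[OF x(1)] i1s(1) by (simp add: L_def)
      then show "u \<in> (\<lambda>x\<in>L. x) ` carrier X'"
        unfolding cX' by (intro rev_image_eqI[of u]) simp_all
    next
      fix u assume "u \<in> (\<lambda>x\<in>L. x) ` carrier X'"
      then have u: "u \<in> carrier B" "p2 u = \<zero>\<^bsub>W\<^esub>" "g' u = \<zero>\<^bsub>Z\<^esub>"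
        unfolding cX' by (auto simp: L_def)
      have "g (p1 u) = \<zero>\<^bsub>Z\<^esub>"
        using g'v[OF u(1)] u hs(4) gs(1) p1s(1) lm_add(2)[OF l(3)] by simp
      then obtain x where x: "x \<in> carrier X" "p1 u = f x" using sd(7)[OF p1s(1)[OF u(1)]] by blast
      have "u = i1 (p1 u)" using bD(9)[OF u(1)] u(2) i2s(4) i1s(1) p1s(1)[OF u(1)] lm_add(2)[OF lB] by simp
      then show "u \<in> ?a ` carrier X" using x by (intro rev_image_eqI[OF x(1)]) simp
    qed
    obtain k where "k \<in> lin_iso \<Lambda> X' X"
      by (rule iso_same_image[OF l(1) lX' lB a ainj b binj im])
    then show ?thesis by (rule K0_iso[OF X'E cD(1)])
  qed
  moreover have "almost X' f' P ?p W"
    unfolding almost_def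
  proof (intro conjI c'(1) W ballI)
    fix s assume s: "s \<in> Hom W P"
    show "\<exists>w\<in>carrier W. ?p (s w) \<noteq> w"
    proof (rule ccontr)
      assume "\<not> ?thesis"
      then have ps: "?p (s w) = w" if "w \<in> carrier W" for w using that by blast
      have sK: "s w \<in> K" if "w \<in> carrier W" for w using hom_closed[OF s that] by (simp add: P(2))
      have sB: "s \<in> Hom W B"
      proof -
        have "compose (carrier W) (\<lambda>x\<in>K. x) s \<in> Hom W B" by (rule compose_hom[OF s inclP l(4)])
        moreover have "compose (carrier W) (\<lambda>x\<in>K. x) s = s"
        proof (rule lin_hom_eqI[OF \<open>compose (carrier W) (\<lambda>x\<in>K. x) s \<in> Hom W B\<close> s])
          show "compose (carrier W) (\<lambda>x\<in>K. x) s w = s w" if "w \<in> carrier W" for w using that sK by simp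
        qed
        ultimately show ?thesis by simp
      qed
      \<comment> \<open>A section of the projection from P to W provides first components y with g y
        + h w = 0. Their negatives factor h through g, although h lies outside S.\<close>
      let ?m = "hom_diff W Y (hom_zero W Y) (compose (carrier W) p1 s)"
      have m: "?m \<in> Hom W Y" by (rule diff_hom[OF l(4,2) zero_hom[OF l(4,2)] compose_hom[OF sB bD(3) l(4)]])
      have "h = compose (carrier W) g ?m"
      proof (rule lin_hom_eqI[OF hH compose_hom[OF m sd(2) l(4)]])
        fix w assume w: "w \<in> carrier W"
        note k = sK[OF w]
        have kB: "s w \<in> carrier B" "g' (s w) = \<zero>\<^bsub>Z\<^esub>" "p2 (s w) = w"
          using k ps[OF w] by (simp_all add: K_def)
        have pc: "p1 (s w) \<in> carrier Y" by (rule p1s(1)[OF kB(1)])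
        have "g (p1 (s w)) \<oplus>\<^bsub>Z\<^esub> h w = \<zero>\<^bsub>Z\<^esub>"
          using g'v[OF kB(1)] kB by simp
        then have "h w \<oplus>\<^bsub>Z\<^esub> g (p1 (s w)) = \<zero>\<^bsub>Z\<^esub>"
          using lm_ac(1)[OF l(3) gs(1)[OF pc] hs(1)[OF w]] by simp
        then have "h w = \<ominus>\<^bsub>Z\<^esub> g (p1 (s w))"
          using lm_minus(7)[OF l(3) hs(1)[OF w] gs(1)[OF pc]] by simp
        also have "\<dots> = g (\<ominus>\<^bsub>Y\<^esub> p1 (s w))" using gs(5)[OF pc] by simp
        also have "\<ominus>\<^bsub>Y\<^esub> p1 (s w) = ?m w" using w lm_add(9)[OF l(2) pc] by simp
        finally show "h w = compose (carrier W) g ?m w" using w by (simp only: compose_apply)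
      qed
      then have "h \<in> im_f Y g W" using m by (auto simp: im_f_def)
      then show False using h(2) S[OF WE] by simp
    qed
  next
    fix U k assume U: "U \<in> \<E>" and k: "k \<in> radical \<Lambda> U W"
    have lU: "lm U" using U by simp
    have kH: "k \<in> Hom U W" using radicalD(1)[OF E_Mo[OF U] E_Mo[OF WE] k] .
    note ks = hom_simps[OF kH lU l(4)]
    let ?hk = "compose (carrier U) h k"
    have hk: "?hk \<in> Hom U Z" by (rule compose_hom[OF kH hH lU])
    have "?hk \<in> S U"
    proof (rule ccontr)
      assume nS: "?hk \<notin> S U"
      \<comment> \<open>V is the subfunctor generated by S and h k. If it exceeded S it would be all
        of T, so h = t + h k e with t in S. As k e is radical, 1 - k e is invertible, and h, being t
        composed with the inverse, would lie in S.\<close>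
      define V where "V U' = {hom_add U' Z t (compose (carrier U') ?hk e) | t e. t \<in> S U' \<and> e \<in> Hom U' U}" for U'
      have VI: "hom_add U' Z t (compose (carrier U') ?hk e) \<in> V U'" if "t \<in> S U'" "e \<in> Hom U' U" for U' t e
        using that unfolding V_def by blast
      have VH: "hom_add U' Z t (compose (carrier U') ?hk e) \<in> Hom U' Z" if "U' \<in> \<E>" "t \<in> S U'" "e \<in> Hom U' U" for U' t e
        by (rule add_hom[OF E_lm[OF that(1)] l(3) subfD(1)[OF subS that(1,2)] compose_hom[OF that(3) hk E_lm[OF that(1)]]])
      have SV: "S U' \<subseteq> V U'" if U': "U' \<in> \<E>" for U'
      proof
        fix t assume t: "t \<in> S U'"
        have lU': "lm U'" using U' by simp
        have z: "hom_zero U' U \<in> Hom U' U" by (rule zero_hom[OF lU' lU])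
        have "t = hom_add U' Z t (compose (carrier U') ?hk (hom_zero U' U))"
          by (rule lin_hom_eqI[OF subfD(1)[OF subS U' t] VH[OF U' t z]])
            (simp add: lU ks(4) hs(4) lm_add(2)[OF l(3)] hom_closed[OF subfD(1)[OF subS U' t]])
        then show "t \<in> V U'" using VI[OF t z] by simp
      qed
      have VT: "V U' \<subseteq> T U'" if U': "U' \<in> \<E>" for U'
      proof
        fix v assume "v \<in> V U'"
        then obtain t e where te: "t \<in> S U'" "e \<in> Hom U' U" "v = hom_add U' Z t (compose (carrier U') ?hk e)"
          unfolding V_def by blast
        have "t \<in> T U'" using te(1) simple_stepD(1)[OF ss U'] by blast
        moreover have "?hk \<in> T U" by (rule subfD(4)[OF T WE U kH h(1)])
        then have "compose (carrier U') ?hk e \<in> T U'" by (rule subfD(4)[OF T U U' te(2)])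
        ultimately show "v \<in> T U'" unfolding te(3) by (rule subfD(3)[OF T U'])
      qed
      have subV: "subf Z V"
        unfolding subf_def
      proof (intro ballI conjI)
        fix U' assume U': "U' \<in> \<E>"
        have lU': "lm U'" using U' by simp
        show "V U' \<subseteq> Hom U' Z" using VT[OF U'] subfD(1)[OF T U'] by blast
        show "hom_zero U' Z \<in> V U'" using SV[OF U'] subfD(2)[OF subS U'] by blast
        fix v assume v: "v \<in> V U'"
        then obtain t e where te: "t \<in> S U'" "e \<in> Hom U' U" "v = hom_add U' Z t (compose (carrier U') ?hk e)"
          unfolding V_def by blast
        note tc = hom_closed[OF subfD(1)[OF subS U' te(1)]]
        show "hom_add U' Z v v' \<in> V U'" if v': "v' \<in> V U'" for v'
        proof -
          obtain t' e' where te': "t' \<in> S U'" "e' \<in> Hom U' U" "v' = hom_add U' Z t' (compose (carrier U') ?hk e')"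
            using v' unfolding V_def by blast
          note tc' = hom_closed[OF subfD(1)[OF subS U' te'(1)]]
          have e: "hom_add U' U e e' \<in> Hom U' U" by (rule add_hom[OF lU' lU te(2) te'(2)])
          have t: "hom_add U' Z t t' \<in> S U'" by (rule subfD(3)[OF subS U' te(1) te'(1)])
          have "hom_add U' Z v v' = hom_add U' Z (hom_add U' Z t t') (compose (carrier U') ?hk (hom_add U' U e e'))"
          proof (rule lin_hom_eqI[OF add_hom[OF lU' l(3)] VH[OF U' t e]])
            show "v \<in> Hom U' Z" "v' \<in> Hom U' Z" using v v' VT[OF U'] subfD(1)[OF T U'] by blast+
            fix x assume x: "x \<in> carrier U'"
            have ec: "e x \<in> carrier U" "e' x \<in> carrier U"
              using hom_closed[OF te(2) x] hom_closed[OF te'(2) x] .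
            have hc: "h (k (e x)) \<in> carrier Z" "h (k (e' x)) \<in> carrier Z"
              using ec ks(1) hs(1) by simp_all
            have "h (k (e x \<oplus>\<^bsub>U\<^esub> e' x)) = h (k (e x)) \<oplus>\<^bsub>Z\<^esub> h (k (e' x))"
              using ks(1,2) hs(2) ec by simp
            then show "hom_add U' Z v v' x = hom_add U' Z (hom_add U' Z t t') (compose (carrier U') ?hk (hom_add U' U e e')) x"
              unfolding te(3) te'(3) using x ec lU hc tc[OF x] tc'[OF x] l(3) by (simp add: lm_ac[OF l(3)])
          qed
          then show ?thesis using VI[OF t e] by simp
        qed
        show "compose (carrier U'') v k' \<in> V U''" if k': "U'' \<in> \<E>" "k' \<in> Hom U'' U'" for U'' k'
        proof -
          have lU'': "lm U''" using k' by simp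
          have e: "compose (carrier U'') e k' \<in> Hom U'' U" by (rule compose_hom[OF k'(2) te(2) lU''])
          have t: "compose (carrier U'') t k' \<in> S U''" by (rule subfD(4)[OF subS U' k' te(1)])
          have vH: "v \<in> Hom U' Z" using v VT[OF U'] subfD(1)[OF T U'] by blast
          have "compose (carrier U'') v k' = hom_add U'' Z (compose (carrier U'') t k') (compose (carrier U'') ?hk (compose (carrier U'') e k'))"
            by (rule lin_hom_eqI[OF compose_hom[OF k'(2) vH lU''] VH[OF k'(1) t e]])
              (simp add: te(3) hom_closed[OF k'(2)] hom_closed[OF te(2)])
          then show ?thesis using VI[OF t e] by simp
        qed
      qed
      have "?hk \<in> V U"
      proof -
        have z: "hom_zero U Z \<in> S U" by (rule subfD(2)[OF subS U])
        have "?hk = hom_add U Z (hom_zero U Z) (compose (carrier U) ?hk (hom_id U))"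
          by (rule lin_hom_eqI[OF hk VH[OF U z id_hom[OF lU]]]) (simp add: lm_add(1)[OF l(3)] ks(1) hs(1))
        then show ?thesis using VI[OF z id_hom[OF lU]] by simp
      qed
      then have ne: "V U \<noteq> S U" using nS by auto
      have "V W = T W" by (rule simple_stepD(3)[OF ss subV SV VT U ne WE])
      then have "h \<in> V W" using h(1) by simp
      then obtain t e where te: "t \<in> S W" "e \<in> Hom W U" "h = hom_add W Z t (compose (carrier W) ?hk e)"
        unfolding V_def by blast
      note es = hom_simps[OF te(2) l(4) lU]
      let ?ke = "compose (carrier W) k e"
      have ke: "?ke \<in> radical \<Lambda> W W"
        by (rule radical_pre[OF E_Mo[OF WE] E_Mo[OF U] E_Mo[OF WE] k te(2)])
      let ?d = "hom_diff W W (hom_id W) (compose (carrier W) (hom_id W) ?ke)"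
      have d: "?d \<in> lin_iso \<Lambda> W W" using ke id_hom[OF l(4)] by (simp add: radical_def)
      have dH: "?d \<in> Hom W W" using d by (simp add: lin_iso_def)
      obtain v where v: "v \<in> lin_iso \<Lambda> W W" "\<And>w. w \<in> carrier W \<Longrightarrow> v (?d w) = w" "\<And>w. w \<in> carrier W \<Longrightarrow> ?d (v w) = w"
        by (rule lin_iso_inv[OF l(4,4) d]) (rule that; blast)
      have vH: "v \<in> Hom W W" using v(1) by (simp add: lin_iso_def)
      have hd: "h (?d w) = t w" if w: "w \<in> carrier W" for w
      proof -
        have kc: "k (e w) \<in> carrier W" using ks(1)[OF es(1)[OF w]] .
        have tw: "t w \<in> carrier Z" by (rule hom_closed[OF subfD(1)[OF subS WE te(1)] w])
        have "h w = hom_add W Z t (compose (carrier W) ?hk e) w" using te(3) by simp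
        then have "h w = t w \<oplus>\<^bsub>Z\<^esub> h (k (e w))" using w es(1)[OF w] by simp
        moreover have "?d w = w \<ominus>\<^bsub>W\<^esub> k (e w)" using w kc by simp
        ultimately show ?thesis using hs(6)[OF w kc] lm_minus(4)[OF l(3) tw hs(1)[OF kc]] by simp
      qed
      have "h = compose (carrier W) t v"
      proof (rule lin_hom_eqI[OF hH compose_hom[OF vH subfD(1)[OF subS WE te(1)] l(4)]])
        fix w assume w: "w \<in> carrier W"
        have "h w = h (?d (v w))" by (simp only: v(3)[OF w])
        also have "\<dots> = t (v w)" by (rule hd[OF hom_closed[OF vH w]])
        finally show "h w = compose (carrier W) t v w" using w by (simp only: compose_apply)
      qed
      then show False using subfD(4)[OF subS WE WE vH te(1)] h(2) by simp
    qed
    then obtain m where m: "m \<in> Hom U Y" "?hk = compose (carrier U) g m"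
      using S[OF U] by (auto simp: im_f_def)
    note ms = hom_simps[OF m(1) lU l(2)]
    have hm: "h (k u) = g (m u)" if u: "u \<in> carrier U" for u
      using fun_cong[OF m(2), of u] u by simp
    \<comment> \<open>Since h k = g m, the pair (- m, k) has values in P, and it lifts k along the
      projection to W.\<close>
    let ?n = "hom_diff U B (compose (carrier U) i2 k) (compose (carrier U) i1 m)"
    have n: "?n \<in> Hom U B"
      by (rule diff_hom[OF lU lB compose_hom[OF kH bD(2) lU] compose_hom[OF m(1) bD(1) lU]])
    have nv: "?n u = i2 (k u) \<ominus>\<^bsub>B\<^esub> i1 (m u)" if "u \<in> carrier U" for u using that by simp
    have nc: "?n u \<in> K" "p2 (?n u) = k u" if u: "u \<in> carrier U" for u
    proof -
      have c: "k u \<in> carrier W" "m u \<in> carrier Y" using ks(1)[OF u] ms(1)[OF u] .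
      have cB: "i2 (k u) \<in> carrier B" "i1 (m u) \<in> carrier B" using i2s(1)[OF c(1)] i1s(1)[OF c(2)] .
      have "g' (?n u) = h (k u) \<ominus>\<^bsub>Z\<^esub> g (m u)"
        unfolding nv[OF u] hom_simps(6)[OF g'H lB l(3) cB] g'1[OF c(2)] g'2[OF c(1)] ..
      also have "\<dots> = \<zero>\<^bsub>Z\<^esub>"
        unfolding hm[OF u] by (rule lm_add(3)[OF l(3) gs(1)[OF c(2)]])
      finally show "?n u \<in> K" using hom_closed[OF n u] unfolding K_def by blast
      show "p2 (?n u) = k u"
        unfolding nv[OF u] p2s(6)[OF cB] bD(7)[OF c(1)] bD(6)[OF c(2)] by (rule lm_add(4)[OF l(4) c(1)])
    qed
    have "?n \<in> Hom U P" unfolding P(3) by (rule corestrict_hom[OF n nc(1)])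
    moreover have "\<forall>u\<in>carrier U. ?p (?n u) = k u"
    proof
      fix u assume u: "u \<in> carrier U"
      show "?p (?n u) = k u" using nc[OF u] by (simp only: restrict_apply if_True)
    qed
    ultimately show "\<exists>k'\<in>Hom U P. \<forall>u\<in>carrier U. ?p (k' u) = k u" by blast
  qed
  then have "defect X' P W \<in> AR_group \<Lambda> \<E>" by (rule almost_defect)
  ultimately have "defect X P W \<in> AR_group \<Lambda> \<E>" by simp
  moreover have "K0 B = K0 Y + K0 W" by (rule K0_bip[OF BE cD(2) WE B(2)])
  ultimately show thesis using that[OF P(1) imB WE] by blast
qed

text \<open>Each use of \<open>chain_step\<close> removes the lowest factor of the filtration; in
  the sum of the two resulting classes the terms of P and W cancel. At length 0 the identity of Z
  lies in the image of g, so g splits, and comparison with the conflation 0, Z, Z shows that the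
  class is 0.\<close>

lemma chain_defect:
  "\<lbrakk>conflation \<Lambda> \<E> X f Y g Z; \<forall>i\<le>n. subf Z (T i); \<forall>U\<in>\<E>. T 0 U = im_f Y g U; \<forall>U\<in>\<E>. T n U = Hom U Z;
    \<forall>i<n. simple_step Z (T i) (T (Suc i))\<rbrakk> \<Longrightarrow> defect X Y Z \<in> AR_group \<Lambda> \<E>"
proof (induction n arbitrary: T X f Y g)
  case 0
  note cD = conflationD[OF 0(1)] and sd = short_exactD[OF conflationD(4)[OF 0(1)]]
  have l: "lm Z" "lm Y" using cD by simp_all
  note idZ = id_hom[OF l(1)]
  have "hom_id Z \<in> im_f Y g Z" using 0(3,4) cD(3) idZ by auto
  then obtain s where s: "s \<in> Hom Z Y" "hom_id Z = compose (carrier Z) g s" by (auto simp: im_f_def)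
  have sv: "g (s z) = z" if "z \<in> carrier Z" for z using fun_cong[OF s(2), of z] that by simp
  have surj: "hom_id Z ` carrier Z = carrier Z" by (force simp: image_iff)
  obtain X' f' where c': "conflation \<Lambda> \<E> X' f' Z (hom_id Z) Z"
    "carrier X' = {y \<in> carrier Z. hom_id Z y = \<zero>\<^bsub>Z\<^esub>}" "X' = Z\<lparr>carrier := {y \<in> carrier Z. hom_id Z y = \<zero>\<^bsub>Z\<^esub>}\<rparr>"
    by (rule conflation_ker[OF cD(3,3) idZ surj])
  have "\<zero>\<^bsub>X'\<^esub> = \<zero>\<^bsub>Z\<^esub>" using c'(3) by simp
  then have "carrier X' = {\<zero>\<^bsub>X'\<^esub>}" using c'(2) l(1) by auto
  then have "K0 X' = 0" by (rule K0_zero[OF conflationD(1)[OF c'(1)]])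
  moreover have "K0 X + K0 Z = K0 X' + K0 Y"
    by (rule K0_schanuel[OF 0(1) c'(1) sd(2) _ s(1)]) (use sv hom_closed[OF sd(2)] in auto)
  ultimately have "defect X Y Z = 0" by (simp add: algebra_simps)
  then show ?case using AR_zero by simp
next
  case (Suc n)
  have ss: "simple_step Z (T 0) (T (Suc 0))" using Suc.prems(5) by blast
  have T1: "subf Z (T (Suc 0))" using Suc.prems(2) by simp
  have T0: "\<And>U. U \<in> \<E> \<Longrightarrow> T 0 U = im_f Y g U" using Suc.prems(3) by blast
  obtain P fP B gB W where P: "conflation \<Lambda> \<E> P fP B gB Z" "\<forall>U\<in>\<E>. im_f B gB U = T (Suc 0) U"
    "W \<in> \<E>" "defect X P W \<in> AR_group \<Lambda> \<E>" "K0 B = K0 Y + K0 W"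
    by (rule chain_step[OF Suc.prems(1) T1 ss T0])
  have "defect P B Z \<in> AR_group \<Lambda> \<E>"
    by (rule Suc.IH[OF P(1), of "\<lambda>i. T (Suc i)"]) (use Suc.prems(2,4,5) P(2) in auto)
  then have "defect X P W + defect P B Z \<in> AR_group \<Lambda> \<E>" by (rule AR_add[OF P(4)])
  moreover have "defect X P W + defect P B Z = defect X Y Z" using P(5) by simp
  ultimately show ?case by simp
qed

end

section \<open>Functors on the subcategory\<close>

text \<open>Restricting the carrier to T changes neither products nor cosets, so the quotient of T
  by S can be computed with the cosets of the ambient group.\<close>

lemma (in comm_group) quotient_sub_hom:
  assumes S: "subgroup S G" and T: "subgroup T G" and ST: "S \<subseteq> T"
  shows "comm_group (G\<lparr>carrier := T\<rparr> Mod S)"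
    "group_hom (G\<lparr>carrier := T\<rparr>) (G\<lparr>carrier := T\<rparr> Mod S) (\<lambda>a. S #> a)"
    "\<lbrakk>a \<in> T; b \<in> T\<rbrakk> \<Longrightarrow> (S #> a) <#> (S #> b) = S #> (a \<otimes> b)"
    "carrier (G\<lparr>carrier := T\<rparr> Mod S) = (\<lambda>a. S #> a) ` T"
proof -
  let ?G = "G\<lparr>carrier := T\<rparr>"
  have rc: "r_coset ?G = r_coset G" by (intro ext) (simp add: r_coset_def)
  have "group ?G" by (rule subgroup.subgroup_is_group[OF T is_group])
  then have g: "comm_group ?G"
    by (rule group.group_comm_groupI) (use subgroup.subset[OF T] m_comm in auto)
  have "subgroup S ?G" by (rule subgroup_incl[OF S T ST])
  then have n: "S \<lhd> ?G" by (rule comm_group.subgroup_imp_normal[OF g])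
  show "comm_group (?G Mod S)" by (rule comm_group.abelian_FactGroup[OF g \<open>subgroup S ?G\<close>])
  then have gQ: "group (?G Mod S)" by (rule comm_group.axioms)
  have "(\<lambda>a. S #> a) \<in> hom ?G (?G Mod S)"
    using normal.r_coset_hom_Mod[OF n] by (simp add: rc)
  then show "group_hom ?G (?G Mod S) (\<lambda>a. S #> a)"
    using g gQ by (simp add: group_hom_def group_hom_axioms_def comm_group_def)
  show "(S #> a) <#> (S #> b) = S #> (a \<otimes> b)" if "a \<in> T" "b \<in> T"
    using normal.rcos_sum[OF subgroup_imp_normal[OF S], of a b] that subgroup.subset[OF T] by auto
  show "carrier (?G Mod S) = (\<lambda>a. S #> a) ` T"
    by (simp add: carrier_FactGroup rc)
qed

lemma additive_functorD:
  assumes "additive_functor \<Lambda> \<E> F"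
  shows "X \<in> \<E> \<Longrightarrow> comm_group (obj F X)"
    "\<lbrakk>X \<in> \<E>; Y \<in> \<E>; f \<in> lin_hom \<Lambda> X Y\<rbrakk> \<Longrightarrow> arr F X Y f \<in> hom (obj F Y) (obj F X)"
    "\<lbrakk>X \<in> \<E>; v \<in> carrier (obj F X)\<rbrakk> \<Longrightarrow> arr F X X (hom_id X) v = v"
    "\<lbrakk>X \<in> \<E>; Y \<in> \<E>; Z \<in> \<E>; f \<in> lin_hom \<Lambda> X Y; g \<in> lin_hom \<Lambda> Y Z; v \<in> carrier (obj F Z)\<rbrakk> \<Longrightarrow>
      arr F X Z (compose (carrier X) g f) v = arr F X Y f (arr F Y Z g v)"
    "\<lbrakk>X \<in> \<E>; Y \<in> \<E>; f \<in> lin_hom \<Lambda> X Y; g \<in> lin_hom \<Lambda> X Y; v \<in> carrier (obj F Y)\<rbrakk> \<Longrightarrow>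
      arr F X Y (hom_add X Y f g) v = arr F X Y f v \<otimes>\<^bsub>obj F X\<^esub> arr F X Y g v"
  using assms unfolding additive_functor_def by blast+

lemma subfunctorD:
  assumes "subfunctor \<Lambda> \<E> F S"
  shows "X \<in> \<E> \<Longrightarrow> subgroup (S X) (obj F X)"
    "\<lbrakk>X \<in> \<E>; Y \<in> \<E>; f \<in> lin_hom \<Lambda> X Y; v \<in> S Y\<rbrakk> \<Longrightarrow> arr F X Y f v \<in> S X"
  using assms unfolding subfunctor_def by blast+

section \<open>Subquotients of additive functors and simplicity\<close>

locale subquotient_setup = resolving_setup R \<Lambda> \<E>
  for R :: "'r ring" and \<Lambda> :: "('r, 'a) module" and \<E> :: "('a, (nat \<Rightarrow> 'a) set) module set" +
  fixes F :: "('a, (nat \<Rightarrow> 'a) set, 'v) ab_functor" and S T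
  assumes F: "additive_functor \<Lambda> \<E> F" and S: "subfunctor \<Lambda> \<E> F S" and T: "subfunctor \<Lambda> \<E> F T"
    and ST: "X \<in> \<E> \<Longrightarrow> S X \<subseteq> T X"
begin

abbreviation Q where "Q \<equiv> subquotient F T S"

abbreviation cs where "cs X v \<equiv> S X #>\<^bsub>obj F X\<^esub> v"

lemma T_closed: "\<lbrakk>X \<in> \<E>; v \<in> T X\<rbrakk> \<Longrightarrow> v \<in> carrier (obj F X)"
  using subgroup.subset[OF subfunctorD(1)[OF T]] by blast

lemma S_closed: "\<lbrakk>X \<in> \<E>; v \<in> S X\<rbrakk> \<Longrightarrow> v \<in> carrier (obj F X)"
  using T_closed ST by blast

lemma group_F: "X \<in> \<E> \<Longrightarrow> group (obj F X)"
  using additive_functorD(1)[OF F] comm_group.axioms by blast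

lemma Q_obj:
  assumes X: "X \<in> \<E>"
  shows "comm_group (obj Q X)"
    "group_hom ((obj F X)\<lparr>carrier := T X\<rparr>) (obj Q X) (cs X)"
    "\<lbrakk>v \<in> T X; w \<in> T X\<rbrakk> \<Longrightarrow> cs X v \<otimes>\<^bsub>obj Q X\<^esub> cs X w = cs X (v \<otimes>\<^bsub>obj F X\<^esub> w)"
    "carrier (obj Q X) = cs X ` T X" "\<one>\<^bsub>obj Q X\<^esub> = S X"
proof -
  note q = comm_group.quotient_sub_hom[OF additive_functorD(1)[OF F X] subfunctorD(1)[OF S X] subfunctorD(1)[OF T X] ST[OF X]]
  have e: "obj Q X = (obj F X)\<lparr>carrier := T X\<rparr> Mod S X" by (simp add: subquotient_def)
  show "comm_group (obj Q X)" "group_hom ((obj F X)\<lparr>carrier := T X\<rparr>) (obj Q X) (cs X)"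
    "carrier (obj Q X) = cs X ` T X" "\<one>\<^bsub>obj Q X\<^esub> = S X"
    using q(1,2,4) by (simp_all add: e)
  have "set_mult ((obj F X)\<lparr>carrier := T X\<rparr>) = set_mult (obj F X)"
    by (intro ext) (simp add: set_mult_def)
  then show "cs X v \<otimes>\<^bsub>obj Q X\<^esub> cs X w = cs X (v \<otimes>\<^bsub>obj F X\<^esub> w)" if "v \<in> T X" "w \<in> T X"
    using q(3)[OF that] by (simp add: e)
qed

text \<open>\<open>subquotient\<close> acts on a coset by taking its image and then multiplying by
  \<open>S X\<close>. The image of \<open>S Y\<close> lies in \<open>S X\<close>, so the result is a
  single coset of \<open>S X\<close>.\<close>

lemma Q_arr:
  assumes X: "X \<in> \<E>" and Y: "Y \<in> \<E>" and f: "f \<in> lin_hom \<Lambda> X Y" and v: "v \<in> T Y"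
  shows "arr Q X Y f (cs Y v) = cs X (arr F X Y f v)"
proof -
  interpret GX: group "obj F X" by (rule group_F[OF X])
  interpret GY: group "obj F Y" by (rule group_F[OF Y])
  note h = additive_functorD(2)[OF F X Y f]
  have vY: "v \<in> carrier (obj F Y)" by (rule T_closed[OF Y v])
  have ac: "arr F X Y f w \<in> carrier (obj F X)" if "w \<in> carrier (obj F Y)" for w using hom_in_carrier[OF h that] .
  have am: "arr F X Y f (s \<otimes>\<^bsub>obj F Y\<^esub> v) = arr F X Y f s \<otimes>\<^bsub>obj F X\<^esub> arr F X Y f v" if "s \<in> S Y" for s
    by (rule hom_mult[OF h S_closed[OF Y that] vY])
  show ?thesis
  proof (intro equalityI subsetI)
    fix x assume "x \<in> arr Q X Y f (cs Y v)"
    then obtain s t where st: "s \<in> S X" "t \<in> S Y" "x = s \<otimes>\<^bsub>obj F X\<^esub> arr F X Y f (t \<otimes>\<^bsub>obj F Y\<^esub> v)"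
      by (auto simp: subquotient_def set_mult_def r_coset_def)
    have fs: "arr F X Y f t \<in> S X" by (rule subfunctorD(2)[OF S X Y f st(2)])
    have "x = (s \<otimes>\<^bsub>obj F X\<^esub> arr F X Y f t) \<otimes>\<^bsub>obj F X\<^esub> arr F X Y f v"
      unfolding st(3) am[OF st(2)]
      by (rule GX.m_assoc[symmetric, OF S_closed[OF X st(1)] S_closed[OF X fs] ac[OF vY]])
    moreover have "s \<otimes>\<^bsub>obj F X\<^esub> arr F X Y f t \<in> S X"
      by (rule subgroup.m_closed[OF subfunctorD(1)[OF S X] st(1) fs])
    ultimately show "x \<in> cs X (arr F X Y f v)" by (auto simp: r_coset_def)
  next
    fix x assume "x \<in> cs X (arr F X Y f v)"
    then obtain s where "s \<in> S X" "x = s \<otimes>\<^bsub>obj F X\<^esub> arr F X Y f v"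
      by (auto simp: r_coset_def)
    then show "x \<in> arr Q X Y f (cs Y v)"
      using GY.rcos_self[OF vY subfunctorD(1)[OF S Y]] by (auto simp: subquotient_def set_mult_def)
  qed
qed

lemma Q_additive: "additive_functor \<Lambda> \<E> Q"
  unfolding additive_functor_def
proof (intro conjI ballI)
  note Fh = additive_functorD[OF F]
  show "comm_group (obj Q X)" if "X \<in> \<E>" for X by (rule Q_obj(1)[OF that])
  show "arr Q X Y f \<in> hom (obj Q Y) (obj Q X)" if X: "X \<in> \<E>" and Y: "Y \<in> \<E>" and f: "f \<in> lin_hom \<Lambda> X Y" for X Y f
  proof (rule homI)
    show "arr Q X Y f c \<in> carrier (obj Q X)" if "c \<in> carrier (obj Q Y)" for c
      using that Q_arr[OF X Y f] subfunctorD(2)[OF T X Y f] by (auto simp: Q_obj(4)[OF X] Q_obj(4)[OF Y])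
    fix c d assume "c \<in> carrier (obj Q Y)" "d \<in> carrier (obj Q Y)"
    then obtain v w where vw: "v \<in> T Y" "w \<in> T Y" "c = cs Y v" "d = cs Y w"
      by (auto simp: Q_obj(4)[OF Y])
    have "v \<otimes>\<^bsub>obj F Y\<^esub> w \<in> T Y"
      by (rule subgroup.m_closed[OF subfunctorD(1)[OF T Y] vw(1,2)])
    then show "arr Q X Y f (c \<otimes>\<^bsub>obj Q Y\<^esub> d) = arr Q X Y f c \<otimes>\<^bsub>obj Q X\<^esub> arr Q X Y f d"
      unfolding vw(3,4) Q_obj(3)[OF Y vw(1,2)] Q_arr[OF X Y f vw(1)] Q_arr[OF X Y f vw(2)]
        Q_obj(3)[OF X subfunctorD(2)[OF T X Y f vw(1)] subfunctorD(2)[OF T X Y f vw(2)]]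
      by (simp add: Q_arr[OF X Y f] hom_mult[OF Fh(2)[OF X Y f] T_closed[OF Y vw(1)] T_closed[OF Y vw(2)]])
  qed
  show "arr Q X X (hom_id X) c = c" if X: "X \<in> \<E>" and c: "c \<in> carrier (obj Q X)" for X c
  proof -
    obtain v where v: "v \<in> T X" "c = cs X v" using c by (auto simp: Q_obj(4)[OF X])
    then show ?thesis using Q_arr[OF X X id_hom[OF E_lm[OF X]] v(1)] Fh(3)[OF X T_closed[OF X v(1)]] by simp
  qed
  show "arr Q X Z (compose (carrier X) g f) c = arr Q X Y f (arr Q Y Z g c)"
    if X: "X \<in> \<E>" and Y: "Y \<in> \<E>" and Z: "Z \<in> \<E>" and f: "f \<in> Hom X Y" and g: "g \<in> Hom Y Z"
      and c: "c \<in> carrier (obj Q Z)" for X Y Z f g c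
  proof -
    obtain v where v: "v \<in> T Z" "c = cs Z v" using c by (auto simp: Q_obj(4)[OF Z])
    show ?thesis
      unfolding v(2) Q_arr[OF X Z compose_hom[OF f g E_lm[OF X]] v(1)] Q_arr[OF Y Z g v(1)]
        Q_arr[OF X Y f subfunctorD(2)[OF T Y Z g v(1)]] Fh(4)[OF X Y Z f g T_closed[OF Z v(1)]] ..
  qed
  show "arr Q X Y (hom_add X Y f g) c = arr Q X Y f c \<otimes>\<^bsub>obj Q X\<^esub> arr Q X Y g c"
    if X: "X \<in> \<E>" and Y: "Y \<in> \<E>" and f: "f \<in> Hom X Y" and g: "g \<in> Hom X Y" and c: "c \<in> carrier (obj Q Y)"
    for X Y f g c
  proof -
    obtain v where v: "v \<in> T Y" "c = cs Y v" using c by (auto simp: Q_obj(4)[OF Y])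
    show ?thesis
      unfolding v(2) Q_arr[OF X Y add_hom[OF E_lm[OF X] E_lm[OF Y] f g] v(1)] Q_arr[OF X Y f v(1)] Q_arr[OF X Y g v(1)]
        Q_obj(3)[OF X subfunctorD(2)[OF T X Y f v(1)] subfunctorD(2)[OF T X Y g v(1)]]
        Fh(5)[OF X Y f g T_closed[OF Y v(1)]] ..
  qed
qed

text \<open>Correspondence theorem for functors: subfunctors of T/S are the images of subfunctors V
  between S and T, and V is recovered from its image because it contains S. Simplicity can then be
  tested without cosets.\<close>

lemma simple_iff:
  "simple_functor \<Lambda> \<E> Q \<longleftrightarrow> (\<exists>X\<in>\<E>. S X \<noteq> T X) \<and>
    (\<forall>V. subfunctor \<Lambda> \<E> F V \<longrightarrow> (\<forall>X\<in>\<E>. S X \<subseteq> V X \<and> V X \<subseteq> T X) \<longrightarrow>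
      (\<forall>X\<in>\<E>. V X = S X) \<or> (\<forall>X\<in>\<E>. V X = T X))"
proof -
  have cs_one: "cs X v = S X \<longleftrightarrow> v \<in> S X" if "X \<in> \<E>" "v \<in> T X" for X v
    using group.coset_join1[OF group_F[OF that(1)] _ T_closed[OF that] subfunctorD(1)[OF S that(1)]]
      group.coset_join2[OF group_F[OF that(1)] T_closed[OF that] subfunctorD(1)[OF S that(1)]] by blast
  have ne: "(\<exists>X\<in>\<E>. carrier (obj Q X) \<noteq> {\<one>\<^bsub>obj Q X\<^esub>}) \<longleftrightarrow> (\<exists>X\<in>\<E>. S X \<noteq> T X)"
  proof (rule bex_cong[OF refl])
    fix X assume X: "X \<in> \<E>"
    have "S X \<in> cs X ` T X"
      using cs_one[OF X] subgroup.one_closed[OF subfunctorD(1)[OF S X]] ST[OF X] by (intro rev_image_eqI) auto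
    then have "carrier (obj Q X) = {\<one>\<^bsub>obj Q X\<^esub>} \<longleftrightarrow> (\<forall>v\<in>T X. cs X v = S X)"
      unfolding Q_obj(4)[OF X] Q_obj(5)[OF X] by blast
    moreover have "S X = T X \<longleftrightarrow> (\<forall>v\<in>T X. cs X v = S X)"
      using cs_one[OF X] ST[OF X] by auto
    ultimately show "(carrier (obj Q X) \<noteq> {\<one>\<^bsub>obj Q X\<^esub>}) = (S X \<noteq> T X)" by simp
  qed
  have image: "subfunctor \<Lambda> \<E> Q (\<lambda>X. cs X ` V X)"
    if V: "subfunctor \<Lambda> \<E> F V" and VT: "\<forall>X\<in>\<E>. V X \<subseteq> T X" for V
    unfolding subfunctor_def
  proof (intro conjI ballI)
    fix X assume X: "X \<in> \<E>"
    have "subgroup (V X) ((obj F X)\<lparr>carrier := T X\<rparr>)"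
      by (rule group.subgroup_incl[OF group_F[OF X] subfunctorD(1)[OF V X] subfunctorD(1)[OF T X]]) (use VT X in blast)
    then show "subgroup (cs X ` V X) (obj Q X)"
      by (rule group_hom.subgroup_img_is_subgroup[OF Q_obj(2)[OF X]])
    show "arr Q X Y f ` cs Y ` V Y \<subseteq> cs X ` V X" if Y: "Y \<in> \<E>" and f: "f \<in> Hom X Y" for Y f
      using Q_arr[OF X Y f] VT Y subfunctorD(2)[OF V X Y f] by (auto simp: subset_iff)
  qed
  have ends: "cs X ` V X = {S X} \<longleftrightarrow> V X = S X" "cs X ` V X = cs X ` T X \<longleftrightarrow> V X = T X"
    if V: "subfunctor \<Lambda> \<E> F V" and VT: "\<forall>X\<in>\<E>. S X \<subseteq> V X \<and> V X \<subseteq> T X" and X: "X \<in> \<E>" for V X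
  proof -
    have i: "S X \<subseteq> V X" "V X \<subseteq> T X" using VT X by blast+
    have one: "\<one>\<^bsub>obj F X\<^esub> \<in> S X" by (rule subgroup.one_closed[OF subfunctorD(1)[OF S X]])
    have 1: "cs X v = S X \<longleftrightarrow> v \<in> S X" if "v \<in> V X" for v using cs_one[OF X] that i(2) by blast
    have 2: "cs X ` V X = {S X} \<longleftrightarrow> (\<forall>v\<in>V X. cs X v = S X)" using one i(1) by auto
    show "cs X ` V X = {S X} \<longleftrightarrow> V X = S X" unfolding 2 using 1 i(1) by auto
    have "T X \<subseteq> V X" if e: "cs X ` V X = cs X ` T X"
    proof
      fix t assume t: "t \<in> T X"
      then have "cs X t \<in> cs X ` V X" unfolding e by (rule imageI)
      then obtain v where v: "v \<in> V X" "cs X v = cs X t" by auto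
      have "t \<in> cs X v"
        unfolding v(2) by (rule group.rcos_self[OF group_F[OF X] T_closed[OF X t] subfunctorD(1)[OF S X]])
      then show "t \<in> V X"
        using v(1) i(1) subgroup.m_closed[OF subfunctorD(1)[OF V X]] by (auto simp: r_coset_def)
    qed
    then show "cs X ` V X = cs X ` T X \<longleftrightarrow> V X = T X" using i(2) by auto
  qed
  have preimage: "\<exists>V. subfunctor \<Lambda> \<E> F V \<and> (\<forall>X\<in>\<E>. S X \<subseteq> V X \<and> V X \<subseteq> T X \<and> \<V> X = cs X ` V X)"
    if \<V>: "subfunctor \<Lambda> \<E> Q \<V>" for \<V>
  proof -
    define V where "V X = {v \<in> T X. cs X v \<in> \<V> X}" for X
    have sub: "\<V> X \<subseteq> cs X ` T X" if "X \<in> \<E>" for X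
      using subgroup.subset[OF subfunctorD(1)[OF \<V> that]] Q_obj(4)[OF that] by blast
    have "subfunctor \<Lambda> \<E> F V"
      unfolding subfunctor_def
    proof (intro conjI ballI)
      fix X assume X: "X \<in> \<E>"
      interpret h: group_hom "(obj F X)\<lparr>carrier := T X\<rparr>" "obj Q X" "cs X" by (rule Q_obj(2)[OF X])
      have "subgroup (V X) ((obj F X)\<lparr>carrier := T X\<rparr>)"
      proof (rule h.G.subgroupI)
        show "V X \<subseteq> carrier ((obj F X)\<lparr>carrier := T X\<rparr>)" by (auto simp: V_def)
        show "V X \<noteq> {}"
          using h.hom_one subgroup.one_closed[OF subfunctorD(1)[OF \<V> X]] h.G.one_closed by (auto simp: V_def)
        show "inv\<^bsub>(obj F X)\<lparr>carrier := T X\<rparr>\<^esub> v \<in> V X" if "v \<in> V X" for v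
          using that h.hom_inv[of v] h.G.inv_closed[of v] subgroup.m_inv_closed[OF subfunctorD(1)[OF \<V> X]] by (auto simp: V_def)
        show "v \<otimes>\<^bsub>(obj F X)\<lparr>carrier := T X\<rparr>\<^esub> w \<in> V X" if "v \<in> V X" "w \<in> V X" for v w
          using that h.hom_mult[of v w] h.G.m_closed[of v w] subgroup.m_closed[OF subfunctorD(1)[OF \<V> X]] by (auto simp: V_def)
      qed
      then show "subgroup (V X) (obj F X)"
        by (rule group.incl_subgroup[OF group_F[OF X] subfunctorD(1)[OF T X]])
      show "arr F X Y f ` V Y \<subseteq> V X" if Y: "Y \<in> \<E>" and f: "f \<in> Hom X Y" for Y f
        using subfunctorD(2)[OF T X Y f] subfunctorD(2)[OF \<V> X Y f] Q_arr[OF X Y f] by (force simp: V_def)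
    qed
    moreover have "S X \<subseteq> V X \<and> V X \<subseteq> T X \<and> \<V> X = cs X ` V X" if X: "X \<in> \<E>" for X
    proof -
      have "S X \<in> \<V> X"
        using subgroup.one_closed[OF subfunctorD(1)[OF \<V> X]] by (simp add: Q_obj(5)[OF X])
      have "S X \<subseteq> V X"
      proof
        fix v assume v: "v \<in> S X"
        then have vT: "v \<in> T X" using ST[OF X] by blast
        then have "cs X v = S X" using cs_one[OF X vT] v by simp
        then show "v \<in> V X" using vT \<open>S X \<in> \<V> X\<close> by (simp add: V_def)
      qed
      then show ?thesis using sub[OF X] by (auto simp: V_def)
    qed
    ultimately show ?thesis by (intro exI[of _ V]) blast
  qed
  show ?thesis
    unfolding simple_functor_def ne
  proof (intro conj_cong refl iffI allI impI)
    fix V assume simple: "\<forall>\<V>. subfunctor \<Lambda> \<E> Q \<V> \<longrightarrow>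
        (\<forall>X\<in>\<E>. \<V> X = {\<one>\<^bsub>obj Q X\<^esub>}) \<or> (\<forall>X\<in>\<E>. \<V> X = carrier (obj Q X))"
      and V: "subfunctor \<Lambda> \<E> F V" and VT: "\<forall>X\<in>\<E>. S X \<subseteq> V X \<and> V X \<subseteq> T X"
    have "subfunctor \<Lambda> \<E> Q (\<lambda>X. cs X ` V X)" by (rule image[OF V]) (use VT in blast)
    then have "(\<forall>X\<in>\<E>. cs X ` V X = {\<one>\<^bsub>obj Q X\<^esub>}) \<or> (\<forall>X\<in>\<E>. cs X ` V X = carrier (obj Q X))"
      using simple by blast
    then show "(\<forall>X\<in>\<E>. V X = S X) \<or> (\<forall>X\<in>\<E>. V X = T X)"
      using ends[OF V VT] Q_obj(4,5) by simp
  next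
    fix \<V> assume simple: "\<forall>V. subfunctor \<Lambda> \<E> F V \<longrightarrow> (\<forall>X\<in>\<E>. S X \<subseteq> V X \<and> V X \<subseteq> T X) \<longrightarrow>
        (\<forall>X\<in>\<E>. V X = S X) \<or> (\<forall>X\<in>\<E>. V X = T X)"
      and \<V>: "subfunctor \<Lambda> \<E> Q \<V>"
    obtain V where V: "subfunctor \<Lambda> \<E> F V" "\<forall>X\<in>\<E>. S X \<subseteq> V X \<and> V X \<subseteq> T X \<and> \<V> X = cs X ` V X"
      using preimage[OF \<V>] by blast
    then have VT: "\<forall>X\<in>\<E>. S X \<subseteq> V X \<and> V X \<subseteq> T X" by blast
    then have "(\<forall>X\<in>\<E>. V X = S X) \<or> (\<forall>X\<in>\<E>. V X = T X)"
      using simple V(1) by blast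
    then show "(\<forall>X\<in>\<E>. \<V> X = {\<one>\<^bsub>obj Q X\<^esub>}) \<or> (\<forall>X\<in>\<E>. \<V> X = carrier (obj Q X))"
      using ends[OF V(1) VT] Q_obj(4,5) V(2) by simp
  qed
qed

end

section \<open>Representable functors, their quotients and filtrations\<close>

context resolving_setup
begin

lemma hom_functor_simps [simp]:
  "carrier (obj (hom_functor \<Lambda> Z) U) = Hom U Z" "monoid.mult (obj (hom_functor \<Lambda> Z) U) = hom_add U Z"
  "\<one>\<^bsub>obj (hom_functor \<Lambda> Z) U\<^esub> = hom_zero U Z"
  "arr (hom_functor \<Lambda> Z) U V k h = compose (carrier U) h k"
  by (simp_all add: hom_functor_def)

lemma hom_functor_additive:
  assumes Z: "Z \<in> \<E>"
  shows "additive_functor \<Lambda> \<E> (hom_functor \<Lambda> Z)"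
  unfolding additive_functor_def
proof (intro conjI ballI)
  have lZ: "lm Z" using Z by simp
  show "comm_group (obj (hom_functor \<Lambda> Z) U)" if "U \<in> \<E>" for U
  proof -
    interpret H: abelian_group "hom_mod U Z" by (rule R.lm_group[OF hom_mod_lm[OF E_lm[OF that] lZ]])
    have "\<exists>k\<in>Hom U Z. hom_add U Z k h = hom_zero U Z" if "h \<in> Hom U Z" for h
      using H.l_neg[of h] H.a_inv_closed[of h] that by (intro bexI[of _ "\<ominus>\<^bsub>hom_mod U Z\<^esub> h"]) simp_all
    then show ?thesis
      using H.a_closed H.a_assoc H.a_comm H.l_zero H.zero_closed by (intro comm_groupI) simp_all
  qed
  fix U V f assume U: "U \<in> \<E>" and V: "V \<in> \<E>" and f: "f \<in> Hom U V"
  have l: "lm U" "lm V" using U V by simp_all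
  note fs = hom_simps[OF f l]
  show "arr (hom_functor \<Lambda> Z) U V f \<in> hom (obj (hom_functor \<Lambda> Z) V) (obj (hom_functor \<Lambda> Z) U)"
  proof (rule homI)
    show "arr (hom_functor \<Lambda> Z) U V f h \<in> carrier (obj (hom_functor \<Lambda> Z) U)"
      if "h \<in> carrier (obj (hom_functor \<Lambda> Z) V)" for h
      using that compose_hom[OF f _ l(1)] by simp
    fix h k assume "h \<in> carrier (obj (hom_functor \<Lambda> Z) V)" "k \<in> carrier (obj (hom_functor \<Lambda> Z) V)"
    then have hk: "h \<in> Hom V Z" "k \<in> Hom V Z" by simp_all
    have "compose (carrier U) (hom_add V Z h k) f = hom_add U Z (compose (carrier U) h f) (compose (carrier U) k f)"
      by (rule lin_hom_eqI[OF compose_hom[OF f add_hom[OF l(2) lZ hk] l(1)]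
          add_hom[OF l(1) lZ compose_hom[OF f hk(1) l(1)] compose_hom[OF f hk(2) l(1)]]]) (simp add: fs(1))
    then show "arr (hom_functor \<Lambda> Z) U V f (h \<otimes>\<^bsub>obj (hom_functor \<Lambda> Z) V\<^esub> k) =
      arr (hom_functor \<Lambda> Z) U V f h \<otimes>\<^bsub>obj (hom_functor \<Lambda> Z) U\<^esub> arr (hom_functor \<Lambda> Z) U V f k" by simp
  qed
  show "arr (hom_functor \<Lambda> Z) U W (compose (carrier U) g f) h =
      arr (hom_functor \<Lambda> Z) U V f (arr (hom_functor \<Lambda> Z) V W g h)"
    if W: "W \<in> \<E>" and g: "g \<in> Hom V W" and h: "h \<in> carrier (obj (hom_functor \<Lambda> Z) W)" for W g h
  proof -
    have h: "h \<in> Hom W Z" using h by simp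
    have "compose (carrier U) h (compose (carrier U) g f) = compose (carrier U) (compose (carrier V) h g) f"
      by (rule lin_hom_eqI[OF compose_hom[OF compose_hom[OF f g l(1)] h l(1)]
          compose_hom[OF f compose_hom[OF g h l(2)] l(1)]]) (simp add: fs(1))
    then show ?thesis by simp
  qed
  show "arr (hom_functor \<Lambda> Z) U V (hom_add U V f g) h =
      arr (hom_functor \<Lambda> Z) U V f h \<otimes>\<^bsub>obj (hom_functor \<Lambda> Z) U\<^esub> arr (hom_functor \<Lambda> Z) U V g h"
    if g: "g \<in> Hom U V" and h: "h \<in> carrier (obj (hom_functor \<Lambda> Z) V)" for g h
  proof -
    have h: "h \<in> Hom V Z" using h by simp
    have "compose (carrier U) h (hom_add U V f g) = hom_add U Z (compose (carrier U) h f) (compose (carrier U) h g)"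
      by (rule lin_hom_eqI[OF compose_hom[OF add_hom[OF l f g] h l(1)]
          add_hom[OF l(1) lZ compose_hom[OF f h l(1)] compose_hom[OF g h l(1)]]])
        (simp add: fs(1) hom_closed[OF g] hom_simps(2)[OF h l(2) lZ])
    then show ?thesis by simp
  qed
next
  fix U h assume U: "U \<in> \<E>" and "h \<in> carrier (obj (hom_functor \<Lambda> Z) U)"
  then have h: "h \<in> Hom U Z" by simp
  have lU: "lm U" using U by simp
  have "compose (carrier U) h (hom_id U) = h"
    by (rule lin_hom_eqI[OF compose_hom[OF id_hom[OF lU] h lU] h]) simp
  then show "arr (hom_functor \<Lambda> Z) U U (hom_id U) h = h" by simp
qed

text \<open>Only inverses need an argument: the negative of h is h composed with minus the identity
  of U, so it belongs to the family by stability under composition.\<close>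

lemma subf_subfunctor:
  assumes Z: "Z \<in> \<E>" and V: "subf Z V"
  shows "subfunctor \<Lambda> \<E> (hom_functor \<Lambda> Z) V"
  unfolding subfunctor_def
proof (intro conjI ballI)
  fix U assume U: "U \<in> \<E>"
  have l: "lm U" "lm Z" using U Z by simp_all
  have g: "group (obj (hom_functor \<Lambda> Z) U)"
    using additive_functorD(1)[OF hom_functor_additive[OF Z] U] comm_group.axioms by blast
  show "subgroup (V U) (obj (hom_functor \<Lambda> Z) U)"
  proof (rule group.subgroupI[OF g])
    show "V U \<subseteq> carrier (obj (hom_functor \<Lambda> Z) U)" using subfD(1)[OF V U] by auto
    show "V U \<noteq> {}" using subfD(2)[OF V U] by blast
    show "h \<otimes>\<^bsub>obj (hom_functor \<Lambda> Z) U\<^esub> k \<in> V U" if "h \<in> V U" "k \<in> V U" for h k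
      using subfD(3)[OF V U that] by simp
    fix h assume h: "h \<in> V U"
    note hH = subfD(1)[OF V U h] and idU = id_hom[OF l(1)] and zU = zero_hom[OF l(1,1)]
    let ?m = "compose (carrier U) h (hom_diff U U (hom_zero U U) (hom_id U))"
    have m: "?m \<in> V U" by (rule subfD(4)[OF V U U diff_hom[OF l(1,1) zU idU] h])
    have "hom_add U Z ?m h = hom_zero U Z"
    proof (rule lin_hom_eqI[OF add_hom[OF l subfD(1)[OF V U m] hH] zero_hom[OF l]])
      fix u assume u: "u \<in> carrier U"
      have "?m u = \<ominus>\<^bsub>Z\<^esub> h u" using u hom_simps(5)[OF hH l u] lm_add(9)[OF l(1) u] by simp
      then show "hom_add U Z ?m h u = hom_zero U Z u" using u lm_add(5)[OF l(2) hom_closed[OF hH u]] by simp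
    qed
    then have "inv\<^bsub>obj (hom_functor \<Lambda> Z) U\<^esub> h = ?m"
      by (intro group.inv_equality[OF g]) (use hH subfD(1)[OF V U m] in simp_all)
    then show "inv\<^bsub>obj (hom_functor \<Lambda> Z) U\<^esub> h \<in> V U" using m by simp
  qed
  show "arr (hom_functor \<Lambda> Z) U U' k ` V U' \<subseteq> V U" if "U' \<in> \<E>" "k \<in> Hom U U'" for U' k
    using subfD(4)[OF V that(1) U that(2)] by auto
qed

text \<open>The subfunctors of a quotient of a representable functor by the image of \<open>f\<close> correspond to the
  subfunctors of the representable functor containing this image.\<close>

definition presents where
  "presents M Y f Z \<pi> \<longleftrightarrow> additive_functor \<Lambda> \<E> M \<and> deflation \<Lambda> \<E> Y f Z \<and>
    nat_trans \<Lambda> \<E> (hom_functor \<Lambda> Z) M \<pi> \<and>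
    (\<forall>U\<in>\<E>. \<pi> U ` Hom U Z = carrier (obj M U) \<and>
      kernel (obj (hom_functor \<Lambda> Z) U) (obj M U) (\<pi> U) = im_f Y f U)"

lemma effaceable_iff: "effaceable \<Lambda> \<E> M \<longleftrightarrow> (\<exists>Y f Z \<pi>. presents M Y f Z \<pi>)"
  unfolding effaceable_def presents_def im_f_def by blast

lemma presentsD:
  assumes "presents M Y f Z \<pi>"
  shows "additive_functor \<Lambda> \<E> M" "\<exists>X k. conflation \<Lambda> \<E> X k Y f Z" "Y \<in> \<E>" "Z \<in> \<E>" "f \<in> Hom Y Z"
    "U \<in> \<E> \<Longrightarrow> group_hom (obj (hom_functor \<Lambda> Z) U) (obj M U) (\<pi> U)"
    "U \<in> \<E> \<Longrightarrow> \<pi> U ` Hom U Z = carrier (obj M U)"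
    "\<lbrakk>U \<in> \<E>; h \<in> Hom U Z\<rbrakk> \<Longrightarrow> \<pi> U h = \<one>\<^bsub>obj M U\<^esub> \<longleftrightarrow> h \<in> im_f Y f U"
    "\<lbrakk>U \<in> \<E>; U' \<in> \<E>; k \<in> Hom U' U; h \<in> Hom U Z\<rbrakk> \<Longrightarrow> \<pi> U' (compose (carrier U') h k) = arr M U' U k (\<pi> U h)"
proof -
  show 1: "additive_functor \<Lambda> \<E> M" and 2: "\<exists>X k. conflation \<Lambda> \<E> X k Y f Z"
    using assms unfolding presents_def deflation_def by blast+
  from 2 obtain X' k' where c: "conflation \<Lambda> \<E> X' k' Y f Z" by blast
  then show "Y \<in> \<E>" and Z: "Z \<in> \<E>" by (rule conflationD)+
  show "f \<in> Hom Y Z" using short_exactD(2)[OF conflationD(4)[OF c]] .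
  show "\<pi> U ` Hom U Z = carrier (obj M U)" if "U \<in> \<E>"
    using assms that unfolding presents_def by blast
  show "group_hom (obj (hom_functor \<Lambda> Z) U) (obj M U) (\<pi> U)" if U: "U \<in> \<E>"
    using assms U additive_functorD(1)[OF 1 U] additive_functorD(1)[OF hom_functor_additive[OF Z] U]
    unfolding presents_def nat_trans_def group_hom_def group_hom_axioms_def comm_group_def by blast
  show "\<pi> U h = \<one>\<^bsub>obj M U\<^esub> \<longleftrightarrow> h \<in> im_f Y f U" if U: "U \<in> \<E>" "h \<in> Hom U Z"
  proof -
    have "kernel (obj (hom_functor \<Lambda> Z) U) (obj M U) (\<pi> U) = im_f Y f U"
      using assms U unfolding presents_def by blast
    then show ?thesis using U(2) by (auto simp: kernel_def)
  qed
  show "\<pi> U' (compose (carrier U') h k) = arr M U' U k (\<pi> U h)"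
    if "U \<in> \<E>" "U' \<in> \<E>" "k \<in> Hom U' U" "h \<in> Hom U Z"
    using assms that unfolding presents_def nat_trans_def by simp
qed

text \<open>Two morphisms with the same image under \<pi> differ by an element of
  \<open>im_f\<close>, which V contains. Hence V is the full preimage of its image.\<close>

lemma presents_fibre:
  assumes p: "presents M Y f Z \<pi>" and U: "U \<in> \<E>" and h: "h \<in> Hom U Z" and V: "subf Z V" "im_f Y f U \<subseteq> V U"
    and e: "\<pi> U h \<in> \<pi> U ` V U"
  shows "h \<in> V U"
proof -
  interpret h: group_hom "obj (hom_functor \<Lambda> Z) U" "obj M U" "\<pi> U" by (rule presentsD(6)[OF p U])
  let ?G = "obj (hom_functor \<Lambda> Z) U"
  note s = subfunctorD(1)[OF subf_subfunctor[OF presentsD(4)[OF p] V(1)] U]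
  obtain v where v: "v \<in> V U" "\<pi> U h = \<pi> U v" using e by auto
  have vG: "v \<in> carrier ?G" and hG: "h \<in> carrier ?G" using subfD(1)[OF V(1) U v(1)] h by simp_all
  have c: "h \<otimes>\<^bsub>?G\<^esub> inv\<^bsub>?G\<^esub> v \<in> carrier ?G" using vG hG by blast
  have "\<pi> U (h \<otimes>\<^bsub>?G\<^esub> inv\<^bsub>?G\<^esub> v) = \<one>\<^bsub>obj M U\<^esub>"
    using h.hom_mult[OF hG h.G.inv_closed[OF vG]] h.hom_inv[OF vG] v(2) h.H.r_inv[OF h.hom_closed[OF vG]] by simp
  then have "h \<otimes>\<^bsub>?G\<^esub> inv\<^bsub>?G\<^esub> v \<in> im_f Y f U"
    using presentsD(8)[OF p U] c by simp
  then have "h \<otimes>\<^bsub>?G\<^esub> inv\<^bsub>?G\<^esub> v \<in> V U" using V(2) by blast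
  then have "(h \<otimes>\<^bsub>?G\<^esub> inv\<^bsub>?G\<^esub> v) \<otimes>\<^bsub>?G\<^esub> v \<in> V U"
    by (rule subgroup.m_closed[OF s _ v(1)])
  then show ?thesis using h.G.m_assoc[OF hG h.G.inv_closed[OF vG] vG] h.G.l_inv[OF vG] h.G.r_one[OF hG] by simp
qed

lemma presents_image:
  assumes p: "presents M Y f Z \<pi>" and V: "subf Z V"
  shows "subfunctor \<Lambda> \<E> M (\<lambda>U. \<pi> U ` V U)"
  unfolding subfunctor_def
proof (intro conjI ballI)
  fix U assume U: "U \<in> \<E>"
  show "subgroup (\<pi> U ` V U) (obj M U)"
    by (rule group_hom.subgroup_img_is_subgroup[OF presentsD(6)[OF p U]
      subfunctorD(1)[OF subf_subfunctor[OF presentsD(4)[OF p] V] U]])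
  show "arr M U U' k ` \<pi> U' ` V U' \<subseteq> \<pi> U ` V U" if U': "U' \<in> \<E>" and k: "k \<in> Hom U U'" for U' k
  proof
    fix w assume "w \<in> arr M U U' k ` \<pi> U' ` V U'"
    then obtain h where h: "h \<in> V U'" "w = arr M U U' k (\<pi> U' h)" by auto
    have "w = \<pi> U (compose (carrier U) h k)"
      unfolding h(2) by (rule presentsD(9)[OF p U' U k subfD(1)[OF V U' h(1)], symmetric])
    then show "w \<in> \<pi> U ` V U" using subfD(4)[OF V U' U k h(1)] by blast
  qed
qed

definition pull where
  "pull Z \<pi> W U = {h \<in> Hom U Z. \<pi> U h \<in> W U}"

lemma presents_pull:
  assumes p: "presents M Y f Z \<pi>" and W: "subfunctor \<Lambda> \<E> M W"
  shows "subf Z (pull Z \<pi> W)" "U \<in> \<E> \<Longrightarrow> im_f Y f U \<subseteq> pull Z \<pi> W U" "U \<in> \<E> \<Longrightarrow> \<pi> U ` pull Z \<pi> W U = W U"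
proof -
  have lZ: "lm Z" using presentsD(4)[OF p] by simp
  show "subf Z (pull Z \<pi> W)"
    unfolding subf_def
  proof (intro ballI conjI)
    fix U assume U: "U \<in> \<E>"
    interpret h: group_hom "obj (hom_functor \<Lambda> Z) U" "obj M U" "\<pi> U" by (rule presentsD(6)[OF p U])
    note s = subfunctorD(1)[OF W U]
    show "pull Z \<pi> W U \<subseteq> Hom U Z" by (auto simp: pull_def)
    show "hom_zero U Z \<in> pull Z \<pi> W U"
      using h.hom_one h.G.one_closed subgroup.one_closed[OF s] by (simp add: pull_def)
    show "hom_add U Z h k \<in> pull Z \<pi> W U" if "h \<in> pull Z \<pi> W U" "k \<in> pull Z \<pi> W U" for h k
      using that h.hom_mult[of h k] h.G.m_closed[of h k] subgroup.m_closed[OF s] by (simp add: pull_def)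
    show "compose (carrier U') h k \<in> pull Z \<pi> W U'" if U': "U' \<in> \<E>" "k \<in> Hom U' U" "h \<in> pull Z \<pi> W U" for U' k h
    proof -
      have h: "h \<in> Hom U Z" "\<pi> U h \<in> W U" using U'(3) by (simp_all add: pull_def)
      have "compose (carrier U') h k \<in> Hom U' Z" by (rule compose_hom[OF U'(2) h(1) E_lm[OF U'(1)]])
      then show ?thesis
        using presentsD(9)[OF p U U'(1,2) h(1)] subfunctorD(2)[OF W U'(1) U U'(2) h(2)] by (simp add: pull_def)
    qed
  qed
  show "im_f Y f U \<subseteq> pull Z \<pi> W U" if U: "U \<in> \<E>"
  proof
    fix h assume h: "h \<in> im_f Y f U"
    then have hH: "h \<in> Hom U Z" using subfD(1)[OF im_f_subf[OF presentsD(3,4,5)[OF p]] U] by blast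
    then have "\<pi> U h = \<one>\<^bsub>obj M U\<^esub>" using presentsD(8)[OF p U hH] h by simp
    then show "h \<in> pull Z \<pi> W U"
      using hH subgroup.one_closed[OF subfunctorD(1)[OF W U]] by (simp add: pull_def)
  qed
  show "\<pi> U ` pull Z \<pi> W U = W U" if U: "U \<in> \<E>"
    using subgroup.subset[OF subfunctorD(1)[OF W U]] presentsD(7)[OF p U] by (force simp: pull_def image_iff)
qed

lemma pull_mono:
  assumes p: "presents M Y f Z \<pi>" and W: "subfunctor \<Lambda> \<E> M W" "subfunctor \<Lambda> \<E> M W'" and U: "U \<in> \<E>"
  shows "pull Z \<pi> W U = pull Z \<pi> W' U \<longleftrightarrow> W U = W' U" "W U \<subseteq> W' U \<Longrightarrow> pull Z \<pi> W U \<subseteq> pull Z \<pi> W' U"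
proof -
  show "pull Z \<pi> W U = pull Z \<pi> W' U \<longleftrightarrow> W U = W' U"
  proof
    assume "pull Z \<pi> W U = pull Z \<pi> W' U"
    then have "\<pi> U ` pull Z \<pi> W U = \<pi> U ` pull Z \<pi> W' U" by simp
    then show "W U = W' U" by (simp only: presents_pull(3)[OF p W(1) U] presents_pull(3)[OF p W(2) U])
  qed (simp only: pull_def)
  show "W U \<subseteq> W' U \<Longrightarrow> pull Z \<pi> W U \<subseteq> pull Z \<pi> W' U"
    unfolding pull_def by blast
qed

text \<open>A composition series of M is pulled back along \<pi>. The zero functor at its bottom
  becomes the kernel \<open>im_f\<close>, and \<open>simple_iff\<close> turns simple factors into
  simple steps.\<close>

lemma finite_length_filtration:
  assumes p: "presents M Y f Z \<pi>" and fl: "finite_length \<Lambda> \<E> M"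
  obtains n T where "\<forall>i\<le>n. subf Z (T i)" "\<forall>U\<in>\<E>. T 0 U = im_f Y f U" "\<forall>U\<in>\<E>. T n U = Hom U Z"
    "\<forall>i<n. simple_step Z (T i) (T (Suc i))"
proof -
  obtain n S where S: "\<And>i. i \<le> n \<Longrightarrow> subfunctor \<Lambda> \<E> M (S i)" "\<And>U. U \<in> \<E> \<Longrightarrow> S 0 U = {\<one>\<^bsub>obj M U\<^esub>}"
    "\<And>U. U \<in> \<E> \<Longrightarrow> S n U = carrier (obj M U)" "\<And>i U. \<lbrakk>i < n; U \<in> \<E>\<rbrakk> \<Longrightarrow> S i U \<subseteq> S (Suc i) U"
    "\<And>i. i < n \<Longrightarrow> simple_functor \<Lambda> \<E> (subquotient M (S (Suc i)) (S i))"
    using fl unfolding finite_length_def by metis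
  have "\<forall>i\<le>n. subf Z (pull Z \<pi> (S i))" using presents_pull(1)[OF p] S(1) by blast
  moreover have "\<forall>U\<in>\<E>. pull Z \<pi> (S 0) U = im_f Y f U"
    using presentsD(8)[OF p] S(2) subfD(1)[OF im_f_subf[OF presentsD(3,4,5)[OF p]]] by (auto simp: pull_def)
  moreover have "\<forall>U\<in>\<E>. pull Z \<pi> (S n) U = Hom U Z"
    using presentsD(7)[OF p] S(3) by (auto simp: pull_def)
  moreover have "simple_step Z (pull Z \<pi> (S i)) (pull Z \<pi> (S (Suc i)))" if i: "i < n" for i
  proof -
    have s: "subfunctor \<Lambda> \<E> M (S i)" "subfunctor \<Lambda> \<E> M (S (Suc i))"
      using S(1) i by simp_all
    interpret q: subquotient_setup R \<Lambda> \<E> M "S i" "S (Suc i)"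
      by unfold_locales (rule presentsD(1)[OF p] s S(4)[OF i]; assumption)+
    have ne: "\<exists>U\<in>\<E>. S i U \<noteq> S (Suc i) U"
      and simple: "\<And>V. \<lbrakk>subfunctor \<Lambda> \<E> M V; \<forall>U\<in>\<E>. S i U \<subseteq> V U \<and> V U \<subseteq> S (Suc i) U\<rbrakk> \<Longrightarrow>
        (\<forall>U\<in>\<E>. V U = S i U) \<or> (\<forall>U\<in>\<E>. V U = S (Suc i) U)"
      using S(5)[OF i] q.simple_iff by blast+
    show ?thesis
      unfolding simple_step_def
    proof (intro conjI ballI allI impI)
      show "pull Z \<pi> (S i) U \<subseteq> pull Z \<pi> (S (Suc i)) U" if "U \<in> \<E>" for U
        by (rule pull_mono(2)[OF p s that S(4)[OF i that]])
      show "\<exists>U\<in>\<E>. pull Z \<pi> (S i) U \<noteq> pull Z \<pi> (S (Suc i)) U"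
        using ne pull_mono(1)[OF p s] by blast
      fix V assume V: "subf Z V" and between: "\<forall>U\<in>\<E>. pull Z \<pi> (S i) U \<subseteq> V U \<and> V U \<subseteq> pull Z \<pi> (S (Suc i)) U"
      let ?W = "\<lambda>U. \<pi> U ` V U"
      have W: "subfunctor \<Lambda> \<E> M ?W" by (rule presents_image[OF p V])
      have "S i U \<subseteq> ?W U \<and> ?W U \<subseteq> S (Suc i) U" if U: "U \<in> \<E>" for U
        using between U presents_pull(3)[OF p s(1) U] presents_pull(3)[OF p s(2) U] by blast
      then have cases: "(\<forall>U\<in>\<E>. ?W U = S i U) \<or> (\<forall>U\<in>\<E>. ?W U = S (Suc i) U)"
        using simple[OF W] by blast
      \<comment> \<open>V contains the kernel of \<pi>, so it is determined by its image; the
        alternative for the image thus passes back to V.\<close>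
      have VW: "V U = pull Z \<pi> ?W U" if U: "U \<in> \<E>" for U
      proof -
        have "im_f Y f U \<subseteq> V U" using presents_pull(2)[OF p s(1) U] between U by blast
        then show ?thesis using presents_fibre[OF p U _ V] subfD(1)[OF V U] by (auto simp: pull_def)
      qed
      have "V U = pull Z \<pi> (S j) U" if U: "U \<in> \<E>" and e: "?W U = S j U" for U j
        unfolding VW[OF U] unfolding pull_def e ..
      with cases show "(\<forall>U\<in>\<E>. V U = pull Z \<pi> (S i) U) \<or> (\<forall>U\<in>\<E>. V U = pull Z \<pi> (S (Suc i)) U)"
        by blast
    qed
  qed
  ultimately show thesis by (intro that[of n "\<lambda>i. pull Z \<pi> (S i)"]) blast+
qed

text \<open>The filtration is pushed forward along \<pi>. All its members contain the kernel
  \<open>im_f\<close>, so each is recovered from its image by \<open>pull\<close>, and the steps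
  stay strict and simple.\<close>

lemma filtration_finite_length:
  assumes p: "presents M Y f Z \<pi>" and T: "\<forall>i\<le>n. subf Z (T i)" "\<forall>U\<in>\<E>. T 0 U = im_f Y f U"
    "\<forall>U\<in>\<E>. T n U = Hom U Z" "\<forall>i<n. simple_step Z (T i) (T (Suc i))"
  shows "finite_length \<Lambda> \<E> M"
proof -
  let ?S = "\<lambda>i U. \<pi> U ` T i U"
  have sT: "subf Z (T i)" if "i \<le> n" for i using T(1) that by blast
  have im: "im_f Y f U \<subseteq> T i U" if "i \<le> n" "U \<in> \<E>" for i U
    using that(1)
  proof (induction i)
    case (Suc i)
    then show ?case using simple_stepD(1)[of Z "T i" "T (Suc i)" U] T(4) that(2) by force
  qed (use T(2) that(2) in simp)
  have sS: "subfunctor \<Lambda> \<E> M (?S i)" if "i \<le> n" for i by (rule presents_image[OF p sT[OF that]])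
  have pS: "pull Z \<pi> (?S i) U = T i U" if i: "i \<le> n" and U: "U \<in> \<E>" for i U
    using presents_fibre[OF p U _ sT[OF i] im[OF i U]] subfD(1)[OF sT[OF i] U] by (auto simp: pull_def)
  have "?S 0 U = {\<one>\<^bsub>obj M U\<^esub>}" if U: "U \<in> \<E>" for U
  proof -
    have "hom_zero U Z \<in> T 0 U" by (rule subfD(2)[OF sT U]) simp
    moreover have "\<pi> U h = \<one>\<^bsub>obj M U\<^esub>" if "h \<in> T 0 U" for h
      using presentsD(8)[OF p U subfD(1)[OF sT U that]] T(2) U that by simp
    ultimately show ?thesis by auto
  qed
  moreover have "?S n U = carrier (obj M U)" if U: "U \<in> \<E>" for U using T(3) U presentsD(7)[OF p U] by simp
  moreover have "?S i U \<subseteq> ?S (Suc i) U" if "i < n" "U \<in> \<E>" for i U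
    using simple_stepD(1)[of Z "T i" "T (Suc i)" U] T(4) that by blast
  moreover have "simple_functor \<Lambda> \<E> (subquotient M (?S (Suc i)) (?S i))" if i: "i < n" for i
  proof -
    have s: "subfunctor \<Lambda> \<E> M (?S i)" "subfunctor \<Lambda> \<E> M (?S (Suc i))"
      using sS i by simp_all
    have st: "simple_step Z (T i) (T (Suc i))" using T(4) i by blast
    have le: "i \<le> n" "Suc i \<le> n" using i by simp_all
    interpret q: subquotient_setup R \<Lambda> \<E> M "?S i" "?S (Suc i)"
      by unfold_locales (rule presentsD(1)[OF p] s image_mono[OF simple_stepD(1)[OF st]]; assumption)+
    show ?thesis
      unfolding q.simple_iff
    proof (intro conjI allI impI)
      obtain U where U: "U \<in> \<E>" "T i U \<noteq> T (Suc i) U" using simple_stepD(2)[OF st] by blast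
      then have "?S i U \<noteq> ?S (Suc i) U"
        using pull_mono(1)[OF p s U(1)] pS[OF le(1) U(1)] pS[OF le(2) U(1)] by simp
      then show "\<exists>U\<in>\<E>. ?S i U \<noteq> ?S (Suc i) U" using U(1) by blast
      fix V assume V: "subfunctor \<Lambda> \<E> M V" and between: "\<forall>U\<in>\<E>. ?S i U \<subseteq> V U \<and> V U \<subseteq> ?S (Suc i) U"
      have "T i U \<subseteq> pull Z \<pi> V U" "pull Z \<pi> V U \<subseteq> T (Suc i) U" if U: "U \<in> \<E>" for U
        using pull_mono(2)[OF p s(1) V U] pull_mono(2)[OF p V s(2) U] between U pS[OF le(1) U] pS[OF le(2) U] by simp_all
      then have "(\<forall>U\<in>\<E>. pull Z \<pi> V U = T i U) \<or> (\<forall>U\<in>\<E>. pull Z \<pi> V U = T (Suc i) U)"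
        using st presents_pull(1)[OF p V] unfolding simple_step_def by blast
      then show "(\<forall>U\<in>\<E>. V U = ?S i U) \<or> (\<forall>U\<in>\<E>. V U = ?S (Suc i) U)"
        using presents_pull(3)[OF p V] by metis
    qed
  qed
  ultimately show ?thesis
    unfolding finite_length_def using sS by (intro exI[of _ n] exI[of _ ?S] conjI allI ballI impI) simp_all
qed

lemma subf_Hom:
  assumes "Z \<in> \<E>" shows "subf Z (\<lambda>U. Hom U Z)"
  unfolding subf_def
proof (intro ballI conjI)
  have lZ: "lm Z" using assms by simp
  fix U assume U: "U \<in> \<E>"
  have lU: "lm U" using U by simp
  show "hom_zero U Z \<in> Hom U Z" by (rule zero_hom[OF lU lZ])
  show "hom_add U Z h k \<in> Hom U Z" if "h \<in> Hom U Z" "k \<in> Hom U Z" for h k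
    by (rule add_hom[OF lU lZ that])
  show "compose (carrier U') h k \<in> Hom U' Z" if "U' \<in> \<E>" "k \<in> Hom U' U" "h \<in> Hom U Z" for U' k h
    by (rule compose_hom[OF that(2,3) E_lm[OF that(1)]])
qed simp

text \<open>The cosets forming the values are sets of homomorphisms. This functor therefore has
  exactly the value type over which \<open>admissible\<close> quantifies.\<close>

lemma cokernel_presents:
  assumes c: "conflation \<Lambda> \<E> X k Y g Z"
  shows "presents (subquotient (hom_functor \<Lambda> Z) (\<lambda>U. Hom U Z) (im_f Y g)) Y g Z
    (\<lambda>U h. im_f Y g U #>\<^bsub>obj (hom_functor \<Lambda> Z) U\<^esub> h)"
proof -
  note cD = conflationD[OF c]
  note gH = short_exactD(2)[OF cD(4)]
  have I: "subfunctor \<Lambda> \<E> (hom_functor \<Lambda> Z) (im_f Y g)"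
    by (rule subf_subfunctor[OF cD(3) im_f_subf[OF cD(2,3) gH]])
  have H: "subfunctor \<Lambda> \<E> (hom_functor \<Lambda> Z) (\<lambda>U. Hom U Z)"
    by (rule subf_subfunctor[OF cD(3) subf_Hom[OF cD(3)]])
  interpret q: subquotient_setup R \<Lambda> \<E> "hom_functor \<Lambda> Z" "im_f Y g" "\<lambda>U. Hom U Z"
    by unfold_locales (rule hom_functor_additive[OF cD(3)] I H subsetI, (erule (1) subfD(1)[OF im_f_subf[OF cD(2,3) gH]])?)+
  let ?Q = "subquotient (hom_functor \<Lambda> Z) (\<lambda>U. Hom U Z) (im_f Y g)"
  have "group_hom (obj (hom_functor \<Lambda> Z) U) (obj ?Q U) (q.cs U)" if U: "U \<in> \<E>" for U
  proof -
    have e: "(obj (hom_functor \<Lambda> Z) U)\<lparr>carrier := Hom U Z\<rparr> = obj (hom_functor \<Lambda> Z) U"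
      by (simp add: hom_functor_def)
    show ?thesis using q.Q_obj(2)[OF U] by (simp only: e)
  qed
  then have "nat_trans \<Lambda> \<E> (hom_functor \<Lambda> Z) ?Q q.cs"
    unfolding nat_trans_def using q.Q_arr group_hom.homh by fastforce
  moreover have "kernel (obj (hom_functor \<Lambda> Z) U) (obj ?Q U) (q.cs U) = im_f Y g U" if U: "U \<in> \<E>" for U
  proof -
    note s = subfunctorD(1)[OF I U] and g = q.group_F[OF U]
    have "q.cs U h = im_f Y g U \<longleftrightarrow> h \<in> im_f Y g U" if "h \<in> Hom U Z" for h
      using group.coset_join1[OF g _ _ s] group.coset_join2[OF g _ s] that by auto
    then show ?thesis using subgroup.subset[OF s] by (auto simp: kernel_def q.Q_obj(5)[OF U])
  qed
  moreover have "deflation \<Lambda> \<E> Y g Z" using c by (auto simp: deflation_def)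
  ultimately show ?thesis
    unfolding presents_def using q.Q_additive q.Q_obj(4) by simp
qed

theorem admissible_AR:
  assumes "admissible \<Lambda> \<E>"
  shows "AR_group \<Lambda> \<E> = Ex_group \<Lambda> \<E>"
proof
  show "AR_group \<Lambda> \<E> \<subseteq> Ex_group \<Lambda> \<E>"
    unfolding AR_group_def Ex_group_def
    by (rule group.mono_generate[OF K0_split_simps(4)]) (unfold AR_conflation_def, blast)
  have "defect X Y Z \<in> AR_group \<Lambda> \<E>" if c: "conflation \<Lambda> \<E> X f Y g Z" for X f Y g Z
  proof -
    note p = cokernel_presents[OF c]
    then have "effaceable \<Lambda> \<E> (subquotient (hom_functor \<Lambda> Z) (\<lambda>U. Hom U Z) (im_f Y g))"
      unfolding effaceable_iff by blast
    then have fl: "finite_length \<Lambda> \<E> (subquotient (hom_functor \<Lambda> Z) (\<lambda>U. Hom U Z) (im_f Y g))"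
      using assms unfolding admissible_def by blast
    obtain n T where T: "\<forall>i\<le>n. subf Z (T i)" "\<forall>U\<in>\<E>. T 0 U = im_f Y g U" "\<forall>U\<in>\<E>. T n U = Hom U Z"
      "\<forall>i<n. simple_step Z (T i) (T (Suc i))"
      by (rule finite_length_filtration[OF p fl])
    show ?thesis by (rule chain_defect[OF c T])
  qed
  then show "Ex_group \<Lambda> \<E> \<subseteq> AR_group \<Lambda> \<E>"
    unfolding Ex_group_def
    by (intro group.generate_subgroup_incl[OF K0_split_simps(4)] AR_subgroup) blast
qed

text \<open>The scalar r acts on Hom(G,Z) as composition with the endomorphism \<open>scal r\<close>
  of G. Stability of V under composition thus makes \<open>V G\<close> a submodule, so that lengths
  apply to it.\<close>

lemma subf_submod:
  assumes G: "G \<in> \<E>" and Z: "Z \<in> \<E>" and V: "subf Z V"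
  shows "R.submod (hom_mod G Z) (V G)"
proof (rule R.submodI)
  show "V G \<subseteq> carrier (hom_mod G Z)" using subfD(1)[OF V G] by auto
  show "\<zero>\<^bsub>hom_mod G Z\<^esub> \<in> V G" using subfD(2)[OF V G] by simp
  show "h \<oplus>\<^bsub>hom_mod G Z\<^esub> k \<in> V G" if "h \<in> V G" "k \<in> V G" for h k
    using subfD(3)[OF V G that] by simp
  fix r h assume r: "r \<in> carrier R" and h: "h \<in> V G"
  have l: "lm G" "lm Z" using G Z by simp_all
  note hH = subfD(1)[OF V G h]
  let ?s = "\<lambda>u\<in>carrier G. scal r \<odot>\<^bsub>G\<^esub> hom_id G u"
  have s: "?s \<in> Hom G G" by (rule scal_hom[OF l(1,1) id_hom[OF l(1)] r])
  have "(\<lambda>u\<in>carrier G. scal r \<odot>\<^bsub>Z\<^esub> h u) = compose (carrier G) h ?s"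
    by (rule lin_hom_eqI[OF scal_hom[OF l hH r] compose_hom[OF s hH l(1)]])
      (simp add: hom_simps(3)[OF hH l scal(1)[OF r]])
  then show "r \<odot>\<^bsub>hom_mod G Z\<^esub> h \<in> V G" using subfD(4)[OF V G G s h] by simp
qed

text \<open>A subfunctor is determined by its value on an additive generator, since every \<open>h\<close> on a summand of
  \<open>G\<^sup>n\<close> is a sum of morphisms factoring through \<open>h\<close>'s restrictions to the copies of \<open>G\<close>.\<close>

lemma subf_le_generator:
  assumes G: "G \<in> \<E>" "\<E> = add_closure \<Lambda> G" and Z: "Z \<in> \<E>" and S: "subf Z S" and T: "subf Z T"
    and le: "S G \<subseteq> T G" and U: "U \<in> \<E>"
  shows "S U \<subseteq> T U"
proof
  fix h assume h: "h \<in> S U"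
  obtain n and Y X' :: "('a, (nat \<Rightarrow> 'a) set) module" where Y: "Y \<in> Mo" "X' \<in> Mo" "direct_sum \<Lambda> Y (replicate n G)" "direct_sum \<Lambda> Y [U, X']"
    using U G(2) unfolding add_closure_def by blast
  have l: "lm G" "lm Z" "lm Y" "lm U" "lm X'" using G Z Y U by simp_all
  have YE: "Y \<in> \<E>" by (rule E_direct_sum[OF _ Y(1,3)]) (use G in auto)
  obtain i j p q where b: "bip Y U X' i j p q" using direct_sum_pair[OF l(3,4,5)] Y(4) by auto
  note bD = bipD[OF b]
  obtain \<iota> \<pi> where d: "dsum Y (replicate n G) \<iota> \<pi>"
    using direct_sum_iff[OF l(3), of "replicate n G"] Y(3) l(1) by auto
  have dh: "\<iota> k \<in> Hom G Y" "\<pi> k \<in> Hom Y G" if "k < n" for k using d that unfolding dsum_def by auto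
  have ds: "y = (\<Oplus>\<^bsub>Y\<^esub>k\<in>{..<n}. \<iota> k (\<pi> k y))" if "y \<in> carrier Y" for y using d that unfolding dsum_def by auto
  interpret Y: abelian_group Y by (rule lm_group[OF l(3)])
  note hH = subfD(1)[OF S U h]
  have hp: "compose (carrier Y) h p \<in> Hom Y Z" by (rule compose_hom[OF bD(3) hH l(3)])
  \<comment> \<open>The identity of U is built up from its components through the copies of G. Each
    new term of the partial sum is the restriction of h to one copy, an element of
    \<open>S G\<close> and hence of \<open>T G\<close>, composed with a morphism from U to
    G.\<close>
  let ?s = "\<lambda>m. \<lambda>u\<in>carrier U. h (p (\<Oplus>\<^bsub>Y\<^esub>k\<in>{..<m}. \<iota> k (\<pi> k (i u))))"
  have c: "\<iota> k (\<pi> k (i u)) \<in> carrier Y" if "k < n" "u \<in> carrier U" for k u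
    using hom_closed[OF dh(1)[OF that(1)]] hom_closed[OF dh(2)[OF that(1)]] hom_closed[OF bD(1) that(2)] by blast
  have "m \<le> n \<Longrightarrow> ?s m \<in> T U" for m
  proof (induction m)
    case 0
    have "?s 0 = hom_zero U Z"
      using hom_simps(4)[OF bD(3) l(3,4)] hom_simps(4)[OF hH l(4,2)] by (auto simp: hom_zero_def)
    then show ?case using subfD(2)[OF T U] by simp
  next
    case (Suc m)
    have m: "m < n" "m \<le> n" using Suc.prems by simp_all
    note IH = Suc.IH[OF m(2)]
    have e: "compose (carrier U) (\<pi> m) i \<in> Hom U G" by (rule compose_hom[OF bD(1) dh(2)[OF m(1)] l(4)])
    have "compose (carrier G) h (compose (carrier G) p (\<iota> m)) \<in> S G"
      by (rule subfD(4)[OF S U G(1) compose_hom[OF dh(1)[OF m(1)] bD(3) l(1)] h])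
    then have "compose (carrier G) h (compose (carrier G) p (\<iota> m)) \<in> T G" using le by blast
    then have t: "compose (carrier U) (compose (carrier G) h (compose (carrier G) p (\<iota> m))) (compose (carrier U) (\<pi> m) i) \<in> T U"
      (is "?t \<in> _") by (rule subfD(4)[OF T G(1) U e])
    have "?s (Suc m) u = hom_add U Z (?s m) ?t u" if u: "u \<in> carrier U" for u
    proof -
      have pc: "(\<lambda>k. \<iota> k (\<pi> k (i u))) \<in> {..<m} \<rightarrow> carrier Y"
        using c[OF _ u] m by auto
      have fc: "(\<Oplus>\<^bsub>Y\<^esub>k\<in>{..<m}. \<iota> k (\<pi> k (i u))) \<in> carrier Y"
        using pc by (rule Y.finsum_closed)
      have "(\<Oplus>\<^bsub>Y\<^esub>k\<in>{..<Suc m}. \<iota> k (\<pi> k (i u))) =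
          \<iota> m (\<pi> m (i u)) \<oplus>\<^bsub>Y\<^esub> (\<Oplus>\<^bsub>Y\<^esub>k\<in>{..<m}. \<iota> k (\<pi> k (i u)))"
        unfolding lessThan_Suc by (rule Y.finsum_insert) (use pc c[OF m(1) u] in auto)
      also have "\<dots> = (\<Oplus>\<^bsub>Y\<^esub>k\<in>{..<m}. \<iota> k (\<pi> k (i u))) \<oplus>\<^bsub>Y\<^esub> \<iota> m (\<pi> m (i u))"
        by (rule Y.a_comm[OF c[OF m(1) u] fc])
      finally have "h (p (\<Oplus>\<^bsub>Y\<^esub>k\<in>{..<Suc m}. \<iota> k (\<pi> k (i u)))) =
          h (p (\<Oplus>\<^bsub>Y\<^esub>k\<in>{..<m}. \<iota> k (\<pi> k (i u)))) \<oplus>\<^bsub>Z\<^esub> h (p (\<iota> m (\<pi> m (i u))))"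
        using hom_simps(2)[OF hp l(3,2) fc c[OF m(1) u]] fc c[OF m(1) u] by simp
      then show ?thesis using u hom_closed[OF e u] by simp
    qed
    then have "?s (Suc m) = hom_add U Z (?s m) ?t"
      by (intro ext) (simp add: hom_add_def)
    then show ?case using subfD(3)[OF T U IH t] by (simp only:)
  qed
  then have sT: "?s n \<in> T U" by simp
  have "h = ?s n"
  proof (rule lin_hom_eqI[OF hH subfD(1)[OF T U sT]])
    fix u assume u: "u \<in> carrier U"
    have "?s n u = h (p (i u))" using ds[OF hom_closed[OF bD(1) u]] u by simp
    then show "h u = ?s n u" using bD(5)[OF u] by simp
  qed
  then show "h \<in> T U" using sT by simp
qed

lemma simple_step_cong:
  assumes "simple_step Z S T" "\<And>U. U \<in> \<E> \<Longrightarrow> S' U = S U" "\<And>U. U \<in> \<E> \<Longrightarrow> T' U = T U"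
  shows "simple_step Z S' T'"
  using assms(1) unfolding simple_step_def by (simp add: assms(2,3) cong: ball_cong bex_cong)

text \<open>Induction on the length of \<open>T G\<close> modulo \<open>S G\<close>. If the step
  from S to T is not simple, some V lies properly between. By \<open>subf_le_generator\<close> it
  differs from S and from T already at G, so both halves have smaller length, and their filtrations
  are joined.\<close>

lemma filtration_ex:
  assumes G: "G \<in> \<E>" "\<E> = add_closure \<Lambda> G" and Z: "Z \<in> \<E>"
  shows "\<lbrakk>subf Z S; subf Z T; \<forall>U\<in>\<E>. S U \<subseteq> T U; R.mlen (hom_mod G Z) (S G) (T G) = enat m\<rbrakk> \<Longrightarrow>
    \<exists>n F. (\<forall>i\<le>n. subf Z (F i)) \<and> (\<forall>U\<in>\<E>. F 0 U = S U) \<and> (\<forall>U\<in>\<E>. F n U = T U) \<and>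
      (\<forall>i<n. simple_step Z (F i) (F (Suc i)))"
proof (induction m arbitrary: S T rule: less_induct)
  case (less m)
  note S = less.prems(1) and T = less.prems(2) and ST = less.prems(3)
  show ?case
  proof (cases "(\<forall>U\<in>\<E>. S U = T U) \<or> simple_step Z S T")
    case True
    then show ?thesis
    proof
      assume "\<forall>U\<in>\<E>. S U = T U"
      then show ?thesis using S by (intro exI[of _ "0::nat"] exI[of _ "\<lambda>_. S"]) simp
    next
      assume "simple_step Z S T"
      then show ?thesis using S T
        by (intro exI[of _ "1::nat"] exI[of _ "\<lambda>i. if i = 0 then S else T"]) simp
    qed
  next
    case False
    then obtain V where V: "subf Z V" and between: "\<forall>U\<in>\<E>. S U \<subseteq> V U \<and> V U \<subseteq> T U"
      and ne: "\<not> (\<forall>U\<in>\<E>. V U = S U)" "\<not> (\<forall>U\<in>\<E>. V U = T U)"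
      using ST unfolding simple_step_def by blast
    have neG: "S G \<noteq> V G" "V G \<noteq> T G"
    proof -
      show "S G \<noteq> V G"
        using subf_le_generator[OF G Z V S] between ne(1) by blast
      show "V G \<noteq> T G"
        using subf_le_generator[OF G Z T V] between ne(2) by blast
    qed
    have l: "R.lm (hom_mod G Z)" by (rule hom_mod_lm) (use G(1) Z in simp_all)
    note sm = subf_submod[OF G(1) Z S] subf_submod[OF G(1) Z V] subf_submod[OF G(1) Z T]
    have i: "S G \<subseteq> V G" "V G \<subseteq> T G" using between G(1) by blast+
    have "enat m = R.mlen (hom_mod G Z) (S G) (V G) + R.mlen (hom_mod G Z) (V G) (T G)"
      using R.len_add[OF l sm i] less.prems(4) by simp
    moreover have "R.mlen (hom_mod G Z) (S G) (V G) \<noteq> 0" "R.mlen (hom_mod G Z) (V G) (T G) \<noteq> 0"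
      using R.len_eq_0_iff[OF l sm(1,2) i(1)] R.len_eq_0_iff[OF l sm(2,3) i(2)] neG by simp_all
    ultimately obtain a b where ab: "R.mlen (hom_mod G Z) (S G) (V G) = enat a"
      "R.mlen (hom_mod G Z) (V G) (T G) = enat b" "a < m" "b < m"
      by (cases "R.mlen (hom_mod G Z) (S G) (V G)"; cases "R.mlen (hom_mod G Z) (V G) (T G)")
        (auto simp: zero_enat_def)
    have SV: "\<forall>U\<in>\<E>. S U \<subseteq> V U" and VT: "\<forall>U\<in>\<E>. V U \<subseteq> T U"
      using between by blast+
    obtain n1 F1 where F1: "\<forall>i\<le>n1. subf Z (F1 i)" "\<forall>U\<in>\<E>. F1 0 U = S U" "\<forall>U\<in>\<E>. F1 n1 U = V U"
      "\<forall>i<n1. simple_step Z (F1 i) (F1 (Suc i))"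
      using less.IH[OF ab(3) S V SV ab(1)] by blast
    obtain n2 F2 where F2: "\<forall>i\<le>n2. subf Z (F2 i)" "\<forall>U\<in>\<E>. F2 0 U = V U" "\<forall>U\<in>\<E>. F2 n2 U = T U"
      "\<forall>i<n2. simple_step Z (F2 i) (F2 (Suc i))"
      using less.IH[OF ab(4) V T VT ab(2)] by blast
    \<comment> \<open>At the junction \<open>n1\<close> the two filtrations agree only on objects of
      \<open>\<E>\<close>, so the last step of the first one is transported by
      \<open>simple_step_cong\<close>.\<close>
    let ?F = "\<lambda>i. if i < n1 then F1 i else F2 (i - n1)"
    have F1': "?F i U = F1 i U" if "i \<le> n1" "U \<in> \<E>" for i U
      using that F1(3) F2(2) by (cases "i = n1") simp_all
    have "simple_step Z (?F i) (?F (Suc i))" if i: "i < n1 + n2" for i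
    proof (cases "i < n1")
      case True
      then have "simple_step Z (F1 i) (F1 (Suc i))" using F1(4) by blast
      then show ?thesis by (rule simple_step_cong) (rule F1'; use True in simp)+
    next
      case False
      then have "simple_step Z (F2 (i - n1)) (F2 (Suc (i - n1)))" using F2(4) i by simp
      then show ?thesis using False by (simp add: Suc_diff_le)
    qed
    moreover have "\<forall>i\<le>n1 + n2. subf Z (?F i)" using F1(1) F2(1) by auto
    moreover have "\<forall>U\<in>\<E>. ?F 0 U = S U" using F1'[of 0] F1(2) by simp
    moreover have "\<forall>U\<in>\<E>. ?F (n1 + n2) U = T U" using F2(3) by simp
    ultimately show ?thesis by (intro exI[of _ "n1 + n2"] exI[of _ ?F]) blast
  qed
qed

theorem finite_type_admissible:
  assumes "finite_type \<Lambda> \<E>"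
  shows "admissible \<Lambda> \<E>"
proof -
  obtain G where G: "G \<in> \<E>" "\<E> = add_closure \<Lambda> G" using assms by (auto simp: finite_type_def)
  have "finite_length \<Lambda> \<E> M" if "presents M Y f Z \<pi>" for M :: "('a, (nat \<Rightarrow> 'a) set, 'v) ab_functor" and Y f Z \<pi>
  proof -
    note p = presentsD[OF that]
    have S: "subf Z (im_f Y f)" by (rule im_f_subf[OF p(3,4,5)])
    note T = subf_Hom[OF p(4)]
    have ST: "\<forall>U\<in>\<E>. im_f Y f U \<subseteq> Hom U Z" using subfD(1)[OF S] by blast
    note fin = hom_mod_fin[OF E_Mo[OF G(1)] E_Mo[OF p(4)]]
    have l: "R.lm (hom_mod G Z)" by (rule hom_mod_lm) (use G(1) p(4) in simp_all)
    note sm = subf_submod[OF G(1) p(4) S] subf_submod[OF G(1) p(4) T]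
    have "R.mlen (hom_mod G Z) (im_f Y f G) (Hom G Z) \<le> R.tlen (hom_mod G Z)"
      using R.len_mono[OF l R.submod_zero[OF l] sm(1) sm(2) sm(2)] R.submodD(2)[OF sm(1)] ST G(1) by auto
    then obtain m where m: "R.mlen (hom_mod G Z) (im_f Y f G) (Hom G Z) = enat m"
      using fin enat_ile not_infinity_eq by metis
    show ?thesis
      using filtration_ex[OF G p(4) S T ST m] filtration_finite_length[OF that] by blast
  qed
  then show ?thesis unfolding admissible_def effaceable_iff by blast
qed

end

section \<open>Simple modules and projective covers\<close>

context mod_base
begin

definition simple where
  "simple X \<longleftrightarrow> carrier X \<noteq> {\<zero>\<^bsub>X\<^esub>} \<and> (\<forall>V. submod X V \<longrightarrow> V = {\<zero>\<^bsub>X\<^esub>} \<or> V = carrier X)"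

lemma simple_hom_surj:
  assumes X: "lm X" and S: "lm S" "simple S" and f: "f \<in> lin_hom A X S" and x: "x \<in> carrier X" "f x \<noteq> \<zero>\<^bsub>S\<^esub>"
  shows "f ` carrier X = carrier S"
proof -
  have "submod S (f ` carrier X)" by (rule submod_image[OF X S(1) f submod_carrier[OF X]])
  moreover have "f ` carrier X \<noteq> {\<zero>\<^bsub>S\<^esub>}" using x by auto
  ultimately show ?thesis using S(2) unfolding simple_def by blast
qed

lemma simple_hom_iso:
  assumes Q: "lm Q" "simple Q" and S: "lm S" "simple S" and f: "f \<in> lin_hom A Q S"
    and x: "x \<in> carrier Q" "f x \<noteq> \<zero>\<^bsub>S\<^esub>"
  shows "f \<in> lin_iso A Q S"
proof -
  let ?K = "{y \<in> carrier Q. f y = \<zero>\<^bsub>S\<^esub>}"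
  have "submod Q ?K" by (rule ker_submod[OF Q(1) S(1) f])
  moreover have "?K \<noteq> carrier Q" using x by blast
  ultimately have K: "?K = {\<zero>\<^bsub>Q\<^esub>}" using Q(2) unfolding simple_def by blast
  have "\<forall>y\<in>carrier Q. f y = \<zero>\<^bsub>S\<^esub> \<longrightarrow> y = \<zero>\<^bsub>Q\<^esub>"
    using K by blast
  then have "inj_on f (carrier Q)" using hom_inj_iff[OF Q(1) S(1) f] by blast
  then show ?thesis using f simple_hom_surj[OF Q(1) S f x] by (simp add: lin_iso_def bij_betw_def)
qed

lemma direct_sum_retr:
  fixes B :: "('a, 'm) module"
  assumes B: "lm B" and Ys: "\<And>Y. Y \<in> set Ys \<Longrightarrow> lm Y" and ds: "direct_sum A B Ys" and Y: "Y \<in> set Ys"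
  shows "retr Y B"
proof -
  obtain \<iota> \<pi> where d: "dsum B Ys \<iota> \<pi>" using direct_sum_iff[OF B Ys] ds by blast
  obtain k where k: "k < length Ys" "Y = Ys ! k" using Y by (metis in_set_conv_nth)
  have "\<iota> k \<in> lin_hom A Y B" "\<pi> k \<in> lin_hom A B Y" "\<forall>y\<in>carrier Y. \<pi> k (\<iota> k y) = y"
    using d k unfolding dsum_def by auto
  then show ?thesis unfolding retr_def by blast
qed

lemma bip_retr_bip:
  assumes l: "lm X" "lm X1" "lm X2" "lm Y" "lm Y1" "lm Y2"
    and b: "bip X X1 X2 i1 i2 p1 p2" and d: "bip Y Y1 Y2 j1 j2 q1 q2" and r: "retr X1 Y1" "retr X2 Y2"
  shows "retr X Y"
proof -
  obtain a1 c1 where r1: "a1 \<in> lin_hom A X1 Y1" "c1 \<in> lin_hom A Y1 X1" "\<forall>x\<in>carrier X1. c1 (a1 x) = x"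
    using r(1) unfolding retr_def by blast
  obtain a2 c2 where r2: "a2 \<in> lin_hom A X2 Y2" "c2 \<in> lin_hom A Y2 X2" "\<forall>x\<in>carrier X2. c2 (a2 x) = x"
    using r(2) unfolding retr_def by blast
  note bD = bipD[OF b] and dD = bipD[OF d]
  let ?a1 = "compose (carrier X) j1 (compose (carrier X) a1 p1)" and ?a2 = "compose (carrier X) j2 (compose (carrier X) a2 p2)"
  let ?c1 = "compose (carrier Y) i1 (compose (carrier Y) c1 q1)" and ?c2 = "compose (carrier Y) i2 (compose (carrier Y) c2 q2)"
  have a: "hom_add X Y ?a1 ?a2 \<in> lin_hom A X Y"
    by (rule add_hom[OF l(1,4) compose_hom[OF compose_hom[OF bD(3) r1(1) l(1)] dD(1) l(1)]
      compose_hom[OF compose_hom[OF bD(4) r2(1) l(1)] dD(2) l(1)]])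
  have c: "hom_add Y X ?c1 ?c2 \<in> lin_hom A Y X"
    by (rule add_hom[OF l(4,1) compose_hom[OF compose_hom[OF dD(3) r1(2) l(4)] bD(1) l(4)]
      compose_hom[OF compose_hom[OF dD(4) r2(2) l(4)] bD(2) l(4)]])
  have "hom_add Y X ?c1 ?c2 (hom_add X Y ?a1 ?a2 x) = x" if x: "x \<in> carrier X" for x
  proof -
    let ?y1 = "a1 (p1 x)" and ?y2 = "a2 (p2 x)"
    have px: "p1 x \<in> carrier X1" "p2 x \<in> carrier X2"
      using hom_closed[OF bD(3) x] hom_closed[OF bD(4) x] .
    have y: "?y1 \<in> carrier Y1" "?y2 \<in> carrier Y2"
      using hom_closed[OF r1(1) px(1)] hom_closed[OF r2(1) px(2)] .
    have j: "j1 ?y1 \<in> carrier Y" "j2 ?y2 \<in> carrier Y"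
      using hom_closed[OF dD(1) y(1)] hom_closed[OF dD(2) y(2)] .
    have q1: "q1 (j1 ?y1 \<oplus>\<^bsub>Y\<^esub> j2 ?y2) = ?y1"
      using hom_simps(2)[OF dD(3) l(4,5) j] dD(5)[OF y(1)] dD(8)[OF y(2)] lm_add(2)[OF l(5) y(1)] by simp
    have q2: "q2 (j1 ?y1 \<oplus>\<^bsub>Y\<^esub> j2 ?y2) = ?y2"
      using hom_simps(2)[OF dD(4) l(4,6) j] dD(6)[OF y(1)] dD(7)[OF y(2)] lm_add(1)[OF l(6) y(2)] by simp
    have "hom_add X Y ?a1 ?a2 x = j1 ?y1 \<oplus>\<^bsub>Y\<^esub> j2 ?y2" using x by simp
    moreover have "j1 ?y1 \<oplus>\<^bsub>Y\<^esub> j2 ?y2 \<in> carrier Y" using j l(4) by simp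
    ultimately have "hom_add Y X ?c1 ?c2 (hom_add X Y ?a1 ?a2 x) = i1 (c1 ?y1) \<oplus>\<^bsub>X\<^esub> i2 (c2 ?y2)"
      using q1 q2 by simp
    then show ?thesis using r1(3) r2(3) px bD(9)[OF x] by simp
  qed
  then show ?thesis unfolding retr_def using a c by blast
qed

end

context artin_setup
begin

lemma quotient_simple:
  fixes X :: "('a, 'm) module"
  assumes X: "X \<in> Mo" and D: "submod X D" "D \<subset> carrier X"
    and mx: "\<And>E. \<lbrakk>submod X E; D \<subseteq> E\<rbrakk> \<Longrightarrow> E = D \<or> E = carrier X"
  obtains Q :: "('a, 'm) module" and q where "Q \<in> Mo" "simple Q" "q \<in> Hom X Q" "q ` carrier X = carrier Q"
    "\<forall>x\<in>carrier X. q x = \<zero>\<^bsub>Q\<^esub> \<longleftrightarrow> x \<in> D"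
proof -
  obtain Q :: "('a, 'm) module" and q where Q: "Q \<in> Mo" "q \<in> Hom X Q" "q ` carrier X = carrier Q"
    "\<forall>x\<in>carrier X. q x = \<zero>\<^bsub>Q\<^esub> \<longleftrightarrow> x \<in> D"
    by (rule quotient_Mo[OF X D(1)])
  have l: "lm X" "lm Q" using X Q(1) by simp_all
  have "simple Q"
    unfolding simple_def
  proof (intro conjI allI impI)
    obtain c where c: "c \<in> carrier X" "c \<notin> D" using D(2) by blast
    then have "q c \<noteq> \<zero>\<^bsub>Q\<^esub>" "q c \<in> carrier Q" using Q(3,4) by auto
    then show "carrier Q \<noteq> {\<zero>\<^bsub>Q\<^esub>}" by blast
    fix V assume V: "submod Q V"
    let ?E = "{x \<in> carrier X. q x \<in> V}"
    have E: "submod X ?E" by (rule submod_vimage[OF l Q(2) submod_carrier[OF l(1)] V])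
    have "d \<in> ?E" if d: "d \<in> D" for d
    proof -
      have "d \<in> carrier X" using d D(2) by blast
      then have "q d = \<zero>\<^bsub>Q\<^esub>" using Q(4) d by blast
      then show ?thesis using \<open>d \<in> carrier X\<close> submodD(2)[OF V] by simp
    qed
    then have "?E = D \<or> ?E = carrier X" by (intro mx E subsetI)
    moreover have "\<exists>x\<in>?E. v = q x" if "v \<in> V" for v
      using submodD(1)[OF V that] that unfolding Q(3)[symmetric] by auto
    ultimately show "V = {\<zero>\<^bsub>Q\<^esub>} \<or> V = carrier Q"
    proof (elim disjE)
      assume *: "?E = D" "\<And>v. v \<in> V \<Longrightarrow> \<exists>x\<in>?E. v = q x"
      have "v = \<zero>\<^bsub>Q\<^esub>" if v: "v \<in> V" for v
      proof -
        obtain x where x: "x \<in> ?E" "v = q x" using *(2)[OF v] by blast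
        then have "x \<in> carrier X" "x \<in> D" using *(1) by blast+
        then show ?thesis using Q(4) x(2) by blast
      qed
      then have "V = {\<zero>\<^bsub>Q\<^esub>}" using submodD(2)[OF V] by blast
      then show ?thesis ..
    next
      assume *: "?E = carrier X"
      have "v \<in> V" if v: "v \<in> carrier Q" for v
      proof -
        have "v \<in> q ` carrier X" using v Q(3) by simp
        then obtain x where x: "x \<in> carrier X" "v = q x" by auto
        then have "x \<in> ?E" using * by blast
        then show ?thesis using x(2) by blast
      qed
      then have "V = carrier Q" using submodD(1)[OF V] by blast
      then show ?thesis ..
    qed
  qed
  then show thesis using that Q by blast
qed

text \<open>The family consists of composition factors of C. Let D be maximal in C and let t be a
  morphism to a simple module that is nonzero on C. Either t is nonzero on D and induction applies,
  or it factors through the simple module C/D, and the factor is an isomorphism by Schur's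
  lemma.\<close>

lemma simple_factors:
  fixes X :: "('a, 'm) module"
  assumes X: "X \<in> Mo"
  shows "\<lbrakk>submod X C; mlen X {\<zero>\<^bsub>X\<^esub>} C = enat n\<rbrakk> \<Longrightarrow>
    \<exists>\<F> :: ('a, 'm) module set. finite \<F> \<and> (\<forall>F\<in>\<F>. F \<in> Mo \<and> simple F) \<and>
      (\<forall>S :: ('a, 'm) module. \<forall>t. S \<in> Mo \<longrightarrow> simple S \<longrightarrow> t \<in> Hom X S \<longrightarrow> (\<exists>c\<in>C. t c \<noteq> \<zero>\<^bsub>S\<^esub>) \<longrightarrow>
        (\<exists>F\<in>\<F>. \<exists>r. r \<in> lin_iso \<Lambda> F S))"
proof (induction n arbitrary: C rule: less_induct)
  case (less n)
  note C = less.prems(1)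
  have lX: "lm X" using X by simp
  show ?case
  proof (cases "C = {\<zero>\<^bsub>X\<^esub>}")
    case True
    have "t c = \<zero>\<^bsub>S\<^esub>" if "S \<in> Mo" "t \<in> Hom X S" "c \<in> C" for S :: "('a, 'm) module" and t c
      using that True hom_simps(4)[OF that(2) lX] by simp
    then show ?thesis by (intro exI[of _ "{}"]) blast
  next
    case False
    have fin: "mlen X {\<zero>\<^bsub>X\<^esub>} C \<noteq> \<infinity>" using less.prems(2) by simp
    obtain D where D: "submod X D" "D \<subset> C" "\<forall>E. submod X E \<longrightarrow> D \<subseteq> E \<longrightarrow> E \<subseteq> C \<longrightarrow> E = D \<or> E = C"
      using maximal_submod_ex[OF lX C False fin] by blast
    have z: "{\<zero>\<^bsub>X\<^esub>} \<subseteq> D" using submodD(2)[OF D(1)] by blast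
    have "mlen X {\<zero>\<^bsub>X\<^esub>} D + mlen X D C = enat n"
      using len_add[OF lX submod_zero[OF lX] D(1) C z] D(2) less.prems(2) by simp
    moreover have "mlen X D C \<noteq> 0" using len_eq_0_iff[OF lX D(1) C] D(2) by blast
    ultimately obtain m where m: "mlen X {\<zero>\<^bsub>X\<^esub>} D = enat m" "m < n"
      by (cases "mlen X {\<zero>\<^bsub>X\<^esub>} D"; cases "mlen X D C") (auto simp: zero_enat_def)
    obtain \<F> :: "('a, 'm) module set" where \<F>: "finite \<F>" "\<forall>F\<in>\<F>. F \<in> Mo \<and> simple F"
      "\<forall>S :: ('a, 'm) module. \<forall>t. S \<in> Mo \<longrightarrow> simple S \<longrightarrow> t \<in> Hom X S \<longrightarrow> (\<exists>c\<in>D. t c \<noteq> \<zero>\<^bsub>S\<^esub>) \<longrightarrow>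
        (\<exists>F\<in>\<F>. \<exists>r. r \<in> lin_iso \<Lambda> F S)"
      using less.IH[OF m(2) D(1) m(1)] by blast
    let ?C = "X\<lparr>carrier := C\<rparr>"
    have CM: "?C \<in> Mo" by (rule sub_Mo[OF X C])
    have D': "submod ?C D" using submod_sub[OF C] D(1,2) by blast
    have mx: "E = D \<or> E = carrier ?C" if E: "submod ?C E" "D \<subseteq> E" for E
    proof -
      have "E \<subseteq> C" using submodD(1)[OF E(1)] by auto
      then show ?thesis using D(3) E(2) submod_sub[OF C, of E] E(1) by simp
    qed
    have DC: "D \<subset> carrier ?C" using D(2) by simp
    obtain Q :: "('a, 'm) module" and q where Q: "Q \<in> Mo" "simple Q" "q \<in> Hom ?C Q" "q ` carrier ?C = carrier Q"
      "\<forall>x\<in>carrier ?C. q x = \<zero>\<^bsub>Q\<^esub> \<longleftrightarrow> x \<in> D"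
      by (rule quotient_simple[OF CM D' DC mx])
    have "\<exists>F\<in>insert Q \<F>. \<exists>r. r \<in> lin_iso \<Lambda> F S"
      if S: "S \<in> Mo" "simple S" and t: "t \<in> Hom X S" and c: "c \<in> C" "t c \<noteq> \<zero>\<^bsub>S\<^esub>"
      for S :: "('a, 'm) module" and t c
    proof (cases "\<exists>d\<in>D. t d \<noteq> \<zero>\<^bsub>S\<^esub>")
      case True
      then show ?thesis using \<F>(3) S t by blast
    next
      case False
      have lS: "lm S" using S by simp
      have rt: "restrict t C \<in> Hom ?C S" by (rule restrict_hom[OF lX lS t C])
      have ker: "restrict t C b = \<zero>\<^bsub>S\<^esub>" if b: "b \<in> carrier ?C" "q b = \<zero>\<^bsub>Q\<^esub>" for b
      proof -
        have "b \<in> D" using b Q(5) by blast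
        then show ?thesis using b(1) False by simp
      qed
      obtain r where r: "r \<in> Hom Q S" "\<forall>b\<in>carrier ?C. r (q b) = restrict t C b"
        by (rule coker_factor[OF Mo_lm[OF CM] Mo_lm[OF Q(1)] lS Q(3,4) rt ker])
      have "r (q c) \<noteq> \<zero>\<^bsub>S\<^esub>" using r(2) c by simp
      then have "r \<in> lin_iso \<Lambda> Q S"
        by (rule simple_hom_iso[OF Mo_lm[OF Q(1)] Q(2) lS S(2) r(1) hom_closed[OF Q(3)], rotated]) (use c in simp)
      then show ?thesis by blast
    qed
    then show ?thesis using \<F>(1,2) Q(1,2) by (intro exI[of _ "insert Q \<F>"]) blast
  qed
qed

text \<open>L is free of rank one on u, expressed by generation and by the freedom to prescribe the
  image of u. In this form the isomorphism with the regular module can be forgotten.\<close>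

definition generator :: "('a, 'm) module \<Rightarrow> 'm \<Rightarrow> bool" where
  "generator L u \<longleftrightarrow> u \<in> carrier L \<and> (\<forall>x\<in>carrier L. \<exists>a\<in>carrier \<Lambda>. x = a \<odot>\<^bsub>L\<^esub> u) \<and>
    (\<forall>X :: ('a, 'm) module. lm X \<longrightarrow> (\<forall>x\<in>carrier X. \<exists>t\<in>Hom L X. t u = x))"

text \<open>Projectivity of L at a single value: as u generates L and its image can be prescribed, a
  preimage of \<open>b u\<close> under g determines the whole lift.\<close>

lemma generator_lift:
  fixes L Y Z :: "('a, 'm) module"
  assumes L: "lm L" "generator L u" and Y: "lm Y" and Z: "lm Z" and g: "g \<in> Hom Y Z" and b: "b \<in> Hom L Z"
    and im: "b u \<in> g ` carrier Y"
  obtains b' where "b' \<in> Hom L Y" "\<forall>x\<in>carrier L. g (b' x) = b x"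
proof -
  obtain y where y: "y \<in> carrier Y" "b u = g y" using im by blast
  obtain b' where b': "b' \<in> Hom L Y" "b' u = y" using L(2) Y y(1) unfolding generator_def by blast
  have u: "u \<in> carrier L" using L(2) unfolding generator_def by blast
  have "g (b' x) = b x" if x: "x \<in> carrier L" for x
  proof -
    obtain a where a: "a \<in> carrier \<Lambda>" "x = a \<odot>\<^bsub>L\<^esub> u"
      using L(2) x unfolding generator_def by blast
    show ?thesis
      unfolding a(2) hom_simps(3)[OF b'(1) L(1) Y a(1) u] hom_simps(3)[OF b L(1) Z a(1) u] b'(2)
        hom_simps(3)[OF g Y Z a(1) y(1)] y(2) ..
  qed
  then show thesis using that b'(1) by blast
qed

text \<open>A nonzero U has a simple quotient S by a maximal submodule, and a nonzero element of S
  is the image of u under some morphism from L. So S is isomorphic to one of the finitely many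
  composition factors of L.\<close>

lemma simple_quotients_finite:
  fixes L :: "('a, 'm) module"
  assumes L: "L \<in> Mo" "generator L u"
  obtains \<F> :: "('a, 'm) module set" where "finite \<F>" "\<forall>F\<in>\<F>. F \<in> Mo \<and> simple F"
    "\<forall>U\<in>(Mo :: ('a, 'm) module set). carrier U \<noteq> {\<zero>\<^bsub>U\<^esub>} \<longrightarrow>
      (\<exists>F\<in>\<F>. \<exists>q\<in>Hom U F. q ` carrier U = carrier F)"
proof -
  have lL: "lm L" using L by simp
  obtain n where n: "tlen L = enat n" using Mo_fin(1)[OF L(1)] not_infinity_eq by metis
  obtain \<F> :: "('a, 'm) module set" where \<F>: "finite \<F>" "\<forall>F\<in>\<F>. F \<in> Mo \<and> simple F"
    "\<forall>S :: ('a, 'm) module. \<forall>t. S \<in> Mo \<longrightarrow> simple S \<longrightarrow> t \<in> Hom L S \<longrightarrow> (\<exists>c\<in>carrier L. t c \<noteq> \<zero>\<^bsub>S\<^esub>) \<longrightarrow>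
      (\<exists>F\<in>\<F>. \<exists>r. r \<in> lin_iso \<Lambda> F S)"
    using simple_factors[OF L(1) submod_carrier[OF lL] n] by blast
  have "\<exists>F\<in>\<F>. \<exists>q\<in>Hom U F. q ` carrier U = carrier F" if U: "U \<in> Mo" "carrier U \<noteq> {\<zero>\<^bsub>U\<^esub>}" for U :: "('a, 'm) module"
  proof -
    have lU: "lm U" using U by simp
    obtain D where D: "submod U D" "D \<subset> carrier U" "\<forall>E. submod U E \<longrightarrow> D \<subseteq> E \<longrightarrow> E \<subseteq> carrier U \<longrightarrow> E = D \<or> E = carrier U"
      using maximal_submod_ex[OF lU submod_carrier[OF lU] U(2) Mo_fin(1)[OF U(1)]] by blast
    have mx: "E = D \<or> E = carrier U" if "submod U E" "D \<subseteq> E" for E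
    proof -
      have "E \<subseteq> carrier U" using submodD(1)[OF that(1)] by blast
      then show ?thesis using D(3) that by simp
    qed
    obtain S :: "('a, 'm) module" and \<pi> where S: "S \<in> Mo" "simple S" "\<pi> \<in> Hom U S" "\<pi> ` carrier U = carrier S"
      "\<forall>x\<in>carrier U. \<pi> x = \<zero>\<^bsub>S\<^esub> \<longleftrightarrow> x \<in> D"
      by (rule quotient_simple[OF U(1) D(1,2) mx])
    have lS: "lm S" using S by simp
    obtain s where s: "s \<in> carrier S" "s \<noteq> \<zero>\<^bsub>S\<^esub>"
      using S(2) lm_closed(1)[OF lS] unfolding simple_def by blast
    obtain t where t: "t \<in> Hom L S" "t u = s" using L(2) lS s(1) unfolding generator_def by blast
    have "u \<in> carrier L" using L(2) unfolding generator_def by blast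
    then obtain F r where F: "F \<in> \<F>" "r \<in> lin_iso \<Lambda> F S" using \<F>(3) S(1,2) t s(2) by blast
    have lF: "lm F" using F(1) \<F>(2) by simp
    obtain r' where r': "r' \<in> lin_iso \<Lambda> S F" "\<And>x. x \<in> carrier F \<Longrightarrow> r' (r x) = x" "\<And>y. y \<in> carrier S \<Longrightarrow> r (r' y) = y"
      by (rule lin_iso_inv[OF lF lS F(2)]) (rule that; blast)
    have r'H: "r' \<in> Hom S F" and r's: "r' ` carrier S = carrier F"
      using r'(1) by (auto simp: lin_iso_def bij_betw_def)
    have "compose (carrier U) r' \<pi> ` carrier U = r' ` \<pi> ` carrier U" by force
    then have "compose (carrier U) r' \<pi> ` carrier U = carrier F" using S(4) r's by simp
    then show ?thesis using F(1) compose_hom[OF S(3) r'H lU] by blast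
  qed
  then show thesis using that[OF \<F>(1,2)] by blast
qed

end

section \<open>Covers by the regular module and recognition of finite type\<close>

context resolving_setup
begin

lemma generator_ex:
  obtains L u where "L \<in> \<E>" "generator L u"
proof -
  let ?R = "regular_module \<Lambda>"
  obtain L where L: "L \<in> \<E>" "isomorphic \<Lambda> ?R L" using res unfolding resolving_def by blast
  then obtain \<phi> where \<phi>: "\<phi> \<in> lin_iso \<Lambda> ?R L" by (auto simp: isomorphic_def)
  have l: "lm ?R" "lm L" using regular_lm L(1) by simp_all
  obtain \<psi> where \<psi>: "\<psi> \<in> lin_iso \<Lambda> L ?R" "\<And>x. x \<in> carrier ?R \<Longrightarrow> \<psi> (\<phi> x) = x" "\<And>y. y \<in> carrier L \<Longrightarrow> \<phi> (\<psi> y) = y"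
    by (rule lin_iso_inv[OF l \<phi>]) (rule that; blast)
  have h: "\<phi> \<in> Hom ?R L" "\<psi> \<in> Hom L ?R" using \<phi> \<psi>(1) by (simp_all add: lin_iso_def)
  interpret A: ring \<Lambda> by (rule ring_A)
  note \<phi>s = hom_simps[OF h(1) l]
  have c: "carrier ?R = carrier \<Lambda>" by (simp add: regular_module_def)
  have "generator L (\<phi> \<one>\<^bsub>\<Lambda>\<^esub>)"
    unfolding generator_def
  proof (intro conjI ballI allI impI)
    show u: "\<phi> \<one>\<^bsub>\<Lambda>\<^esub> \<in> carrier L" using \<phi>s(1) by (simp add: c)
    show "\<exists>a\<in>carrier \<Lambda>. x = a \<odot>\<^bsub>L\<^esub> \<phi> \<one>\<^bsub>\<Lambda>\<^esub>" if x: "x \<in> carrier L" for x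
    proof -
      have p: "\<psi> x \<in> carrier \<Lambda>" using hom_closed[OF h(2) x] by (simp add: c)
      have "\<phi> (\<psi> x \<odot>\<^bsub>?R\<^esub> \<one>\<^bsub>\<Lambda>\<^esub>) = \<psi> x \<odot>\<^bsub>L\<^esub> \<phi> \<one>\<^bsub>\<Lambda>\<^esub>"
        by (rule \<phi>s(3)) (use p c in auto)
      then have "x = \<psi> x \<odot>\<^bsub>L\<^esub> \<phi> \<one>\<^bsub>\<Lambda>\<^esub>"
        using p \<psi>(3)[OF x] by (simp add: regular_module_def)
      then show ?thesis using p by blast
    qed
    fix X :: "('a, (nat \<Rightarrow> 'a) set) module" and x assume X: "lm X" and x: "x \<in> carrier X"
    let ?m = "\<lambda>a\<in>carrier \<Lambda>. a \<odot>\<^bsub>X\<^esub> x"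
    have "compose (carrier L) ?m \<psi> \<in> Hom L X"
      by (rule compose_hom[OF h(2) right_mult_hom[OF X x] l(2)])
    moreover have "compose (carrier L) ?m \<psi> (\<phi> \<one>\<^bsub>\<Lambda>\<^esub>) = x"
      using u \<psi>(2)[of "\<one>\<^bsub>\<Lambda>\<^esub>"] lm_smult(1)[OF X x] by (simp add: c)
    ultimately show "\<exists>t\<in>Hom L X. t (\<phi> \<one>\<^bsub>\<Lambda>\<^esub>) = x" by blast
  qed
  then show thesis by (rule that[OF L(1)])
qed

lemma direct_sum_ex: "set Xs \<subseteq> \<E> \<Longrightarrow> \<exists>B\<in>\<E>. direct_sum \<Lambda> B Xs"
proof (induction Xs)
  case Nil
  obtain L u where L: "L \<in> \<E>" using generator_ex by blast
  have lL: "lm L" using L by simp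
  have "L\<lparr>carrier := {\<zero>\<^bsub>L\<^esub>}\<rparr> \<in> Mo"
    by (rule sub_Mo[OF E_Mo[OF L] submod_zero[OF lL]])
  then have Z: "L\<lparr>carrier := {\<zero>\<^bsub>L\<^esub>}\<rparr> \<in> \<E>" by (rule E_zero) simp
  moreover have "direct_sum \<Lambda> (L\<lparr>carrier := {\<zero>\<^bsub>L\<^esub>}\<rparr>) []"
    using direct_sum_Nil[OF E_lm[OF Z]] by simp
  ultimately show ?case by blast
next
  case (Cons X Xs)
  then obtain B' where B': "B' \<in> \<E>" "direct_sum \<Lambda> B' Xs" and X: "X \<in> \<E>" and Xs: "set Xs \<subseteq> \<E>"
    by auto
  obtain B :: "('a, (nat \<Rightarrow> 'a) set) module" and i1 i2 p1 p2 where B: "B \<in> Mo" "bip B X B' i1 i2 p1 p2"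
    by (rule bip_ex[OF E_Mo[OF X] E_Mo[OF B'(1)]])
  have "B \<in> \<E>" by (rule E_bip[OF B(1) X B'(1) B(2)])
  moreover have "direct_sum \<Lambda> B (X # Xs)"
    by (rule direct_sum_ConsI[OF Mo_lm[OF B(1)] E_lm[OF X] E_lm[OF B'(1)] _ B(2) B'(2)]) (use Xs in auto)
  ultimately show ?case by blast
qed

lemma cover_ex:
  fixes E :: "('a, (nat \<Rightarrow> 'a) set) module"
  assumes L: "L \<in> \<E>" "generator L u" and E: "E \<in> Mo"
  obtains P n g where "P \<in> \<E>" "direct_sum \<Lambda> P (replicate n L)" "g \<in> Hom P E" "g ` carrier P = carrier E"
proof -
  have l: "lm L" "lm E" using L E by simp_all
  obtain S where S: "finite S" "S \<subseteq> carrier E" "lspan E S = carrier E" using Mo_gen[OF E] .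
  have "\<exists>P\<in>\<E>. \<exists>n. \<exists>g\<in>Hom P E. direct_sum \<Lambda> P (replicate n L) \<and> S \<subseteq> g ` carrier P"
    using S(1,2)
  proof (induction S)
    case empty
    obtain P where P: "P \<in> \<E>" "direct_sum \<Lambda> P []" using direct_sum_ex[of "[]"] by auto
    then show ?case using zero_hom[OF E_lm[OF P(1)] l(2)] by (intro bexI[OF _ P(1)] exI[of _ "0::nat"]) auto
  next
    case (insert s S)
    have "S \<subseteq> carrier E" using insert.prems by blast
    from insert.IH[OF this] show ?case
    proof (elim bexE exE conjE)
      fix P n g assume P: "P \<in> \<E>" "g \<in> Hom P E" "direct_sum \<Lambda> P (replicate n L)" "S \<subseteq> g ` carrier P"
      obtain t where t: "t \<in> Hom L E" "t u = s"
        using L(2) l(2) insert.prems unfolding generator_def by blast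
      have uL: "u \<in> carrier L" using L(2) unfolding generator_def by blast
      obtain B :: "('a, (nat \<Rightarrow> 'a) set) module" and i1 i2 p1 p2 where B: "B \<in> Mo" "bip B L P i1 i2 p1 p2"
        by (rule bip_ex[OF E_Mo[OF L(1)] E_Mo[OF P(1)]])
      note bD = bipD[OF B(2)]
      have lB: "lm B" and lP: "lm P" using B(1) P(1) by simp_all
      have BE: "B \<in> \<E>" by (rule E_bip[OF B(1) L(1) P(1) B(2)])
      have ds: "direct_sum \<Lambda> B (replicate (Suc n) L)"
        using direct_sum_ConsI[OF lB l(1) lP _ B(2) P(3)] l(1) by simp
      let ?g = "hom_add B E (compose (carrier B) t p1) (compose (carrier B) g p2)"
      have g: "?g \<in> Hom B E"
        by (rule add_hom[OF lB l(2) compose_hom[OF bD(3) t(1) lB] compose_hom[OF bD(4) P(2) lB]])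
      have "?g (i1 u) = s"
        using uL t(2) hom_closed[OF bD(1) uL] bD(5,6)[OF uL] hom_simps(4)[OF P(2) lP l(2)] lm_add(2)[OF l(2) hom_closed[OF t(1) uL]] by simp
      moreover have g2: "?g (i2 x) = g x" if x: "x \<in> carrier P" for x
        using x hom_closed[OF bD(2) x] bD(7,8)[OF x] hom_simps(4)[OF t(1) l] lm_add(1)[OF l(2) hom_closed[OF P(2) x]] by simp
      ultimately have "s \<in> ?g ` carrier B" using hom_closed[OF bD(1) uL] by (metis imageI)
      moreover have "y \<in> ?g ` carrier B" if "y \<in> S" for y
      proof -
        obtain x where x: "x \<in> carrier P" "y = g x" using P(4) \<open>y \<in> S\<close> by blast
        then have "y = ?g (i2 x)" by (simp only: g2)
        then show ?thesis using hom_closed[OF bD(2) x(1)] by (rule image_eqI)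
    qed
    ultimately have "insert s S \<subseteq> ?g ` carrier B" by (intro subsetI) (elim insertE; simp only:)
    with ds show ?thesis by (intro bexI[OF _ BE] exI[of _ "Suc n"] bexI[OF _ g] conjI)
    qed
  qed
  then show thesis
  proof (elim bexE exE conjE)
    fix P n g assume P: "P \<in> \<E>" "g \<in> Hom P E" "direct_sum \<Lambda> P (replicate n L)" "S \<subseteq> g ` carrier P"
    have "lspan E S \<subseteq> g ` carrier P"
      by (rule lspan_least[OF submod_image[OF E_lm[OF P(1)] l(2) P(2) submod_carrier[OF E_lm[OF P(1)]]] P(4)])
    then have "g ` carrier P = carrier E" using S(3) hom_closed[OF P(2)] by blast
    then show thesis by (rule that[OF P(1,3,2)])
  qed
qed

text \<open>For \<open>b c \<noteq> 0\<close> the lift \<open>a\<close> of \<open>b\<close> along \<open>b c\<close> satisfies \<open>b c (1 - a c) = 0\<close>, so \<open>1 - a c\<close> is not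
  invertible, and since \<open>U\<close> is indecomposable \<open>a c\<close> is.\<close>

lemma retract_of_generator:
  fixes F P :: "('a, (nat \<Rightarrow> 'a) set) module"
  assumes L: "L \<in> \<E>" "generator L u" and U: "indec U" and F: "F \<in> Mo" "simple F"
    and q: "q \<in> Hom U F" "q ` carrier U = carrier F" and P: "P \<in> Mo" "direct_sum \<Lambda> P (replicate n L)"
    and c: "c \<in> Hom U P" and b: "b \<in> Hom P F" and bc: "\<And>x. x \<in> carrier U \<Longrightarrow> b (c x) = q x"
  shows "retr U L"
proof -
  have l: "lm L" "lm U" "lm F" "lm P" using L indecD(4)[OF U] F P by simp_all
  obtain f0 where "f0 \<in> carrier F" "f0 \<noteq> \<zero>\<^bsub>F\<^esub>"
    using F(2) lm_closed(1)[OF l(3)] unfolding simple_def by blast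
  then obtain x0 where x0: "x0 \<in> carrier U" "q x0 \<noteq> \<zero>\<^bsub>F\<^esub>"
    using q(2) by (metis imageE)
  have cx: "c x0 \<in> carrier P" by (rule hom_closed[OF c x0(1)])
  obtain \<iota> \<pi> where d: "dsum P (replicate n L) \<iota> \<pi>"
    using direct_sum_iff[OF l(4), of "replicate n L"] P(2) l(1) by auto
  have dh: "\<iota> k \<in> Hom L P" "\<pi> k \<in> Hom P L" if "k < n" for k using d that unfolding dsum_def by auto
  have "c x0 = (\<Oplus>\<^bsub>P\<^esub>k\<in>{..<n}. \<iota> k (\<pi> k (c x0)))"
    using d cx unfolding dsum_def by auto
  moreover have "b (\<Oplus>\<^bsub>P\<^esub>k\<in>{..<n}. \<iota> k (\<pi> k (c x0))) = (\<Oplus>\<^bsub>F\<^esub>k\<in>{..<n}. b (\<iota> k (\<pi> k (c x0))))"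
    by (rule hom_finsum[OF l(4,3) b]) (use hom_closed[OF dh(1) hom_closed[OF dh(2) cx]] in auto)
  ultimately have sum: "(\<Oplus>\<^bsub>F\<^esub>k\<in>{..<n}. b (\<iota> k (\<pi> k (c x0)))) \<noteq> \<zero>\<^bsub>F\<^esub>"
    using bc[OF x0(1)] x0(2) by simp
  interpret F: abelian_group F by (rule lm_group[OF l(3)])
  have "\<exists>k<n. b (\<iota> k (\<pi> k (c x0))) \<noteq> \<zero>\<^bsub>F\<^esub>"
  proof (rule ccontr)
    assume "\<not> ?thesis"
    then have "(\<Oplus>\<^bsub>F\<^esub>k\<in>{..<n}. b (\<iota> k (\<pi> k (c x0)))) = (\<Oplus>\<^bsub>F\<^esub>k\<in>{..<n}. \<zero>\<^bsub>F\<^esub>)"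
      by (intro F.finsum_cong') auto
    then show False using sum by (simp add: F.finsum_zero)
  qed
  then obtain k where k: "k < n" "b (\<iota> k (\<pi> k (c x0))) \<noteq> \<zero>\<^bsub>F\<^esub>" by blast
  \<comment> \<open>From here P is replaced by its k-th copy of L. The component of b c through this
    copy is nonzero at \<open>x0\<close>, hence still onto F by simplicity.\<close>
  let ?c = "compose (carrier U) (\<pi> k) c" and ?b = "compose (carrier L) b (\<iota> k)"
  have cH: "?c \<in> Hom U L" and bH: "?b \<in> Hom L F"
    using compose_hom[OF c dh(2)[OF k(1)] l(2)] compose_hom[OF dh(1)[OF k(1)] b l(1)] .
  let ?h = "compose (carrier U) ?b ?c"
  have hH: "?h \<in> Hom U F" by (rule compose_hom[OF cH bH l(2)])
  have h0: "?h x0 \<noteq> \<zero>\<^bsub>F\<^esub>" using k(2) x0(1) hom_closed[OF cH x0(1)] by simp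
  have hs: "?h ` carrier U = carrier F" by (rule simple_hom_surj[OF l(2,3) F(2) hH x0(1) h0])
  have "u \<in> carrier L" using L(2) unfolding generator_def by blast
  then have bu: "?b u \<in> ?h ` carrier U" using hs hom_closed[OF bH] by blast
  obtain a where a: "a \<in> Hom L U" "\<forall>x\<in>carrier L. ?h (a x) = ?b x"
    by (rule generator_lift[OF l(1) L(2) l(2,3) hH bH bu])
  let ?f = "compose (carrier U) a ?c"
  have f: "?f \<in> Hom U U" by (rule compose_hom[OF cH a(1) l(2)])
  have hf: "?h (?f x) = ?h x" if x: "x \<in> carrier U" for x
  proof -
    have "?h (a (?c x)) = ?b (?c x)" using a(2) hom_closed[OF cH x] by blast
    moreover have "?f x = a (?c x)" "?h x = ?b (?c x)" using x by (simp_all only: compose_apply)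
    ultimately show ?thesis by simp
  qed
  let ?m = "hom_diff U U (hom_id U) ?f"
  have m: "?m \<in> Hom U U" by (rule diff_hom[OF l(2,2) id_hom[OF l(2)] f])
  have mv: "?m x = x \<ominus>\<^bsub>U\<^esub> ?f x" if "x \<in> carrier U" for x using that by simp
  have "?m \<notin> lin_iso \<Lambda> U U"
  proof
    assume "?m \<in> lin_iso \<Lambda> U U"
    then have "?m ` carrier U = carrier U" by (simp add: lin_iso_def bij_betw_def)
    then obtain y where y: "y \<in> carrier U" "x0 = ?m y" using x0(1) by blast
    have fy: "?f y \<in> carrier U" by (rule hom_closed[OF f y(1)])
    have "?h x0 = ?h y \<ominus>\<^bsub>F\<^esub> ?h (?f y)"
      unfolding y(2) mv[OF y(1)] by (rule hom_simps(6)[OF hH l(2,3) y(1) fy])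
    also have "\<dots> = \<zero>\<^bsub>F\<^esub>"
      unfolding hf[OF y(1)] by (rule lm_add(3)[OF l(3) hom_closed[OF hH y(1)]])
    finally show False using h0 by simp
  qed
  then have fp: "\<forall>x\<in>carrier U. ?m x = x \<longrightarrow> x = \<zero>\<^bsub>U\<^esub>"
    using indec_local[OF U m] by blast
  have "x = \<zero>\<^bsub>U\<^esub>" if x: "x \<in> carrier U" "?f x = \<zero>\<^bsub>U\<^esub>" for x
  proof -
    have "?m x = x" unfolding mv[OF x(1)] x(2) by (rule lm_add(4)[OF l(2) x(1)])
    then show ?thesis using fp x(1) by blast
  qed
  then have "?f \<in> lin_iso \<Lambda> U U" by (rule inj_endo_surj[OF l(2) f Mo_fin(1)[OF indecD(3)[OF U]]])
  then obtain v where v: "v \<in> lin_iso \<Lambda> U U" "\<And>x. x \<in> carrier U \<Longrightarrow> v (?f x) = x" "\<And>x. x \<in> carrier U \<Longrightarrow> ?f (v x) = x"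
    by (rule lin_iso_inv[OF l(2,2)]) (rule that; blast)
  have vH: "v \<in> Hom U U" using v(1) by (simp add: lin_iso_def)
  have "compose (carrier L) v a (?c x) = x" if x: "x \<in> carrier U" for x
  proof -
    have "compose (carrier L) v a (?c x) = v (a (?c x))" using hom_closed[OF cH x] by (simp only: compose_apply)
    also have "a (?c x) = ?f x" using x by (simp only: compose_apply)
    finally show ?thesis using v(2)[OF x] by simp
  qed
  then show ?thesis unfolding retr_def using cH compose_hom[OF a(1) vH l(1)] by blast
qed

text \<open>Classes of objects have nonnegative coefficients, so the contribution of the summand U
  cannot cancel. For the regular module this confines the classes of indecomposable retracts to a
  finite set.\<close>

lemma retr_K0:
  assumes X: "X \<in> \<E>" and U: "indec U" and r: "retr U X"
  shows "cls U \<in> Poly_Mapping.keys (K0 X)"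
proof -
  have l: "lm X" "lm U" using X indecD(4)[OF U] by simp_all
  obtain V i1 i2 p1 p2 where V: "submod X V" "bip X U (X\<lparr>carrier := V\<rparr>) i1 i2 p1 p2"
    by (rule retr_bip[OF l r])
  have VM: "X\<lparr>carrier := V\<rparr> \<in> Mo" by (rule sub_Mo[OF E_Mo[OF X] V(1)])
  have VE: "X\<lparr>carrier := V\<rparr> \<in> \<E>"
    by (rule E_retr[OF X VM bip_retr[OF bip_sym[OF l(1) V(2)]]])
  have "K0 X = K0 U + K0 (X\<lparr>carrier := V\<rparr>)" by (rule K0_bip[OF X indecD(1)[OF U] VE V(2)])
  moreover have "0 < Poly_Mapping.lookup (K0 U) (cls U)"
  proof -
    obtain d where d: "mult U U = enat d" "0 < d" by (rule mult_self[OF U])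
    have "enat d = enat (nat (Poly_Mapping.lookup (K0 U) (cls U))) * enat d"
      using K0_lookup(1)[OF indecD(1)[OF U] U] d(1) by simp
    then have "d = nat (Poly_Mapping.lookup (K0 U) (cls U)) * d" by simp
    then show ?thesis using d(2) by (cases "0 < Poly_Mapping.lookup (K0 U) (cls U)") auto
  qed
  moreover have "0 \<le> Poly_Mapping.lookup (K0 (X\<lparr>carrier := V\<rparr>)) (cls U)"
    by (rule K0_lookup(2)[OF VE U])
  ultimately show ?thesis by (simp add: in_keys_iff lookup_add)
qed

text \<open>Retractions are assembled summand by summand, one copy of G for each member of the
  list.\<close>

lemma direct_sum_retr_power:
  assumes G: "G \<in> \<E>"
  shows "\<lbrakk>set Xs \<subseteq> \<E>; \<forall>Y\<in>set Xs. retr Y G; X \<in> \<E>; direct_sum \<Lambda> X Xs; B \<in> \<E>;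
    direct_sum \<Lambda> B (replicate (length Xs) G)\<rbrakk> \<Longrightarrow> retr X B"
proof (induction Xs arbitrary: X B)
  case Nil
  have l: "lm X" "lm B" using Nil.prems by simp_all
  have "carrier X = {\<zero>\<^bsub>X\<^esub>}" using direct_sum_Nil[OF l(1)] Nil.prems(4) by simp
  then show ?case
    unfolding retr_def using zero_hom[OF l] zero_hom[OF l(2,1)] l
    by (intro bexI[of _ "hom_zero X B"] bexI[of _ "hom_zero B X"]) auto
next
  case (Cons Y Xs)
  have YE: "Y \<in> \<E>" and Xs: "set Xs \<subseteq> \<E>" "\<forall>Y\<in>set Xs. retr Y G" and rY: "retr Y G"
    using Cons.prems by auto
  have XsM: "set Xs \<subseteq> Mo" using Xs(1) E_Mo by blast
  have GM: "set (replicate (length Xs) G) \<subseteq> Mo" using E_Mo[OF G] by auto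
  obtain X' i1 i2 p1 p2 where X': "X' \<in> Mo" "bip X Y X' i1 i2 p1 p2" "direct_sum \<Lambda> X' Xs"
    by (rule direct_sum_ConsD_Mo[OF E_Mo[OF Cons.prems(3)] E_Mo[OF YE] XsM Cons.prems(4)])
  have dsB: "direct_sum \<Lambda> B (G # replicate (length Xs) G)" using Cons.prems(6) by simp
  obtain B' j1 j2 q1 q2 where B': "B' \<in> Mo" "bip B G B' j1 j2 q1 q2" "direct_sum \<Lambda> B' (replicate (length Xs) G)"
    by (rule direct_sum_ConsD_Mo[OF E_Mo[OF Cons.prems(5)] E_Mo[OF G] GM dsB])
  have X'E: "X' \<in> \<E>" by (rule E_direct_sum[OF Xs(1) X'(1,3)])
  have B'E: "B' \<in> \<E>" by (rule E_direct_sum[OF _ B'(1,3)]) (use G in auto)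
  have "retr X' B'" by (rule Cons.IH[OF Xs X'E X'(3) B'E B'(3)])
  then show ?case
    by (rule bip_retr_bip[OF E_lm[OF Cons.prems(3)] E_lm[OF YE] E_lm[OF X'E] E_lm[OF Cons.prems(5)] E_lm[OF G] E_lm[OF B'E]
      X'(2) B'(2) rY])
qed

text \<open>G is the direct sum of one representative from each class. An object with n
  indecomposable summands is then a retract of the direct sum of n copies of G.\<close>

lemma finite_classes_finite_type:
  assumes fin: "finite (cls ` {W. indec W})"
  shows "finite_type \<Lambda> \<E>"
proof -
  obtain \<W> where \<W>: "finite \<W>" "\<W> \<subseteq> {W. indec W}" "cls ` {W. indec W} = cls ` \<W>"
    using finite_subset_image[OF fin, of cls "{W. indec W}"] by blast
  obtain Ws where Ws: "set Ws = \<W>" using finite_list[OF \<W>(1)] by blast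
  have WsE: "set Ws \<subseteq> \<E>" using Ws \<W>(2) indecD(1) by blast
  obtain G where G: "G \<in> \<E>" "direct_sum \<Lambda> G Ws" using direct_sum_ex[OF WsE] by blast
  have lG: "lm G" using G by simp
  have rG: "retr Y G" if Y: "indec Y" for Y
  proof -
    have "cls Y \<in> cls ` \<W>" using Y unfolding \<W>(3)[symmetric] by blast
    then obtain W where W: "W \<in> \<W>" "cls Y = cls W" by blast
    have WE: "W \<in> \<E>" using W(1) \<W>(2) indecD(1) by blast
    then obtain f where "f \<in> lin_iso \<Lambda> Y W"
      using cls_eq_iff[OF indecD(1)[OF Y] WE] W(2) by (auto simp: isomorphic_def)
    then have "retr Y W" by (rule iso_retr[OF indecD(4)[OF Y] E_lm[OF WE]])
    moreover have "retr W G" by (rule direct_sum_retr[OF lG _ G(2)]) (use WsE Ws W(1) in auto)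
    ultimately show ?thesis by (rule retr_trans[OF indecD(4)[OF Y] E_lm[OF WE] lG])
  qed
  have "\<E> = add_closure \<Lambda> G"
  proof (intro equalityI subsetI)
    fix X assume X: "X \<in> \<E>"
    obtain Xs where Xs: "\<forall>Y\<in>set Xs. indec Y" "direct_sum \<Lambda> X Xs"
      using decomposition_ex[OF X] by blast
    have XsE: "set Xs \<subseteq> \<E>" using Xs(1) indecD(1) by blast
    have "set (replicate (length Xs) G) \<subseteq> \<E>" using G(1) by auto
    then obtain B where B: "B \<in> \<E>" "direct_sum \<Lambda> B (replicate (length Xs) G)"
      using direct_sum_ex by blast
    have l: "lm X" "lm B" using X B by simp_all
    have "retr X B" by (rule direct_sum_retr_power[OF G(1) XsE _ X Xs(2) B]) (use rG Xs(1) in blast)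
    then obtain V i1 i2 p1 p2 where V: "submod B V" "bip B X (B\<lparr>carrier := V\<rparr>) i1 i2 p1 p2"
      by (rule retr_bip[OF l(2,1)])
    have VM: "B\<lparr>carrier := V\<rparr> \<in> Mo" by (rule sub_Mo[OF E_Mo[OF B(1)] V(1)])
    have "direct_sum \<Lambda> B [X, B\<lparr>carrier := V\<rparr>]"
      using direct_sum_pair[OF l(2,1) Mo_lm[OF VM]] V(2) by blast
    then show "X \<in> add_closure \<Lambda> G"
      unfolding add_closure_def using E_Mo[OF X] E_Mo[OF B(1)] B(2) VM by blast
  next
    fix X assume "X \<in> add_closure \<Lambda> G"
    then obtain n Y X' where X: "X \<in> Mo" "Y \<in> Mo" "X' \<in> Mo" "direct_sum \<Lambda> Y (replicate n G)" "direct_sum \<Lambda> Y [X, X']"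
      unfolding add_closure_def by blast
    have "Y \<in> \<E>" by (rule E_direct_sum[OF _ X(2,4)]) (use G in auto)
    then show "X \<in> \<E>" using res X unfolding resolving_def by blast
  qed
  then show ?thesis using G(1) by (auto simp: finite_type_def)
qed

end

section \<open>Length functionals on the Grothendieck group\<close>

lemma lookup_map_rat [simp]:
  "Poly_Mapping.lookup (Poly_Mapping.map rat_of_int c) s = rat_of_int (Poly_Mapping.lookup c s)"
  by (simp add: Poly_Mapping.map.rep_eq when_def)

text \<open>The rational linear functional that takes the value \<open>w s\<close> on the basis
  vector s.\<close>

definition weighted :: "('s \<Rightarrow> nat) \<Rightarrow> ('s \<Rightarrow>\<^sub>0 rat) \<Rightarrow> rat" where
  "weighted w q = (\<Sum>s\<in>Poly_Mapping.keys q. Poly_Mapping.lookup q s * of_nat (w s))"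

lemma weighted_superset:
  assumes "finite A" "Poly_Mapping.keys q \<subseteq> A"
  shows "weighted w q = (\<Sum>s\<in>A. Poly_Mapping.lookup q s * of_nat (w s))"
  unfolding weighted_def using assms by (intro sum.mono_neutral_left) (auto simp: in_keys_iff)

lemma weighted_add: "weighted w (p + q) = weighted w p + weighted w q"
proof -
  let ?A = "Poly_Mapping.keys p \<union> Poly_Mapping.keys q"
  have A: "finite ?A" "Poly_Mapping.keys (p + q) \<subseteq> ?A" by (simp_all add: Poly_Mapping.keys_add)
  show ?thesis
    using weighted_superset[OF A] weighted_superset[of ?A p] weighted_superset[of ?A q]
    by (simp add: lookup_add algebra_simps sum.distrib)
qed

lemma weighted_scale: "weighted w (rat_scale r q) = r * weighted w q"
proof -
  have "Poly_Mapping.keys (rat_scale r q) \<subseteq> Poly_Mapping.keys q" by (auto simp: in_keys_iff)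
  from weighted_superset[OF _ this] show ?thesis
    by (simp add: weighted_def sum_distrib_left algebra_simps)
qed

lemma weighted_0: "weighted w 0 = 0"
  by (simp add: weighted_def)

definition weighted_int where
  "weighted_int w c = weighted w (Poly_Mapping.map rat_of_int c)"

lemma weighted_int_add: "weighted_int w (c + d) = weighted_int w c + weighted_int w d"
proof -
  have "Poly_Mapping.map rat_of_int (c + d) = Poly_Mapping.map rat_of_int c + Poly_Mapping.map rat_of_int d"
    by (rule poly_mapping_eqI) (simp add: lookup_add)
  then show ?thesis by (simp add: weighted_int_def weighted_add)
qed

lemma weighted_int_0: "weighted_int w 0 = 0"
  using weighted_int_add[of w 0 0] by simp

lemma weighted_int_minus: "weighted_int w (- c) = - weighted_int w c"
  using weighted_int_add[of w c "- c"] by (simp add: weighted_int_0)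

lemma weighted_int_frag: "weighted_int w (frag_of s) = of_nat (w s)"
proof -
  have "Poly_Mapping.keys (Poly_Mapping.map rat_of_int (frag_of s)) \<subseteq> {s}" by (auto simp: in_keys_iff)
  from weighted_superset[OF _ this] show ?thesis by (simp add: weighted_int_def)
qed

context resolving_setup
begin

definition hlen :: "('a, (nat \<Rightarrow> 'a) set) module \<Rightarrow> ('a, (nat \<Rightarrow> 'a) set) module \<Rightarrow> nat" where
  "hlen U X = the_enat (R.tlen (hom_mod U X))"

lemma enat_hlen: "\<lbrakk>U \<in> Mo; X \<in> Mo\<rbrakk> \<Longrightarrow> enat (hlen U X) = R.tlen (hom_mod U X)"
  using hom_mod_fin[of U X] by (cases "R.tlen (hom_mod U X)") (simp_all add: hlen_def)

lemma hlen_colen: "\<lbrakk>U \<in> Mo; X \<in> Mo\<rbrakk> \<Longrightarrow> colen U (\<lambda>X. {hom_zero U X}) X = enat (hlen U X)"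
  by (simp add: enat_hlen colen_def)

text \<open>The weight of a class is read off from a chosen indecomposable representative. On other
  sets s the value is arbitrary, which is harmless because classes of objects have coefficient 0
  there.\<close>

definition wt where
  "wt U s = hlen U (SOME W. indec W \<and> cls W = s)"

lemma wt_cls:
  fixes U :: "('a, (nat \<Rightarrow> 'a) set) module"
  assumes U: "U \<in> Mo" and W: "indec W"
  shows "wt U (cls W) = hlen U W"
proof -
  let ?W = "SOME V. indec V \<and> cls V = cls W"
  have V: "indec ?W \<and> cls ?W = cls W" by (rule someI[of _ W]) (use W in simp)
  then have WM: "?W \<in> Mo" using indecD(3) by blast
  have "isomorphic \<Lambda> ?W W" using V cls_eq_iff[of ?W W] indecD(1) W by blast
  then have "colen U (\<lambda>X. {hom_zero U X}) ?W = colen U (\<lambda>X. {hom_zero U X}) W"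
    by (rule colen_iso[OF stable_zero[OF U] U WM indecD(3)[OF W]])
  then show ?thesis using hlen_colen[OF U] indecD(3) V W by (simp add: wt_def)
qed

lemma wt_K0:
  assumes U: "U \<in> Mo" and X: "X \<in> \<E>"
  shows "weighted_int (wt U) (K0 X) = of_nat (hlen U X)"
proof -
  obtain Xs where Xs: "\<forall>Y\<in>set Xs. indec Y" "direct_sum \<Lambda> X Xs"
    using decomposition_ex[OF X] by blast
  have XsM: "set Xs \<subseteq> Mo" using Xs(1) indecD(3) by blast
  have "enat (hlen U X) = (\<Sum>Y\<leftarrow>Xs. colen U (\<lambda>X. {hom_zero U X}) Y)"
    using colen_direct_sum[OF stable_zero[OF U] U E_Mo[OF X] XsM Xs(2)] hlen_colen[OF U E_Mo[OF X]] by simp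
  also have "\<dots> = enat (\<Sum>Y\<leftarrow>Xs. hlen U Y)"
    using XsM by (induction Xs) (auto simp: hlen_colen[OF U] zero_enat_def)
  finally have "hlen U X = (\<Sum>Y\<leftarrow>Xs. hlen U Y)" by simp
  moreover have "weighted_int (wt U) (k0 Xs) = of_nat (\<Sum>Y\<leftarrow>Xs. hlen U Y)"
    using Xs(1) by (induction Xs) (simp_all add: k0_def weighted_int_0 weighted_int_add weighted_int_frag wt_cls[OF U])
  ultimately show ?thesis using K0_eq[OF X Xs] by simp
qed

text \<open>Left exactness of Hom(U,-) identifies Hom(U,Y) modulo Hom(U,X) with \<open>im_f\<close>,
  and d is the length of what remains of Hom(U,Z), that is, of the cokernel functor at U. Placing d
  on the right avoids subtraction of naturals.\<close>

lemma hlen_conflation: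
  assumes c: "conflation \<Lambda> \<E> X f Y g Z" and U: "U \<in> \<E>"
  obtains d where "hlen U X + hlen U Z = hlen U Y + d" "d = 0 \<longleftrightarrow> im_f Y g U = Hom U Z"
proof -
  note cD = conflationD[OF c] and sd = short_exactD[OF conflationD(4)[OF c]]
  have l: "lm X" "lm Y" "lm Z" "lm U" using cD U by simp_all
  note lH = hom_mod_lm[OF l(4,1)] hom_mod_lm[OF l(4,2)] hom_mod_lm[OF l(4,3)]
  let ?f = "\<lambda>h\<in>Hom U X. compose (carrier U) f h" and ?g = "\<lambda>h\<in>Hom U Y. compose (carrier U) g h"
  have h: "?f \<in> lin_hom R (hom_mod U X) (hom_mod U Y)" "?g \<in> lin_hom R (hom_mod U Y) (hom_mod U Z)"
    using post_hom[OF l(4,1,2) sd(1)] post_hom[OF l(4,2,3) sd(2)] .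
  have imf: "?g ` Hom U Y = im_f Y g U" by (simp add: im_f_def)
  have compf: "compose (carrier U) f k \<in> Hom U Y" if "k \<in> Hom U X" for k by (rule compose_hom[OF that sd(1) l(4)])
  have "{h \<in> Hom U X. ?f h = hom_zero U Y} = {hom_zero U X}"
  proof (intro equalityI subsetI)
    fix k assume "k \<in> {h \<in> Hom U X. ?f h = hom_zero U Y}"
    then have "k \<in> Hom U X" "?f k = hom_zero U Y" by blast+
    then have k: "k \<in> Hom U X" "compose (carrier U) f k = hom_zero U Y" by simp_all
    have "k x = \<zero>\<^bsub>X\<^esub>" if x: "x \<in> carrier U" for x
    proof -
      have "f (k x) = \<zero>\<^bsub>Y\<^esub>" using fun_cong[OF k(2), of x] x by simp
      then show ?thesis using sd(3) hom_inj_iff[OF l(1,2) sd(1)] hom_closed[OF k(1) x] by blast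
    qed
    then have "k = hom_zero U X" by (intro lin_hom_eqI[OF k(1) zero_hom[OF l(4,1)]]) simp
    then show "k \<in> {hom_zero U X}" by simp
  next
    fix k assume "k \<in> {hom_zero U X}"
    then have k: "k = hom_zero U X" "k \<in> Hom U X" using zero_hom[OF l(4,1)] by simp_all
    have "compose (carrier U) f k = hom_zero U Y"
      by (rule lin_hom_eqI[OF compf[OF k(2)] zero_hom[OF l(4,2)]]) (simp add: k(1) hom_simps(4)[OF sd(1) l(1,2)])
    then show "k \<in> {h \<in> Hom U X. ?f h = hom_zero U Y}" using k(2) by simp
  qed
  then have 1: "R.tlen (hom_mod U X) = R.mlen (hom_mod U Y) {hom_zero U Y} (?f ` Hom U X)"
    using R.len_ker_im[OF lH(1,2) h(1)] by simp
  have "{h \<in> Hom U Y. ?g h = hom_zero U Z} = ?f ` Hom U X"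
  proof (intro equalityI subsetI)
    fix k assume "k \<in> {h \<in> Hom U Y. ?g h = hom_zero U Z}"
    then have "k \<in> Hom U Y" "?g k = hom_zero U Z" by blast+
    then have k: "k \<in> Hom U Y" "compose (carrier U) g k = hom_zero U Z" by simp_all
    have "k x \<in> f ` carrier X" if x: "x \<in> carrier U" for x
      using fun_cong[OF k(2), of x] x hom_closed[OF k(1) x] by (intro sd(7)) simp_all
    then obtain m where m: "m \<in> Hom U X" "\<forall>x\<in>carrier U. f (m x) = k x"
      by (rule ker_lift[OF l(4,1,2) sd(1,3) k(1)])
    have "k = compose (carrier U) f m" by (rule lin_hom_eqI[OF k(1) compf[OF m(1)]]) (simp add: m(2))
    then show "k \<in> ?f ` Hom U X" using m(1) by auto
  next
    fix k assume "k \<in> ?f ` Hom U X"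
    then obtain m where m: "m \<in> Hom U X" "k = compose (carrier U) f m" by auto
    have k: "k \<in> Hom U Y" unfolding m(2) by (rule compf[OF m(1)])
    have "compose (carrier U) g k = hom_zero U Z"
      by (rule lin_hom_eqI[OF compose_hom[OF k sd(2) l(4)] zero_hom[OF l(4,3)]])
        (simp add: m(2) sd(6) hom_closed[OF m(1)])
    then show "k \<in> {h \<in> Hom U Y. ?g h = hom_zero U Z}" using k by simp
  qed
  then have 2: "R.tlen (hom_mod U Y) = R.tlen (hom_mod U X) + R.mlen (hom_mod U Z) {hom_zero U Z} (im_f Y g U)"
    using R.len_hom[OF lH(2,3) h(2)] 1 imf by simp
  note s = subf_submod[OF U cD(3) im_f_subf[OF cD(2,3) sd(2)]] R.submod_carrier[OF lH(3)]
  have i: "{\<zero>\<^bsub>hom_mod U Z\<^esub>} \<subseteq> im_f Y g U" "im_f Y g U \<subseteq> carrier (hom_mod U Z)"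
    using R.submodD(2)[OF s(1)] R.submodD(1)[OF s(1)] by blast+
  have 3: "R.tlen (hom_mod U Z) = R.mlen (hom_mod U Z) {hom_zero U Z} (im_f Y g U) + R.mlen (hom_mod U Z) (im_f Y g U) (Hom U Z)"
    using R.len_add[OF lH(3) R.submod_zero[OF lH(3)] s i] by simp
  have 4: "R.mlen (hom_mod U Z) (im_f Y g U) (Hom U Z) = 0 \<longleftrightarrow> im_f Y g U = Hom U Z"
    using R.len_eq_0_iff[OF lH(3) s i(2)] by simp
  note eU = enat_hlen[OF E_Mo[OF U] E_Mo[OF cD(1)]] enat_hlen[OF E_Mo[OF U] E_Mo[OF cD(2)]] enat_hlen[OF E_Mo[OF U] E_Mo[OF cD(3)]]
  obtain a b where ab: "R.mlen (hom_mod U Z) {hom_zero U Z} (im_f Y g U) = enat a"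
    "R.mlen (hom_mod U Z) (im_f Y g U) (Hom U Z) = enat b"
    using 3 eU(3) by (cases "R.mlen (hom_mod U Z) {hom_zero U Z} (im_f Y g U)";
      cases "R.mlen (hom_mod U Z) (im_f Y g U) (Hom U Z)") auto
  have "enat (hlen U Y) = enat (hlen U X + a)" unfolding eU(2) 2 ab(1) eU(1)[symmetric] by simp
  moreover have "enat (hlen U Z) = enat (a + b)" unfolding eU(3) 3 ab by simp
  ultimately have "hlen U X + hlen U Z = hlen U Y + b" by simp
  then show thesis by (rule that) (use 4 ab(2) in \<open>simp add: zero_enat_def\<close>)
qed

lemma wt_defect:
  assumes c: "conflation \<Lambda> \<E> X f Y g Z" and U: "U \<in> \<E>"
  shows "weighted_int (wt U) (defect X Y Z) = 0 \<longleftrightarrow> im_f Y g U = Hom U Z"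
proof -
  note cD = conflationD[OF c] and w = wt_K0[OF E_Mo[OF U]]
  obtain d where d: "hlen U X + hlen U Z = hlen U Y + d" "d = 0 \<longleftrightarrow> im_f Y g U = Hom U Z"
    by (rule hlen_conflation[OF c U])
  have "weighted_int (wt U) (defect X Y Z) = of_nat (hlen U X) - of_nat (hlen U Y) + of_nat (hlen U Z)"
    using weighted_int_add[of "wt U" "K0 X - K0 Y" "K0 Z"] weighted_int_add[of "wt U" "K0 X" "- K0 Y"]
    by (simp add: weighted_int_minus w[OF cD(1)] w[OF cD(2)] w[OF cD(3)])
  also have "\<dots> = of_nat (hlen U X + hlen U Z) - of_nat (hlen U Y)" by simp
  also have "\<dots> = of_nat d" unfolding d(1) by simp
  finally show ?thesis using d(2) by simp
qed

text \<open>The indecomposables at which the length functional detects q. They are counted by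
  isomorphism class, since one class may contain infinitely many modules.\<close>

abbreviation support where
  "support q \<equiv> cls ` {U. indec U \<and> weighted (wt U) q \<noteq> 0}"

text \<open>For an AR conflation ending in Z, a morphism to Z from an indecomposable U not
  isomorphic to Z is radical and so lifts along the deflation. The class of Z is therefore the only
  one a generator can contribute, and finiteness of the support survives sums and inverses.\<close>

lemma AR_support:
  assumes "c \<in> AR_group \<Lambda> \<E>"
  shows "finite (support (Poly_Mapping.map rat_of_int c))"
proof -
  let ?H = "{defect X Y Z | X f Y g Z. AR_conflation \<Lambda> \<E> X f Y g Z}"
  let ?N = "\<lambda>c. cls ` {U. indec U \<and> weighted_int (wt U) c \<noteq> 0}"
  have H: "finite (?N h)" "h \<in> carrier (K0_split \<Lambda> \<E>)" if h: "h \<in> ?H" for h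
  proof -
    obtain X f Y g Z where X: "h = defect X Y Z" "AR_conflation \<Lambda> \<E> X f Y g Z" using h by blast
    then have c: "conflation \<Lambda> \<E> X f Y g Z" and r: "right_almost_split \<Lambda> \<E> Y g Z"
      by (simp_all add: AR_conflation_def)
    have Z: "indec Z" using r by (simp add: right_almost_split_def)
    note cD = conflationD[OF c]
    show "h \<in> carrier (K0_split \<Lambda> \<E>)" unfolding X(1) by (rule defect_carrier[OF cD(1-3)])
    have "cls U = cls Z" if U: "indec U" and ne: "weighted_int (wt U) h \<noteq> 0" for U
    proof (rule ccontr)
      assume n: "cls U \<noteq> cls Z"
      have "h' \<in> im_f Y g U" if h': "h' \<in> Hom U Z" for h'
      proof -
        have "h' \<in> radical \<Lambda> U Z"
        proof (rule ccontr)
          assume "h' \<notin> radical \<Lambda> U Z"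
          then have "h' \<in> lin_iso \<Lambda> U Z" by (rule indec_nonradical_iso[OF U Z h'])
          then have "isomorphic \<Lambda> U Z" by (auto simp: isomorphic_def)
          then show False using n cls_eq_iff[OF indecD(1)[OF U] cD(3)] by blast
        qed
        then obtain k where "k \<in> Hom U Y" "h' = compose (carrier U) g k"
          using r indecD(1)[OF U] unfolding right_almost_split_def by blast
        then show ?thesis by (simp add: im_f_def)
      qed
      then have "im_f Y g U = Hom U Z"
        using subfD(1)[OF im_f_subf[OF cD(2,3) short_exactD(2)[OF cD(4)]] indecD(1)[OF U]] by blast
      then show False using ne wt_defect[OF c indecD(1)[OF U]] by (simp add: X(1))
    qed
    then have "?N h \<subseteq> {cls Z}" by blast
    then show "finite (?N h)" by (rule finite_subset) simp
  qed
  have "c \<in> generate (K0_split \<Lambda> \<E>) ?H" using assms by (simp add: AR_group_def)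
  then have "finite (?N c)"
  proof (induction rule: generate.induct)
    case one
    then show ?case by (simp add: K0_split_simps(3) weighted_int_0)
  next
    case (incl h)
    then show ?case by (rule H(1))
  next
    case (inv h)
    have "inv\<^bsub>K0_split \<Lambda> \<E>\<^esub> h = - h"
      by (rule group.inv_equality[OF K0_split_simps(4)])
        (use H(2)[OF inv] in \<open>simp_all add: K0_split_simps(1,2,3)\<close>)
    then show ?case using H(1)[OF inv] by (simp add: weighted_int_minus)
  next
    case (eng h1 h2)
    have "?N (h1 + h2) \<subseteq> ?N h1 \<union> ?N h2" by (auto simp: weighted_int_add)
    then show ?case using eng.IH by (simp add: K0_split_simps(2) finite_subset)
  qed
  then show ?thesis by (simp add: weighted_int_def)
qed

text \<open>Vectors of finite support form a rational subspace, so finiteness passes from the AR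
  group to its rational span. Equality of the rational spans then transfers it to the class of an
  arbitrary conflation.\<close>

lemma conflation_support:
  assumes eq: "tensor_rat (AR_group \<Lambda> \<E>) = tensor_rat (Ex_group \<Lambda> \<E>)" and c: "conflation \<Lambda> \<E> X f Y g Z"
  shows "finite (cls ` {U. indec U \<and> im_f Y g U \<noteq> Hom U Z})"
proof -
  let ?q = "Poly_Mapping.map rat_of_int (defect X Y Z)"
  have "defect X Y Z \<in> Ex_group \<Lambda> \<E>"
    unfolding Ex_group_def by (rule generate.incl) (use c in blast)
  then have q: "?q \<in> tensor_rat (AR_group \<Lambda> \<E>)"
    unfolding eq unfolding tensor_rat_def by (intro rat_free.span_base imageI)
  have "rat_free.subspace {q. finite (support q)}"
  proof (rule rat_free.subspaceI; clarsimp simp: weighted_0)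
    show "finite (support (p + q))" if "finite (support p)" "finite (support q)" for p q
    proof -
      have "support (p + q) \<subseteq> support p \<union> support q" by (auto simp: weighted_add)
      then show ?thesis using that by (meson finite_UnI finite_subset)
    qed
    show "finite (support (rat_scale r q))" if "finite (support q)" for r q
    proof -
      have "support (rat_scale r q) \<subseteq> support q" by (auto simp: weighted_scale)
      then show ?thesis using that by (rule finite_subset)
    qed
  qed
  then have "tensor_rat (AR_group \<Lambda> \<E>) \<subseteq> {q. finite (support q)}"
    unfolding tensor_rat_def by (intro rat_free.span_minimal) (use AR_support in blast)
  then have "finite (support ?q)" using q by blast
  moreover have "weighted (wt U) ?q \<noteq> 0 \<longleftrightarrow> im_f Y g U \<noteq> Hom U Z" if "indec U" for U
    using wt_defect[OF c indecD(1)[OF that]] by (simp add: weighted_int_def)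
  then have "support ?q = cls ` {U. indec U \<and> im_f Y g U \<noteq> Hom U Z}" by (metis (mono_tags, lifting))
  ultimately show ?thesis by simp
qed

theorem tensor_finite_type:
  assumes cf: "contravariantly_finite \<Lambda> \<E>"
    and eq: "tensor_rat (AR_group \<Lambda> \<E>) = tensor_rat (Ex_group \<Lambda> \<E>)"
  shows "finite_type \<Lambda> \<E>"
proof -
  obtain L u where L: "L \<in> \<E>" "generator L u" by (rule generator_ex)
  obtain \<F> :: "('a, (nat \<Rightarrow> 'a) set) module set" where \<F>: "finite \<F>" "\<forall>F\<in>\<F>. F \<in> Mo \<and> simple F"
    "\<forall>U\<in>(Mo :: ('a, (nat \<Rightarrow> 'a) set) module set). carrier U \<noteq> {\<zero>\<^bsub>U\<^esub>} \<longrightarrow>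
      (\<exists>F\<in>\<F>. \<exists>q\<in>Hom U F. q ` carrier U = carrier F)"
    by (rule simple_quotients_finite[OF E_Mo[OF L(1)] L(2)])
  have "\<exists>B. finite B \<and> (\<forall>U. indec U \<longrightarrow> cls U \<notin> B \<longrightarrow> (\<forall>q\<in>Hom U F. q ` carrier U = carrier F \<longrightarrow> retr U L))"
    if F: "F \<in> \<F>" for F
  proof -
    have FM: "F \<in> Mo" "simple F" using F \<F>(2) by blast+
    obtain E p where E: "right_approximation \<Lambda> \<E> E p F"
      using cf FM(1) unfolding contravariantly_finite_def by blast
    then have EE: "E \<in> \<E>" and p: "p \<in> Hom E F"
      and ap: "\<And>U q. \<lbrakk>U \<in> \<E>; q \<in> Hom U F\<rbrakk> \<Longrightarrow> \<exists>k\<in>Hom U E. q = compose (carrier U) p k"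
      unfolding right_approximation_def by blast+
    obtain P n g where P: "P \<in> \<E>" "direct_sum \<Lambda> P (replicate n L)" "g \<in> Hom P E" "g ` carrier P = carrier E"
      by (rule cover_ex[OF L E_Mo[OF EE]])
    obtain K k where c: "conflation \<Lambda> \<E> K k P g E" by (rule conflation_ker[OF P(1) EE P(3,4)])
    have lP: "lm P" using P(1) by simp
    \<comment> \<open>The exceptional classes for F. For any other U all morphisms to E lift to P. A
      morphism from U to F factors through the approximation p, hence through P, which is the
      situation of \<open>retract_of_generator\<close>.\<close>
    let ?B = "cls ` {U. indec U \<and> im_f P g U \<noteq> Hom U E}"
    have "retr U L" if U: "indec U" "cls U \<notin> ?B" and q: "q \<in> Hom U F" "q ` carrier U = carrier F" for U q
    proof -
      have im: "im_f P g U = Hom U E" using U by blast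
      obtain k where k: "k \<in> Hom U E" "q = compose (carrier U) p k"
        using ap[OF indecD(1)[OF U(1)] q(1)] by blast
      then have "k \<in> im_f P g U" using im by simp
      then obtain m where m: "m \<in> Hom U P" "k = compose (carrier U) g m" by (auto simp: im_f_def)
      have "compose (carrier P) p g (m x) = q x" if x: "x \<in> carrier U" for x
        unfolding k(2) m(2) using x hom_closed[OF m(1) x] by simp
      then show ?thesis
        by (rule retract_of_generator[OF L U(1) FM q E_Mo[OF P(1)] P(2) m(1) compose_hom[OF P(3) p lP]])
    qed
    note retr = this
    show ?thesis
    proof (intro exI[of _ ?B] conjI conflation_support[OF eq c] allI impI ballI)
      fix U q assume "indec U" "cls U \<notin> ?B" "q \<in> Hom U F" "q ` carrier U = carrier F"
      then show "retr U L" by (rule retr)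
    qed
  qed
  then have "\<forall>F\<in>\<F>. \<exists>B. finite B \<and> (\<forall>U. indec U \<longrightarrow> cls U \<notin> B \<longrightarrow>
      (\<forall>q\<in>Hom U F. q ` carrier U = carrier F \<longrightarrow> retr U L))" by (rule ballI)
  from bchoice[OF this] obtain B where B: "\<forall>F\<in>\<F>. finite (B F) \<and> (\<forall>U. indec U \<longrightarrow> cls U \<notin> B F \<longrightarrow>
      (\<forall>q\<in>Hom U F. q ` carrier U = carrier F \<longrightarrow> retr U L))" ..
  \<comment> \<open>Every indecomposable U maps onto some F in \<F>. If its class is not exceptional
    for this F, then U is a summand of L, and its class occurs in the class of L.\<close>
  have "cls U \<in> (\<Union>F\<in>\<F>. B F) \<union> Poly_Mapping.keys (K0 L)" if U: "indec U" for U
  proof (rule ccontr)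
    assume n: "\<not> ?thesis"
    obtain F q where F: "F \<in> \<F>" "q \<in> Hom U F" "q ` carrier U = carrier F"
      using \<F>(3) indecD(2,3)[OF U] by blast
    have "cls U \<notin> B F" using n F(1) by blast
    then have "retr U L" using bspec[OF B F(1)] F(2,3) U by blast
    then have "cls U \<in> Poly_Mapping.keys (K0 L)" by (rule retr_K0[OF L(1) U])
    then show False using n by blast
  qed
  then have "cls ` {U. indec U} \<subseteq> (\<Union>F\<in>\<F>. B F) \<union> Poly_Mapping.keys (K0 L)"
    by blast
  moreover have "finite ((\<Union>F\<in>\<F>. B F) \<union> Poly_Mapping.keys (K0 L))" using \<F>(1) B by simp
  ultimately show ?thesis using finite_classes_finite_type finite_subset by blast
qed

end

theorem theorem4p11:
  fixes R :: "'r ring" and \<Lambda> :: "('r, 'a) module"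
    and \<E> :: "('a, (nat \<Rightarrow> 'a) set) module set"
  assumes "artin_algebra R \<Lambda>"
    and "resolving \<Lambda> \<E>"
    and "contravariantly_finite \<Lambda> \<E>"
  shows "(finite_type \<Lambda> \<E> \<longleftrightarrow> admissible \<Lambda> \<E>) \<and>
    (admissible \<Lambda> \<E> \<longleftrightarrow> AR_group \<Lambda> \<E> = Ex_group \<Lambda> \<E>) \<and>
    (AR_group \<Lambda> \<E> = Ex_group \<Lambda> \<E> \<longleftrightarrow>
      tensor_rat (AR_group \<Lambda> \<E>) = tensor_rat (Ex_group \<Lambda> \<E>))"
proof -
  interpret resolving_setup R \<Lambda> \<E>
    using assms(1,2) by (simp add: resolving_setup_def artin_setup_def resolving_setup_axioms_def)
  \<comment> \<open>The step from (3) to (4) is congruence and closes the cycle (1), (2), (3), (4),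
    (1).\<close>
  show ?thesis
    using finite_type_admissible admissible_AR tensor_finite_type[OF assms(3)] by metis
qed

end
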